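(* Work in $\mathsf{ZF}+\mathsf{AD}^+$ and assume $V=\mathrm{L}\bigl(\wp(\mathbb{R})\bigr)$. Suppose that $\Theta$ is singular, and let $\mathbb{P}$ be $\mathrm{Add}(\Theta,1)$ as computed in $\mathrm{HOD}$, where $\mathrm{Add}(\Theta,1)=\{p \mid p\colon\gamma\to 2 \text{ for some } \gamma<\Theta\}$ ordered by reverse inclusion. Then $\mathsf{AD}$ fails in $V[G]$ for every $\mathbb{P}$-generic filter $G$ over $V$.
   Context: $\Theta$ denotes the supremum of the ordinals that are surjective images of $\mathbb{R}$. $\mathrm{HOD}$ is the class of hereditarily ordinal definable sets (sets $x$ such that every element of the transitive closure of $\{x\}$ is definable by a first-order formula with ordinal parameters). $\mathsf{AD}$ is the Axiom of Determinacy and $\mathsf{AD}^+$ is Woodin's strengthening of $\mathsf{AD}$. *)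

theory Defs
  imports Main
begin

text \<open>
  A theorem of a theory extending ZF is rendered as a statement about all models of that theory.
  A structure for the language of set theory is a binary relation on a type; it need not be
  well-founded, so that ``true in all models'' means the same as ``provable''.

  The axiom schemes of ZF are stated with a deep embedding of first-order formulas.
  Every other set-theoretic notion is written directly in HOL as a first-order property of the
  structure: quantifiers range over the elements of the structure only, and in particular natural
  numbers, formulas, functions and ordinals are those of the structure.
\<close>

datatype fm = Mem nat nat | Eq nat nat | Neg fm | And fm fm | Ex nat fm

primrec sat :: "('v \<Rightarrow> 'v \<Rightarrow> bool) \<Rightarrow> (nat \<Rightarrow> 'v) \<Rightarrow> fm \<Rightarrow> bool" where
  "sat E s (Mem i j) \<longleftrightarrow> E (s i) (s j)"
| "sat E s (Eq i j) \<longleftrightarrow> s i = s j"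
| "sat E s (Neg \<phi>) \<longleftrightarrow> \<not> sat E s \<phi>"
| "sat E s (And \<phi> \<psi>) \<longleftrightarrow> sat E s \<phi> \<and> sat E s \<psi>"
| "sat E s (Ex i \<phi>) \<longleftrightarrow> (\<exists>x. sat E (s(i := x)) \<phi>)"

locale eps_structure =
  fixes mem :: "'v \<Rightarrow> 'v \<Rightarrow> bool"
begin

definition elts :: "'v \<Rightarrow> 'v set" where
  "elts a = {x. mem x a}"

text \<open>\<open>setof S\<close> is meaningful only if \<open>S\<close> is the extension of an element of the structure;
  below, this is always provable in ZF.\<close>

definition setof :: "'v set \<Rightarrow> 'v" where
  "setof S = (THE z. elts z = S)"


subsection \<open>The axioms of ZF\<close>

text \<open>In the two schemes, \<open>x\<close> and \<open>y\<close> are the variables 0 and 1; all other variables are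
  parameters, with values given by \<open>s\<close>.\<close>

definition ZF :: bool where
  "ZF \<longleftrightarrow>
     (\<forall>a b. elts a = elts b \<longrightarrow> a = b) \<and>
     (\<forall>a. elts a \<noteq> {} \<longrightarrow> (\<exists>x\<in>elts a. elts x \<inter> elts a = {})) \<and>
     (\<forall>a b. \<exists>c. elts c = {a, b}) \<and>
     (\<forall>a. \<exists>u. elts u = (\<Union>x\<in>elts a. elts x)) \<and>
     (\<forall>a. \<exists>p. elts p = {x. elts x \<subseteq> elts a}) \<and>
     (\<exists>w. (\<exists>e\<in>elts w. elts e = {}) \<and> (\<forall>x\<in>elts w. \<exists>y\<in>elts w. elts y = insert x (elts x))) \<and>
     (\<forall>\<phi> s a. \<exists>b. elts b = {x \<in> elts a. sat mem (s(0 := x)) \<phi>}) \<and>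
     (\<forall>\<phi> s a. (\<forall>x\<in>elts a. \<exists>!y. sat mem (s(0 := x, 1 := y)) \<phi>) \<longrightarrow>
        (\<exists>b. elts b = {y. \<exists>x\<in>elts a. sat mem (s(0 := x, 1 := y)) \<phi>}))"


subsection \<open>Basic set theory\<close>

definition zero :: 'v where "zero = setof {}"
definition sc :: "'v \<Rightarrow> 'v" where "sc x = setof (insert x (elts x))"
definition one :: 'v where "one = sc zero"
definition two :: 'v where "two = sc one"
definition three :: 'v where "three = sc two"
definition four :: 'v where "four = sc three"

definition pair :: "'v \<Rightarrow> 'v \<Rightarrow> 'v" where
  "pair x y = setof {setof {x}, setof {x, y}}"

definition power :: "'v \<Rightarrow> 'v" where
  "power a = setof {x. elts x \<subseteq> elts a}"

definition transitive :: "'v \<Rightarrow> bool" where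
  "transitive a \<longleftrightarrow> (\<forall>x\<in>elts a. elts x \<subseteq> elts a)"

text \<open>The transitive closure of \<open>{x}\<close>.\<close>

definition tc_sing :: "'v \<Rightarrow> 'v" where
  "tc_sing x = setof {y. \<forall>t. transitive t \<and> x \<in> elts t \<longrightarrow> y \<in> elts t}"

definition Ord :: "'v \<Rightarrow> bool" where
  "Ord a \<longleftrightarrow> transitive a \<and> (\<forall>x\<in>elts a. transitive x)"

definition Limit :: "'v \<Rightarrow> bool" where
  "Limit a \<longleftrightarrow> Ord a \<and> zero \<in> elts a \<and> (\<forall>x\<in>elts a. sc x \<in> elts a)"

definition omega :: 'v where
  "omega = setof {n. \<forall>w. zero \<in> elts w \<and> (\<forall>x\<in>elts w. sc x \<in> elts w) \<longrightarrow> n \<in> elts w}"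

definition even_nat :: "'v \<Rightarrow> bool" where
  "even_nat n \<longleftrightarrow> (\<forall>w. zero \<in> elts w \<and> (\<forall>x\<in>elts w. sc (sc x) \<in> elts w) \<longrightarrow> n \<in> elts w)"

definition func :: "'v \<Rightarrow> 'v \<Rightarrow> 'v \<Rightarrow> bool" where
  "func f a b \<longleftrightarrow>
     (\<forall>p\<in>elts f. \<exists>x\<in>elts a. \<exists>y\<in>elts b. p = pair x y) \<and>
     (\<forall>x\<in>elts a. \<exists>!y. pair x y \<in> elts f)"

definition func_on :: "'v \<Rightarrow> 'v \<Rightarrow> bool" where
  "func_on f a \<longleftrightarrow> (\<exists>b. func f a b)"

definition app :: "'v \<Rightarrow> 'v \<Rightarrow> 'v" where
  "app f x = (THE y. pair x y \<in> elts f)"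

definition surj_func :: "'v \<Rightarrow> 'v \<Rightarrow> 'v \<Rightarrow> bool" where
  "surj_func f a b \<longleftrightarrow> func f a b \<and> (\<forall>y\<in>elts b. \<exists>x\<in>elts a. app f x = y)"

definition restr :: "'v \<Rightarrow> 'v \<Rightarrow> 'v" where
  "restr f a = setof {p \<in> elts f. \<exists>x\<in>elts a. \<exists>y. p = pair x y}"

definition fspace :: "'v \<Rightarrow> 'v \<Rightarrow> 'v" where
  "fspace a b = setof {f. func f a b}"

definition finseq :: "'v \<Rightarrow> 'v" where
  "finseq a = setof {s. \<exists>n\<in>elts omega. func s n a}"

text \<open>As usual in descriptive set theory, the reals are the elements of Baire space.\<close>

definition reals :: 'v where
  "reals = fspace omega omega"

definition Theta :: 'v where
  "Theta = setof (\<Union>\<alpha>\<in>{\<alpha>. Ord \<alpha> \<and> (\<exists>f. surj_func f reals \<alpha>)}. elts \<alpha>)"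

definition cofinal_func :: "'v \<Rightarrow> 'v \<Rightarrow> 'v \<Rightarrow> bool" where
  "cofinal_func f a k \<longleftrightarrow> func f a k \<and>
     (\<forall>b\<in>elts k. \<exists>x\<in>elts a. b = app f x \<or> b \<in> elts (app f x))"

definition cf :: "'v \<Rightarrow> 'v" where
  "cf k = (THE a. Ord a \<and> (\<exists>f. cofinal_func f a k) \<and> (\<forall>b\<in>elts a. \<not> (\<exists>f. cofinal_func f b k)))"

definition singular :: "'v \<Rightarrow> bool" where
  "singular k \<longleftrightarrow> Limit k \<and> cf k \<in> elts k"


subsection \<open>Determinacy\<close>

text \<open>The game of length \<open>omega\<close> on \<open>X\<close> with payoff set \<open>A\<close> for player I, who moves at even
  stages. A strategy maps every finite sequence of moves to a move.\<close>

definition determined :: "'v \<Rightarrow> 'v \<Rightarrow> bool" where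
  "determined X A \<longleftrightarrow>
     (\<exists>\<sigma>\<in>elts (fspace (finseq X) X). \<forall>x\<in>elts (fspace omega X).
        (\<forall>n\<in>elts omega. even_nat n \<longrightarrow> app x n = app \<sigma> (restr x n)) \<longrightarrow> x \<in> elts A) \<or>
     (\<exists>\<sigma>\<in>elts (fspace (finseq X) X). \<forall>x\<in>elts (fspace omega X).
        (\<forall>n\<in>elts omega. \<not> even_nat n \<longrightarrow> app x n = app \<sigma> (restr x n)) \<longrightarrow> x \<notin> elts A)"

definition AD :: bool where
  "AD \<longleftrightarrow> (\<forall>A. elts A \<subseteq> elts reals \<longrightarrow> determined omega A)"

definition DC_reals :: bool where
  "DC_reals \<longleftrightarrow>
     (\<forall>r. (\<forall>x\<in>elts reals. \<exists>y\<in>elts reals. pair x y \<in> elts r) \<longrightarrow>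
        (\<exists>f\<in>elts (fspace omega reals). \<forall>n\<in>elts omega. pair (app f n) (app f (sc n)) \<in> elts r))"

text \<open>\<open>\<infinity>\<close>-Borel codes are the (well-founded) codes built from the codes \<open>pair zero s\<close> of
  basic open sets by complements \<open>pair one c\<close> and by unions \<open>pair two f\<close> of well-ordered sequences
  \<open>f\<close> of codes. The function \<open>e\<close> sends each member of a set \<open>t\<close> of codes, closed under
  subcodes, to the set of reals that it codes; \<open>e\<close> is unique, by foundation.\<close>

definition borel_interp :: "'v \<Rightarrow> 'v \<Rightarrow> bool" where
  "borel_interp e t \<longleftrightarrow> func_on e t \<and> (\<forall>d\<in>elts t.
     (\<exists>s\<in>elts (finseq omega). d = pair zero s \<and>
        elts (app e d) = {x \<in> elts reals. elts s \<subseteq> elts x}) \<or>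
     (\<exists>c\<in>elts t. d = pair one c \<and> elts (app e d) = elts reals - elts (app e c)) \<or>
     (\<exists>\<gamma> f. Ord \<gamma> \<and> func f \<gamma> t \<and> d = pair two f \<and>
        elts (app e d) = (\<Union>\<alpha>\<in>elts \<gamma>. elts (app e (app f \<alpha>)))))"

definition infty_Borel :: "'v \<Rightarrow> bool" where
  "infty_Borel A \<longleftrightarrow> (\<exists>e t. borel_interp e t \<and> (\<exists>c\<in>elts t. app e c = A))"

text \<open>Continuity for the product of the discrete topologies.\<close>

definition continuous_to_reals :: "'v \<Rightarrow> 'v \<Rightarrow> bool" where
  "continuous_to_reals f X \<longleftrightarrow> func f (fspace omega X) reals \<and>
     (\<forall>x\<in>elts (fspace omega X). \<forall>n\<in>elts omega. \<exists>m\<in>elts omega. \<forall>y\<in>elts (fspace omega X).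
        restr y m = restr x m \<longrightarrow> restr (app f y) n = restr (app f x) n)"

text \<open>The case \<open>\<kappa> = 0\<close> must be excluded, since there are no strategies on the empty set.\<close>

definition ordinal_determinacy :: bool where
  "ordinal_determinacy \<longleftrightarrow>
     (\<forall>\<kappa>\<in>elts Theta. \<kappa> \<noteq> zero \<longrightarrow> (\<forall>f A. continuous_to_reals f \<kappa> \<and> elts A \<subseteq> elts reals \<longrightarrow>
        determined \<kappa> (setof {x \<in> elts (fspace omega \<kappa>). app f x \<in> elts A})))"

text \<open>\<open>AD_plus\<close> implies \<open>AD\<close>: in ordinal determinacy take \<open>\<kappa>\<close> to be \<open>omega\<close> and the
  identity function.\<close>

definition AD_plus :: bool where
  "AD_plus \<longleftrightarrow> DC_reals \<and> (\<forall>A. elts A \<subseteq> elts reals \<longrightarrow> infty_Borel A) \<and> ordinal_determinacy"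


subsection \<open>Definability inside the structure\<close>

text \<open>Codes of formulas as sets: \<open>v\<^sub>i \<in> v\<^sub>j\<close>, \<open>v\<^sub>i = v\<^sub>j\<close>, negation, conjunction, existential
  quantification over \<open>v\<^sub>i\<close>.\<close>

definition cMem :: "'v \<Rightarrow> 'v \<Rightarrow> 'v" where "cMem i j = pair zero (pair i j)"
definition cEq :: "'v \<Rightarrow> 'v \<Rightarrow> 'v" where "cEq i j = pair one (pair i j)"
definition cNeg :: "'v \<Rightarrow> 'v" where "cNeg \<phi> = pair two \<phi>"
definition cAnd :: "'v \<Rightarrow> 'v \<Rightarrow> 'v" where "cAnd \<phi> \<psi> = pair three (pair \<phi> \<psi>)"
definition cEx :: "'v \<Rightarrow> 'v \<Rightarrow> 'v" where "cEx i \<phi> = pair four (pair i \<phi>)"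

text \<open>Assignments to the variables are functions with domain \<open>omega\<close>.\<close>

definition upd :: "'v \<Rightarrow> 'v \<Rightarrow> 'v \<Rightarrow> 'v" where
  "upd s i a = setof (insert (pair i a) {p \<in> elts s. \<forall>b. p \<noteq> pair i b})"

text \<open>\<open>S\<close> sends each member of a set \<open>t\<close> of formulas, closed under subformulas, to the set of
  assignments that satisfy it in \<open>(A, \<in>)\<close>. By foundation, the members of such a \<open>t\<close>
  are indeed (finite) formulas, and \<open>S\<close> is unique.\<close>

definition sat_interp :: "'v \<Rightarrow> 'v \<Rightarrow> 'v \<Rightarrow> bool" where
  "sat_interp A S t \<longleftrightarrow> func_on S t \<and> (\<forall>\<chi>\<in>elts t.
     (\<exists>i\<in>elts omega. \<exists>j\<in>elts omega. \<chi> = cMem i j \<and>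
        elts (app S \<chi>) = {s \<in> elts (fspace omega A). app s i \<in> elts (app s j)}) \<or>
     (\<exists>i\<in>elts omega. \<exists>j\<in>elts omega. \<chi> = cEq i j \<and>
        elts (app S \<chi>) = {s \<in> elts (fspace omega A). app s i = app s j}) \<or>
     (\<exists>\<phi>\<in>elts t. \<chi> = cNeg \<phi> \<and>
        elts (app S \<chi>) = elts (fspace omega A) - elts (app S \<phi>)) \<or>
     (\<exists>\<phi>\<in>elts t. \<exists>\<psi>\<in>elts t. \<chi> = cAnd \<phi> \<psi> \<and>
        elts (app S \<chi>) = elts (app S \<phi>) \<inter> elts (app S \<psi>)) \<or>
     (\<exists>i\<in>elts omega. \<exists>\<phi>\<in>elts t. \<chi> = cEx i \<phi> \<and>
        elts (app S \<chi>) =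
          {s \<in> elts (fspace omega A). \<exists>a\<in>elts A. upd s i a \<in> elts (app S \<phi>)}))"

definition Sat :: "'v \<Rightarrow> 'v \<Rightarrow> 'v \<Rightarrow> bool" where
  "Sat A \<phi> s \<longleftrightarrow> (\<exists>S t. sat_interp A S t \<and> \<phi> \<in> elts t \<and> s \<in> elts (app S \<phi>))"

text \<open>The subsets of \<open>A\<close> definable over \<open>(A, \<in>)\<close> from parameters in \<open>A\<close>.\<close>

definition Def :: "'v \<Rightarrow> 'v" where
  "Def A = setof {x. \<exists>\<phi>. \<exists>s\<in>elts (fspace omega A). elts x = {y \<in> elts A. Sat A \<phi> (upd s zero y)}}"

text \<open>\<open>h\<close> is the hierarchy \<open>L\<^sub>\<beta>(X)\<close> for \<open>\<beta> \<le> \<alpha>\<close>, which starts with the transitive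
  closure of \<open>{X}\<close>.\<close>

definition L_hierarchy :: "'v \<Rightarrow> 'v \<Rightarrow> 'v \<Rightarrow> bool" where
  "L_hierarchy X \<alpha> h \<longleftrightarrow> Ord \<alpha> \<and> func_on h (sc \<alpha>) \<and> (\<forall>\<beta>\<in>elts (sc \<alpha>).
     (\<beta> = zero \<longrightarrow> app h \<beta> = tc_sing X) \<and>
     (\<forall>\<gamma>. \<beta> = sc \<gamma> \<longrightarrow> app h \<beta> = Def (app h \<gamma>)) \<and>
     (Limit \<beta> \<longrightarrow> elts (app h \<beta>) = (\<Union>\<gamma>\<in>elts \<beta>. elts (app h \<gamma>))))"

definition V_eq_L_of :: "'v \<Rightarrow> bool" where
  "V_eq_L_of X \<longleftrightarrow> (\<forall>x. \<exists>\<alpha> h. L_hierarchy X \<alpha> h \<and> x \<in> elts (app h \<alpha>))"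

definition V_hierarchy :: "'v \<Rightarrow> 'v \<Rightarrow> bool" where
  "V_hierarchy \<alpha> h \<longleftrightarrow> Ord \<alpha> \<and> func_on h (sc \<alpha>) \<and>
     (\<forall>\<beta>\<in>elts (sc \<alpha>). elts (app h \<beta>) = (\<Union>\<gamma>\<in>elts \<beta>. elts (power (app h \<gamma>))))"

definition V_level :: "'v \<Rightarrow> 'v" where
  "V_level \<alpha> = (THE v. \<exists>h. V_hierarchy \<alpha> h \<and> v = app h \<alpha>)"

text \<open>The usual first-order rendering of ordinal definability: \<open>x\<close> is the unique element of
  some \<open>V\<^sub>\<beta>\<close> that satisfies some formula in \<open>(V\<^sub>\<beta>, \<in>)\<close>, with ordinals as the values of all
  variables other than \<open>v\<^sub>0\<close>. By reflection, this captures definability over the universe.\<close>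

definition OD :: "'v \<Rightarrow> bool" where
  "OD x \<longleftrightarrow> (\<exists>\<beta> \<phi>. Ord \<beta> \<and> x \<in> elts (V_level \<beta>) \<and>
     (\<exists>s\<in>elts (fspace omega (V_level \<beta>)).
        (\<forall>i\<in>elts omega. i \<noteq> zero \<longrightarrow> Ord (app s i)) \<and>
        (\<forall>y\<in>elts (V_level \<beta>). Sat (V_level \<beta>) \<phi> (upd s zero y) \<longleftrightarrow> y = x)))"

definition HOD :: "'v \<Rightarrow> bool" where
  "HOD x \<longleftrightarrow> (\<forall>y\<in>elts (tc_sing x). OD y)"


subsection \<open>Forcing\<close>

text \<open>\<open>Add(\<kappa>, 1)\<close> as computed in a transitive class \<open>C\<close> that contains \<open>\<kappa>\<close>; being a function
  from \<open>\<gamma>\<close> to \<open>2\<close> is absolute for such classes. The order is reverse inclusion.\<close>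

definition Add_in :: "('v \<Rightarrow> bool) \<Rightarrow> 'v \<Rightarrow> 'v" where
  "Add_in C \<kappa> = setof {p. C p \<and> (\<exists>\<gamma>\<in>elts \<kappa>. func p \<gamma> two)}"

definition rev_incl :: "'v \<Rightarrow> 'v \<Rightarrow> bool" where
  "rev_incl p q \<longleftrightarrow> elts q \<subseteq> elts p"

definition dense_in :: "'v \<Rightarrow> ('v \<Rightarrow> 'v \<Rightarrow> bool) \<Rightarrow> 'v \<Rightarrow> bool" where
  "dense_in P le D \<longleftrightarrow> elts D \<subseteq> elts P \<and> (\<forall>p\<in>elts P. \<exists>d\<in>elts D. le d p)"

text \<open>Here \<open>G\<close> is an arbitrary external set of conditions, whereas \<open>D\<close> ranges over the dense
  sets that belong to the structure.\<close>

definition generic_filter :: "'v \<Rightarrow> ('v \<Rightarrow> 'v \<Rightarrow> bool) \<Rightarrow> 'v set \<Rightarrow> bool" where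
  "generic_filter P le G \<longleftrightarrow>
     G \<subseteq> elts P \<and> G \<noteq> {} \<and>
     (\<forall>p\<in>G. \<forall>q\<in>elts P. le p q \<longrightarrow> q \<in> G) \<and>
     (\<forall>p\<in>G. \<forall>q\<in>G. \<exists>r\<in>G. le r p \<and> le r q) \<and>
     (\<forall>D. dense_in P le D \<longrightarrow> G \<inter> elts D \<noteq> {})"

text \<open>\<open>P\<close>-names are the sets of pairs of a \<open>P\<close>-name and a condition.\<close>

definition forcing_name :: "'v \<Rightarrow> 'v \<Rightarrow> bool" where
  "forcing_name P \<tau> \<longleftrightarrow> (\<exists>t. \<tau> \<in> elts t \<and>
     (\<forall>\<sigma>\<in>elts t. \<forall>x\<in>elts \<sigma>. \<exists>\<rho>\<in>elts t. \<exists>p\<in>elts P. x = pair \<rho> p))"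

text \<open>\<open>w\<close> is the value of \<open>\<tau>\<close> by \<open>g\<close>, in the sense of the recursion
  \<open>val \<sigma> = {val \<rho> | \<exists>p \<in> g. (\<rho>, p) \<in> \<sigma>}\<close>.\<close>

definition name_value :: "'v \<Rightarrow> 'v \<Rightarrow> 'v \<Rightarrow> bool" where
  "name_value g \<tau> w \<longleftrightarrow> (\<exists>e t. func_on e t \<and> \<tau> \<in> elts t \<and> app e \<tau> = w \<and>
     (\<forall>\<sigma>\<in>elts t.
        (\<forall>\<rho>. \<forall>p\<in>elts g. pair \<rho> p \<in> elts \<sigma> \<longrightarrow> \<rho> \<in> elts t) \<and>
        elts (app e \<sigma>) = {app e \<rho> |\<rho>. \<exists>p\<in>elts g. pair \<rho> p \<in> elts \<sigma>}))"

end

text \<open>\<open>N\<close>, together with the embedding \<open>j\<close> of \<open>M\<close> onto a transitive subclass of \<open>N\<close>, is the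
  generic extension \<open>M[G]\<close>: a model of ZF that contains \<open>G\<close> and whose elements are the values by
  \<open>G\<close> of the \<open>P\<close>-names of \<open>M\<close>. As \<open>M\<close> may be ill-founded, the values are computed inside \<open>N\<close>.\<close>

definition generic_extension ::
  "('v \<Rightarrow> 'v \<Rightarrow> bool) \<Rightarrow> 'v \<Rightarrow> 'v set \<Rightarrow> ('w \<Rightarrow> 'w \<Rightarrow> bool) \<Rightarrow> ('v \<Rightarrow> 'w) \<Rightarrow> bool" where
  "generic_extension M P G N j \<longleftrightarrow>
     eps_structure.ZF N \<and>
     inj j \<and> (\<forall>x. eps_structure.elts N (j x) = j ` eps_structure.elts M x) \<and>
     (\<exists>g. eps_structure.elts N g = j ` G \<and>
        (\<forall>w. \<exists>\<tau>. eps_structure.forcing_name M P \<tau> \<and> eps_structure.name_value N g (j \<tau>) w))"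

end

theory Submission
	imports Defs
begin

text \<open>Let \<open>M\<close> be the ground model and assume that AD holds in \<open>N\<close>, the extension by \<open>G\<close>.

	No set of natural numbers is new. For a set \<open>C\<close> of reals, consider the game in which player I
	builds a real in \<open>C\<close> and has to announce infinitely often that its next value will be
	at least the next move of player II. If player II has a winning strategy, then countably many
	reals dominate \<open>C\<close>. If player I has one, then playing against it on three boards shows that every set of
	natural numbers is decoded from three members of \<open>C\<close>. Apply this in \<open>N\<close> to the reals of \<open>M\<close>: in the
	second case we are done. In the first case, evaluating a name for the dominating family yields in \<open>M\<close> a
	family indexed by pairs of a condition and a finite sequence that dominates all reals. The conditions are
	ordinal definable, so the index set has a choice function; by the same game in \<open>M\<close>, there is then a
	choice function for the reals, which AD refutes by a game on increasing sequences.

	Hence \<open>N\<close> has no new strategies on the natural numbers, and no new subsets of ordinals below \<open>Theta\<close>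
	by the coding lemma: initial segments of a set of ordinals are coded by reals, and winning strategies in games
	between codes are codes of longer initial segments.

	Finally, let \<open>f\<close> be cofinal in \<open>Theta\<close> with domain the cofinality \<open>\<delta>\<close> of \<open>Theta\<close>. The set of all
	\<open>i < \<delta>\<close> at which the generic function takes the value \<open>1\<close> at \<open>f(i)\<close> is a subset of an ordinal below
	\<open>Theta\<close>, but by genericity it is not in \<open>M\<close>.\<close>

section \<open>Definability calculus: HOL predicates as instances of the axiom schemes\<close>

section \<open>First-order definable predicates\<close>

text \<open>Determinacy of the extension, assumed for contradiction, replaces it. Domination is used
  because it survives names: a name offers several possible values at each argument, but if a
  condition makes all of them large, the least one is large too, and least values need no choice.
  The only forcing relation needed says that a name has a given number as value. Of the three
  boards, the first sets a threshold and the other two race past it; the bit tells which of them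
  stops lower. Coding by reals needs ordinals below \<open>Theta\<close>; the generic function has
  length \<open>Theta\<close>, and singularity compresses it to length \<open>\<delta>\<close>. The
  models may be ill-founded, with nonstandard numbers and formulas. Induction and recursion
  therefore cover only first-order definable predicates, which the rules \<open>df\<close> verify,
  and in the extension ground-model notions enter through sets of the ground model.\<close>

primrec ren :: "(nat => nat) => fm => fm" where
	"ren f (Mem i j) = Mem (f i) (f j)"
| "ren f (Eq i j) = Eq (f i) (f j)"
| "ren f (Neg \<phi>) = Neg (ren f \<phi>)"
| "ren f (And \<phi> \<psi>) = And (ren f \<phi>) (ren f \<psi>)"
| "ren f (Ex i \<phi>) = Ex (f i) (ren f \<phi>)"

text \<open>Quantifiers are bounded by \<open>U\<close> because formulas are used twice: with
  \<open>U = UNIV\<close> for the axiom schemes, and with \<open>U\<close> a level of the cumulative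
  hierarchy for ordinal definability.\<close>

primrec satr :: "'v set => ('v => 'v => bool) => (nat => 'v) => fm => bool" where
	"satr U E s (Mem i j) \<longleftrightarrow> E (s i) (s j)"
| "satr U E s (Eq i j) \<longleftrightarrow> s i = s j"
| "satr U E s (Neg \<phi>) \<longleftrightarrow> \<not> satr U E s \<phi>"
| "satr U E s (And \<phi> \<psi>) \<longleftrightarrow> satr U E s \<phi> \<and> satr U E s \<psi>"
| "satr U E s (Ex i \<phi>) \<longleftrightarrow> (\<exists>x\<in>U. satr U E (s(i := x)) \<phi>)"

lemma satr_UNIV: "satr UNIV E s \<phi> = sat E s \<phi>"
	by (induction \<phi> arbitrary: s) auto

lemma satr_ren: "inj f ==> satr U E s (ren f \<phi>) = satr U E (s \<circ> f) \<phi>"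
proof (induction \<phi> arbitrary: s)
	case (Ex i \<phi>)
	have "(s(f i := x)) \<circ> f = (s \<circ> f)(i := x)" for x
		using Ex.prems by (auto simp: fun_eq_iff inj_eq)
	then show ?case by (simp only: ren.simps satr.simps Ex.IH[OF Ex.prems])
qed auto

text \<open>Even variables carry parameters and odd variables carry arguments, so that a formula has
  infinitely many of both and parameters can be added without touching the arguments.\<close>

definition mrg :: "(nat => 'v) => (nat => 'v) => nat => 'v" where
	"mrg c s i = (if even i then c (i div 2) else s (i div 2))"

lemma range_mrg: "range c \<subseteq> A ==> range s \<subseteq> A ==> mrg c s i \<in> A"
	by (auto simp: mrg_def)

context eps_structure
begin

text \<open>The predicate \<open>Q\<close> on assignments is definable over \<open>U\<close> by a first-order formula with parameters
	from \<open>K\<close>; below, \<open>dfn\<close> and \<open>dft\<close> make the axiom schemes of ZF available for predicates and operations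
	defined in HOL.\<close>

definition dfr :: "'v set => 'v set => ((nat => 'v) => bool) => bool" where
	"dfr U K Q \<longleftrightarrow> (\<exists>\<phi> c. range c \<subseteq> K \<and> (\<forall>s. range s \<subseteq> U --> Q s = satr U mem (mrg c s) \<phi>))"

lemma dfr_conj:
	assumes "dfr U K P" and "dfr U K Q"
	shows "dfr U K (\<lambda>s. P s \<and> Q s)"
proof -
	obtain \<phi> c where 1: "range c \<subseteq> K" "\<And>s. range s \<subseteq> U ==> P s = satr U mem (mrg c s) \<phi>"
		using assms(1) unfolding dfr_def by metis
	obtain \<psi> d where 2: "range d \<subseteq> K" "\<And>s. range s \<subseteq> U ==> Q s = satr U mem (mrg d s) \<psi>"
		using assms(2) unfolding dfr_def by metis
	\<comment> \<open>The parameter variables 2k of the two formulas move to 4k and 4k + 2, which is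
	  where \<open>mrg (mrg c d) s\<close> keeps \<open>c\<close> and \<open>d\<close>. Argument
	  variables stay.\<close>
	let ?f = "\<lambda>i::nat. if even i then 2*i else i" and ?g = "\<lambda>i::nat. if even i then 2*i+2 else i"
	have f: "inj ?f" unfolding inj_def by (auto; presburger)
	have g: "inj ?g" unfolding inj_def by (auto; presburger)
	have "mrg (mrg c d) s \<circ> ?f = mrg c s" for s
		by (auto simp: fun_eq_iff mrg_def)
	moreover have "mrg (mrg c d) s \<circ> ?g = mrg d s" for s
		by (auto simp: fun_eq_iff mrg_def)
	moreover have "range (mrg c d) \<subseteq> K" using range_mrg[OF 1(1) 2(1)] by auto
	ultimately show ?thesis
		unfolding dfr_def using 1 2
		by (intro exI[of _ "And (ren ?f \<phi>) (ren ?g \<psi>)"] exI[of _ "mrg c d"])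
			 (simp add: satr_ren[OF f] satr_ren[OF g])
qed

lemma dfr_neg: "dfr U K P ==> dfr U K (\<lambda>s. \<not> P s)"
	unfolding dfr_def by (metis satr.simps(3))

text \<open>De Bruijn convention: entry 0 of the assignment is the bound element and the surrounding
  assignment is shifted by one. In this form a HOL predicate can be decomposed by resolution
  alone.\<close>

lemma dfr_ex:
	assumes "dfr U K (\<lambda>s. Q (s 0) (\<lambda>n. s (Suc n)))"
	shows "dfr U K (\<lambda>s. \<exists>x\<in>U. Q x s)"
proof -
	obtain \<phi> c where 1: "range c \<subseteq> K"
		"\<And>s. range s \<subseteq> U ==> Q (s 0) (\<lambda>n. s (Suc n)) = satr U mem (mrg c s) \<phi>"
		using assms unfolding dfr_def by metis
	\<comment> \<open>Argument 0, which is variable 1, becomes the quantified variable 0. Parameters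
	  move up by one slot to free it, whence the padded \<open>?c\<close>; the other arguments move
	  down.\<close>
	let ?f = "\<lambda>i::nat. if even i then i+2 else if i = 1 then 0 else i-2"
	have f: "inj ?f" unfolding inj_def by (auto; presburger)
	let ?c = "case_nat (c 0) c"
	have eq: "(mrg ?c s)(0 := x) \<circ> ?f = mrg c (case_nat x s)" for s x
	proof
		fix i :: nat
		consider k where "i = 2*k" | "i = 1" | k where "i = Suc (2 * Suc k)"
			by (metis One_nat_def evenE nat.exhaust oddE plus_1_eq_Suc add.commute mult_0_right)
		then show "((mrg ?c s)(0 := x) \<circ> ?f) i = mrg c (case_nat x s) i"
			by cases (auto simp: mrg_def)
	qed
	have "Q x s = satr U mem ((mrg ?c s)(0 := x)) (ren ?f \<phi>)" if "range s \<subseteq> U" "x \<in> U" for x s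
	proof -
		have "range (case_nat x s) \<subseteq> U" using that by (auto simp: image_subset_iff split: nat.splits)
		from 1(2)[OF this] show ?thesis by (simp add: satr_ren[OF f] eq)
	qed
	moreover have "range ?c \<subseteq> K" using 1(1) by (auto simp: image_subset_iff split: nat.splits)
	ultimately show ?thesis
		unfolding dfr_def by (intro exI[of _ "Ex 0 (ren ?f \<phi>)"] exI[of _ ?c]) simp
qed

text \<open>The element \<open>k\<close> fills the parameter sequence, whose values must lie in
  \<open>K\<close>.\<close>

lemma dfr_mem_vv: "k \<in> K ==> dfr U K (\<lambda>s. s i \<in> elts (s j))"
	unfolding dfr_def elts_def
	by (rule exI[of _ "Mem (Suc (2*i)) (Suc (2*j))"], rule exI[of _ "\<lambda>_. k"]) (auto simp: mrg_def)

lemma dfr_mem_vc: "k \<in> K ==> dfr U K (\<lambda>s. s i \<in> elts k)"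
	unfolding dfr_def elts_def
	by (rule exI[of _ "Mem (Suc (2*i)) 0"], rule exI[of _ "\<lambda>_. k"]) (auto simp: mrg_def)

lemma dfr_mem_cv: "k \<in> K ==> dfr U K (\<lambda>s. k \<in> elts (s i))"
	unfolding dfr_def elts_def
	by (rule exI[of _ "Mem 0 (Suc (2*i))"], rule exI[of _ "\<lambda>_. k"]) (auto simp: mrg_def)

lemma dfr_eq_vv: "k \<in> K ==> dfr U K (\<lambda>s. s i = s j)"
	unfolding dfr_def
	by (rule exI[of _ "Eq (Suc (2*i)) (Suc (2*j))"], rule exI[of _ "\<lambda>_. k"]) (auto simp: mrg_def)

lemma dfr_eq_vc: "k \<in> K ==> dfr U K (\<lambda>s. s i = k)"
	unfolding dfr_def
	by (rule exI[of _ "Eq (Suc (2*i)) 0"], rule exI[of _ "\<lambda>_. k"]) (auto simp: mrg_def)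

lemma dfr_imp: "dfr U K P ==> dfr U K Q ==> dfr U K (\<lambda>s. P s --> Q s)"
	using dfr_neg[OF dfr_conj[OF _ dfr_neg[of U K Q]], of P] by simp

lemma dfr_disj: "dfr U K P ==> dfr U K Q ==> dfr U K (\<lambda>s. P s \<or> Q s)"
	using dfr_imp[OF dfr_neg[of U K P], of Q] by (simp add: disj_imp)

lemma dfr_iff: "dfr U K P ==> dfr U K Q ==> dfr U K (\<lambda>s. P s = Q s)"
	unfolding iff_conv_conj_imp by (intro dfr_conj dfr_imp)

lemma dfr_all:
	"dfr U K (\<lambda>s. Q (s 0) (\<lambda>n. s (Suc n))) ==> dfr U K (\<lambda>s. \<forall>x\<in>U. Q x s)"
	using dfr_neg[OF dfr_ex[OF dfr_neg], of U K "Q"] by simp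

subsection \<open>Definability over the whole structure\<close>

definition dfn :: "((nat => 'v) => bool) => bool" where
	"dfn Q \<longleftrightarrow> dfr UNIV UNIV Q"

definition dft :: "((nat => 'v) => 'v) => bool" where
	"dft t \<longleftrightarrow> dfn (\<lambda>s. s 0 = t (\<lambda>n. s (Suc n)))"

named_theorems df

lemma dfn_conj [df]: "dfn P ==> dfn Q ==> dfn (\<lambda>s. P s \<and> Q s)"
	unfolding dfn_def by (rule dfr_conj)
lemma dfn_neg [df]: "dfn P ==> dfn (\<lambda>s. \<not> P s)"
	unfolding dfn_def by (rule dfr_neg)
lemma dfn_disj [df]: "dfn P ==> dfn Q ==> dfn (\<lambda>s. P s \<or> Q s)"
	unfolding dfn_def by (rule dfr_disj)
lemma dfn_imp [df]: "dfn P ==> dfn Q ==> dfn (\<lambda>s. P s --> Q s)"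
	unfolding dfn_def by (rule dfr_imp)
lemma dfn_iff [df]: "dfn P ==> dfn Q ==> dfn (\<lambda>s. P s = Q s)"
	unfolding dfn_def by (rule dfr_iff)
lemma dfn_ex [df]: "dfn (\<lambda>s. Q (s 0) (\<lambda>n. s (Suc n))) ==> dfn (\<lambda>s. \<exists>x. Q x s)"
	unfolding dfn_def using dfr_ex[of UNIV UNIV Q] by simp
lemma dfn_all [df]: "dfn (\<lambda>s. Q (s 0) (\<lambda>n. s (Suc n))) ==> dfn (\<lambda>s. \<forall>x. Q x s)"
	unfolding dfn_def using dfr_all[of UNIV UNIV Q] by simp

lemma dfn_const [df]: "dfn (\<lambda>s. b)"
proof -
	have "dfn (\<lambda>s. s 0 = s 0)" unfolding dfn_def by (rule dfr_eq_vv) simp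
	from this dfn_neg[OF this] show ?thesis by (cases b) auto
qed

lemma dfn_ren:
	assumes "dfn Q" and g: "inj g"
	shows "dfn (\<lambda>s. Q (\<lambda>n. s (g n)))"
proof -
	obtain \<phi> c where 1: "\<And>s. Q s = satr UNIV mem (mrg c s) \<phi>"
		using assms(1) unfolding dfn_def dfr_def by auto
	let ?f = "\<lambda>i::nat. if even i then i else Suc (2 * g (i div 2))"
	have f: "inj ?f"
	proof (rule injI)
		fix x y :: nat assume e: "?f x = ?f y"
		have "even (?f x) = even x" for x :: nat by simp
		then have p: "even x = even y" using e by metis
		show "x = y"
		proof (cases "even x")
			case True
			then show ?thesis using e p by simp
		next
			case False
			then have "g (x div 2) = g (y div 2)" using e p by simp
			then have "x div 2 = y div 2" using injD[OF g] by blast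
			then show ?thesis using False p by presburger
		qed
	qed
	have "mrg c s \<circ> ?f = mrg c (\<lambda>n. s (g n))" for s
		by (auto simp: fun_eq_iff mrg_def)
	then show ?thesis unfolding dfn_def dfr_def using 1
		by (intro exI[of _ "ren ?f \<phi>"] exI[of _ c]) (simp add: satr_ren[OF f])
qed

text \<open>The outer variables become parameters: \<open>mrg c e\<close> interleaves their fixed
  values with the old parameters. Separation with HOL variables as parameters relies on
  this.\<close>

lemma dfn_inst:
	assumes "dfn (\<lambda>s. Q (s 0) (\<lambda>n. s (Suc n)))"
	shows "dfn (\<lambda>s. Q (s 0) e)"
proof -
	obtain \<phi> c where 1: "\<And>s. Q (s 0) (\<lambda>n. s (Suc n)) = satr UNIV mem (mrg c s) \<phi>"
		using assms unfolding dfn_def dfr_def by auto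
	let ?f = "\<lambda>i::nat. if even i then 2*i else if i = 1 then 1 else 2*(i-2)"
	have f: "inj ?f" unfolding inj_def by (auto; presburger)
	have eq: "mrg (mrg c e) s \<circ> ?f = mrg c (case_nat (s 0) e)" for s
	proof
		fix i :: nat
		consider k where "i = 2*k" | "i = 1" | k where "i = Suc (2 * Suc k)"
			by (metis One_nat_def evenE nat.exhaust oddE plus_1_eq_Suc add.commute mult_0_right)
		then show "(mrg (mrg c e) s \<circ> ?f) i = mrg c (case_nat (s 0) e) i"
			by cases (auto simp: mrg_def)
	qed
	have "Q (s 0) e = satr UNIV mem (mrg (mrg c e) s) (ren ?f \<phi>)" for s
		using 1[of "case_nat (s 0) e"] by (simp add: satr_ren[OF f] eq)
	then show ?thesis unfolding dfn_def dfr_def by auto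
qed

lemma dft_var [df]: "dft (\<lambda>s. s i)"
	unfolding dft_def dfn_def by (rule dfr_eq_vv) simp
lemma dft_const [df]: "dft (\<lambda>s. a)"
	unfolding dft_def dfn_def by (rule dfr_eq_vc) simp

lemma dfn_subst:
	assumes "dfn (\<lambda>s. Q (s 0) (\<lambda>n. s (Suc n)))" "dft t"
	shows "dfn (\<lambda>s. Q (t s) s)"
proof -
	have "dfn (\<lambda>s. \<exists>x. x = t s \<and> Q x s)"
		by (intro dfn_ex dfn_conj assms(1)) (use assms(2) in \<open>simp add: dft_def\<close>)
	then show ?thesis by simp
qed

lemma dft_ren:
	assumes "dft t" and "inj g"
	shows "dft (\<lambda>s. t (\<lambda>n. s (g n)))"
proof -
	let ?h = "case_nat 0 (\<lambda>n. Suc (g n))"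
	have "inj ?h"
	proof (rule injI)
		fix x y assume "?h x = ?h y"
		then show "x = y" using injD[OF assms(2)] by (cases x; cases y) auto
	qed
	from dfn_ren[OF assms(1)[unfolded dft_def] this] show ?thesis
		unfolding dft_def by simp
qed

lemma dft_Suc: "dft t ==> dft (\<lambda>s. t (\<lambda>n. s (Suc n)))"
	by (rule dft_ren) auto

text \<open>Pattern for extending \<open>df\<close>: definability of a new notion is shown for
  variables as arguments, and substitution carries it over to arbitrary definable terms.\<close>

lemma dfn_app1: "dfn (\<lambda>s. R (s 0)) ==> dft t ==> dfn (\<lambda>s. R (t s))"
	by (rule dfn_subst)

lemma dfn_app2:
	assumes "dfn (\<lambda>s. R (s 0) (s 1))" "dft t" "dft u"
	shows "dfn (\<lambda>s. R (t s) (u s))"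
proof (rule dfn_subst[of "\<lambda>x s. R x (u s)", OF _ assms(2)])
	have "dfn (\<lambda>s. R (s 1) (s 0))"
		using dfn_ren[OF assms(1), of "\<lambda>n. if n = 0 then 1 else if n = 1 then 0 else n"]
		by (auto simp: inj_def)
	then show "dfn (\<lambda>s. R (s 0) (u (\<lambda>n. s (Suc n))))"
		using dfn_subst[of "\<lambda>x s. R (s 0) x" "\<lambda>s. u (\<lambda>n. s (Suc n))"] dft_Suc[OF assms(3)] by simp
qed

lemma dfn_app3:
	assumes "dfn (\<lambda>s. R (s 0) (s 1) (s 2))" "dft t" "dft u" "dft v"
	shows "dfn (\<lambda>s. R (t s) (u s) (v s))"
proof (rule dfn_subst[of "\<lambda>x s. R x (u s) (v s)", OF _ assms(2)])
	have 1: "dfn (\<lambda>s. R (s 1) (s 2) (s 0))"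
		using dfn_ren[OF assms(1), of "\<lambda>n. if n = 0 then 1 else if n = 1 then 2 else if n = 2 then 0 else n"]
		by (auto simp: inj_def)
	have "dfn (\<lambda>s. R (s 1) (s 0) (v (\<lambda>n. s (Suc (Suc n)))))"
	proof -
		have "dfn (\<lambda>s. R (s 2) (s 1) (s 0))"
			using dfn_ren[OF assms(1), of "\<lambda>n. if n = 0 then 2 else if n = 2 then 0 else n"]
			by (auto simp: inj_def)
		then show ?thesis
			using dfn_subst[of "\<lambda>x s. R (s 1) (s 0) x" "\<lambda>s. v (\<lambda>n. s (Suc (Suc n)))"]
				 dft_Suc[OF dft_Suc[OF assms(4)]] by (simp add: numeral_2_eq_2)
	qed
	then show "dfn (\<lambda>s. R (s 0) (u (\<lambda>n. s (Suc n))) (v (\<lambda>n. s (Suc n))))"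
		using dfn_subst[of "\<lambda>x s. R (s 0) x (v (\<lambda>n. s (Suc n)))" "\<lambda>s. u (\<lambda>n. s (Suc n))"]
			dft_Suc[OF assms(3)] by simp
qed

lemma dfn_app4:
	assumes "dfn (\<lambda>s. R (s 0) (s 1) (s 2) (s 3))" "dft t" "dft u" "dft v" "dft w"
	shows "dfn (\<lambda>s. R (t s) (u s) (v s) (w s))"
proof (rule dfn_subst[of "\<lambda>x s. R x (u s) (v s) (w s)", OF _ assms(2)])
	let ?R = "\<lambda>a b c d. R d a b c"
	have 1: "dfn (\<lambda>s. R (s 1) (s 2) (s 3) (s 0))"
		using dfn_ren[OF assms(1), of "\<lambda>n. if n = 0 then 1 else if n = 1 then 2 else if n = 2 then 3 else if n = 3 then 0 else n"]
		by (auto simp: inj_def)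
	have p: "dfn (\<lambda>s. R (s 3) (s 2) (s 1) (s 0))"
		using dfn_ren[OF assms(1), of "\<lambda>n. if n = 0 then 3 else if n = 1 then 2 else if n = 2 then 1 else if n = 3 then 0 else n"]
		by (auto simp: inj_def)
	have q: "dfn (\<lambda>s. R (s 2) (s 1) (s 0) (w (\<lambda>n. s (Suc (Suc (Suc n))))))"
		using dfn_subst[of "\<lambda>x s. R (s 2) (s 1) (s 0) x" "\<lambda>s. w (\<lambda>n. s (Suc (Suc (Suc n))))"] p
			dft_Suc[OF dft_Suc[OF dft_Suc[OF assms(5)]]] by (simp add: numeral_2_eq_2 numeral_3_eq_3)
	have r: "dfn (\<lambda>s. R (s 1) (s 0) (v (\<lambda>n. s (Suc (Suc n)))) (w (\<lambda>n. s (Suc (Suc n)))))"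
		using dfn_subst[of "\<lambda>x s. R (s 1) (s 0) x (w (\<lambda>n. s (Suc (Suc n))))" "\<lambda>s. v (\<lambda>n. s (Suc (Suc n)))"] q
			dft_Suc[OF dft_Suc[OF assms(4)]] by (simp add: numeral_2_eq_2 numeral_3_eq_3)
	show "dfn (\<lambda>s. R (s 0) (u (\<lambda>n. s (Suc n))) (v (\<lambda>n. s (Suc n))) (w (\<lambda>n. s (Suc n))))"
		using dfn_subst[of "\<lambda>x s. R (s 0) x (v (\<lambda>n. s (Suc n))) (w (\<lambda>n. s (Suc n)))" "\<lambda>s. u (\<lambda>n. s (Suc n))"] r
			dft_Suc[OF assms(3)] by simp
qed

lemma dft_subst:
	assumes "dft (\<lambda>s. F (s 0) (\<lambda>n. s (Suc n)))" "dft t"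
	shows "dft (\<lambda>s. F (t s) s)"
proof -
	have "dfn (\<lambda>s. s 1 = F (s 0) (\<lambda>n. s (Suc (Suc n))))"
		using dfn_ren[OF assms(1)[unfolded dft_def], of "\<lambda>n. if n = 0 then 1 else if n = 1 then 0 else n"]
		by (auto simp: inj_def)
	then show ?thesis unfolding dft_def
		using dfn_subst[of "\<lambda>x s. s 0 = F x (\<lambda>n. s (Suc n))" "\<lambda>s. t (\<lambda>n. s (Suc n))"] dft_Suc[OF assms(2)]
		by simp
qed

lemma dft_app1: "dft (\<lambda>s. F (s 0)) ==> dft t ==> dft (\<lambda>s. F (t s))"
	by (rule dft_subst)

lemma dft_app2: "dft (\<lambda>s. F (s 0) (s 1)) ==> dft t ==> dft u ==> dft (\<lambda>s. F (t s) (u s))"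
	unfolding dft_def using dfn_app3[of "\<lambda>y a b. y = F a b" "\<lambda>s. s 0"]
		dft_Suc dft_var[of 0] by (simp add: dft_def numeral_2_eq_2)

lemma dft_app3:
	"dft (\<lambda>s. F (s 0) (s 1) (s 2)) ==> dft t ==> dft u ==> dft v ==> dft (\<lambda>s. F (t s) (u s) (v s))"
	unfolding dft_def[of "\<lambda>s. F (s 0) (s 1) (s 2)"] dft_def[of "\<lambda>s. F (t s) (u s) (v s)"]
	using dfn_app4[of "\<lambda>y a b c. y = F a b c" "\<lambda>s. s 0" "\<lambda>s. t (\<lambda>n. s (Suc n))" "\<lambda>s. u (\<lambda>n. s (Suc n))" "\<lambda>s. v (\<lambda>n. s (Suc n))"]
		dft_Suc dft_var[of 0] by (simp add: numeral_2_eq_2 numeral_3_eq_3)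

lemma dfn_mem [df]: "dft t ==> dft u ==> dfn (\<lambda>s. t s \<in> elts (u s))"
	by (rule dfn_app2[of "\<lambda>x y. x \<in> elts y"]) (auto simp: dfn_def intro: dfr_mem_vv)
lemma dfn_eq [df]: "dft t ==> dft u ==> dfn (\<lambda>s. t s = u s)"
	by (rule dfn_app2[of "\<lambda>x y. x = y"]) (auto simp: dfn_def intro: dfr_eq_vv)

lemma dfn_ball [df]:
	"dft t ==> dfn (\<lambda>s. P (s 0) (\<lambda>n. s (Suc n))) ==> dfn (\<lambda>s. \<forall>x\<in>elts (t s). P x s)"
	unfolding Ball_def by (intro dfn_all dfn_imp dfn_mem dft_Suc df)
lemma dfn_bex [df]:
	"dft t ==> dfn (\<lambda>s. P (s 0) (\<lambda>n. s (Suc n))) ==> dfn (\<lambda>s. \<exists>x\<in>elts (t s). P x s)"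
	unfolding Bex_def by (intro dfn_ex dfn_conj dfn_mem dft_Suc df)
lemma dfn_sub [df]: "dft t ==> dft u ==> dfn (\<lambda>s. elts (t s) \<subseteq> elts (u s))"
	unfolding subset_iff by (intro dfn_all dfn_imp dfn_mem dft_Suc df)
lemma dfn_ex1 [df]:
	assumes "dfn (\<lambda>s. Q (s 0) (\<lambda>n. s (Suc n)))"
	shows "dfn (\<lambda>s. \<exists>!x. Q x s)"
proof -
	have "dfn (\<lambda>s. Q (s 0) (\<lambda>n. s (Suc (Suc n))))"
		using dfn_ren[OF assms, of "\<lambda>n. if n = 0 then 0 else Suc n"] by (auto simp: inj_def)
	then show ?thesis unfolding Ex1_def by (intro df) (use assms in simp_all)
qed

lemma dft_if [df]: "dfn P ==> dft t ==> dft u ==> dft (\<lambda>s. if P s then t s else u s)"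
proof -
	assume a: "dfn P" "dft t" "dft u"
	have "dfn (\<lambda>s. (P (\<lambda>n. s (Suc n)) \<and> s 0 = t (\<lambda>n. s (Suc n))) \<or> (\<not> P (\<lambda>n. s (Suc n)) \<and> s 0 = u (\<lambda>n. s (Suc n))))"
		using a dfn_ren[OF a(1), of Suc] by (intro dfn_disj dfn_conj dfn_neg) (auto simp: dft_def)
	then show ?thesis unfolding dft_def by (rule back_subst[of dfn]) (auto simp: fun_eq_iff)
qed

end

section \<open>Elementary set theory\<close>

locale zf = eps_structure mem for mem :: "'v => 'v => bool" +
	assumes ZF: ZF
begin

definition isset :: "'v set => bool" where
	"isset S \<longleftrightarrow> (\<exists>z. elts z = S)"

lemmas ZF_axioms = ZF[unfolded ZF_def]
lemmas ax_ext = ZF_axioms[THEN conjunct1]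
lemmas ax_foundation = ZF_axioms[THEN conjunct2, THEN conjunct1]
lemmas ax_pairing = ZF_axioms[THEN conjunct2, THEN conjunct2, THEN conjunct1]
lemmas ax_union = ZF_axioms[THEN conjunct2, THEN conjunct2, THEN conjunct2, THEN conjunct1]
lemmas ax_power = ZF_axioms[THEN conjunct2, THEN conjunct2, THEN conjunct2, THEN conjunct2, THEN conjunct1]
lemmas ax_infinity =
	ZF_axioms[THEN conjunct2, THEN conjunct2, THEN conjunct2, THEN conjunct2, THEN conjunct2, THEN conjunct1]
lemmas ax_separation =
	ZF_axioms[THEN conjunct2, THEN conjunct2, THEN conjunct2, THEN conjunct2, THEN conjunct2, THEN conjunct2,
		THEN conjunct1]
lemmas ax_replacement =
	ZF_axioms[THEN conjunct2, THEN conjunct2, THEN conjunct2, THEN conjunct2, THEN conjunct2, THEN conjunct2,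
		THEN conjunct2]

lemma elts_inject: "elts a = elts b ==> a = b"
	using ax_ext by blast

lemma foundation: "x \<in> elts a ==> \<exists>x\<in>elts a. elts x \<inter> elts a = {}"
	using ax_foundation by blast

lemma isset_elts [simp]: "isset (elts a)"
	unfolding isset_def by blast

lemma isset_upair: "isset {a, b}"
	using ax_pairing unfolding isset_def by blast

lemma isset_union: "isset (\<Union>x\<in>elts a. elts x)"
	using ax_union unfolding isset_def by blast

lemma isset_power: "isset {x. elts x \<subseteq> elts a}"
	using ax_power unfolding isset_def by blast

lemma elts_setof [simp]: "isset S ==> elts (setof S) = S"
	unfolding isset_def setof_def by (metis (mono_tags, lifting) elts_inject theI_unique)

lemma setof_elts [simp]: "setof (elts a) = a"
	by (rule elts_inject) simp

lemma isset_sep: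
	assumes "dfn (\<lambda>s. Q (s 0))"
	shows "isset {x \<in> elts a. Q x}"
proof -
	obtain \<phi> c where 1: "\<And>s. Q (s 0) = sat mem (mrg c s) \<phi>"
		using assms unfolding dfn_def dfr_def satr_UNIV by auto
	\<comment> \<open>The separated element is argument 0 of \<open>\<phi>\<close>, hence variable 1,
	  whereas the axiom binds variable 0. All other variables move up by one.\<close>
	let ?f = "\<lambda>i::nat. if i = 1 then 0 else Suc i"
	have f: "inj ?f" by (auto simp: inj_def)
	let ?e = "\<lambda>j. if j = 1 then c 0 else mrg c (\<lambda>_. a) (j - 1)"
	have "(?e(0 := x)) \<circ> ?f = mrg c (case_nat x (\<lambda>_. a))" for x
	proof
		fix i :: nat
		have "0 < i div 2" if "odd i" "i \<noteq> 1" using that by presburger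
		then show "((?e(0 := x)) \<circ> ?f) i = mrg c (case_nat x (\<lambda>_. a)) i"
			by (auto simp: mrg_def split: nat.splits)
	qed
	then have "sat mem (?e(0 := x)) (ren ?f \<phi>) = Q x" for x
		using satr_ren[OF f, of UNIV mem "?e(0 := x)" \<phi>] 1[of "case_nat x (\<lambda>_. a)"]
		by (simp add: satr_UNIV)
	then have "{x \<in> elts a. Q x} = {x \<in> elts a. sat mem (?e(0 := x)) (ren ?f \<phi>)}" by simp
	then show ?thesis unfolding isset_def
		using ax_separation[rule_format, of a ?e "ren ?f \<phi>"] by simp
qed

lemma isset_image:
	assumes "dft (\<lambda>s. F (s 0))"
	shows "isset (F ` elts a)"
proof -
	obtain \<phi> c where 1: "\<And>s. (s 0 = F (s 1)) = sat mem (mrg c s) \<phi>"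
		using assms unfolding dft_def dfn_def dfr_def satr_UNIV by auto
	\<comment> \<open>Here \<open>y\<close> is argument 0 and \<open>x\<close> is argument 1, hence
	  variables 1 and 3. Replacement expects \<open>x\<close> at 0 and \<open>y\<close> at 1, so 0 and
	  3 are exchanged.\<close>
	let ?f = "\<lambda>i::nat. if i = 0 then 3 else if i = 3 then 0 else i"
	have f: "inj ?f" by (auto simp: inj_def)
	let ?e = "(mrg c (\<lambda>_. a))(3 := c 0)"
	have eq: "(?e(0 := x, 1 := y)) \<circ> ?f = mrg c (case_nat y (case_nat x (\<lambda>_. a)))" for x y
	proof
		fix i :: nat
		consider "i = 0" | "i = 1" | "i = 2" | "i = 3" | j where "i = Suc (Suc (Suc (Suc j)))"
			by (metis One_nat_def Suc_1 numeral_3_eq_3 not0_implies_Suc)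
		then show "((?e(0 := x, 1 := y)) \<circ> ?f) i = mrg c (case_nat y (case_nat x (\<lambda>_. a))) i"
			by cases (auto simp: mrg_def numeral_3_eq_3)
	qed
	have iff: "sat mem (?e(0 := x, 1 := y)) (ren ?f \<phi>) \<longleftrightarrow> y = F x" for x y
	proof -
		have "sat mem (?e(0 := x, 1 := y)) (ren ?f \<phi>) = sat mem (mrg c (case_nat y (case_nat x (\<lambda>_. a)))) \<phi>"
			using satr_ren[OF f, of UNIV mem "?e(0 := x, 1 := y)" \<phi>] unfolding satr_UNIV eq .
		also have "\<dots> \<longleftrightarrow> y = F x" using 1[of "case_nat y (case_nat x (\<lambda>_. a))"] by simp
		finally show ?thesis .
	qed
	have "\<exists>b. elts b = {y. \<exists>x\<in>elts a. sat mem (?e(0 := x, 1 := y)) (ren ?f \<phi>)}"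
		by (rule ax_replacement[rule_format]) (simp only: iff, blast)
	moreover have "{y. \<exists>x\<in>elts a. sat mem (?e(0 := x, 1 := y)) (ren ?f \<phi>)} = F ` elts a"
		by (simp only: iff) blast
	ultimately show ?thesis unfolding isset_def by simp
qed

lemma isset_sub: "S \<subseteq> elts a ==> dfn (\<lambda>s. s 0 \<in> S) ==> isset S"
	using isset_sep[of "\<lambda>x. x \<in> S" a] by (simp add: Collect_conj_eq Int_absorb1)

lemma isset_UN:
	assumes "dft (\<lambda>s. F (s 0))"
	shows "isset (\<Union>x\<in>elts a. elts (F x))"
	using isset_union[of "setof (F ` elts a)"] isset_image[OF assms] by simp

lemma isset_sing: "isset {a}"
	using isset_upair[of a a] by simp

lemma isset_Un: "isset (elts a \<union> elts b)"
	using isset_union[of "setof {a, b}"] isset_upair by simp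

lemma isset_insert: "isset (insert x (elts a))"
	using isset_Un[of "setof {x}" a] isset_sing by simp

lemma isset_empty: "isset {}"
	using isset_sep[OF dfn_const[of False]] by simp

text \<open>\<open>setof\<close> is a definite description. Its graph is first-order once the
  described set exists for every assignment, so existence has to be unconditional.\<close>

lemma dft_setof:
	assumes "dfn (\<lambda>s. P (s 0) (\<lambda>n. s (Suc n)))" and "\<And>s. isset {x. P x s}"
	shows "dft (\<lambda>s. setof {x. P x s})"
proof -
	have 1: "dfn (\<lambda>s. P (s 0) (\<lambda>n. s (Suc (Suc n))))"
		using dfn_ren[OF assms(1), of "\<lambda>n. if n = 0 then 0 else Suc n"] by (auto simp: inj_def)
	have "dfn (\<lambda>s. \<forall>x. x \<in> elts (s 0) \<longleftrightarrow> P x (\<lambda>n. s (Suc n)))"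
		by (intro df) (use 1 in simp_all)
	moreover have "(\<forall>x. x \<in> elts y \<longleftrightarrow> P x e) \<longleftrightarrow> y = setof {x. P x e}" for y e
		using assms(2)[of e] by (metis Collect_cong Collect_mem_eq elts_setof mem_Collect_eq setof_elts)
	ultimately show ?thesis unfolding dft_def by simp
qed

lemma dft_inst:
	assumes "dft (\<lambda>s. F (s 0) (\<lambda>n. s (Suc n)))"
	shows "dft (\<lambda>s. F (s 0) e)"
proof -
	have "dfn (\<lambda>s. (\<lambda>y s'. s 0 = s 0) (s 0) s)" by (intro df)
	have 1: "dfn (\<lambda>s. s 1 = F (s 0) (\<lambda>n. s (Suc (Suc n))))"
		using dfn_ren[OF assms(1)[unfolded dft_def], of "\<lambda>n. if n = 0 then 1 else if n = 1 then 0 else n"]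
		by (auto simp: inj_def)
	obtain \<phi> c where 2: "\<And>s. (s 1 = F (s 0) (\<lambda>n. s (Suc (Suc n)))) = sat mem (mrg c s) \<phi>"
		using 1 unfolding dfn_def dfr_def satr_UNIV by auto
	let ?f = "\<lambda>i::nat. if even i then 2*i else if i = 1 then 3 else if i = 3 then 1 else 2*(i-4)"
	have f: "inj ?f" unfolding inj_def by (auto; presburger)
	have eq: "mrg (mrg c e) s \<circ> ?f = mrg c (case_nat (s 1) (case_nat (s 0) e))" for s
	proof
		fix i :: nat
		consider k where "i = 2*k" | "i = 1" | "i = 3" | k where "i = Suc (2 * Suc (Suc k))"
			by (metis One_nat_def evenE nat.exhaust oddE plus_1_eq_Suc add.commute mult_0_right numeral_3_eq_3 mult_Suc_right Suc_1 add_2_eq_Suc)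
		then show "(mrg (mrg c e) s \<circ> ?f) i = mrg c (case_nat (s 1) (case_nat (s 0) e)) i"
			by cases (auto simp: mrg_def)
	qed
	have "(s 0 = F (s 1) e) = sat mem (mrg (mrg c e) s) (ren ?f \<phi>)" for s
		using 2[of "case_nat (s 1) (case_nat (s 0) e)"] satr_ren[OF f, of UNIV mem "mrg (mrg c e) s" \<phi>]
		by (simp add: satr_UNIV eq)
	then show ?thesis unfolding dft_def dfn_def dfr_def satr_UNIV by auto
qed

subsection \<open>Pairs and unions\<close>

definition sing :: "'v => 'v" where "sing x = setof {y. y = x}"
definition up :: "'v => 'v => 'v" where "up x y = setof {z. z = x \<or> z = y}"
definition un :: "'v => 'v" where "un a = setof {x. \<exists>y\<in>elts a. x \<in> elts y}"
definition un2 :: "'v => 'v => 'v" where "un2 a b = setof {x. x \<in> elts a \<or> x \<in> elts b}"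

lemma isset_sing': "isset {y. y = x}" using isset_sing by simp
lemma Collect_up: "{z. z = x \<or> z = y} = {x, y}" by auto
lemma isset_up': "isset {z. z = x \<or> z = y}" using isset_upair[of x y] by (simp add: Collect_up)
lemma isset_un': "isset {x. \<exists>y\<in>elts a. x \<in> elts y}" using isset_union[of a] by (simp add: UNION_eq)
lemma isset_un2': "isset {x. x \<in> elts a \<or> x \<in> elts b}" using isset_Un[of a b] by (simp add: Un_def)

lemma elts_sing [simp]: "elts (sing x) = {x}" by (simp add: sing_def isset_sing)
lemma elts_up [simp]: "elts (up x y) = {x, y}" by (simp add: up_def Collect_up isset_upair)
lemma elts_un [simp]: "elts (un a) = (\<Union>x\<in>elts a. elts x)" by (auto simp: un_def isset_un')
lemma elts_un2 [simp]: "elts (un2 a b) = elts a \<union> elts b" by (auto simp: un2_def isset_un2')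
lemma elts_zero [simp]: "elts zero = {}" by (simp add: zero_def isset_empty)
lemma elts_sc [simp]: "elts (sc x) = insert x (elts x)" by (simp add: sc_def isset_insert)
lemma elts_power [simp]: "elts (power a) = {x. elts x \<subseteq> elts a}" by (simp add: power_def isset_power)
lemma pair_eq: "pair x y = up (sing x) (up x y)" by (simp add: pair_def up_def sing_def Collect_up)

lemma up_eq_iff: "up x y = up u v \<longleftrightarrow> (x = u \<and> y = v) \<or> (x = v \<and> y = u)"
	by (metis doubleton_eq_iff elts_up elts_inject)
lemma sing_up: "sing x = up x x"
	by (rule elts_inject) simp
lemma pair_inject [simp]: "pair x y = pair u v \<longleftrightarrow> x = u \<and> y = v"
	unfolding pair_eq sing_up up_eq_iff by auto

lemma elts_eq_empty [simp]: "elts x = {} \<longleftrightarrow> x = zero"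
	by (metis elts_inject elts_zero)

lemma dft_sing [df]: "dft t ==> dft (\<lambda>s. sing (t s))"
proof (rule dft_app1[of sing])
	show "dft (\<lambda>s. sing (s 0))"
		unfolding sing_def by (rule dft_setof) ((intro df)[1], rule isset_sing')
qed

lemma dft_up [df]: "dft t ==> dft u ==> dft (\<lambda>s. up (t s) (u s))"
proof (rule dft_app2[of up])
	show "dft (\<lambda>s. up (s 0) (s 1))"
		unfolding up_def by (rule dft_setof) ((intro df)[1], rule isset_up')
qed

lemma dft_pair [df]: "dft t ==> dft u ==> dft (\<lambda>s. pair (t s) (u s))"
	unfolding pair_eq by (intro df)
lemma dft_un [df]: "dft t ==> dft (\<lambda>s. un (t s))"
proof (rule dft_app1[of un])
	show "dft (\<lambda>s. un (s 0))"
		unfolding un_def by (rule dft_setof) ((intro df)[1], rule isset_un')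
qed

lemma dft_un2 [df]: "dft t ==> dft u ==> dft (\<lambda>s. un2 (t s) (u s))"
proof (rule dft_app2[of un2])
	show "dft (\<lambda>s. un2 (s 0) (s 1))"
		unfolding un2_def by (rule dft_setof) ((intro df)[1], rule isset_un2')
qed

lemma sc_eq: "sc x = un2 x (sing x)"
	by (rule elts_inject) auto
lemma dft_sc [df]: "dft t ==> dft (\<lambda>s. sc (t s))"
	unfolding sc_eq by (intro df)
lemma dft_power [df]: "dft t ==> dft (\<lambda>s. power (t s))"
proof (rule dft_app1[of power])
	show "dft (\<lambda>s. power (s 0))"
		unfolding power_def by (rule dft_setof) ((intro df)[1], rule isset_power)
qed

lemma not_mem_self [simp]: "x \<notin> elts x"
	using foundation[of x "sing x"] by auto
lemma mem_asym: "x \<in> elts y ==> y \<notin> elts x"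
	using foundation[of x "up x y"] by auto
lemma sc_inject [simp]: "sc x = sc y \<longleftrightarrow> x = y"
	by (metis elts_sc insert_iff mem_asym)
lemma sc_neq_zero [simp]: "sc x \<noteq> zero" "zero \<noteq> sc x"
	by (metis elts_sc elts_zero insert_not_empty)+

subsection \<open>Functions\<close>

definition prd :: "'v => 'v => 'v" where
	"prd a b = setof {p. \<exists>x\<in>elts a. \<exists>y\<in>elts b. p = pair x y}"

lemma isset_prd: "isset {p. \<exists>x\<in>elts a. \<exists>y\<in>elts b. p = pair x y}"
proof (rule isset_sub)
	show "{p. \<exists>x\<in>elts a. \<exists>y\<in>elts b. p = pair x y} \<subseteq> elts (power (power (un2 a b)))"
		by (auto simp: pair_eq)
qed (simp, intro df)

lemma elts_prd: "elts (prd a b) = {p. \<exists>x\<in>elts a. \<exists>y\<in>elts b. p = pair x y}"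
	unfolding prd_def by (simp add: isset_prd)

lemma pair_in_prd [simp]: "pair x y \<in> elts (prd a b) \<longleftrightarrow> x \<in> elts a \<and> y \<in> elts b"
	by (auto simp: elts_prd)

text \<open>A total replacement for the definite description \<open>app\<close>: the union of all
  values of \<open>f\<close> at \<open>x\<close>. It agrees with \<open>app\<close> on functions, is
  \<open>zero\<close> outside the domain, and is first-order and absolute without side
  conditions.\<close>

definition ap :: "'v => 'v => 'v" where
	"ap f x = setof {z. \<exists>y. pair x y \<in> elts f \<and> z \<in> elts y}"

lemma isset_ap: "isset {z. \<exists>y. pair x y \<in> elts f \<and> z \<in> elts y}"
	by (rule isset_sub[of _ "un (un (un f))"]) (auto simp: pair_eq intro!: df)

lemma elts_ap: "elts (ap f x) = {z. \<exists>y. pair x y \<in> elts f \<and> z \<in> elts y}"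
	unfolding ap_def by (simp add: isset_ap)

lemma dft_ap [df]: "dft t ==> dft u ==> dft (\<lambda>s. ap (t s) (u s))"
proof (rule dft_app2[of ap])
	show "dft (\<lambda>s. ap (s 0) (s 1))"
		unfolding ap_def by (rule dft_setof) ((intro df)[1], rule isset_ap)
qed

lemma func_on_iff:
	"func_on f a \<longleftrightarrow> (\<forall>p\<in>elts f. \<exists>x\<in>elts a. \<exists>y. p = pair x y) \<and> (\<forall>x\<in>elts a. \<exists>!y. pair x y \<in> elts f)"
	(is "_ \<longleftrightarrow> ?R")
proof
	assume ?R
	have "isset {y. \<exists>x. pair x y \<in> elts f}"
		by (rule isset_sub[of _ "un (un f)"]) (auto simp: pair_eq intro!: df)
	then have "elts (setof {y. \<exists>x. pair x y \<in> elts f}) = {y. \<exists>x. pair x y \<in> elts f}" by simp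
	then show "func_on f a" using \<open>?R\<close> unfolding func_on_def func_def
		by (intro exI[of _ "setof {y. \<exists>x. pair x y \<in> elts f}"]) fastforce
qed (auto simp: func_on_def func_def)

lemma func_onD1: "func_on f a ==> p \<in> elts f ==> \<exists>x\<in>elts a. \<exists>y. p = pair x y"
	unfolding func_on_iff by (drule conjunct1) (rule bspec)

lemma func_onD2: "func_on f a ==> x \<in> elts a ==> \<exists>!y. pair x y \<in> elts f"
	unfolding func_on_iff by (drule conjunct2) (rule bspec)

lemma func_on_dom: "func_on f a ==> pair x y \<in> elts f ==> x \<in> elts a"
	by (drule (1) func_onD1) auto

lemma func_on_unique:
	assumes "func_on f a" "pair x y \<in> elts f" "pair x y' \<in> elts f"
	shows "y' = y"
	using func_onD2[OF assms(1) func_on_dom[OF assms(1,2)]] assms(2,3) by blast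

lemma pair_in_func:
	assumes f: "func_on f a"
	shows "pair x y \<in> elts f \<longleftrightarrow> x \<in> elts a \<and> y = ap f x"
proof -
	have 1: "y = ap f x" if "pair x y \<in> elts f" for x y
	proof (rule elts_inject)
		have "y' = y" if "pair x y' \<in> elts f" for y'
			using func_on_unique[OF f \<open>pair x y \<in> elts f\<close> that] .
		then show "elts y = elts (ap f x)" unfolding elts_ap using that by blast
	qed
	show ?thesis
	proof
		assume "x \<in> elts a \<and> y = ap f x"
		then show "pair x y \<in> elts f" using func_onD2[OF f, of x] 1 by blast
	qed (use 1 func_on_dom[OF f] in blast)
qed

lemma in_func_on:
	assumes "func_on f a"
	shows "p \<in> elts f \<longleftrightarrow> (\<exists>x\<in>elts a. p = pair x (ap f x))"
proof
	assume p: "p \<in> elts f"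
	then obtain x y where "x \<in> elts a" "p = pair x y" using func_onD1[OF assms] by blast
	with p show "\<exists>x\<in>elts a. p = pair x (ap f x)" using pair_in_func[OF assms, of x y] by auto
qed (use pair_in_func[OF assms] in blast)

lemma app_eq: "func_on f a ==> x \<in> elts a ==> app f x = ap f x"
	unfolding app_def by (simp add: pair_in_func)

lemma func_func_on: "func f a b ==> func_on f a"
	unfolding func_on_def by blast

lemma func_iff: "func f a b \<longleftrightarrow> func_on f a \<and> (\<forall>x\<in>elts a. ap f x \<in> elts b)"
proof
	assume 1: "func f a b"
	then have 2: "func_on f a" by (rule func_func_on)
	have "ap f x \<in> elts b" if "x \<in> elts a" for x
	proof -
		have "pair x (ap f x) \<in> elts f" using pair_in_func[OF 2] that by simp
		then obtain x' y where "y \<in> elts b" "pair x (ap f x) = pair x' y"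
			using 1 unfolding func_def by blast
		then show ?thesis by (metis pair_inject)
	qed
	with 2 show "func_on f a \<and> (\<forall>x\<in>elts a. ap f x \<in> elts b)" by simp
next
	assume 1: "func_on f a \<and> (\<forall>x\<in>elts a. ap f x \<in> elts b)"
	then have f: "func_on f a" by simp
	show "func f a b" unfolding func_def
	proof (intro conjI ballI)
		fix p assume "p \<in> elts f"
		then show "\<exists>x\<in>elts a. \<exists>y\<in>elts b. p = pair x y" using 1 in_func_on[OF f] by blast
	next
		fix x assume "x \<in> elts a"
		then show "\<exists>!y. pair x y \<in> elts f" by (rule func_onD2[OF f])
	qed
qed

lemma func_ap: "func f a b ==> x \<in> elts a ==> ap f x \<in> elts b"
	by (simp add: func_iff)

lemma func_app: "func f a b ==> x \<in> elts a ==> app f x = ap f x"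
	by (rule app_eq) (rule func_func_on)

lemma fun_ext: "func_on f a ==> func_on g a ==> (\<And>x. x \<in> elts a ==> ap f x = ap g x) ==> f = g"
	by (rule elts_inject) (auto simp: in_func_on)

lemma dfn_func_on [df]: "dft t ==> dft u ==> dfn (\<lambda>s. func_on (t s) (u s))"
	by (rule dfn_app2[of func_on]) (unfold func_on_iff, intro df)
lemma dfn_func [df]: "dft t ==> dft u ==> dft v ==> dfn (\<lambda>s. func (t s) (u s) (v s))"
	by (rule dfn_app3[of func]) (unfold func_iff, intro df)

definition lam :: "'v => ('v => 'v) => 'v" where
	"lam a F = setof {p. \<exists>x\<in>elts a. p = pair x (F x)}"

lemma isset_lam: "dft (\<lambda>s. F (s 0)) ==> isset {p. \<exists>x\<in>elts a. p = pair x (F x)}"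
	using isset_image[of "\<lambda>x. pair x (F x)" a] by (simp add: df image_def Bex_def)

lemma elts_lam: "dft (\<lambda>s. F (s 0)) ==> elts (lam a F) = {p. \<exists>x\<in>elts a. p = pair x (F x)}"
	unfolding lam_def by (simp add: isset_lam)

lemma func_on_lam: "dft (\<lambda>s. F (s 0)) ==> func_on (lam a F) a"
	unfolding func_on_iff by (auto simp: elts_lam)

lemma ap_lam: "dft (\<lambda>s. F (s 0)) ==> x \<in> elts a ==> ap (lam a F) x = F x"
	using pair_in_func[OF func_on_lam[of F a], of x "F x"] by (auto simp: elts_lam)

lemma func_lam: "dft (\<lambda>s. F (s 0)) ==> (\<And>x. x \<in> elts a ==> F x \<in> elts b) ==> func (lam a F) a b"
	by (simp add: func_iff func_on_lam ap_lam)

lemma lam_cong: "(\<And>x. x \<in> elts a ==> F x = G x) ==> lam a F = lam a G"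
	unfolding lam_def by (rule arg_cong[of _ _ setof]) auto

lemma dft_lam [df]:
	assumes F: "dft (\<lambda>s. F (s 0) (\<lambda>n. s (Suc n)))" and t: "dft t"
	shows "dft (\<lambda>s. lam (t s) (\<lambda>x. F x s))"
proof -
	have 1: "dft (\<lambda>s. F (s 0) (\<lambda>n. s (Suc (Suc (Suc n)))))"
		using dft_ren[OF F, of "\<lambda>n. if n = 0 then 0 else Suc (Suc n)"] by (auto simp: inj_def)
	have "dft (\<lambda>s. setof {p. \<exists>x\<in>elts (s 0). p = pair x (F x (\<lambda>n. s (Suc n)))})"
		by (rule dft_setof) ((intro df 1)[1], rule isset_lam[OF dft_inst[OF F]])
	then have "dft (\<lambda>s. lam (s 0) (\<lambda>x. F x (\<lambda>n. s (Suc n))))" unfolding lam_def .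
	from dft_subst[OF this t] show ?thesis .
qed

lemma elts_restr: "elts (restr f a) = {p \<in> elts f. \<exists>x\<in>elts a. \<exists>y. p = pair x y}"
	unfolding restr_def
	by (rule elts_setof, rule isset_sub[of _ f]) (auto intro!: df)

lemma restr_eq: "func_on f a ==> elts b \<subseteq> elts a ==> restr f b = lam b (ap f)"
	by (rule elts_inject) (auto simp: elts_restr elts_lam df in_func_on)

lemma restr_lam: "dft (\<lambda>s. F (s 0)) ==> elts b \<subseteq> elts a ==> restr (lam a F) b = lam b F"
	by (simp add: restr_eq[OF func_on_lam]) (metis (no_types, lifting) ap_lam lam_cong subsetD)

lemma dft_restr [df]: "dft t ==> dft u ==> dft (\<lambda>s. restr (t s) (u s))"
proof (rule dft_app2[of restr])
	have "dft (\<lambda>s. setof {p. p \<in> elts (s 0) \<and> (\<exists>x\<in>elts (s 1). \<exists>y. p = pair x y)})"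
		by (rule dft_setof) ((intro df)[1], rule isset_sep, intro df)
	then show "dft (\<lambda>s. restr (s 0) (s 1))" unfolding restr_def .
qed

definition dom :: "'v => 'v" where "dom f = setof {x. \<exists>y. pair x y \<in> elts f}"

lemma isset_dom: "isset {x. \<exists>y. pair x y \<in> elts f}"
	by (rule isset_sub[of _ "un (un f)"]) (auto simp: pair_eq intro!: df)

lemma elts_dom: "elts (dom f) = {x. \<exists>y. pair x y \<in> elts f}"
	unfolding dom_def by (simp add: isset_dom)

lemma dom_eq: "func_on f a ==> dom f = a"
	by (rule elts_inject) (simp add: elts_dom pair_in_func)

lemma dft_dom [df]: "dft t ==> dft (\<lambda>s. dom (t s))"
proof (rule dft_app1[of dom])
	show "dft (\<lambda>s. dom (s 0))"
		unfolding dom_def by (rule dft_setof) ((intro df)[1], rule isset_dom)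
qed

lemma isset_fspace: "isset {f. func f a b}"
proof (rule isset_sub)
	show "{f. func f a b} \<subseteq> elts (power (prd a b))"
		by (auto simp: func_def)
qed (simp, intro df)

lemma elts_fspace [simp]: "elts (fspace a b) = {f. func f a b}"
	unfolding fspace_def by (simp add: isset_fspace)

lemma dft_fspace [df]: "dft t ==> dft u ==> dft (\<lambda>s. fspace (t s) (u s))"
proof (rule dft_app2[of fspace])
	show "dft (\<lambda>s. fspace (s 0) (s 1))"
		unfolding fspace_def by (rule dft_setof) ((intro df)[1], rule isset_fspace)
qed

lemma sepI: "dfn (\<lambda>s. Q (s 0)) ==> elts (setof {x \<in> elts a. Q x}) = {x \<in> elts a. Q x}"
	by (simp add: isset_sep)

lemma dft_sep [df]:
	assumes F: "dfn (\<lambda>s. Q (s 0) (\<lambda>n. s (Suc n)))" and t: "dft t"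
	shows "dft (\<lambda>s. setof {x \<in> elts (t s). Q x s})"
proof -
	have 1: "dfn (\<lambda>s. Q (s 0) (\<lambda>n. s (Suc (Suc n))))"
		using dfn_ren[OF F, of "\<lambda>n. if n = 0 then 0 else Suc n"] by (auto simp: inj_def)
	have "dft (\<lambda>s. setof {x. x \<in> elts (s 0) \<and> Q x (\<lambda>n. s (Suc n))})"
		by (rule dft_setof) ((intro df 1)[1], rule isset_sep[OF dfn_inst[OF F]])
	from dft_subst[OF this t] show ?thesis .
qed

end

section \<open>Ordinals and recursion\<close>

context eps_structure
begin

lemma dft_subst2:
	assumes "dft (\<lambda>s. F (s 0) (s 1) (\<lambda>n. s (Suc (Suc n))))" "dft t" "dft u"
	shows "dft (\<lambda>s. F (t s) (u s) s)"
proof (rule dft_subst[of "\<lambda>x s. F x (u s) s", OF _ assms(2)])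
	have "dft (\<lambda>s. F (s 1) (s 0) (\<lambda>n. s (Suc (Suc n))))"
		using dft_ren[OF assms(1), of "\<lambda>n. if n = 0 then 1 else if n = 1 then 0 else n"]
		by (auto simp: inj_def)
	then show "dft (\<lambda>s. F (s 0) (u (\<lambda>n. s (Suc n))) (\<lambda>n. s (Suc n)))"
		using dft_subst[of "\<lambda>y s. F (s 0) y (\<lambda>n. s (Suc n))" "\<lambda>s. u (\<lambda>n. s (Suc n))"] dft_Suc[OF assms(3)]
		by simp
qed

end

context zf
begin

lemma dfn_transitive [df]: "dft t ==> dfn (\<lambda>s. transitive (t s))"
	by (rule dfn_app1[of transitive]) (unfold transitive_def, intro df)
lemma dfn_Ord [df]: "dft t ==> dfn (\<lambda>s. Ord (t s))"
	by (rule dfn_app1[of Ord]) (unfold Ord_def, intro df)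

lemma transD: "transitive a ==> x \<in> elts a ==> y \<in> elts x ==> y \<in> elts a"
	unfolding transitive_def by blast
lemma Ord_trans: "Ord a ==> x \<in> elts a ==> y \<in> elts x ==> y \<in> elts a"
	unfolding Ord_def by (blast intro: transD)
lemma Ord_in: "Ord a ==> x \<in> elts a ==> Ord x"
	unfolding Ord_def by (meson transD)
lemma Ord_subset: "Ord a ==> x \<in> elts a ==> elts x \<subseteq> elts a"
	by (blast intro: Ord_trans)
lemma Ord_zero [simp]: "Ord zero"
	unfolding Ord_def transitive_def by simp
lemma Ord_sc: "Ord a ==> Ord (sc a)"
	unfolding Ord_def transitive_def by auto

lemma minimal:
	assumes "dfn (\<lambda>s. Q (s 0))" "x \<in> elts a" "Q x"
	shows "\<exists>y\<in>elts a. Q y \<and> (\<forall>z\<in>elts y. z \<in> elts a --> \<not> Q z)"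
proof -
	have e: "elts (setof {x \<in> elts a. Q x}) = {x \<in> elts a. Q x}" using sepI[OF assms(1)] .
	show ?thesis using foundation[of x "setof {x \<in> elts a. Q x}"] assms(2,3) unfolding e by blast
qed

lemma Ord_induct:
	assumes "dfn (\<lambda>s. Q (s 0))" "Ord a"
		and step: "\<And>a. Ord a ==> (\<And>b. b \<in> elts a ==> Q b) ==> Q a"
	shows "Q a"
proof (rule ccontr)
	assume "\<not> Q a"
	then obtain y where y: "y \<in> elts (sc a)" "\<not> Q y" "\<forall>z\<in>elts y. z \<in> elts (sc a) --> Q z"
		using minimal[OF dfn_neg[OF assms(1)], of a "sc a"] by auto
	have "Ord y" using Ord_in[OF Ord_sc[OF assms(2)] y(1)] .
	moreover have "Q z" if "z \<in> elts y" for z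
		using y(3) that Ord_trans[OF Ord_sc[OF assms(2)] y(1) that] by blast
	ultimately show False using step y(2) by blast
qed

lemma Ord_least:
	assumes "dfn (\<lambda>s. Q (s 0))" "Ord a" "Q a"
	shows "\<exists>b. Ord b \<and> b \<in> elts (sc a) \<and> Q b \<and> (\<forall>c\<in>elts b. \<not> Q c)"
proof -
	obtain y where y: "y \<in> elts (sc a)" "Q y" "\<forall>z\<in>elts y. z \<in> elts (sc a) --> \<not> Q z"
		using minimal[OF assms(1), of a "sc a"] assms(3) by auto
	then show ?thesis using Ord_in[OF Ord_sc[OF assms(2)] y(1)] Ord_trans[OF Ord_sc[OF assms(2)] y(1)]
		by blast
qed

lemma Ord_linear: "Ord a ==> Ord b ==> a \<in> elts b \<or> a = b \<or> b \<in> elts a"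
proof -
	have "\<forall>b. Ord b --> a \<in> elts b \<or> a = b \<or> b \<in> elts a" if "Ord a" for a
	proof (rule Ord_induct[OF _ that], intro df, intro allI impI)
		fix a b assume a: "Ord a" and IH: "\<And>x. x \<in> elts a ==> \<forall>b. Ord b --> x \<in> elts b \<or> x = b \<or> b \<in> elts x"
			and b: "Ord b"
		show "a \<in> elts b \<or> a = b \<or> b \<in> elts a"
		proof (rule Ord_induct[OF _ b], intro df)
			fix b assume b: "Ord b" and IH2: "\<And>y. y \<in> elts b ==> a \<in> elts y \<or> a = y \<or> y \<in> elts a"
			show "a \<in> elts b \<or> a = b \<or> b \<in> elts a"
			proof (rule ccontr)
				assume n: "\<not> ?thesis"
				have "elts b \<subseteq> elts a" using IH2 n Ord_trans[OF b] by blast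
				moreover have "elts a \<subseteq> elts b" using IH b n Ord_trans[OF a] by blast
				ultimately show False using n elts_inject by blast
			qed
		qed
	qed
	then show "Ord a ==> Ord b ==> ?thesis" by blast
qed

lemma Ord_subset_iff: "Ord a ==> Ord b ==> elts a \<subseteq> elts b \<longleftrightarrow> a \<in> elts b \<or> a = b"
	by (metis Ord_linear Ord_subset not_mem_self order_refl subsetD)

lemma Ord_not_mem: "Ord a ==> Ord b ==> a \<notin> elts b \<longleftrightarrow> elts b \<subseteq> elts a"
	by (metis Ord_linear Ord_subset_iff mem_asym not_mem_self)

lemma Ord_un: "(\<And>x. x \<in> elts a ==> Ord x) ==> Ord (un a)"
	unfolding Ord_def transitive_def by simp blast

lemma Ord_un2: "Ord a ==> Ord b ==> Ord (un2 a b)"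
	unfolding Ord_def transitive_def by simp blast

lemma un2_max: "Ord a ==> Ord b ==> un2 a b = (if a \<in> elts b then b else a)"
	by (rule elts_inject) (use Ord_not_mem[of a b] Ord_subset[of b a] in auto)

text \<open>If no element of the ordinal \<open>a\<close> satisfies \<open>Q\<close>, then \<open>lst a Q\<close> is \<open>a\<close> itself.\<close>

definition lst :: "'v => ('v => bool) => 'v" where
	"lst a Q = setof {x \<in> elts a. \<forall>y\<in>elts a. Q y --> x \<in> elts y}"

lemma lst_eq:
	assumes Q: "dfn (\<lambda>s. Q (s 0))" and a: "Ord a" and b: "b \<in> elts a" "Q b" "\<forall>c\<in>elts b. \<not> Q c"
	shows "lst a Q = b"
proof (rule elts_inject)
	have "dfn (\<lambda>s. \<forall>y\<in>elts a. Q y --> s 0 \<in> elts y)"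
		by (intro df) (use dfn_app1[OF Q dft_var[of 0]] in simp)
	then have "elts (lst a Q) = {x \<in> elts a. \<forall>y\<in>elts a. Q y --> x \<in> elts y}"
		unfolding lst_def by (rule sepI)
	also have "\<dots> = elts b"
	proof (intro equalityI subsetI)
		fix x assume x: "x \<in> elts b"
		have "x \<in> elts y" if "y \<in> elts a" "Q y" for y
			using Ord_linear[OF Ord_in[OF a b(1)] Ord_in[OF a that(1)]] b(3) that x
				Ord_trans[OF Ord_in[OF a that(1)], of b x] by blast
		then show "x \<in> {x \<in> elts a. \<forall>y\<in>elts a. Q y --> x \<in> elts y}"
			using x Ord_trans[OF a b(1)] by blast
	qed (use b in auto)
	finally show "elts (lst a Q) = elts b" .
qed

lemma lst:
	assumes Q: "dfn (\<lambda>s. Q (s 0))" and a: "Ord a" and x: "x \<in> elts a" "Q x"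
	shows "lst a Q \<in> elts a" "Q (lst a Q)" "y \<in> elts (lst a Q) ==> \<not> Q y"
proof -
	obtain b where b: "b \<in> elts a" "Q b" "\<forall>c\<in>elts b. \<not> Q c"
		using minimal[of Q x a] assms Ord_trans[OF a] by blast
	from lst_eq[OF Q a this] show "lst a Q \<in> elts a" "Q (lst a Q)" "y \<in> elts (lst a Q) ==> \<not> Q y"
		using b by auto
qed

lemma dft_lst [df]:
	assumes Q: "dfn (\<lambda>s. Q (s 0) (\<lambda>n. s (Suc n)))" and t: "dft t"
	shows "dft (\<lambda>s. lst (t s) (\<lambda>x. Q x s))"
proof -
	have 1: "dfn (\<lambda>s. Q (s 0) (\<lambda>n. s (Suc (Suc (Suc n)))))"
		using dfn_ren[OF Q, of "\<lambda>n. if n = 0 then 0 else Suc (Suc n)"] by (auto simp: inj_def)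
	have "dft (\<lambda>s. setof {x \<in> elts (s 0). \<forall>y\<in>elts (s 0). Q y (\<lambda>n. s (Suc n)) --> x \<in> elts y})"
		by (intro df) (use 1 in simp_all)
	then have "dft (\<lambda>s. lst (s 0) (\<lambda>x. Q x (\<lambda>n. s (Suc n))))" unfolding lst_def .
	from dft_subst[OF this t] show ?thesis .
qed

subsection \<open>The natural numbers\<close>

lemma isset_omega: "isset {n. \<forall>w. zero \<in> elts w \<and> (\<forall>x\<in>elts w. sc x \<in> elts w) --> n \<in> elts w}"
proof -
	obtain w e where w: "e \<in> elts w" "elts e = {}" "\<forall>x\<in>elts w. \<exists>y\<in>elts w. elts y = insert x (elts x)"
		using ax_infinity by blast
	have "e = zero" using w(2) by simp
	moreover have "sc x \<in> elts w" if "x \<in> elts w" for x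
		using w(3) that elts_inject[of _ "sc x"] by (metis elts_sc)
	ultimately have "{n. \<forall>w. zero \<in> elts w \<and> (\<forall>x\<in>elts w. sc x \<in> elts w) --> n \<in> elts w} \<subseteq> elts w"
		using w(1) by blast
	then show ?thesis by (rule isset_sub) (simp, intro df)
qed

lemma elts_omega: "elts omega = {n. \<forall>w. zero \<in> elts w \<and> (\<forall>x\<in>elts w. sc x \<in> elts w) --> n \<in> elts w}"
	unfolding omega_def by (simp add: isset_omega)

lemma zero_omega [simp]: "zero \<in> elts omega"
	by (simp add: elts_omega)
lemma sc_omega [simp]: "n \<in> elts omega ==> sc n \<in> elts omega"
	by (simp add: elts_omega)

text \<open>The numbers of the structure may be nonstandard, so induction reaches only predicates
  that separation covers; the case \<open>dfn\<close> collects this obligation.\<close>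

lemma omega_induct [consumes 1, case_names dfn zero sc]:
	assumes "n \<in> elts omega" "dfn (\<lambda>s. Q (s 0))" "Q zero" "\<And>n. n \<in> elts omega ==> Q n ==> Q (sc n)"
	shows "Q n"
proof -
	have e: "elts (setof {x \<in> elts omega. Q x}) = {x \<in> elts omega. Q x}" using sepI[OF assms(2)] .
	have "n \<in> elts (setof {x \<in> elts omega. Q x})"
		using assms(1) unfolding elts_omega[THEN set_eq_iff[THEN iffD1], rule_format, of n, simplified]
		by (rule allE[of _ "setof {x \<in> elts omega. Q x}"]) (use e assms(3,4) in auto)
	then show ?thesis unfolding e by simp
qed

lemma Ord_nat: "n \<in> elts omega ==> Ord n"
	by (induction rule: omega_induct) (intro df, simp_all add: Ord_sc)

lemma nat_cases: "n \<in> elts omega ==> n = zero \<or> (\<exists>m\<in>elts omega. n = sc m)"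
	by (induction rule: omega_induct) (intro df, auto)

lemma trans_omega: "n \<in> elts omega ==> x \<in> elts n ==> x \<in> elts omega"
proof -
	have "n \<in> elts omega ==> elts n \<subseteq> elts omega"
		by (induction rule: omega_induct) (intro df, auto)
	then show "n \<in> elts omega ==> x \<in> elts n ==> x \<in> elts omega" by blast
qed

lemma Ord_omega [simp]: "Ord omega"
	unfolding Ord_def transitive_def using trans_omega Ord_nat[unfolded Ord_def transitive_def] by blast

lemma un_sc: "Ord n ==> un (sc n) = n"
	by (rule elts_inject) (auto dest: Ord_trans)

lemma sc_in_omega [simp]: "sc n \<in> elts omega \<longleftrightarrow> n \<in> elts omega"
	using trans_omega[of "sc n" n] by auto

lemma sc_mono:
	assumes "Ord a" "x \<in> elts a" shows "sc x \<in> elts (sc a)"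
	using Ord_linear[OF Ord_sc[OF Ord_in[OF assms]] assms(1)] assms(2) mem_asym[OF assms(2)] by auto

lemma zero_in_sc: "n \<in> elts omega ==> zero \<in> elts (sc n)"
	by (induction rule: omega_induct) (intro df, auto)

lemma zero_in: "Ord a ==> a \<noteq> zero ==> zero \<in> elts a"
	using Ord_linear[of zero a] by auto

subsection \<open>Transfinite recursion\<close>

definition tap :: "('v => 'v => 'v) => 'v => 'v => bool" where
	"tap F a h \<longleftrightarrow> Ord a \<and> func_on h a \<and> (\<forall>b\<in>elts a. ap h b = F b (restr h b))"
definition hst :: "('v => 'v => 'v) => 'v => 'v" where
	"hst F a = setof {p. \<exists>h. tap F a h \<and> p \<in> elts h}"
definition trec :: "('v => 'v => 'v) => 'v => 'v" where
	"trec F a = F a (hst F a)"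

lemma tap_unique:
	assumes "tap F a h" "tap F a h'"
	shows "h = h'"
proof (rule fun_ext)
	have a: "Ord a" and h: "func_on h a" "func_on h' a" using assms unfolding tap_def by auto
	show "func_on h a" "func_on h' a" by fact+
	have *: "Ord x ==> x \<in> elts a --> ap h x = ap h' x" for x
	proof (erule Ord_induct[rotated], intro impI)
		fix b assume b: "Ord b" "b \<in> elts a" and IH: "\<And>c. c \<in> elts b ==> c \<in> elts a --> ap h c = ap h' c"
		have "restr h b = restr h' b"
			using IH Ord_trans[OF a b(2)] Ord_subset[OF a b(2)] h
			by (auto simp: restr_eq intro!: lam_cong)
		then show "ap h b = ap h' b" using assms b(2) unfolding tap_def by simp
	qed (intro df)
	show "\<And>x. x \<in> elts a ==> ap h x = ap h' x" using * Ord_in[OF a] by blast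
qed

text \<open>True for arbitrary \<open>F\<close>: there is at most one history of length
  \<open>a\<close>, so the collection of its pairs is either that history or empty. Hence
  \<open>dft_setof\<close> applies to \<open>hst\<close> before the existence of histories is
  known.\<close>

lemma isset_hst: "isset {p. \<exists>h. tap F a h \<and> p \<in> elts h}"
proof (cases "\<exists>h. tap F a h")
	case True
	then obtain h where "tap F a h" by blast
	then have "{p. \<exists>h. tap F a h \<and> p \<in> elts h} = elts h" using tap_unique by blast
	then show ?thesis by simp
qed (simp add: isset_empty)

lemma hst_eq: "tap F a h ==> hst F a = h"
	unfolding hst_def using isset_hst tap_unique
	by (intro elts_inject) (auto dest: tap_unique)

lemma dft_trec [df]:
	assumes F: "dft (\<lambda>s. F (s 0) (s 1) (\<lambda>n. s (Suc (Suc n))))" and t: "dft t"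
	shows "dft (\<lambda>s. trec (\<lambda>a h. F a h s) (t s))"
proof -
	let ?F = "\<lambda>s a h. F a h (\<lambda>n. s (Suc n))"
	have 1: "dft (\<lambda>s. F (s 0) (restr (s 1) (s 0)) (\<lambda>n. s (Suc (Suc (Suc (Suc n))))))"
	proof -
		have "dft (\<lambda>s. F (s 0) (s 1) (\<lambda>n. s (Suc (Suc (Suc (Suc (Suc (Suc n))))))))"
			using dft_ren[OF F, of "\<lambda>n. if n = 0 then 0 else if n = 1 then 1 else Suc (Suc (Suc (Suc n)))"]
			by (auto simp: inj_def)
		then show ?thesis
			by (rule dft_subst2[of "\<lambda>x y s. F x y (\<lambda>n. s (Suc (Suc (Suc (Suc n)))))" "\<lambda>s. s 0" "\<lambda>s. restr (s 1) (s 0)"])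
				 (intro df)+
	qed
	have "dfn (\<lambda>s. tap (?F (\<lambda>n. s (Suc (Suc n)))) (s 2) (s 0))" unfolding tap_def
		by (intro df) (use 1 in \<open>simp_all add: numeral_2_eq_2\<close>)
	then have 2: "dft (\<lambda>s. hst (?F s) (s 0))" unfolding hst_def
		by (intro dft_setof isset_hst df) (simp add: numeral_2_eq_2)
	have "dft (\<lambda>s. F (s 0) (s 1) (\<lambda>n. s (Suc (Suc (Suc n)))))"
		using dft_ren[OF F, of "\<lambda>n. if n = 0 then 0 else if n = 1 then 1 else Suc n"]
		by (auto simp: inj_def)
	then have "dft (\<lambda>s. trec (?F s) (s 0))" unfolding trec_def
		by (rule dft_subst2[of "\<lambda>x y s. F x y (\<lambda>n. s (Suc n))" "\<lambda>s. s 0" "\<lambda>s. hst (?F s) (s 0)"])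
			 (intro df 2)+
	from dft_subst[of "\<lambda>x s. trec (\<lambda>a h. F a h s) x", OF this t] show ?thesis .
qed

lemma trec:
	assumes F: "dft (\<lambda>s. F (s 0) (s 1))" and a: "Ord a"
	shows "trec F a = F a (lam a (trec F))"
proof -
	have d: "dft (\<lambda>s. trec F (s 0))" by (intro df F)
	have dh: "dft (\<lambda>s. hst F (s 0))"
	proof -
		have 1: "dft (\<lambda>s. F (s 0) (restr (s 1) (s 0)))"
			by (rule dft_subst2[of "\<lambda>x y s. F x y" "\<lambda>s. s 0" "\<lambda>s. restr (s 1) (s 0)", OF F]) (intro df)+
		have "dfn (\<lambda>s. tap F (s 2) (s 0))" unfolding tap_def
			by (intro df) (use 1 in \<open>simp_all add: numeral_2_eq_2\<close>)
		then show ?thesis unfolding hst_def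
			by (intro dft_setof isset_hst df) (simp add: numeral_2_eq_2)
	qed
	have "hst F a = lam a (trec F)"
	proof (rule Ord_induct[OF _ a])
		show "dfn (\<lambda>s. hst F (s 0) = lam (s 0) (trec F))"
			by (intro df dh) (use F in \<open>simp_all\<close>)
		fix a assume a: "Ord a" and IH: "\<And>b. b \<in> elts a ==> hst F b = lam b (trec F)"
		show "hst F a = lam a (trec F)"
		proof (rule hst_eq)
			have "ap (lam a (trec F)) b = F b (restr (lam a (trec F)) b)" if b: "b \<in> elts a" for b
			proof -
				have "ap (lam a (trec F)) b = F b (hst F b)" unfolding ap_lam[OF d b] by (rule trec_def)
				also have "hst F b = restr (lam a (trec F)) b"
					using IH[OF b] restr_lam[OF d Ord_subset[OF a b]] by simp
				finally show ?thesis .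
			qed
			then show "tap F a (lam a (trec F))" unfolding tap_def
				using a func_on_lam[OF d] by blast
		qed
	qed
	then show ?thesis by (simp add: trec_def)
qed

definition nrec :: "'v => ('v => 'v => 'v) => 'v => 'v" where
	"nrec a F = trec (\<lambda>n h. if n = zero then a else F (un n) (ap h (un n)))"

lemma dft_nrec [df]:
	assumes a: "dft a" and F: "dft (\<lambda>s. F (s 0) (s 1) (\<lambda>n. s (Suc (Suc n))))" and t: "dft t"
	shows "dft (\<lambda>s. nrec (a s) (\<lambda>k x. F k x s) (t s))"
proof -
	have "dft (\<lambda>s. F (s 0) (s 1) (\<lambda>n. s (Suc (Suc (Suc (Suc n))))))"
		using dft_ren[OF F, of "\<lambda>n. if n = 0 then 0 else if n = 1 then 1 else Suc (Suc n)"]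
		by (auto simp: inj_def)
	then have 1: "dft (\<lambda>s. F (un (s 0)) (ap (s 1) (un (s 0))) (\<lambda>n. s (Suc (Suc n))))"
		by (rule dft_subst2[of "\<lambda>x y s. F x y (\<lambda>n. s (Suc (Suc n)))" "\<lambda>s. un (s 0)" "\<lambda>s. ap (s 1) (un (s 0))"])
			 (intro df)+
	show ?thesis unfolding nrec_def
		by (intro df t) (use 1 dft_Suc[OF dft_Suc[OF a]] in simp_all)
qed

lemma dft_nrec_step:
	assumes F: "dft (\<lambda>s. F (s 0) (s 1))"
	shows "dft (\<lambda>s. if s 0 = zero then a else F (un (s 0)) (ap (s 1) (un (s 0))))"
proof -
	have "dft (\<lambda>s. F (un (s 0)) (ap (s 1) (un (s 0))))"
		by (rule dft_subst2[of "\<lambda>x y s. F x y" "\<lambda>s. un (s 0)" "\<lambda>s. ap (s 1) (un (s 0))", OF F]) (intro df)+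
	then show ?thesis by (intro df)
qed

lemma nrec_zero:
	assumes F: "dft (\<lambda>s. F (s 0) (s 1))" shows "nrec a F zero = a"
	unfolding nrec_def by (subst trec[OF dft_nrec_step[OF F]]) simp_all

lemma nrec_sc:
	assumes F: "dft (\<lambda>s. F (s 0) (s 1))" and n: "n \<in> elts omega"
	shows "nrec a F (sc n) = F n (nrec a F n)"
proof -
	have 2: "dft (\<lambda>s. nrec a F (s 0))" by (intro df F)
	show ?thesis
		using ap_lam[OF 2, of n "sc n"] unfolding nrec_def
		by (subst trec[OF dft_nrec_step[OF F]]) (simp_all add: Ord_sc Ord_nat n un_sc)
qed

lemma nrec_type:
	assumes F: "dft (\<lambda>s. F (s 0) (s 1))" and n: "n \<in> elts omega" and a: "a \<in> elts A"
		and "\<And>k x. k \<in> elts omega ==> x \<in> elts A ==> F k x \<in> elts A"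
	shows "nrec a F n \<in> elts A"
	using n by (induction rule: omega_induct) (intro df F, simp_all add: nrec_zero[OF F] nrec_sc[OF F] a assms(4))

subsection \<open>Transitive closures\<close>

lemma transitive_superset: "\<exists>t. transitive t \<and> x \<in> elts t"
proof -
	let ?t = "\<lambda>n. nrec (sing x) (\<lambda>k. un) n"
	have d: "dft (\<lambda>s. ?t (s 0))" "dft (\<lambda>s. un (s 1))" by (intro df)+
	define t where "t = setof (\<Union>n\<in>elts omega. elts (?t n))"
	have t: "elts t = (\<Union>n\<in>elts omega. elts (?t n))"
		unfolding t_def by (rule elts_setof, rule isset_UN, rule d)
	have "z \<in> elts t" if y: "y \<in> elts t" and "z \<in> elts y" for y z
	proof -
		obtain n where n: "n \<in> elts omega" "y \<in> elts (?t n)" using y unfolding t by blast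
		then have "z \<in> elts (?t (sc n))" using \<open>z \<in> elts y\<close> by (auto simp: nrec_sc[OF d(2)])
		then show ?thesis using n sc_omega unfolding t by blast
	qed
	moreover have "x \<in> elts t" unfolding t
		by (rule UN_I[of zero]) (simp_all add: nrec_zero[OF d(2)])
	ultimately show ?thesis unfolding transitive_def by blast
qed

lemma isset_tc_sing: "isset {y. \<forall>t. transitive t \<and> x \<in> elts t --> y \<in> elts t}"
proof -
	obtain t where "transitive t \<and> x \<in> elts t" using transitive_superset by blast
	then have "{y. \<forall>t. transitive t \<and> x \<in> elts t --> y \<in> elts t} \<subseteq> elts t" by blast
	then show ?thesis by (rule isset_sub) (simp, intro df)
qed

lemma elts_tc_sing: "elts (tc_sing x) = {y. \<forall>t. transitive t \<and> x \<in> elts t --> y \<in> elts t}"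
	unfolding tc_sing_def by (simp add: isset_tc_sing)

lemma dft_tc_sing [df]: "dft t ==> dft (\<lambda>s. tc_sing (t s))"
proof (rule dft_app1[of tc_sing])
	show "dft (\<lambda>s. tc_sing (s 0))" unfolding tc_sing_def
		by (rule dft_setof) ((intro df)[1], rule isset_tc_sing)
qed

lemma transitive_tc_sing: "transitive (tc_sing x)"
	unfolding transitive_def elts_tc_sing by blast
lemma tc_sing_self [simp]: "x \<in> elts (tc_sing x)"
	by (simp add: elts_tc_sing)
lemma tc_sing_min: "transitive t ==> x \<in> elts t ==> elts (tc_sing x) \<subseteq> elts t"
	by (auto simp: elts_tc_sing)
lemma tc_sing_mem: "y \<in> elts x ==> elts (tc_sing y) \<subseteq> elts (tc_sing x)"
	by (rule tc_sing_min[OF transitive_tc_sing]) (rule transD[OF transitive_tc_sing tc_sing_self])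

lemma tc_sing_cases: 
	assumes "y \<in> elts (tc_sing x)" shows "y = x \<or> (\<exists>z\<in>elts x. y \<in> elts (tc_sing z))"
proof -
	let ?t = "setof (insert x (\<Union>z\<in>elts x. elts (tc_sing z)))"
	have "isset (\<Union>z\<in>elts x. elts (tc_sing z))" by (rule isset_UN) (intro df)
	then obtain w where w: "elts w = (\<Union>z\<in>elts x. elts (tc_sing z))" unfolding isset_def by blast
	have t: "elts ?t = insert x (\<Union>z\<in>elts x. elts (tc_sing z))"
		using isset_insert[of x w] unfolding w by simp
	have "v \<in> elts ?t" if "u \<in> elts ?t" "v \<in> elts u" for u v
		using that transD[OF transitive_tc_sing _ that(2)] tc_sing_self[of v] unfolding t by blast
	then have "transitive ?t" unfolding transitive_def by blast
	moreover have "x \<in> elts ?t" unfolding t by blast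
	ultimately have "y \<in> elts ?t" using assms unfolding elts_tc_sing using t by blast
	then show ?thesis unfolding t by blast
qed

lemma eps_induct:
	assumes "dfn (\<lambda>s. Q (s 0))" and step: "\<And>x. (\<And>y. y \<in> elts x ==> Q y) ==> Q x"
	shows "Q x"
proof (rule ccontr)
	assume "\<not> Q x"
	then obtain y where y: "y \<in> elts (tc_sing x)" "\<not> Q y" "\<forall>z\<in>elts y. z \<in> elts (tc_sing x) --> Q z"
		using minimal[OF dfn_neg[OF assms(1)], of x "tc_sing x"] by auto
	then have "Q z" if "z \<in> elts y" for z
		using that transD[OF transitive_tc_sing] by blast
	then show False using step y(2) by blast
qed

text \<open>Subformulas lie several memberships deep inside the pairs that code a formula, so the
  induction hypothesis has to cover the whole transitive closure.\<close>

lemma tc_induct: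
	assumes "dfn (\<lambda>s. Q (s 0))"
		and step: "\<And>x. (\<And>z y. z \<in> elts x ==> y \<in> elts (tc_sing z) ==> Q y) ==> Q x"
	shows "Q x"
proof -
	have "\<forall>y\<in>elts (tc_sing x). Q y"
	proof (rule eps_induct[of _ x])
		show "dfn (\<lambda>s. \<forall>y\<in>elts (tc_sing (s 0)). Q y)"
			by (intro df) (use dfn_app1[OF assms(1) dft_var[of 0]] in simp)
		fix x assume IH: "\<And>z. z \<in> elts x ==> \<forall>y\<in>elts (tc_sing z). Q y"
		show "\<forall>y\<in>elts (tc_sing x). Q y"
			using IH step tc_sing_cases by metis
	qed
	then show ?thesis by simp
qed

section \<open>Sets with a choice function\<close>

definition CH :: "'v => bool" where
	"CH A \<longleftrightarrow> (\<exists>c. \<forall>y. elts y \<subseteq> elts A --> y \<noteq> zero --> ap c y \<in> elts y)"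

lemma CH_I:
	assumes F: "dft (\<lambda>s. F (s 0))" and "\<And>y. elts y \<subseteq> elts A ==> y \<noteq> zero ==> F y \<in> elts y"
	shows "CH A"
	unfolding CH_def
	by (rule exI[of _ "lam (power A) F"]) (use assms(2) in \<open>simp add: ap_lam[OF F]\<close>)

lemma nonzero: "y \<noteq> zero \<longleftrightarrow> (\<exists>x. x \<in> elts y)"
	using elts_eq_empty[of y] by blast

lemma CH_Ord:
	assumes a: "Ord a" shows "CH a"
proof (rule CH_I)
	show "dft (\<lambda>s. lst a (\<lambda>x. x \<in> elts (s 0)))" by (intro df)
	fix y assume y: "elts y \<subseteq> elts a" "y \<noteq> zero"
	then obtain x where "x \<in> elts y" unfolding nonzero by blast
	moreover have "dfn (\<lambda>s. s 0 \<in> elts y)" by (intro df)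
	ultimately show "lst a (\<lambda>x. x \<in> elts y) \<in> elts y"
		using lst(2)[OF _ a, of "\<lambda>x. x \<in> elts y" x] y(1) by blast
qed

text \<open>\<open>R\<close> maps part of \<open>A\<close> onto \<open>B\<close>. From a set of
  values one chooses an argument, and the argument determines the value.\<close>

lemma CH_rel:
	assumes A: "CH A" and R: "dfn (\<lambda>s. R (s 0) (s 1))"
		and ex: "\<And>y. y \<in> elts B ==> \<exists>x\<in>elts A. R x y"
		and un: "\<And>x y y'. R x y ==> R x y' ==> y \<in> elts B ==> y' \<in> elts B ==> y = y'"
	shows "CH B"
proof -
	obtain c where c: "\<And>y. elts y \<subseteq> elts A ==> y \<noteq> zero ==> ap c y \<in> elts y"
		using A unfolding CH_def by blast
	let ?x = "\<lambda>z. ap c (setof {x \<in> elts A. \<exists>y\<in>elts z. R x y})"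
	\<comment> \<open>Exactly one \<open>y\<close> in \<open>z\<close> is related to the chosen
	  argument, so it can be written as a union; this avoids a definite description.\<close>
	let ?F = "\<lambda>z. setof {w \<in> elts (un z). \<exists>y\<in>elts z. R (?x z) y \<and> w \<in> elts y}"
	have x: "dft (\<lambda>s. ?x (s 0))" by (intro df dfn_app2[OF R])
	have F: "dft (\<lambda>s. ?F (s 0))"
		by (intro df dfn_app2[OF R] dft_app1[OF x])
	show ?thesis
	proof (rule CH_I[OF F])
		fix z assume z: "elts z \<subseteq> elts B" "z \<noteq> zero"
		have e: "elts (setof {x \<in> elts A. \<exists>y\<in>elts z. R x y}) = {x \<in> elts A. \<exists>y\<in>elts z. R x y}"
			by (rule sepI) (intro df dfn_app2[OF R])
		obtain y0 where "y0 \<in> elts z" using z(2) nonzero by blast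
		then obtain x0 where "x0 \<in> {x \<in> elts A. \<exists>y\<in>elts z. R x y}" using ex[of y0] z(1) by blast
		then have "?x z \<in> elts (setof {x \<in> elts A. \<exists>y\<in>elts z. R x y})"
			by (intro c) (auto simp: e nonzero)
		then obtain y where y: "y \<in> elts z" "R (?x z) y" unfolding e by blast
		have e2: "elts (?F z) = {w \<in> elts (un z). \<exists>y\<in>elts z. R (?x z) y \<and> w \<in> elts y}"
			by (rule sepI) (intro df dfn_app2[OF R])
		have "y' = y" if "y' \<in> elts z" "R (?x z) y'" for y'
			using un[OF that(2) y(2)] that(1) y(1) z(1) by blast
		then have "{w \<in> elts (un z). \<exists>y\<in>elts z. R (?x z) y \<and> w \<in> elts y} = elts y"
			unfolding elts_un using y by blast
		then have "?F z = y" using e2 by (intro elts_inject) simp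
		then show "?F z \<in> elts z" using y(1) by simp
	qed
qed

lemma CH_prd:
	assumes "CH A" "CH B" shows "CH (prd A B)"
proof -
	obtain c where c: "\<And>y. elts y \<subseteq> elts A ==> y \<noteq> zero ==> ap c y \<in> elts y"
		using assms(1) unfolding CH_def by blast
	obtain d where d: "\<And>y. elts y \<subseteq> elts B ==> y \<noteq> zero ==> ap d y \<in> elts y"
		using assms(2) unfolding CH_def by blast
	let ?x = "\<lambda>z. ap c (setof {x \<in> elts A. \<exists>y. pair x y \<in> elts z})"
	let ?y = "\<lambda>z. ap d (setof {y \<in> elts B. pair (?x z) y \<in> elts z})"
	show ?thesis
	proof (rule CH_I)
		show "dft (\<lambda>s. pair (?x (s 0)) (?y (s 0)))" by (intro df)
		fix z assume z: "elts z \<subseteq> elts (prd A B)" "z \<noteq> zero"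
		have e: "elts (setof {x \<in> elts A. \<exists>y. pair x y \<in> elts z}) = {x \<in> elts A. \<exists>y. pair x y \<in> elts z}"
			by (rule sepI) (intro df)
		obtain p where "p \<in> elts z" using z(2) nonzero by blast
		then obtain a b where "pair a b \<in> elts z" "a \<in> elts A" using z(1) by (auto simp: elts_prd)
		then have "?x z \<in> elts (setof {x \<in> elts A. \<exists>y. pair x y \<in> elts z})"
			by (intro c) (auto simp: e nonzero)
		then obtain b where b: "pair (?x z) b \<in> elts z" unfolding e by blast
		have e2: "elts (setof {y \<in> elts B. pair (?x z) y \<in> elts z}) = {y \<in> elts B. pair (?x z) y \<in> elts z}"
			by (rule sepI) (intro df)
		have "b \<in> elts B" using b z(1) pair_in_prd by blast
		then have "?y z \<in> elts (setof {y \<in> elts B. pair (?x z) y \<in> elts z})"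
			using b by (intro d) (auto simp: e2 nonzero)
		then show "pair (?x z) (?y z) \<in> elts z" unfolding e2 by blast
	qed
qed

section \<open>Arithmetic and finite sequences\<close>

definition dbl :: "'v => 'v" where "dbl n = nrec zero (\<lambda>k x. sc (sc x)) n"

lemma dft_dbl [df]: "dft t ==> dft (\<lambda>s. dbl (t s))"
	unfolding dbl_def by (intro df)

lemma dbl_step: "dft (\<lambda>s. sc (sc (s 1)))" by (intro df)
lemma dbl_zero [simp]: "dbl zero = zero"
	unfolding dbl_def by (rule nrec_zero[OF dbl_step])
lemma dbl_sc [simp]: "n \<in> elts omega ==> dbl (sc n) = sc (sc (dbl n))"
	unfolding dbl_def by (rule nrec_sc[OF dbl_step])
lemma dbl_omega [simp]: "n \<in> elts omega ==> dbl n \<in> elts omega"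
	by (induction rule: omega_induct) (intro df, simp_all)

lemma dbl_inject [simp]: 
	assumes "n \<in> elts omega" "m \<in> elts omega"
	shows "dbl n = dbl m \<longleftrightarrow> n = m"
proof -
	have "\<forall>m\<in>elts omega. dbl n = dbl m --> n = m"
		using assms(1)
	proof (induction rule: omega_induct)
		case zero then show ?case using nat_cases by fastforce
	next
		case (sc n) then show ?case using nat_cases by fastforce
	qed (intro df)
	then show ?thesis using assms by blast
qed

lemma sc_dbl_neq [simp]:
	assumes "k \<in> elts omega" "m \<in> elts omega"
	shows "sc (dbl k) \<noteq> dbl m" "dbl m \<noteq> sc (dbl k)"
proof -
	have "\<forall>m\<in>elts omega. sc (dbl k) \<noteq> dbl m"
		using assms(1)
	proof (induction rule: omega_induct)
		case zero then show ?case using nat_cases by fastforce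
	next
		case (sc n) then show ?case using nat_cases by fastforce
	qed (intro df)
	then show "sc (dbl k) \<noteq> dbl m" "dbl m \<noteq> sc (dbl k)" using assms(2) by metis+
qed

lemma dbl_cases: "m \<in> elts omega ==> \<exists>n\<in>elts omega. m = dbl n \<or> m = sc (dbl n)"
proof (induction rule: omega_induct)
	case zero then show ?case by (intro bexI[of _ zero]) simp_all
next
	case (sc n) then show ?case by (metis dbl_sc sc_omega)
qed (intro df)

lemma even_nat_iff: "even_nat n \<longleftrightarrow> (\<exists>k\<in>elts omega. n = dbl k)"
proof
	assume n: "even_nat n"
	have e: "elts (setof {x \<in> elts omega. \<exists>k\<in>elts omega. x = dbl k}) = {x \<in> elts omega. \<exists>k\<in>elts omega. x = dbl k}"
		by (rule sepI) (intro df)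
	have "n \<in> elts (setof {x \<in> elts omega. \<exists>k\<in>elts omega. x = dbl k})"
	proof (rule n[unfolded even_nat_def, rule_format], unfold e, intro conjI ballI)
		show "zero \<in> {x \<in> elts omega. \<exists>k\<in>elts omega. x = dbl k}"
			using dbl_zero zero_omega by (metis (mono_tags, lifting) mem_Collect_eq)
		fix x assume "x \<in> {x \<in> elts omega. \<exists>k\<in>elts omega. x = dbl k}"
		then show "sc (sc x) \<in> {x \<in> elts omega. \<exists>k\<in>elts omega. x = dbl k}"
			using dbl_sc sc_omega by (smt (verit) mem_Collect_eq)
	qed
	then show "\<exists>k\<in>elts omega. n = dbl k" unfolding e by blast
next
	have "even_nat (dbl k)" if "k \<in> elts omega" for k
		using that
	proof (induction rule: omega_induct)
		case dfn show ?case unfolding even_nat_def by (intro df)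
	qed (auto simp: even_nat_def)
	then show "\<exists>k\<in>elts omega. n = dbl k ==> even_nat n" by blast
qed

lemma dfn_even_nat [df]: "dft t ==> dfn (\<lambda>s. even_nat (t s))"
	unfolding even_nat_iff by (intro df dft_Suc)

lemma even_dbl [simp]: "k \<in> elts omega ==> even_nat (dbl k)"
	by (auto simp: even_nat_iff)
lemma odd_dbl [simp]: "k \<in> elts omega ==> \<not> even_nat (sc (dbl k))"
	by (auto simp: even_nat_iff)

lemma dbl_mono: 
	assumes "m \<in> elts omega" "i \<in> elts m"
	shows "dbl i \<in> elts (dbl m)" "sc (dbl i) \<in> elts (dbl m)"
proof -
	have "\<forall>i\<in>elts m. dbl i \<in> elts (dbl m) \<and> sc (dbl i) \<in> elts (dbl m)"
		using assms(1) by (induction rule: omega_induct) (intro df, auto)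
	then show "dbl i \<in> elts (dbl m)" "sc (dbl i) \<in> elts (dbl m)" using assms(2) by blast+
qed

definition hf :: "'v => 'v" where
	"hf m = lst omega (\<lambda>k. m = dbl k \<or> m = sc (dbl k))"

lemma dft_hf [df]: "dft t ==> dft (\<lambda>s. hf (t s))"
	by (rule dft_app1[of hf]) (unfold hf_def, intro df)

lemma hf_dbl [simp]: "k \<in> elts omega ==> hf (dbl k) = k" "k \<in> elts omega ==> hf (sc (dbl k)) = k"
	unfolding hf_def
	by (rule lst_eq; (intro df)?; use trans_omega[of k] in auto)+

lemma hf_omega [simp]: "m \<in> elts omega ==> hf m \<in> elts omega"
	using dbl_cases[of m] by auto

text \<open>This is 2^m (2n + 1), an injective pairing of numbers.\<close>

definition pr :: "'v => 'v => 'v" where "pr m n = nrec (sc (dbl n)) (\<lambda>k. dbl) m"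

lemma pr_step: "dft (\<lambda>s. dbl (s 1))" by (intro df)
lemma dft_pr [df]: "dft t ==> dft u ==> dft (\<lambda>s. pr (t s) (u s))"
	unfolding pr_def by (intro df)
lemma pr_zero [simp]: "pr zero n = sc (dbl n)"
	unfolding pr_def by (rule nrec_zero[OF pr_step])
lemma pr_sc [simp]: "m \<in> elts omega ==> pr (sc m) n = dbl (pr m n)"
	unfolding pr_def by (rule nrec_sc[OF pr_step])
lemma pr_omega [simp]: "m \<in> elts omega ==> n \<in> elts omega ==> pr m n \<in> elts omega"
	by (induction rule: omega_induct) (intro df, simp_all)

lemma pr_inject [simp]:
	assumes "m \<in> elts omega" "n \<in> elts omega" "m' \<in> elts omega" "n' \<in> elts omega"
	shows "pr m n = pr m' n' \<longleftrightarrow> m = m' \<and> n = n'"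
proof -
	have "\<forall>m'\<in>elts omega. pr m n = pr m' n' --> m = m' \<and> n = n'"
		using assms(1)
	proof (induction rule: omega_induct)
		case zero then show ?case using assms(2,4) nat_cases by fastforce
	next
		case (sc m)
		show ?case
		proof (intro ballI impI)
			fix k assume "k \<in> elts omega" "pr (sc m) n = pr k n'"
			then show "sc m = k \<and> n = n'"
				using sc assms(2,4) nat_cases[of k] by auto
		qed
	qed (intro df)
	then show ?thesis using assms(3) by blast
qed

lemma isset_finseq: "isset {s. \<exists>n\<in>elts omega. func s n a}"
proof (rule isset_sub)
	show "{s. \<exists>n\<in>elts omega. func s n a} \<subseteq> elts (power (prd omega a))"
		using trans_omega by (fastforce simp: func_def)
qed (simp, intro df)

lemma elts_finseq: "elts (finseq a) = {s. \<exists>n\<in>elts omega. func s n a}"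
	unfolding finseq_def by (simp add: isset_finseq)

lemma func_dom: "func f a b ==> dom f = a"
	by (rule dom_eq) (rule func_func_on)

lemma in_finseq: "s \<in> elts (finseq a) \<longleftrightarrow> dom s \<in> elts omega \<and> func s (dom s) a"
	by (auto simp: elts_finseq func_dom)

lemma finseqI: "n \<in> elts omega ==> func s n a ==> s \<in> elts (finseq a)"
	by (auto simp: elts_finseq)

definition snoc :: "'v => 'v => 'v" where
	"snoc s a = lam (sc (dom s)) (\<lambda>i. if i = dom s then a else ap s i)"

lemma dft_snoc [df]: "dft t ==> dft u ==> dft (\<lambda>s. snoc (t s) (u s))"
	by (rule dft_app2[of snoc]) (unfold snoc_def, intro df)

lemma snoc_d: "dft (\<lambda>s'. if s' 0 = dom s then a else ap s (s' 0))" by (intro df)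

lemma dom_snoc [simp]: "dom (snoc s a) = sc (dom s)"
	unfolding snoc_def by (rule dom_eq[OF func_on_lam[OF snoc_d]])
lemma ap_snoc: "i \<in> elts (dom s) ==> ap (snoc s a) i = ap s i"
	unfolding snoc_def by (subst ap_lam[OF snoc_d]) auto
lemma ap_snoc_last [simp]: "ap (snoc s a) (dom s) = a"
	unfolding snoc_def by (subst ap_lam[OF snoc_d]) auto
lemma snoc_finseq: "s \<in> elts (finseq A) ==> a \<in> elts A ==> snoc s a \<in> elts (finseq A)"
	unfolding in_finseq dom_snoc
	by (auto simp: func_iff ap_snoc) (auto simp: snoc_def intro: func_on_lam[OF snoc_d])

lemma finseq_ext:
	"s \<in> elts (finseq A) ==> t \<in> elts (finseq A) ==> dom s = dom t ==>
		(\<And>i. i \<in> elts (dom s) ==> ap s i = ap t i) ==> s = t"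
	unfolding in_finseq by (rule fun_ext[of _ "dom s"]) (auto intro: func_func_on)

lemma restr_finseq: "func f a A ==> n \<in> elts omega ==> elts n \<subseteq> elts a ==> restr f n \<in> elts (finseq A)"
	by (rule finseqI[of n]) (auto simp: restr_eq[OF func_func_on] func_ap intro!: func_lam df)

lemma ap_restr: "func_on f a ==> elts n \<subseteq> elts a ==> i \<in> elts n ==> ap (restr f n) i = ap f i"
	by (simp add: restr_eq ap_lam df)

lemma dom_restr: "func_on f a ==> elts n \<subseteq> elts a ==> dom (restr f n) = n"
	by (simp add: restr_eq dom_eq[OF func_on_lam] df)

lemma restr_restr: "func_on f a ==> elts n \<subseteq> elts a ==> elts m \<subseteq> elts n ==> restr (restr f n) m = restr f m"
	by (rule elts_inject) (auto simp: elts_restr)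

text \<open>Prefixes are coded by iterated pairing. The successor sets every nonempty sequence apart
  from the empty one, whose code is \<open>zero\<close>, so that a code also determines the
  length.\<close>

definition cd :: "'v => 'v => 'v" where "cd s n = nrec zero (\<lambda>k x. sc (pr x (ap s k))) n"
definition code :: "'v => 'v" where "code s = cd s (dom s)"

lemma dft_cd [df]: "dft t ==> dft u ==> dft (\<lambda>s. cd (t s) (u s))"
	by (rule dft_app2[of cd]) (unfold cd_def, intro df)
lemma dft_code [df]: "dft t ==> dft (\<lambda>s. code (t s))"
	unfolding code_def by (intro df)

lemma cd_step: "dft (\<lambda>s'. sc (pr (s' 1) (ap s (s' 0))))" by (intro df)
lemma cd_zero: "cd s zero = zero"
	unfolding cd_def by (rule nrec_zero[OF cd_step])
lemma cd_sc: "n \<in> elts omega ==> cd s (sc n) = sc (pr (cd s n) (ap s n))"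
	unfolding cd_def by (rule nrec_sc[OF cd_step])

lemma cd_omega:
	assumes s: "s \<in> elts (finseq omega)" and n: "n \<in> elts omega" 
	shows "elts n \<subseteq> elts (dom s) --> cd s n \<in> elts omega"
	using n
proof (induction rule: omega_induct)
	case (sc n)
	then show ?case using s by (auto simp: cd_sc in_finseq func_ap)
qed (intro df, simp add: cd_zero)

lemma code_omega: "s \<in> elts (finseq omega) ==> code s \<in> elts omega"
	unfolding code_def using cd_omega[of s "dom s"] by (simp add: in_finseq)

lemma code_inject:
	assumes s: "s \<in> elts (finseq omega)" and t: "t \<in> elts (finseq omega)" and eq: "code s = code t"
	shows "s = t"
proof -
	have *: "\<forall>m\<in>elts omega. elts n \<subseteq> elts (dom s) \<and> elts m \<subseteq> elts (dom t) \<and> cd s n = cd t m -->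
		 n = m \<and> (\<forall>i\<in>elts n. ap s i = ap t i)" if "n \<in> elts omega" for n
		using that
	proof (induction rule: omega_induct)
		case zero then show ?case using nat_cases by (fastforce simp: cd_zero cd_sc)
	next
		case (sc n)
		show ?case
		proof (intro ballI impI, elim conjE)
			fix m assume m: "m \<in> elts omega" "elts (sc n) \<subseteq> elts (dom s)" "elts m \<subseteq> elts (dom t)" "cd s (sc n) = cd t m"
			then obtain k where k: "k \<in> elts omega" "m = sc k"
				using nat_cases[of m] sc.hyps by (auto simp: cd_zero cd_sc)
			have "pr (cd s n) (ap s n) = pr (cd t k) (ap t k)"
				using m(4) k sc.hyps by (simp add: cd_sc)
			moreover have "cd s n \<in> elts omega" "cd t k \<in> elts omega" "ap s n \<in> elts omega" "ap t k \<in> elts omega"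
				using cd_omega[OF s sc.hyps] cd_omega[OF t k(1)] m k s t by (auto simp: in_finseq func_ap)
			ultimately have "cd s n = cd t k" "ap s n = ap t k" by auto
			then show "sc n = m \<and> (\<forall>i\<in>elts (sc n). ap s i = ap t i)"
				using sc.IH k m by auto
		qed
	qed (intro df)
	have "dom s = dom t \<and> (\<forall>i\<in>elts (dom s). ap s i = ap t i)"
		using *[of "dom s"] s t eq unfolding code_def in_finseq by blast
	then show ?thesis using finseq_ext[OF s t] by blast
qed

section \<open>Consequences of determinacy inside a single model\<close>

section \<open>Games on the natural numbers\<close>

abbreviation St :: 'v where "St \<equiv> fspace (finseq omega) omega"

lemma in_reals: "x \<in> elts reals \<longleftrightarrow> func x omega omega"
	by (simp add: reals_def)

lemma omega_subset: "n \<in> elts omega ==> elts n \<subseteq> elts omega"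
	by (auto intro: trans_omega)

lemma real_ap: "x \<in> elts reals ==> n \<in> elts omega ==> ap x n \<in> elts omega"
	by (simp add: in_reals func_ap)

lemma real_lam: "dft (\<lambda>s. F (s 0)) ==> (\<And>n. n \<in> elts omega ==> F n \<in> elts omega) ==> lam omega F \<in> elts reals"
	by (simp add: in_reals func_lam)

lemma real_restr:
	assumes "x \<in> elts reals" "n \<in> elts omega"
	shows "restr x n \<in> elts (finseq omega)" "dom (restr x n) = n"
		"\<And>i. i \<in> elts n ==> ap (restr x n) i = ap x i"
proof -
	have f: "func x omega omega" using assms(1) unfolding in_reals .
	note s = omega_subset[OF assms(2)]
	show "restr x n \<in> elts (finseq omega)" by (rule restr_finseq[OF f assms(2) s])
	show "dom (restr x n) = n" by (rule dom_restr[OF func_func_on[OF f] s])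
	show "ap (restr x n) i = ap x i" if "i \<in> elts n" for i
		by (rule ap_restr[OF func_func_on[OF f] s that])
qed

lemma real_ext:
	assumes "x \<in> elts reals" "y \<in> elts reals" "\<And>n. n \<in> elts omega ==> ap x n = ap y n"
	shows "x = y"
proof -
	have "func_on x omega" "func_on y omega"
		using assms(1,2) unfolding in_reals by (blast intro: func_func_on)+
	then show ?thesis by (rule fun_ext) (rule assms(3))
qed

lemma restr_cong:
	assumes "x \<in> elts reals" "y \<in> elts reals" "n \<in> elts omega" "\<And>i. i \<in> elts n ==> ap x i = ap y i"
	shows "restr x n = restr y n"
proof (rule finseq_ext[OF real_restr(1)[OF assms(1,3)] real_restr(1)[OF assms(2,3)]])
	show "dom (restr x n) = dom (restr y n)"
		unfolding real_restr(2)[OF assms(1,3)] real_restr(2)[OF assms(2,3)] ..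
	fix i assume "i \<in> elts (dom (restr x n))"
	then have i: "i \<in> elts n" unfolding real_restr(2)[OF assms(1,3)] .
	show "ap (restr x n) i = ap (restr y n) i"
		unfolding real_restr(3)[OF assms(1,3) i] real_restr(3)[OF assms(2,3) i] by (rule assms(4)[OF i])
qed

definition pl :: "('v => 'v) => 'v => 'v" where "pl G = trec (\<lambda>_ h. G h)"
definition play :: "('v => 'v) => 'v" where "play G = lam omega (pl G)"

lemma dft_play:
	assumes G: "dft (\<lambda>s. G (s 0) (\<lambda>n. s (Suc n)))"
	shows "dft (\<lambda>s. play (\<lambda>h. G h s))"
proof -
	have "dft (\<lambda>s. G (s 1) (\<lambda>n. s (Suc (Suc (Suc n)))))"
		using dft_ren[OF G, of "\<lambda>n. if n = 0 then 1 else Suc (Suc n)"] by (auto simp: inj_def)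
	then show ?thesis unfolding play_def pl_def by (intro df) simp
qed

lemma play:
	assumes G: "dft (\<lambda>s. G (s 0))" and t: "\<And>s. s \<in> elts (finseq omega) ==> G s \<in> elts omega"
	shows "play G \<in> elts reals" "\<And>n. n \<in> elts omega ==> ap (play G) n = G (restr (play G) n)"
proof -
	have g: "dft (\<lambda>s. G (s 1))" using dft_app1[OF G dft_var[of 1]] .
	have d: "dft (\<lambda>s. pl G (s 0))" unfolding pl_def by (intro df g)
	have eq: "pl G n = G (lam n (pl G))" if "n \<in> elts omega" for n
		unfolding pl_def by (rule trec[OF g Ord_nat[OF that]])
	have ty: "pl G n \<in> elts omega" if n: "n \<in> elts omega" for n
	proof -
		have "n \<in> elts omega --> pl G n \<in> elts omega"
		proof (rule Ord_induct[OF _ Ord_nat[OF n]])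
			show "dfn (\<lambda>s. s 0 \<in> elts omega --> pl G (s 0) \<in> elts omega)" by (intro df d)
			fix a assume IH: "\<And>b. b \<in> elts a ==> b \<in> elts omega --> pl G b \<in> elts omega"
			show "a \<in> elts omega --> pl G a \<in> elts omega"
			proof
				assume a: "a \<in> elts omega"
				have "lam a (pl G) \<in> elts (finseq omega)"
					by (rule finseqI[OF a], rule func_lam[OF d]) (use IH trans_omega[OF a] in blast)
				then show "pl G a \<in> elts omega" using eq[OF a] t by simp
			qed
		qed
		then show ?thesis using n by blast
	qed
	show "play G \<in> elts reals" unfolding play_def by (rule real_lam[OF d ty])
	fix n assume n: "n \<in> elts omega"
	then show "ap (play G) n = G (restr (play G) n)"
		unfolding play_def using restr_lam[OF d omega_subset[OF n]] ap_lam[OF d n] eq[OF n] by simp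
qed

definition folI :: "'v => 'v => bool" where
	"folI \<sigma> x \<longleftrightarrow> (\<forall>n\<in>elts omega. even_nat n --> ap x n = ap \<sigma> (restr x n))"
definition folII :: "'v => 'v => bool" where
	"folII \<sigma> x \<longleftrightarrow> (\<forall>n\<in>elts omega. \<not> even_nat n --> ap x n = ap \<sigma> (restr x n))"

lemma strat_ap: "\<sigma> \<in> elts St ==> s \<in> elts (finseq omega) ==> ap \<sigma> s \<in> elts omega"
	by (simp add: func_ap)

lemma strat_lam:
	"dft (\<lambda>s. F (s 0)) ==> (\<And>s. s \<in> elts (finseq omega) ==> F s \<in> elts omega) ==> lam (finseq omega) F \<in> elts St"
	by (simp add: func_lam)

text \<open>Determinacy for payoffs given by definable HOL predicates. The strategies are followed
  in the sense of \<open>ap\<close>, for which the rules \<open>df\<close> are available.\<close>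

lemma AD_cases:
	assumes AD and Q: "dfn (\<lambda>s. Q (s 0))"
	obtains \<sigma> where "\<sigma> \<in> elts St" "\<And>x. x \<in> elts reals ==> folI \<sigma> x ==> Q x"
	| \<sigma> where "\<sigma> \<in> elts St" "\<And>x. x \<in> elts reals ==> folII \<sigma> x ==> \<not> Q x"
proof -
	let ?A = "setof {x \<in> elts reals. Q x}"
	have A: "elts ?A = {x \<in> elts reals. Q x}" by (rule sepI[OF Q])
	have app: "app x n = ap x n" "app \<sigma> (restr x n) = ap \<sigma> (restr x n)"
		if "x \<in> elts reals" "n \<in> elts omega" "\<sigma> \<in> elts St" for x n \<sigma>
		using that real_restr(1)[OF that(1,2)] by (auto simp: in_reals intro!: func_app)
	have fI: "folI \<sigma> x \<longleftrightarrow> (\<forall>n\<in>elts omega. even_nat n --> app x n = app \<sigma> (restr x n))"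
		if "x \<in> elts reals" "\<sigma> \<in> elts St" for x \<sigma>
		unfolding folI_def using app[OF that(1) _ that(2)] by simp
	have fII: "folII \<sigma> x \<longleftrightarrow> (\<forall>n\<in>elts omega. \<not> even_nat n --> app x n = app \<sigma> (restr x n))"
		if "x \<in> elts reals" "\<sigma> \<in> elts St" for x \<sigma>
		unfolding folII_def using app[OF that(1) _ that(2)] by simp
	have "elts ?A \<subseteq> elts reals" unfolding A by blast
	then have "determined omega ?A" using assms(1) unfolding AD_def by blast
	then show ?thesis unfolding determined_def A reals_def[symmetric]
	proof (elim disjE bexE)
		fix \<sigma> assume s: "\<sigma> \<in> elts St" and w: "\<forall>x\<in>elts reals.
			(\<forall>n\<in>elts omega. even_nat n --> app x n = app \<sigma> (restr x n)) --> x \<in> {x \<in> elts reals. Q x}"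
		show thesis by (rule that(1)[OF s]) (use w fI[OF _ s] in blast)
	next
		fix \<sigma> assume s: "\<sigma> \<in> elts St" and w: "\<forall>x\<in>elts reals.
			(\<forall>n\<in>elts omega. \<not> even_nat n --> app x n = app \<sigma> (restr x n)) --> x \<notin> {x \<in> elts reals. Q x}"
		show thesis by (rule that(2)[OF s]) (use w fII[OF _ s] in blast)
	qed
qed

definition run :: "'v => 'v => 'v" where
	"run \<sigma> \<tau> = play (\<lambda>h. if even_nat (dom h) then ap \<sigma> h else ap \<tau> h)"

lemma dft_run [df]: "dft t ==> dft u ==> dft (\<lambda>s. run (t s) (u s))"
	by (rule dft_app2[of run]) (unfold run_def, intro dft_play df)

lemma run:
	assumes "\<sigma> \<in> elts St" "\<tau> \<in> elts St"
	shows "run \<sigma> \<tau> \<in> elts reals" "folI \<sigma> (run \<sigma> \<tau>)" "folII \<tau> (run \<sigma> \<tau>)"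
proof -
	have "dft (\<lambda>s. if even_nat (dom (s 0)) then ap \<sigma> (s 0) else ap \<tau> (s 0))" by (intro df)
	note p = play[OF this]
	show r: "run \<sigma> \<tau> \<in> elts reals" unfolding run_def
		by (rule p(1)) (use assms strat_ap in auto)
	have "ap (run \<sigma> \<tau>) n = (if even_nat n then ap \<sigma> (restr (run \<sigma> \<tau>) n) else ap \<tau> (restr (run \<sigma> \<tau>) n))"
		if "n \<in> elts omega" for n
		using p(2)[OF _ that] assms strat_ap real_restr(2)[OF r that] unfolding run_def[symmetric] by auto
	then show "folI \<sigma> (run \<sigma> \<tau>)" "folII \<tau> (run \<sigma> \<tau>)"
		unfolding folI_def folII_def by auto
qed

lemma even_sc [simp]: "k \<in> elts omega ==> even_nat (sc k) \<longleftrightarrow> \<not> even_nat k"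
	using dbl_cases[of k] by (auto simp flip: dbl_sc)

lemma even_zero [simp]: "even_nat zero"
	using even_dbl[of zero] by simp

section \<open>Determinacy refutes choice for reals\<close>

text \<open>From a choice function we obtain a set \<open>B\<close> of increasing sequences that is flipped by
	deleting the first term. In the game in which the players alternately choose the terms of an
	increasing sequence, with payoff given by \<open>B\<close>, a winning strategy can be used on two boards against
	itself, such that the results of the two boards differ in one term.\<close>

definition inc :: "'v => bool" where
	"inc x \<longleftrightarrow> x \<in> elts reals \<and> (\<forall>n\<in>elts omega. ap x n \<in> elts (ap x (sc n)))"
text \<open>The range of \<open>y\<close> from index \<open>i\<close> on. An increasing sequence is
  determined by its range, so agreement of two sequences up to a shift becomes an equality of
  sets.\<close>

definition tl :: "'v => 'v => 'v" where
	"tl y i = setof {v \<in> elts omega. \<exists>n\<in>elts omega. n \<notin> elts i \<and> v = ap y n}"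
definition tail :: "'v => 'v" where
	"tail y = lam omega (\<lambda>n. ap y (sc n))"

lemma dfn_inc [df]: "dft t ==> dfn (\<lambda>s. inc (t s))"
	by (rule dfn_app1[of inc]) (unfold inc_def, intro df)
lemma dft_tl [df]: "dft t ==> dft u ==> dft (\<lambda>s. tl (t s) (u s))"
	by (rule dft_app2[of tl]) (unfold tl_def, intro df)
lemma dft_tail [df]: "dft t ==> dft (\<lambda>s. tail (t s))"
	by (rule dft_app1[of tail]) (unfold tail_def, intro df)

lemma elts_tl: "elts (tl y i) = {v \<in> elts omega. \<exists>n\<in>elts omega. n \<notin> elts i \<and> v = ap y n}"
	unfolding tl_def by (rule sepI) (intro df)

lemma ap_tail: "n \<in> elts omega ==> ap (tail y) n = ap y (sc n)"
	unfolding tail_def by (rule ap_lam) (intro df)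
lemma tail_real: "y \<in> elts reals ==> tail y \<in> elts reals"
	unfolding tail_def by (rule real_lam, intro df) (simp add: real_ap)
lemma inc_tail: "inc y ==> inc (tail y)"
	unfolding inc_def by (simp add: tail_real ap_tail)

lemma inc_mono:
	assumes "inc y" "m \<in> elts omega" "n \<in> elts m"
	shows "ap y n \<in> elts (ap y m)"
proof -
	have "\<forall>n\<in>elts m. ap y n \<in> elts (ap y m)"
		using assms(2)
	proof (induction rule: omega_induct)
		case (sc m)
		have "ap y m \<in> elts (ap y (sc m))" using assms(1) sc.hyps unfolding inc_def by blast
		moreover have "Ord (ap y (sc m))" using assms(1) sc.hyps unfolding inc_def by (auto intro!: Ord_nat real_ap)
		ultimately show ?case using sc.IH Ord_trans by auto
	qed (intro df, simp)
	then show ?thesis using assms(3) by blast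
qed

lemma inc_inject:
	assumes "inc y" "m \<in> elts omega" "n \<in> elts omega"
	shows "ap y n = ap y m \<longleftrightarrow> n = m"
	using inc_mono[OF assms(1,2), of n] inc_mono[OF assms(1,3), of m]
		Ord_linear[OF Ord_nat[OF assms(2)] Ord_nat[OF assms(3)]] by auto

lemma tl_tail:
	assumes "y \<in> elts reals" "i \<in> elts omega" shows "tl (tail y) i = tl y (sc i)"
proof (rule elts_inject)
	have "(\<exists>n\<in>elts omega. n \<notin> elts i \<and> v = ap (tail y) n) \<longleftrightarrow> (\<exists>n\<in>elts omega. n \<notin> elts (sc i) \<and> v = ap y n)" for v
	proof
		assume "\<exists>n\<in>elts omega. n \<notin> elts i \<and> v = ap (tail y) n"
		then obtain n where n: "n \<in> elts omega" "n \<notin> elts i" "v = ap y (sc n)" using ap_tail by metis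
		then have "elts i \<subseteq> elts n" using Ord_not_mem Ord_nat assms(2) by blast
		then have "sc n \<notin> elts (sc i)" using n Ord_not_mem[OF Ord_nat Ord_nat, of "sc n" "sc i"]
				assms(2) Ord_subset_iff[OF Ord_nat Ord_nat, of i n] by auto
		then show "\<exists>n\<in>elts omega. n \<notin> elts (sc i) \<and> v = ap y n" using n by (intro bexI[of _ "sc n"]) auto
	next
		assume "\<exists>n\<in>elts omega. n \<notin> elts (sc i) \<and> v = ap y n"
		then obtain n where n: "n \<in> elts omega" "n \<notin> elts (sc i)" "v = ap y n" by blast
		have "n \<noteq> zero" using n(2) zero_in_sc[OF assms(2)] by blast
		then obtain m where m: "m \<in> elts omega" "n = sc m" using nat_cases n(1) by blast
		then have "m \<notin> elts i" using sc_mono[OF Ord_nat[OF assms(2)]] n(2) by blast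
		then show "\<exists>n\<in>elts omega. n \<notin> elts i \<and> v = ap (tail y) n" using m n by (auto simp: ap_tail)
	qed
	then show "elts (tl (tail y) i) = elts (tl y (sc i))" unfolding elts_tl by blast
qed

lemma tl_least:
	assumes y: "inc y" and i: "i \<in> elts omega"
	shows "ap y i \<in> elts (tl y i)" "\<And>v. v \<in> elts (tl y i) ==> v \<notin> elts (ap y i)"
		"elts (tl y (sc i)) = elts (tl y i) - {ap y i}"
proof -
	have r: "y \<in> elts reals" using y by (simp add: inc_def)
	show "ap y i \<in> elts (tl y i)" unfolding elts_tl using i real_ap[OF r i] by (auto intro!: bexI[of _ i])
	show "v \<notin> elts (ap y i)" if "v \<in> elts (tl y i)" for v
	proof -
		obtain n where n: "n \<in> elts omega" "n \<notin> elts i" "v = ap y n" using \<open>v \<in> elts (tl y i)\<close> by (auto simp: elts_tl)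
		then show ?thesis
			using Ord_linear[OF Ord_nat[OF i] Ord_nat[OF n(1)]] inc_mono[OF y n(1), of i] mem_asym by auto
	qed
	show "elts (tl y (sc i)) = elts (tl y i) - {ap y i}"
		unfolding elts_tl using inc_inject[OF y i] by auto
qed

lemma tl_eq_step:
	assumes y: "inc y" and z: "inc z" and i: "i \<in> elts omega" and k: "k \<in> elts omega"
		and eq: "tl y i = tl z k"
	shows "ap y i = ap z k" "tl y (sc i) = tl z (sc k)"
proof -
	have o: "Ord (ap y i)" "Ord (ap z k)" using y z i k by (auto simp: inc_def intro!: Ord_nat real_ap)
	show "ap y i = ap z k"
		using tl_least(1,2)[OF y i] tl_least(1,2)[OF z k] Ord_linear[OF o] unfolding eq by blast
	then show "tl y (sc i) = tl z (sc k)"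
		using tl_least(3)[OF y i] tl_least(3)[OF z k] eq by (intro elts_inject) simp
qed

text \<open>Equal tails have equal least elements, and removing these leaves equal tails. Both
  indices thus advance together from \<open>i\<close> and \<open>k\<close>, which keeps the parity
  of their difference.\<close>

lemma tl_parity_aux:
	assumes y: "inc y" and z: "inc z" and i: "i \<in> elts omega" and k: "k \<in> elts omega"
		and eq: "tl y i = tl z k" and n: "n \<in> elts omega"
	shows "n \<notin> elts i --> (\<exists>m\<in>elts omega. tl y n = tl z m \<and> (even_nat n = even_nat m) = (even_nat i = even_nat k))"
	using n
proof (induction rule: omega_induct)
	case zero
	have "i = zero" if "zero \<notin> elts i" using zero_in[OF Ord_nat[OF i]] that by blast
	then show ?case using k eq by blast
next
	case (sc n)
	show ?case
	proof
		assume n: "sc n \<notin> elts i"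
		show "\<exists>m\<in>elts omega. tl y (sc n) = tl z m \<and> (even_nat (sc n) = even_nat m) = (even_nat i = even_nat k)"
		proof (cases "n \<in> elts i")
			case True
			then have "sc n = i" using sc_mono[OF Ord_nat[OF i] True] n by simp
			then show ?thesis using k eq by auto
		next
			case False
			then obtain m where m: "m \<in> elts omega" "tl y n = tl z m"
				"(even_nat n = even_nat m) = (even_nat i = even_nat k)" using sc.IH by blast
			have "tl y (sc n) = tl z (sc m)" by (rule tl_eq_step[OF y z sc.hyps m(1,2)])
			then show ?thesis using m sc.hyps by (intro bexI[of _ "sc m"]) auto
		qed
	qed
qed (intro df)

lemma tl_parity:
	assumes y: "inc y" and z: "inc z" and i: "i \<in> elts omega" "i' \<in> elts omega"
		and k: "k \<in> elts omega" "k' \<in> elts omega"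
		and eq: "tl y i = tl z k" "tl y i' = tl z k'"
	shows "(even_nat i = even_nat k) = (even_nat i' = even_nat k')"
proof -
	have *: "(even_nat i = even_nat k) = (even_nat i' = even_nat k')"
		if i: "i \<in> elts omega" "i' \<in> elts omega" and k: "k \<in> elts omega" "k' \<in> elts omega"
			and eq: "tl y i = tl z k" "tl y i' = tl z k'" and n: "i' \<notin> elts i" for i i' k k'
	proof -
		obtain m where m: "m \<in> elts omega" "tl y i' = tl z m"
			"(even_nat i' = even_nat m) = (even_nat i = even_nat k)"
			using tl_parity_aux[OF y z i(1) k(1) eq(1) i(2)] n by blast
		have "ap z m = ap z k'" using tl_eq_step(1)[OF z z m(1) k(2)] m(2) eq(2) by simp
		then have "m = k'" using inc_inject[OF z k(2) m(1)] by blast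
		then show ?thesis using m by blast
	qed
	show ?thesis
	proof (cases "i' \<in> elts i")
		case False
		then show ?thesis using *[OF i k eq] by blast
	next
		case True
		then have "i \<notin> elts i'" by (rule mem_asym)
		then show ?thesis using *[OF i(2,1) k(2,1) eq(2,1)] by blast
	qed
qed

text \<open>Increasing sequences are equivalent if some of their tails have the same range.
  \<open>?B\<close> compares \<open>y\<close> with the chosen representative \<open>?r y\<close> of
  its class: matching tails start at indices of equal parity. By \<open>tl_parity\<close> the choice
  of the matching tails is irrelevant, and deleting the first term of \<open>y\<close> leaves the
  class unchanged but shifts the index by one.\<close>

lemma flip_set:
	assumes "CH reals"
	shows "\<exists>B. dfn (\<lambda>s. B (s 0)) \<and> (\<forall>y. inc y --> B (tail y) = (\<not> B y))"
proof -
	obtain c where c: "\<And>y. elts y \<subseteq> elts reals ==> y \<noteq> zero ==> ap c y \<in> elts y"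
		using assms unfolding CH_def by blast
	let ?cl = "\<lambda>y. setof {z \<in> elts reals. inc z \<and> (\<exists>i\<in>elts omega. \<exists>k\<in>elts omega. tl y i = tl z k)}"
	let ?r = "\<lambda>y. ap c (?cl y)"
	let ?B = "\<lambda>y. \<exists>i\<in>elts omega. \<exists>k\<in>elts omega. (even_nat i = even_nat k) \<and> tl y i = tl (?r y) k"
	have cl: "elts (?cl y) = {z \<in> elts reals. inc z \<and> (\<exists>i\<in>elts omega. \<exists>k\<in>elts omega. tl y i = tl z k)}" for y
		by (rule sepI) (intro df)
	have B: "?B y = (even_nat i = even_nat k)"
		if "inc y" "inc (?r y)" "i \<in> elts omega" "k \<in> elts omega" "tl y i = tl (?r y) k" for y i k
		using tl_parity[OF that(1,2)] that(3-5) by blast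
	have "dfn (\<lambda>s. ?B (s 0))" by (intro df)
	moreover have "?B (tail y) = (\<not> ?B y)" if y: "inc y" for y
	proof -
		have yr: "y \<in> elts reals" using y by (simp add: inc_def)
		have "?r y \<in> elts (?cl y)"
		proof (rule c)
			have "y \<in> elts (?cl y)" unfolding cl using y yr
				by (intro CollectI conjI bexI[of _ zero]) simp_all
			then show "?cl y \<noteq> zero" unfolding nonzero by blast
		qed (use cl in blast)
		then obtain i k where r: "inc (?r y)" "i \<in> elts omega" "k \<in> elts omega" "tl y i = tl (?r y) k"
			unfolding cl by blast
		have "elts (?cl (tail y)) = elts (?cl y)"
		proof -
			have "(\<exists>i\<in>elts omega. \<exists>k\<in>elts omega. tl (tail y) i = tl z k) \<longleftrightarrow> (\<exists>i\<in>elts omega. \<exists>k\<in>elts omega. tl y i = tl z k)"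
				if "inc z" for z
				using tl_tail[OF yr] tl_eq_step(2)[OF y that] sc_omega by metis
			then show ?thesis unfolding cl by blast
		qed
		then have "?cl (tail y) = ?cl y" by (rule elts_inject)
		then have r': "?r (tail y) = ?r y" by (rule arg_cong)
		have "tl (tail y) i = tl (?r (tail y)) (sc k)"
			unfolding r' tl_tail[OF yr r(2)] by (rule tl_eq_step(2)[OF y r])
		moreover have "inc (?r (tail y))" unfolding r' by (rule r(1))
		ultimately have "?B (tail y) = (even_nat i = even_nat (sc k))"
			using B[OF inc_tail[OF y] _ r(2) sc_omega[OF r(3)]] by blast
		then show ?thesis unfolding B[OF y r] even_sc[OF r(3)] by blast
	qed
	ultimately show ?thesis by (intro exI[of _ ?B]) blast
qed

lemma not_incD:
	assumes "x \<in> elts reals" "\<not> inc x"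
	obtains n where "n \<in> elts omega" "ap x n \<notin> elts (ap x (sc n))" "\<And>m. m \<in> elts n ==> ap x m \<in> elts (ap x (sc m))"
proof -
	obtain k where k: "k \<in> elts omega" "ap x k \<notin> elts (ap x (sc k))" using assms unfolding inc_def by blast
	have d: "dfn (\<lambda>s. ap x (s 0) \<notin> elts (ap x (sc (s 0))))" by (intro df)
	from lst[OF d Ord_omega k] that show thesis by blast
qed

text \<open>Player II violated the rule first: move number \<open>sc n\<close> of the play \<open>x\<close> was the first one
	that was not larger than its predecessor, and it was a move of player II.\<close>

definition fault :: "'v => bool" where
	"fault x \<longleftrightarrow> (\<exists>n\<in>elts omega. ap x n \<notin> elts (ap x (sc n)) \<and> even_nat n \<and>
		 (\<forall>m\<in>elts n. ap x m \<in> elts (ap x (sc m))))"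

lemma dfn_fault [df]: "dft t ==> dfn (\<lambda>s. fault (t s))"
	by (rule dfn_app1[of fault]) (unfold fault_def, intro df)

lemma not_fault:
	assumes "n \<in> elts omega" "ap x n \<notin> elts (ap x (sc n))" "\<And>m. m \<in> elts n ==> ap x m \<in> elts (ap x (sc m))"
		"\<not> even_nat n"
	shows "\<not> fault x"
proof
	assume "fault x"
	then obtain k where k: "k \<in> elts omega" "ap x k \<notin> elts (ap x (sc k))" "even_nat k"
		"\<forall>m\<in>elts k. ap x m \<in> elts (ap x (sc m))" unfolding fault_def by blast
	then show False using Ord_linear[OF Ord_nat[OF assms(1)] Ord_nat[OF k(1)]] assms by blast
qed

lemma not_fault_inc: "inc x ==> \<not> fault x"
	unfolding fault_def inc_def by blast

lemma AD_not_CH_reals: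
	assumes AD shows "\<not> CH reals"
proof
	assume "CH reals"
	then obtain B where B: "dfn (\<lambda>s. B (s 0))" "\<And>y. inc y ==> B (tail y) = (\<not> B y)"
		using flip_set by blast
	\<comment> \<open>The payoff drops the first term. A strategy of I always makes the same first
	  move, so the flip against it has to come from the second term; against a strategy of II it comes
	  from the first.\<close>
	let ?Q = "\<lambda>x. fault x \<or> (inc x \<and> B (tail x))"
	have Q: "dfn (\<lambda>s. ?Q (s 0))" by (intro df dfn_app1[OF B(1)])
	from assms Q show False
	proof (cases rule: AD_cases)
		case (2 \<tau>)
		let ?stl = "\<lambda>s. lam (un (dom s)) (\<lambda>i. ap s (sc i))"
		\<comment> \<open>I opens with \<open>zero\<close> and then plays on the board \<open>x\<close>
		  what \<open>\<tau>\<close> answers on the board without the first term. Thus both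
		  \<open>x\<close> and \<open>tail x\<close> are plays according to \<open>\<tau>\<close>.\<close>
		let ?G = "\<lambda>s. if dom s = zero then zero else ap \<tau> (?stl s)"
		let ?\<sigma> = "lam (finseq omega) (\<lambda>s. if ?G s \<in> elts omega then ?G s else zero)"
		have d: "dft (\<lambda>s. if ?G (s 0) \<in> elts omega then ?G (s 0) else zero)" by (intro df)
		have s: "?\<sigma> \<in> elts St" by (rule strat_lam[OF d]) simp
		define x where "x = run ?\<sigma> \<tau>"
		note x = run[OF s 2(1), folded x_def]
		define x' where "x' = tail x"
		have x': "x' \<in> elts reals" unfolding x'_def by (rule tail_real[OF x(1)])
		have x'_ap: "ap x' n = ap x (sc n)" if "n \<in> elts omega" for n
			unfolding x'_def by (rule ap_tail[OF that])
		have "folII \<tau> x'"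
			unfolding folII_def
		proof (intro ballI impI)
			fix n assume n: "n \<in> elts omega" "\<not> even_nat n"
			have "ap x' n = ap ?\<sigma> (restr x (sc n))"
				using x(2) n x'_ap[OF n(1)] unfolding folI_def by simp
			also have "\<dots> = (if ?G (restr x (sc n)) \<in> elts omega then ?G (restr x (sc n)) else zero)"
				by (rule ap_lam[OF d]) (rule real_restr(1)[OF x(1)], simp add: n)
			also have "?stl (restr x (sc n)) = restr x' n"
			proof (rule finseq_ext)
				have "dft (\<lambda>s'. ap (restr x (sc n)) (sc (s' 0)))" by (intro df)
				note l = func_on_lam[OF this] ap_lam[OF this]
				have un: "un (dom (restr x (sc n))) = n"
					unfolding real_restr(2)[OF x(1) sc_omega[OF n(1)]] by (rule un_sc[OF Ord_nat[OF n(1)]])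
				have ap: "ap (?stl (restr x (sc n))) i = ap x' i" if "i \<in> elts n" for i
					unfolding un using l(2)[OF that] real_restr(3)[OF x(1) sc_omega[OF n(1)] sc_mono[OF Ord_nat[OF n(1)] that]]
						x'_ap[OF trans_omega[OF n(1) that]] by simp
				have dm: "dom (?stl (restr x (sc n))) = n" unfolding un by (rule dom_eq[OF l(1)])
				show "?stl (restr x (sc n)) \<in> elts (finseq omega)"
					unfolding in_finseq dm func_iff
					using n(1) l(1)[of n] ap real_ap[OF x'] trans_omega[OF n(1)] unfolding un by auto
				show "restr x' n \<in> elts (finseq omega)" by (rule real_restr(1)[OF x' n(1)])
				show "dom (?stl (restr x (sc n))) = dom (restr x' n)"
					unfolding dm by (rule real_restr(2)[OF x' n(1), symmetric])
				show "\<And>i. i \<in> elts (dom (?stl (restr x (sc n)))) ==> ap (?stl (restr x (sc n))) i = ap (restr x' n) i"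
					unfolding dm using ap real_restr(3)[OF x' n(1)] by simp
			qed
			finally show "ap x' n = ap \<tau> (restr x' n)"
				using strat_ap[OF 2(1) real_restr(1)[OF x' n(1)]] real_restr(2)[OF x(1) sc_omega[OF n(1)]] by simp
		qed
		from 2(2)[OF x' this] 2(2)[OF x(1,3)]
		have w: "\<not> fault x'" "inc x' ==> \<not> B (tail x')" "\<not> fault x" "inc x ==> \<not> B (tail x)" by auto
		\<comment> \<open>A first violation in \<open>x\<close> would be due to I, as
		  \<open>\<tau>\<close> commits no fault. On the shifted board the same move belongs to II and
		  would be a fault there.\<close>
		have "inc x"
		proof (rule ccontr)
			assume "\<not> inc x"
			then obtain n where n: "n \<in> elts omega" "ap x n \<notin> elts (ap x (sc n))"
				"\<And>m. m \<in> elts n ==> ap x m \<in> elts (ap x (sc m))" using not_incD[OF x(1)] by blast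
			have "\<not> even_nat n" using w(3) n unfolding fault_def by blast
			then obtain m where m: "m \<in> elts omega" "n = sc m" using nat_cases[OF n(1)] by auto
			have "fault x'" unfolding fault_def
			proof (intro bexI[of _ m] conjI ballI)
				show "ap x' m \<notin> elts (ap x' (sc m))" using n(2) m by (simp add: x'_ap)
				show "even_nat m" using \<open>\<not> even_nat n\<close> m by simp
				fix k assume k: "k \<in> elts m"
				then have "sc k \<in> elts n" using m sc_mono[OF Ord_nat[OF m(1)]] by simp
				then show "ap x' k \<in> elts (ap x' (sc k))"
					using n(3) trans_omega[OF m(1) k] by (simp add: x'_ap)
			qed (rule m(1))
			then show False using w(1) by blast
		qed
		then have "inc x'" unfolding x'_def by (rule inc_tail)
		then show False using w(2) w(4)[OF \<open>inc x\<close>] B(2)[of x'] unfolding x'_def by blast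
	next
		case (1 \<sigma>)
		let ?del = "\<lambda>s. lam (un (dom s)) (\<lambda>i. if i = zero then ap s zero else ap s (sc i))"
		\<comment> \<open>II answers the first move by its successor and afterwards plays what
		  \<open>\<sigma>\<close> plays on the board with the second term deleted. Thus \<open>x\<close>
		  and the shortened sequence \<open>x'\<close> are both plays according to
		  \<open>\<sigma>\<close>.\<close>
		let ?G = "\<lambda>s. if dom s = one then sc (ap s zero) else ap \<sigma> (?del s)"
		let ?\<tau> = "lam (finseq omega) (\<lambda>s. if ?G s \<in> elts omega then ?G s else zero)"
		have d: "dft (\<lambda>s. if ?G (s 0) \<in> elts omega then ?G (s 0) else zero)" by (intro df)
		have s: "?\<tau> \<in> elts St" by (rule strat_lam[OF d]) simp
		define x where "x = run \<sigma> ?\<tau>"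
		note x = run[OF 1(1) s, folded x_def]
		have d': "dft (\<lambda>s. if s 0 = zero then ap x zero else ap x (sc (s 0)))" by (intro df)
		define x' where "x' = lam omega (\<lambda>i. if i = zero then ap x zero else ap x (sc i))"
		have x': "x' \<in> elts reals" unfolding x'_def by (rule real_lam[OF d']) (simp add: real_ap[OF x(1)])
		have x'_ap: "ap x' n = (if n = zero then ap x zero else ap x (sc n))" if "n \<in> elts omega" for n
			unfolding x'_def by (rule ap_lam[OF d' that])
		have II: "ap x n = (if ?G (restr x n) \<in> elts omega then ?G (restr x n) else zero)"
			if "n \<in> elts omega" "\<not> even_nat n" for n
		proof -
			have "ap x n = ap ?\<tau> (restr x n)" using x(3) that unfolding folII_def by blast
			also have "\<dots> = (if ?G (restr x n) \<in> elts omega then ?G (restr x n) else zero)"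
				by (rule ap_lam[OF d]) (rule real_restr(1)[OF x(1)], simp add: that)
			finally show ?thesis .
		qed
		have one: "one \<in> elts omega" "\<not> even_nat one" "zero \<in> elts one" by (simp_all add: one_def)
		have x1: "ap x one = sc (ap x zero)"
			using II[OF one(1,2)] real_restr[OF x(1) one(1)] one real_ap[OF x(1)] by simp
		have "folI \<sigma> x'"
			unfolding folI_def
		proof (intro ballI impI)
			fix n assume n: "n \<in> elts omega" "even_nat n"
			show "ap x' n = ap \<sigma> (restr x' n)"
			proof (cases "n = zero")
				case True
				have "restr x' zero = restr x zero" by (rule restr_cong[OF x' x(1)]) auto
				then show ?thesis using x(2) n True unfolding folI_def by (simp add: x'_ap)
			next
				case False
				have sn: "sc n \<in> elts omega" "\<not> even_nat (sc n)" using n by simp_all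
				have ne: "sc n \<noteq> one" using False by (simp add: one_def)
				have "?del (restr x (sc n)) = restr x' n"
				proof (rule finseq_ext)
					have "dft (\<lambda>s'. if s' 0 = zero then ap (restr x (sc n)) zero else ap (restr x (sc n)) (sc (s' 0)))"
						by (intro df)
					note l = func_on_lam[OF this] ap_lam[OF this]
					have un: "un (dom (restr x (sc n))) = n"
						unfolding real_restr(2)[OF x(1) sc_omega[OF n(1)]] by (rule un_sc[OF Ord_nat[OF n(1)]])
					have ap: "ap (?del (restr x (sc n))) i = ap x' i" if "i \<in> elts n" for i
						unfolding un using l(2)[OF that] real_restr(3)[OF x(1) sc_omega[OF n(1)] sc_mono[OF Ord_nat[OF n(1)] that]]
							x'_ap[OF trans_omega[OF n(1) that]]
							real_restr(3)[OF x(1) sc_omega[OF n(1)] zero_in_sc[OF n(1)]] by simp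
					have dm: "dom (?del (restr x (sc n))) = n" unfolding un by (rule dom_eq[OF l(1)])
					show "?del (restr x (sc n)) \<in> elts (finseq omega)"
						unfolding in_finseq dm func_iff
						using n(1) l(1)[of n] ap real_ap[OF x'] trans_omega[OF n(1)] unfolding un by auto
					show "restr x' n \<in> elts (finseq omega)" by (rule real_restr(1)[OF x' n(1)])
					show "dom (?del (restr x (sc n))) = dom (restr x' n)"
						unfolding dm by (rule real_restr(2)[OF x' n(1), symmetric])
					show "\<And>i. i \<in> elts (dom (?del (restr x (sc n)))) ==> ap (?del (restr x (sc n))) i = ap (restr x' n) i"
						unfolding dm using ap real_restr(3)[OF x' n(1)] by simp
				qed
				then have "?G (restr x (sc n)) = ap \<sigma> (restr x' n)"
					unfolding real_restr(2)[OF x(1) sn(1)] using ne by simp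
				then have "ap x (sc n) = ap \<sigma> (restr x' n)"
					using II[OF sn] strat_ap[OF 1(1) real_restr(1)[OF x' n(1)]] by simp
				then show ?thesis using False n by (simp add: x'_ap)
			qed
		qed
		from 1(2)[OF x' this] 1(2)[OF x(1,2)]
		have w: "fault x' \<or> (inc x' \<and> B (tail x'))" "fault x \<or> (inc x \<and> B (tail x))" by auto
		have incx: "inc x"
		proof (rule ccontr)
			assume "\<not> inc x"
			then obtain n where n: "n \<in> elts omega" "ap x n \<notin> elts (ap x (sc n))"
				"\<And>m. m \<in> elts n ==> ap x m \<in> elts (ap x (sc m))" using not_incD[OF x(1)] by blast
			have ev: "even_nat n" using not_fault[OF n] w(2) \<open>\<not> inc x\<close> by blast
			have "n \<noteq> zero" using n(2) x1 by (auto simp: one_def)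
			then obtain m where m: "m \<in> elts omega" "n = sc m" using nat_cases[OF n(1)] by auto
			have "m \<noteq> zero" using m ev by auto
			have a: "ap x' m \<notin> elts (ap x' (sc m))" using n(2) m \<open>m \<noteq> zero\<close> by (simp add: x'_ap)
			have b: "ap x' k \<in> elts (ap x' (sc k))" if k: "k \<in> elts m" for k
			proof -
				have kw: "k \<in> elts omega" by (rule trans_omega[OF m(1) k])
				have sk: "sc k \<in> elts n" using m sc_mono[OF Ord_nat[OF m(1)]] k by simp
				have 1: "ap x (sc k) \<in> elts (ap x (sc (sc k)))" using n(3)[OF sk] .
				have "ap x zero \<in> elts (ap x (sc (sc zero)))" if "k = zero"
				proof -
					have "ap x zero \<in> elts (ap x (sc zero))" using x1 by (simp add: one_def)
					then show ?thesis using 1 that Ord_trans[OF Ord_nat[OF real_ap[OF x(1)]]] by simp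
				qed
				then show ?thesis using 1 kw by (simp add: x'_ap)
			qed
			have "\<not> fault x'" by (rule not_fault[OF m(1) a b]) (use ev m in auto)
			moreover have "\<not> inc x'" using a m(1) unfolding inc_def by blast
			ultimately show False using w(1) by blast
		qed
		have t: "tail x' = tail (tail x)"
			by (rule real_ext) (simp_all add: tail_real x' x(1) ap_tail x'_ap)
		have "inc x'"
			unfolding inc_def
		proof (intro conjI x' ballI)
			fix n assume n: "n \<in> elts omega"
			have "ap x zero \<in> elts (ap x (sc (sc zero)))"
				by (rule inc_mono[OF incx]) simp_all
			then show "ap x' n \<in> elts (ap x' (sc n))"
				using n incx by (auto simp: x'_ap inc_def)
		qed
		then have "B (tail (tail x))" "B (tail x)"
			using w not_fault_inc[OF incx] not_fault_inc[of x'] unfolding t by blast+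
		then show False using B(2)[OF inc_tail[OF incx]] by blast
	qed
qed

section \<open>Dominated sets of reals\<close>

lemma le_lt: "Ord a ==> Ord c ==> elts a \<subseteq> elts b ==> b \<in> elts c ==> a \<in> elts c"
	by (metis Ord_linear Ord_trans subsetD mem_asym not_mem_self)

lemma un2_omega [simp]: "a \<in> elts omega ==> b \<in> elts omega ==> un2 a b \<in> elts omega"
	by (simp add: un2_max Ord_nat)

lemma le_dbl: "k \<in> elts omega ==> elts k \<subseteq> elts (dbl k)"
proof (induction rule: omega_induct)
	case (sc n)
	then have "n \<in> elts (dbl n) \<or> n = dbl n"
		using Ord_subset_iff[OF Ord_nat[OF sc.hyps] Ord_nat[OF dbl_omega[OF sc.hyps]]] by simp
	then show ?case using sc by auto
qed ((intro df)[1], simp)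

lemma hf_le: "m \<in> elts omega ==> elts (hf m) \<subseteq> elts m"
	using dbl_cases[of m] le_dbl by fastforce

lemma hf_less: "m \<in> elts omega ==> b \<in> elts omega ==> m \<in> elts b ==> hf m \<in> elts b"
	using le_lt[OF Ord_nat Ord_nat hf_le] by simp

lemma snoc_restr:
	assumes s: "s \<in> elts (finseq A)" and n: "dom s = sc n"
	shows "snoc (restr s n) (ap s n) = s"
proof (rule finseq_ext)
	have f: "func s (sc n) A" "n \<in> elts omega" using s unfolding in_finseq n by simp_all
	have sub: "elts n \<subseteq> elts (sc n)" by auto
	note r = restr_finseq[OF f(1,2) sub] dom_restr[OF func_func_on[OF f(1)] sub]
		ap_restr[OF func_func_on[OF f(1)] sub]
	show "snoc (restr s n) (ap s n) \<in> elts (finseq A)"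
		by (rule snoc_finseq[OF r(1)]) (use func_ap[OF f(1)] in simp)
	show "dom (snoc (restr s n) (ap s n)) = dom s" using r(2) n by simp
	show "\<And>i. i \<in> elts (dom (snoc (restr s n) (ap s n))) ==> ap (snoc (restr s n) (ap s n)) i = ap s i"
		using r(2,3) ap_snoc[of _ "restr s n"] ap_snoc_last[of "restr s n"] by auto
qed (rule s)

text \<open>A finite box has a finite image. The induction on the length generalizes over
  \<open>h\<close>: the last entry is absorbed by passing to the least bound over all its values
  below \<open>b\<close>.\<close>

lemma bounded_on_bounded:
	assumes n: "n \<in> elts omega" and b: "b \<in> elts omega" and h: "h \<in> elts St"
	shows "\<exists>c\<in>elts omega. \<forall>s\<in>elts (finseq omega). dom s = n \<and> (\<forall>i\<in>elts n. ap s i \<in> elts b) --> ap h s \<in> elts c"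
proof -
	have "\<forall>h\<in>elts St. \<exists>c\<in>elts omega. \<forall>s\<in>elts (finseq omega).
		 dom s = n \<and> (\<forall>i\<in>elts n. ap s i \<in> elts b) --> ap h s \<in> elts c"
		using n
	proof (induction rule: omega_induct)
		case zero
		show ?case
		proof
			fix h assume h: "h \<in> elts St"
			show "\<exists>c\<in>elts omega. \<forall>s\<in>elts (finseq omega). dom s = zero \<and> (\<forall>i\<in>elts zero. ap s i \<in> elts b) --> ap h s \<in> elts c"
			proof (cases "\<exists>s\<in>elts (finseq omega). dom s = zero")
				case True
				then obtain e where e: "e \<in> elts (finseq omega)" "dom e = zero" by blast
				have "s = e" if "s \<in> elts (finseq omega)" "dom s = zero" for s
					by (rule finseq_ext[OF that(1) e(1)]) (use that e in auto)
				then show ?thesis using strat_ap[OF h e(1)]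
					by (intro bexI[of _ "sc (ap h e)"]) auto
			qed (rule bexI[of _ zero], auto)
		qed
	next
		case (sc n)
		show ?case
		proof
			fix h assume h: "h \<in> elts St"
			let ?P = "\<lambda>s' c. \<forall>a\<in>elts b. ap h (snoc s' a) \<in> elts c"
			have ex: "\<exists>c\<in>elts omega. ?P s' c" if s': "s' \<in> elts (finseq omega)" for s'
			proof -
				have "\<exists>c\<in>elts omega. \<forall>a\<in>elts b. a \<in> elts omega --> ap h (snoc s' a) \<in> elts c" using b
				proof (induction rule: omega_induct)
					case (sc b)
					then obtain c where "c \<in> elts omega" "\<forall>a\<in>elts b. a \<in> elts omega --> ap h (snoc s' a) \<in> elts c" by blast
					then show ?case using sc.hyps strat_ap[OF h snoc_finseq[OF s' sc.hyps]]
						by (intro bexI[of _ "un2 c (sc (ap h (snoc s' b)))"]) auto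
				qed ((intro df)[1], rule bexI[of _ zero], auto)
				then show ?thesis using trans_omega[OF b] by blast
			qed
			let ?h = "\<lambda>s'. lst omega (?P s')"
			have d: "dft (\<lambda>s. ?h (s 0))" by (intro df)
			have P: "?h s' \<in> elts omega" "?P s' (?h s')" if "s' \<in> elts (finseq omega)" for s'
			proof -
				have dP: "dfn (\<lambda>s. ?P s' (s 0))" by (intro df)
				obtain c where "c \<in> elts omega" "?P s' c" using ex[OF \<open>s' \<in> elts (finseq omega)\<close>] by blast
				from lst(1,2)[OF dP Ord_omega this] show "?h s' \<in> elts omega" "?P s' (?h s')" by blast+
			qed
			have "lam (finseq omega) ?h \<in> elts St" by (rule strat_lam[OF d P(1)])
			then obtain c where c: "c \<in> elts omega" "\<forall>s\<in>elts (finseq omega). dom s = n \<and> (\<forall>i\<in>elts n. ap s i \<in> elts b)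
					 --> ap (lam (finseq omega) ?h) s \<in> elts c"
				using sc.IH by blast
			show "\<exists>c\<in>elts omega. \<forall>s\<in>elts (finseq omega). dom s = sc n \<and> (\<forall>i\<in>elts (sc n). ap s i \<in> elts b) --> ap h s \<in> elts c"
			proof (intro bexI[of _ c] ballI impI, elim conjE)
				fix s assume s: "s \<in> elts (finseq omega)" "dom s = sc n" "\<forall>i\<in>elts (sc n). ap s i \<in> elts b"
				have f: "func s (sc n) omega" using s by (simp add: in_finseq)
				have sub: "elts n \<subseteq> elts (sc n)" by auto
				note r = restr_finseq[OF f sc.hyps sub] dom_restr[OF func_func_on[OF f] sub]
					ap_restr[OF func_func_on[OF f] sub]
				have "?h (restr s n) \<in> elts c"
					using c(2)[rule_format, OF r(1)] r s(3) ap_lam[OF d r(1)] by auto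
				moreover have "ap h (snoc (restr s n) (ap s n)) \<in> elts (?h (restr s n))"
					using P(2)[OF r(1)] s(3) by auto
				ultimately show "ap h s \<in> elts c"
					unfolding snoc_restr[OF s(1,2)] using Ord_trans[OF Ord_nat[OF c(1)]] by blast
			qed (rule c(1))
		qed
	qed (intro df)
	then show ?thesis using h by blast
qed

text \<open>The game for a set \<open>C\<close> of reals. At stage \<open>2m\<close>, player I plays \<open>2v(m)\<close> or \<open>2v(m) + 1\<close>; the latter
	announces that \<open>v(m + 1)\<close> will be at least the number that player II plays next. Player I
	must make infinitely many announcements, keep them, and produce a \<open>v\<close> in \<open>C\<close>.\<close>

definition vl :: "'v => 'v" where
	"vl x = lam omega (\<lambda>m. hf (ap x (dbl m)))"
definition flag :: "'v => 'v => bool" where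
	"flag x m \<longleftrightarrow> \<not> even_nat (ap x (dbl m))"
definition wins :: "'v => 'v => bool" where
	"wins C x \<longleftrightarrow> vl x \<in> elts C \<and> (\<forall>n\<in>elts omega. \<exists>m\<in>elts omega. m \<notin> elts n \<and> flag x m) \<and>
		 (\<forall>m\<in>elts omega. flag x m --> elts (ap x (sc (dbl m))) \<subseteq> elts (hf (ap x (dbl (sc m)))))"

definition dominated :: "'v => bool" where
	"dominated C \<longleftrightarrow> (\<exists>B. func B (finseq omega) reals \<and>
		 (\<forall>v\<in>elts C. \<exists>t\<in>elts (finseq omega). \<forall>m\<in>elts omega. elts (ap v m) \<subseteq> elts (ap (ap B t) m)))"

lemma dft_vl [df]: "dft t ==> dft (\<lambda>s. vl (t s))"
	by (rule dft_app1[of vl]) (unfold vl_def, intro df)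
lemma dfn_flag [df]: "dft t ==> dft u ==> dfn (\<lambda>s. flag (t s) (u s))"
	unfolding flag_def by (intro df)
lemma dfn_wins [df]: "dft t ==> dft u ==> dfn (\<lambda>s. wins (t s) (u s))"
	by (rule dfn_app2[of wins]) (unfold wins_def, intro df)

lemma vl_real: "x \<in> elts reals ==> vl x \<in> elts reals"
	unfolding vl_def by (rule real_lam, intro df) (simp add: real_ap)
lemma ap_vl: "m \<in> elts omega ==> ap (vl x) m = hf (ap x (dbl m))"
	unfolding vl_def by (rule ap_lam) (intro df)

text \<open>The greedy play of player I against \<open>\<tau>\<close>: announce whenever the announcement will be kept.\<close>

definition grs :: "'v => 'v => 'v => 'v" where
	"grs \<tau> v s = (if elts (ap \<tau> (snoc s (sc (dbl (ap v (hf (dom s))))))) \<subseteq> elts (ap v (sc (hf (dom s))))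
			then sc (dbl (ap v (hf (dom s)))) else dbl (ap v (hf (dom s))))"
definition gr :: "'v => 'v => 'v" where
	"gr \<tau> v = run (lam (finseq omega) (grs \<tau> v)) \<tau>"

lemma dft_grs [df]: "dft t ==> dft u ==> dft w ==> dft (\<lambda>s. grs (t s) (u s) (w s))"
	by (rule dft_app3[of grs]) (unfold grs_def, intro df)
lemma dft_gr [df]: "dft t ==> dft u ==> dft (\<lambda>s. gr (t s) (u s))"
	by (rule dft_app2[of gr]) (unfold gr_def, intro df)

lemma gr:
	assumes t: "\<tau> \<in> elts St" and v: "v \<in> elts reals"
	shows "gr \<tau> v \<in> elts reals" "folII \<tau> (gr \<tau> v)"
		"\<And>m. m \<in> elts omega ==> ap (gr \<tau> v) (dbl m) = grs \<tau> v (restr (gr \<tau> v) (dbl m))"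
		"vl (gr \<tau> v) = v"
proof -
	have d: "dft (\<lambda>s. grs \<tau> v (s 0))" by (intro df)
	have "lam (finseq omega) (grs \<tau> v) \<in> elts St"
		by (rule strat_lam[OF d]) (auto simp: grs_def real_ap[OF v] in_finseq)
	note r = run[OF this t, folded gr_def]
	show "gr \<tau> v \<in> elts reals" "folII \<tau> (gr \<tau> v)" by (rule r)+
	show e: "ap (gr \<tau> v) (dbl m) = grs \<tau> v (restr (gr \<tau> v) (dbl m))" if "m \<in> elts omega" for m
		using r(2) that ap_lam[OF d real_restr(1)[OF r(1), of "dbl m"]] unfolding folI_def by simp
	show "vl (gr \<tau> v) = v"
		by (rule real_ext[OF vl_real[OF r(1)] v])
			 (simp add: ap_vl e grs_def real_restr(2)[OF r(1)] real_ap[OF v])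
qed

lemma gr_flag:
	assumes t: "\<tau> \<in> elts St" and v: "v \<in> elts reals" and m: "m \<in> elts omega"
	shows "flag (gr \<tau> v) m \<longleftrightarrow>
			elts (ap \<tau> (snoc (restr (gr \<tau> v) (dbl m)) (sc (dbl (ap v m))))) \<subseteq> elts (ap v (sc m))"
		"ap (gr \<tau> v) (dbl m) = (if flag (gr \<tau> v) m then sc (dbl (ap v m)) else dbl (ap v m))"
proof -
	note g = gr[OF t v]
	have e: "ap (gr \<tau> v) (dbl m) = (if elts (ap \<tau> (snoc (restr (gr \<tau> v) (dbl m)) (sc (dbl (ap v m))))) \<subseteq> elts (ap v (sc m))
		 then sc (dbl (ap v m)) else dbl (ap v m))"
		unfolding g(3)[OF m] grs_def real_restr(2)[OF g(1) dbl_omega[OF m]] using m by simp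
	show 1: "flag (gr \<tau> v) m \<longleftrightarrow> elts (ap \<tau> (snoc (restr (gr \<tau> v) (dbl m)) (sc (dbl (ap v m))))) \<subseteq> elts (ap v (sc m))"
		unfolding flag_def e using real_ap[OF v m] by simp
	show "ap (gr \<tau> v) (dbl m) = (if flag (gr \<tau> v) m then sc (dbl (ap v m)) else dbl (ap v m))"
		unfolding 1 by (rule e)
qed

text \<open>The greedy play keeps all its announcements and produces \<open>v\<close>, which is in
  \<open>C\<close>. It can therefore lose only by announcing finitely often.\<close>

lemma gr_finite_flags:
	assumes t: "\<tau> \<in> elts St" and v: "v \<in> elts reals" "v \<in> elts C" and w: "\<not> wins C (gr \<tau> v)"
	shows "\<exists>N\<in>elts omega. \<forall>m\<in>elts omega. m \<notin> elts N --> \<not> flag (gr \<tau> v) m"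
proof -
	note g = gr[OF t v(1)]
	have "elts (ap (gr \<tau> v) (sc (dbl m))) \<subseteq> elts (hf (ap (gr \<tau> v) (dbl (sc m))))"
		if m: "m \<in> elts omega" "flag (gr \<tau> v) m" for m
	proof -
		have "restr (gr \<tau> v) (sc (dbl m)) = snoc (restr (restr (gr \<tau> v) (sc (dbl m))) (dbl m)) (ap (restr (gr \<tau> v) (sc (dbl m))) (dbl m))"
			by (rule snoc_restr[of _ omega, symmetric]) (use real_restr[OF g(1)] m in auto)
		also have "restr (restr (gr \<tau> v) (sc (dbl m))) (dbl m) = restr (gr \<tau> v) (dbl m)"
			by (rule restr_restr[of _ omega]) (use g(1) m omega_subset[of "sc (dbl m)"] in \<open>auto simp: in_reals func_func_on\<close>)
		also have "ap (restr (gr \<tau> v) (sc (dbl m))) (dbl m) = sc (dbl (ap v m))"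
			using real_restr(3)[OF g(1), of "sc (dbl m)" "dbl m"] m gr_flag(2)[OF t v(1) m(1)] by simp
		finally have "ap (gr \<tau> v) (sc (dbl m)) = ap \<tau> (snoc (restr (gr \<tau> v) (dbl m)) (sc (dbl (ap v m))))"
			using g(2) m unfolding folII_def by simp
		moreover have "hf (ap (gr \<tau> v) (dbl (sc m))) = ap v (sc m)"
			using ap_vl[of "sc m" "gr \<tau> v"] m g(4) by simp
		ultimately show ?thesis using gr_flag(1)[OF t v(1) m(1)] m(2) by simp
	qed
	then show ?thesis using w v(2) g(4) unfolding wins_def by auto
qed

text \<open>All announcements in the greedy play for \<open>v\<close> are made within the position \<open>t\<close>.\<close>

definition Kt :: "'v => 'v => 'v => bool" where
	"Kt \<tau> t v \<longleftrightarrow> v \<in> elts reals \<and> (\<exists>N\<in>elts omega. restr (gr \<tau> v) (dom t) = t \<and> dom t = dbl (sc N) \<and>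
		 (\<forall>m\<in>elts omega. m \<notin> elts N --> \<not> flag (gr \<tau> v) m))"

lemma dfn_Kt [df]: "dft t ==> dft u ==> dft w ==> dfn (\<lambda>s. Kt (t s) (u s) (w s))"
	by (rule dfn_app3[of Kt]) (unfold Kt_def, intro df)

text \<open>Bounds are found move by move. Inside \<open>t\<close> the moves are fixed, and answers
  of \<open>\<tau>\<close> to bounded positions are bounded. Beyond \<open>t\<close> no announcement
  is made, which means that the announcement at stage \<open>m\<close> would not have been kept:
  \<open>v\<close> at \<open>sc m\<close> is below the answer of \<open>\<tau>\<close> to that
  hypothetical announcement, again an answer to a bounded position.\<close>

lemma Kt_bounded:
	assumes st: "\<tau> \<in> elts St" and t: "t \<in> elts (finseq omega)" and n: "n \<in> elts omega"
	shows "\<exists>b\<in>elts omega. \<forall>v. Kt \<tau> t v --> (\<forall>i\<in>elts n. ap (gr \<tau> v) i \<in> elts b)"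
	using n
proof (induction rule: omega_induct)
	case dfn show ?case by (intro df)
next
	case zero show ?case by (rule bexI[of _ zero]) auto
next
	case (sc n)
	then obtain b where b: "b \<in> elts omega" "\<forall>v. Kt \<tau> t v --> (\<forall>i\<in>elts n. ap (gr \<tau> v) i \<in> elts b)" by blast
	have "\<exists>c\<in>elts omega. \<forall>v. Kt \<tau> t v --> ap (gr \<tau> v) n \<in> elts c"
	proof (cases "n \<in> elts (dom t)")
		case True
		have "ap (gr \<tau> v) n = ap t n" if "Kt \<tau> t v" for v
		proof -
			have r: "gr \<tau> v \<in> elts reals" "restr (gr \<tau> v) (dom t) = t" using that gr(1)[OF st] unfolding Kt_def by auto
			have "ap (restr (gr \<tau> v) (dom t)) n = ap (gr \<tau> v) n"
				by (rule real_restr(3)[OF r(1) _ True]) (use t in \<open>simp add: in_finseq\<close>)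
			then show ?thesis unfolding r(2) by simp
		qed
		then show ?thesis using t True by (intro bexI[of _ "sc (ap t n)"]) (auto simp: in_finseq func_ap)
	next
		case False
		obtain k where k: "k \<in> elts omega" "n = dbl k \<or> n = sc (dbl k)" using dbl_cases[OF sc.hyps] by blast
		from k(2) show ?thesis
		proof
			assume nk: "n = sc (dbl k)"
			obtain c where c: "c \<in> elts omega" "\<forall>s\<in>elts (finseq omega). dom s = n \<and> (\<forall>i\<in>elts n. ap s i \<in> elts b) --> ap \<tau> s \<in> elts c"
				using bounded_on_bounded[OF sc.hyps b(1) st] by blast
			have "ap (gr \<tau> v) n \<in> elts c" if K: "Kt \<tau> t v" for v
			proof -
				have v: "v \<in> elts reals" using K by (simp add: Kt_def)
				have "ap (gr \<tau> v) n = ap \<tau> (restr (gr \<tau> v) n)"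
					using gr(2)[OF st v] sc.hyps nk k(1) unfolding folII_def by simp
				then show ?thesis using c(2) real_restr[OF gr(1)[OF st v] sc.hyps] b(2) K by simp
			qed
			then show ?thesis using c(1) by blast
		next
			assume nk: "n = dbl k"
			show ?thesis
			proof (cases "\<exists>v. Kt \<tau> t v")
				case False then show ?thesis using b(1) by blast
			next
				case True
				then obtain N where N: "N \<in> elts omega" "dom t = dbl (sc N)" unfolding Kt_def by blast
				have "k \<notin> elts (sc N)" using dbl_mono(1)[OF sc_omega[OF N(1)]] False nk N(2) by metis
				moreover have "k \<noteq> zero" using calculation zero_in_sc[OF N(1)] by blast
				then obtain m where m: "m \<in> elts omega" "k = sc m" using nat_cases[OF k(1)] by blast
				ultimately have mN: "m \<notin> elts N" using sc_mono[OF Ord_nat[OF N(1)]] by blast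
				have km: "k \<notin> elts N" using mN m Ord_trans[OF Ord_nat[OF N(1)], of k m] by auto
				\<comment> \<open>The bound is \<open>sc b\<close> because the hypothetical announcement 2v(m) +
				  1 is larger by one than the move 2v(m) that was made.\<close>
				obtain c where c: "c \<in> elts omega" "\<forall>s\<in>elts (finseq omega). dom s = sc (dbl m) \<and> (\<forall>i\<in>elts (sc (dbl m)). ap s i \<in> elts (sc b)) --> ap \<tau> s \<in> elts c"
					using bounded_on_bounded[of "sc (dbl m)" "sc b", OF _ _ st] b(1) m(1) by auto
				have "ap (gr \<tau> v) n \<in> elts (dbl c)" if K: "Kt \<tau> t v" for v
				proof -
					have v: "v \<in> elts reals" using K by (simp add: Kt_def)
					note g = gr[OF st v]
					obtain N' where "N' \<in> elts omega" "dom t = dbl (sc N')" "\<forall>m\<in>elts omega. m \<notin> elts N' --> \<not> flag (gr \<tau> v) m"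
						using K unfolding Kt_def by blast
					moreover then have "N' = N" using N dbl_inject[of "sc N'" "sc N"] by simp
					ultimately have nf: "\<not> flag (gr \<tau> v) m" "\<not> flag (gr \<tau> v) k" using m k mN km by auto
					let ?s = "snoc (restr (gr \<tau> v) (dbl m)) (sc (dbl (ap v m)))"
					have dm: "dbl m \<in> elts omega" using m(1) by simp
					have sub: "dbl m \<in> elts n" using nk m by simp
					have "ap (gr \<tau> v) (dbl m) = dbl (ap v m)" using gr_flag(2)[OF st v m(1)] nf(1) by simp
					then have db: "dbl (ap v m) \<in> elts b" using b(2) K sub by metis
					have "ap \<tau> ?s \<in> elts c"
					proof (rule c(2)[rule_format])
						show "?s \<in> elts (finseq omega)"
							by (rule snoc_finseq[OF real_restr(1)[OF g(1) dm]]) (simp add: real_ap[OF v m(1)])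
						have "ap ?s i \<in> elts (sc b)" if "i \<in> elts (sc (dbl m))" for i
						proof (cases "i = dbl m")
							case True
							then have "ap ?s i = sc (dbl (ap v m))"
								using ap_snoc_last[of "restr (gr \<tau> v) (dbl m)"] real_restr(2)[OF g(1) dm] by simp
							then show ?thesis using sc_mono[OF Ord_nat[OF b(1)] db] by simp
						next
							case False
							then have i: "i \<in> elts (dbl m)" using that by simp
							then have "ap ?s i = ap (gr \<tau> v) i"
								using ap_snoc[of i "restr (gr \<tau> v) (dbl m)"] real_restr(2,3)[OF g(1) dm] by simp
							moreover have "i \<in> elts n" using Ord_trans[OF Ord_nat[OF sc.hyps] sub i] .
							ultimately show ?thesis using b(2) K by auto
						qed
						then show "dom ?s = sc (dbl m) \<and> (\<forall>i\<in>elts (sc (dbl m)). ap ?s i \<in> elts (sc b))"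
							using real_restr(2)[OF g(1) dm] by simp
					qed
					moreover have "ap v (sc m) \<in> elts (ap \<tau> ?s)"
						using gr_flag(1)[OF st v m(1)] nf(1) Ord_not_mem[of "ap v (sc m)" "ap \<tau> ?s"]
							Ord_in[OF Ord_nat[OF c(1)] \<open>ap \<tau> ?s \<in> elts c\<close>] Ord_nat[OF real_ap[OF v sc_omega[OF m(1)]]] by blast
					ultimately have "ap v (sc m) \<in> elts c" using Ord_trans[OF Ord_nat[OF c(1)]] by blast
					then have "dbl (ap v k) \<in> elts (dbl c)" using dbl_mono(1)[OF c(1)] m(2) by simp
					then show ?thesis using gr_flag(2)[OF st v k(1)] nf(2) nk by simp
				qed
				then show ?thesis using c(1) dbl_omega by blast
			qed
		qed
	qed
	then obtain c where c: "c \<in> elts omega" "\<forall>v. Kt \<tau> t v --> ap (gr \<tau> v) n \<in> elts c" by blast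
	show ?case
		by (rule bexI[of _ "un2 b c"]) (use b c in auto)
qed

text \<open>Every \<open>v\<close> in \<open>C\<close> stops announcing inside some position
  \<open>t\<close>. By \<open>Kt_bounded\<close> the pointwise least strict bound over all
  \<open>v\<close> with the same \<open>t\<close> is a real, and there are only countably many
  positions.\<close>

lemma dominated_if_II_wins:
	assumes st: "\<tau> \<in> elts St" and C: "elts C \<subseteq> elts reals"
		and w: "\<And>x. x \<in> elts reals ==> folII \<tau> x ==> \<not> wins C x"
	shows "dominated C"
proof -
	let ?P = "\<lambda>t m b. \<forall>v. Kt \<tau> t v --> ap v m \<in> elts b"
	have ex: "\<exists>b\<in>elts omega. ?P t m b" if t: "t \<in> elts (finseq omega)" and m: "m \<in> elts omega" for t m
	proof -
		obtain b where b: "b \<in> elts omega" "\<forall>v. Kt \<tau> t v --> (\<forall>i\<in>elts (sc (dbl m)). ap (gr \<tau> v) i \<in> elts b)"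
			using Kt_bounded[OF st t, of "sc (dbl m)"] m by auto
		have "ap v m \<in> elts b" if K: "Kt \<tau> t v" for v
		proof -
			have v: "v \<in> elts reals" using K by (simp add: Kt_def)
			have "ap v m = hf (ap (gr \<tau> v) (dbl m))" using ap_vl[OF m, of "gr \<tau> v"] gr(4)[OF st v] by simp
			then show ?thesis
				using hf_less[OF real_ap[OF gr(1)[OF st v] dbl_omega[OF m]] b(1)] b(2) K by simp
		qed
		then show ?thesis using b(1) by blast
	qed
	have L: "lst omega (?P t m) \<in> elts omega" "?P t m (lst omega (?P t m))"
		if tm: "t \<in> elts (finseq omega)" "m \<in> elts omega" for t m
	proof -
		have d: "dfn (\<lambda>s. ?P t m (s 0))" by (intro df)
		obtain b where "b \<in> elts omega" "?P t m b" using ex[OF tm] by blast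
		from lst(1,2)[OF d Ord_omega this] show "lst omega (?P t m) \<in> elts omega" "?P t m (lst omega (?P t m))" by blast+
	qed
	let ?B = "\<lambda>t. lam omega (\<lambda>m. lst omega (?P t m))"
	have dB: "dft (\<lambda>s. ?B (s 0))" by (intro df)
	have dl: "dft (\<lambda>s. lst omega (?P t (s 0)))" for t by (intro df)
	have B: "?B t \<in> elts reals" if "t \<in> elts (finseq omega)" for t
		by (rule real_lam[OF dl L(1)[OF that]])
	have "\<exists>t\<in>elts (finseq omega). \<forall>m\<in>elts omega. elts (ap v m) \<subseteq> elts (ap (ap (lam (finseq omega) ?B) t) m)"
		if v: "v \<in> elts C" for v
	proof -
		have vr: "v \<in> elts reals" using C v by blast
		note g = gr[OF st vr]
		obtain N where N: "N \<in> elts omega" "\<forall>m\<in>elts omega. m \<notin> elts N --> \<not> flag (gr \<tau> v) m"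
			using gr_finite_flags[OF st vr v w[OF g(1,2)]] by blast
		let ?t = "restr (gr \<tau> v) (dbl (sc N))"
		have n: "dbl (sc N) \<in> elts omega" using N(1) by simp
		have t: "?t \<in> elts (finseq omega)" "dom ?t = dbl (sc N)" using real_restr[OF g(1) n] by auto
		have K: "Kt \<tau> ?t v" unfolding Kt_def using vr N t(2) by auto
		have "elts (ap v m) \<subseteq> elts (ap (ap (lam (finseq omega) ?B) ?t) m)" if m: "m \<in> elts omega" for m
			unfolding ap_lam[OF dB t(1)] ap_lam[OF dl m]
			using L[OF t(1) m] K Ord_subset[OF Ord_nat] by blast
		then show ?thesis using t(1) by blast
	qed
	moreover have "func (lam (finseq omega) ?B) (finseq omega) reals" by (rule func_lam[OF dB B])
	ultimately show ?thesis unfolding dominated_def by blast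
qed

section \<open>Decoding reals from a winning strategy of player I\<close>

lemma bounded_finseq:
	assumes s: "s \<in> elts (finseq omega)"
	shows "\<exists>b\<in>elts omega. \<forall>i\<in>elts (dom s). ap s i \<in> elts b"
proof -
	have f: "func s (dom s) omega" "dom s \<in> elts omega" using s by (simp_all add: in_finseq)
	have "\<exists>b\<in>elts omega. \<forall>i\<in>elts n. i \<in> elts (dom s) --> ap s i \<in> elts b" if "n \<in> elts omega" for n
		using that
	proof (induction rule: omega_induct)
		case zero show ?case by (rule bexI[of _ zero]) auto
	next
		case (sc n)
		then obtain b where b: "b \<in> elts omega" "\<forall>i\<in>elts n. i \<in> elts (dom s) --> ap s i \<in> elts b" by blast
		show ?case
		proof (cases "n \<in> elts (dom s)")
			case True
			then show ?thesis using b func_ap[OF f(1) True] by (intro bexI[of _ "un2 b (sc (ap s n))"]) auto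
		next
			case False
			then show ?thesis using b by (intro bexI[of _ b]) auto
		qed
	qed (intro df)
	from this[OF f(2)] show ?thesis by blast
qed

definition bd :: "'v => 'v" where
	"bd s = lst omega (\<lambda>b. \<forall>i\<in>elts (dom s). ap s i \<in> elts b)"
definition bn :: "'v => 'v => 'v => 'v" where
	"bn a b c = sc (un2 (un2 (bd a) (bd b)) (bd c))"

lemma dft_bd [df]: "dft t ==> dft (\<lambda>s. bd (t s))"
	by (rule dft_app1[of bd]) (unfold bd_def, intro df)
lemma dft_bn [df]: "dft t ==> dft u ==> dft w ==> dft (\<lambda>s. bn (t s) (u s) (w s))"
	unfolding bn_def by (intro df)

lemma bd:
	assumes s: "s \<in> elts (finseq omega)"
	shows "bd s \<in> elts omega" "\<And>i. i \<in> elts (dom s) ==> ap s i \<in> elts (bd s)"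
proof -
	have d: "dfn (\<lambda>s'. \<forall>i\<in>elts (dom s). ap s i \<in> elts (s' 0))" by (intro df)
	obtain b where "b \<in> elts omega" "\<forall>i\<in>elts (dom s). ap s i \<in> elts b" using bounded_finseq[OF s] by blast
	from lst(1,2)[OF d Ord_omega this]
	show "bd s \<in> elts omega" "\<And>i. i \<in> elts (dom s) ==> ap s i \<in> elts (bd s)" unfolding bd_def by blast+
qed

text \<open>The limit of a chain of positions, read along the diagonal: as the lengths increase
  strictly from a nonempty start, position number \<open>n\<close> has an entry
  \<open>n\<close>.\<close>

definition lim :: "('v => 'v) => 'v" where
	"lim T = lam omega (\<lambda>n. ap (T n) n)"

lemma lim:
	assumes d: "dft (\<lambda>s. T (s 0))"
		and T: "\<And>n. n \<in> elts omega ==> T n \<in> elts (finseq omega)"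
			"\<And>n. n \<in> elts omega ==> dom (T n) \<in> elts (dom (T (sc n)))"
			"\<And>n. n \<in> elts omega ==> restr (T (sc n)) (dom (T n)) = T n"
		and ne: "zero \<in> elts (dom (T zero))"
	shows "lim T \<in> elts reals" "\<And>n. n \<in> elts omega ==> restr (lim T) (dom (T n)) = T n"
		"\<And>n. n \<in> elts omega ==> n \<in> elts (dom (T n))"
proof -
	have dd: "dft (\<lambda>s. ap (T (s 0)) (s 0))" by (intro df d)
	have dm: "dom (T n) \<in> elts omega" if "n \<in> elts omega" for n
		using T(1)[OF that] by (simp add: in_finseq)
	show n: "n \<in> elts (dom (T n))" if "n \<in> elts omega" for n
		using that
	proof (induction rule: omega_induct)
		case dfn show ?case by (intro df d)
	next
		case (sc n)
		have "sc n \<in> elts (sc (dom (T n)))" by (rule sc_mono[OF Ord_nat[OF dm[OF sc.hyps]] sc.IH])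
		then show ?case using T(2)[OF sc.hyps] Ord_trans[OF Ord_nat[OF dm[OF sc_omega[OF sc.hyps]]]] by auto
	qed (rule ne)
	show r: "lim T \<in> elts reals" unfolding lim_def
	proof (rule real_lam[OF dd])
		fix k assume k: "k \<in> elts omega"
		then show "ap (T k) k \<in> elts omega" using func_ap[OF _ n[OF k]] T(1)[OF k] by (simp add: in_finseq)
	qed
	have mono: "\<forall>m\<in>elts n. dom (T m) \<in> elts (dom (T n)) \<and> restr (T n) (dom (T m)) = T m" if "n \<in> elts omega" for n
		using that
	proof (induction rule: omega_induct)
		case dfn show ?case by (intro df d dft_app1[OF d])
	next
		case (sc n)
		have f: "func_on (T (sc n)) (dom (T (sc n)))" using T(1)[OF sc_omega[OF sc.hyps]]
			by (auto simp: in_finseq intro: func_func_on)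
		have s: "elts (dom (T n)) \<subseteq> elts (dom (T (sc n)))"
			using Ord_subset[OF Ord_nat[OF dm[OF sc_omega[OF sc.hyps]]] T(2)[OF sc.hyps]] .
		have "dom (T m) \<in> elts (dom (T (sc n))) \<and> restr (T (sc n)) (dom (T m)) = T m" if m: "m \<in> elts n" for m
		proof -
			have 1: "dom (T m) \<in> elts (dom (T n))" "restr (T n) (dom (T m)) = T m" using sc.IH m by auto
			have "elts (dom (T m)) \<subseteq> elts (dom (T n))" using Ord_subset[OF Ord_nat[OF dm[OF sc.hyps]] 1(1)] .
			then have "restr (restr (T (sc n)) (dom (T n))) (dom (T m)) = restr (T (sc n)) (dom (T m))"
				by (rule restr_restr[OF f s])
			then show ?thesis using 1 s T(3)[OF sc.hyps] by auto
		qed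
		then show ?case using T(2,3)[OF sc.hyps] by auto
	qed auto
	have ap_eq: "ap (T i) i = ap (T n) i" if i: "i \<in> elts (dom (T n))" and nn: "n \<in> elts omega" for i n
	proof -
		have iw: "i \<in> elts omega" using trans_omega[OF dm[OF nn] i] .
		have *: "ap (T k) i = ap (T l) i" if "k \<in> elts omega" "l \<in> elts k" "i \<in> elts (dom (T l))" for k l
		proof -
			have f: "func_on (T k) (dom (T k))" using T(1)[OF that(1)] by (auto simp: in_finseq intro: func_func_on)
			have s: "elts (dom (T l)) \<subseteq> elts (dom (T k))" 
				using mono[OF that(1)] that(2) Ord_subset[OF Ord_nat[OF dm[OF that(1)]]] by blast
			show ?thesis using ap_restr[OF f s that(3)] mono[OF that(1)] that(2) by simp
		qed
		consider "i \<in> elts n" | "i = n" | "n \<in> elts i" using Ord_linear[OF Ord_nat[OF iw] Ord_nat[OF nn]] by blast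
		then show ?thesis
		proof cases
			case 1 then show ?thesis using *[OF nn 1 n[OF iw]] by simp
		next
			case 3 then show ?thesis using *[OF iw 3 i] by simp
		qed simp
	qed
	show "restr (lim T) (dom (T n)) = T n" if nn: "n \<in> elts omega" for n
	proof (rule finseq_ext[OF real_restr(1)[OF r dm[OF nn]] T(1)[OF nn]])
		show "dom (restr (lim T) (dom (T n))) = dom (T n)" by (rule real_restr(2)[OF r dm[OF nn]])
		fix i assume "i \<in> elts (dom (restr (lim T) (dom (T n))))"
		then have i: "i \<in> elts (dom (T n))" unfolding real_restr(2)[OF r dm[OF nn]] .
		have "ap (lim T) i = ap (T i) i" unfolding lim_def by (rule ap_lam[OF dd trans_omega[OF dm[OF nn] i]])
		then show "ap (restr (lim T) (dom (T n))) i = ap (T n) i"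
			using real_restr(3)[OF r dm[OF nn] i] ap_eq[OF i nn] by simp
	qed
qed

text \<open>\<open>nr \<sigma> s K\<close> continues the position \<open>s\<close>, in which player I has just made an announcement, with the
	answer \<open>K\<close> of player II and then zeros, up to the next announcement.\<close>

definition rdy :: "'v => 'v => bool" where
	"rdy \<sigma> s \<longleftrightarrow> s \<in> elts (finseq omega) \<and> (\<exists>m\<in>elts omega. dom s = sc (dbl m) \<and> \<not> even_nat (ap s (dbl m))) \<and>
		 (\<forall>n\<in>elts (dom s). even_nat n --> ap s n = ap \<sigma> (restr s n))"
definition ct :: "'v => 'v => 'v => 'v" where
	"ct \<sigma> s K = run \<sigma> (lam (finseq omega)
		 (\<lambda>u. if dom u \<in> elts (dom s) then ap s (dom u) else if dom u = dom s then K else zero))"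
definition nr :: "'v => 'v => 'v => 'v" where
	"nr \<sigma> s K = restr (ct \<sigma> s K) (sc (dbl (lst omega (\<lambda>m. dom s \<in> elts (dbl m) \<and> flag (ct \<sigma> s K) m))))"

lemma dfn_rdy [df]: "dft t ==> dft u ==> dfn (\<lambda>s. rdy (t s) (u s))"
	by (rule dfn_app2[of rdy]) (unfold rdy_def, intro df)
lemma dft_ct [df]: "dft t ==> dft u ==> dft w ==> dft (\<lambda>s. ct (t s) (u s) (w s))"
	by (rule dft_app3[of ct]) (unfold ct_def, intro df)
lemma dft_nr [df]: "dft t ==> dft u ==> dft w ==> dft (\<lambda>s. nr (t s) (u s) (w s))"
	by (rule dft_app3[of nr]) (unfold nr_def, intro df)

lemma rdy_restr:
	assumes x: "x \<in> elts reals" "folI \<sigma> x" and m: "m \<in> elts omega" "flag x m"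
	shows "rdy \<sigma> (restr x (sc (dbl m)))"
proof -
	have n: "sc (dbl m) \<in> elts omega" using m(1) by simp
	note r = real_restr[OF x(1) n]
	have "ap (restr x (sc (dbl m))) k = ap \<sigma> (restr (restr x (sc (dbl m))) k)"
		if k: "k \<in> elts (sc (dbl m))" "even_nat k" for k
	proof -
		have kw: "k \<in> elts omega" by (rule trans_omega[OF n k(1)])
		have "restr (restr x (sc (dbl m))) k = restr x k"
			by (rule restr_restr[of _ omega])
				 (use x(1) omega_subset[OF n] Ord_subset[OF Ord_nat[OF n] k(1)] in \<open>auto simp: in_reals func_func_on\<close>)
		then show ?thesis using r(3)[OF k(1)] x(2) kw k(2) unfolding folI_def by simp
	qed
	moreover have "\<not> even_nat (ap (restr x (sc (dbl m))) (dbl m))"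
		using r(3)[of "dbl m"] m(2) unfolding flag_def by simp
	ultimately show ?thesis unfolding rdy_def r(2) using r(1) m(1) by blast
qed

text \<open>Player II repeats its moves from \<open>s\<close>, and \<open>s\<close> follows
  \<open>\<sigma>\<close>, so the play reproduces \<open>s\<close> up to the demand
  \<open>K\<close>.\<close>

lemma ct:
	assumes st: "\<sigma> \<in> elts St" and s: "rdy \<sigma> s" and K: "K \<in> elts omega"
	shows "ct \<sigma> s K \<in> elts reals" "folI \<sigma> (ct \<sigma> s K)" "restr (ct \<sigma> s K) (dom s) = s" "ap (ct \<sigma> s K) (dom s) = K"
proof -
	let ?F = "\<lambda>u. if dom u \<in> elts (dom s) then ap s (dom u) else if dom u = dom s then K else zero"
	have d: "dft (\<lambda>s. ?F (s 0))" by (intro df)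
	have sf: "s \<in> elts (finseq omega)" "dom s \<in> elts omega" "func s (dom s) omega"
		using s by (auto simp: rdy_def in_finseq)
	obtain m where m: "m \<in> elts omega" "dom s = sc (dbl m)" using s unfolding rdy_def by blast
	have "lam (finseq omega) ?F \<in> elts St"
		by (rule strat_lam[OF d]) (use K func_ap[OF sf(3)] in auto)
	note r = run[OF st this, folded ct_def]
	show "ct \<sigma> s K \<in> elts reals" "folI \<sigma> (ct \<sigma> s K)" by (rule r)+
	have o: "ap (ct \<sigma> s K) n = ?F (restr (ct \<sigma> s K) n)" if "n \<in> elts omega" "\<not> even_nat n" for n
		using r(3) that ap_lam[OF d real_restr(1)[OF r(1) that(1)]] unfolding folII_def by simp
	have eq: "n \<in> elts (dom s) --> ap (ct \<sigma> s K) n = ap s n" if "Ord n" for n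
		using that
	proof (rule Ord_induct[rotated])
		show "dfn (\<lambda>s'. s' 0 \<in> elts (dom s) --> ap (ct \<sigma> s K) (s' 0) = ap s (s' 0))" by (intro df)
		fix n assume IH: "\<And>k. k \<in> elts n ==> k \<in> elts (dom s) --> ap (ct \<sigma> s K) k = ap s k"
		show "n \<in> elts (dom s) --> ap (ct \<sigma> s K) n = ap s n"
		proof
			assume n: "n \<in> elts (dom s)"
			have nw: "n \<in> elts omega" by (rule trans_omega[OF sf(2) n])
			show "ap (ct \<sigma> s K) n = ap s n"
			proof (cases "even_nat n")
				case True
				have sub: "elts n \<subseteq> elts (dom s)" by (rule Ord_subset[OF Ord_nat[OF sf(2)] n])
				note q = real_restr[OF r(1) nw]
				have "restr (ct \<sigma> s K) n = restr s n"
				proof (rule finseq_ext[OF q(1) restr_finseq[OF sf(3) nw sub]])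
					show "dom (restr (ct \<sigma> s K) n) = dom (restr s n)"
						unfolding q(2) dom_restr[OF func_func_on[OF sf(3)] sub] ..
					fix i assume "i \<in> elts (dom (restr (ct \<sigma> s K) n))"
					then have i: "i \<in> elts n" unfolding q(2) .
					show "ap (restr (ct \<sigma> s K) n) i = ap (restr s n) i"
						unfolding q(3)[OF i] ap_restr[OF func_func_on[OF sf(3)] sub i] using IH[OF i] sub i by blast
				qed
				moreover have "ap s n = ap \<sigma> (restr s n)" using s n True unfolding rdy_def by blast
				ultimately show ?thesis using r(2) nw True unfolding folI_def by simp
			next
				case False
				then show ?thesis using o[OF nw False] real_restr(2)[OF r(1) nw] n by simp
			qed
		qed
	qed
	show "restr (ct \<sigma> s K) (dom s) = s"
	proof (rule finseq_ext[OF real_restr(1)[OF r(1) sf(2)] sf(1) real_restr(2)[OF r(1) sf(2)]])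
		fix i assume "i \<in> elts (dom (restr (ct \<sigma> s K) (dom s)))"
		then have i: "i \<in> elts (dom s)" unfolding real_restr(2)[OF r(1) sf(2)] .
		show "ap (restr (ct \<sigma> s K) (dom s)) i = ap s i"
			unfolding real_restr(3)[OF r(1) sf(2) i] using eq[OF Ord_in[OF Ord_nat[OF sf(2)] i]] i by blast
	qed
	have "\<not> even_nat (dom s)" using m by simp
	then show "ap (ct \<sigma> s K) (dom s) = K"
		using o[OF sf(2)] real_restr(2)[OF r(1) sf(2)] by simp
qed

text \<open>A next announcement exists because I wins and so announces infinitely often. The
  announcement that ends \<open>s\<close> was kept, which forces the next value, at index
  \<open>sc (dom s)\<close>, to be at least \<open>K\<close>.\<close>

lemma nr:
	assumes st: "\<sigma> \<in> elts St" and w: "\<And>x. x \<in> elts reals ==> folI \<sigma> x ==> wins C x"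
		and s: "rdy \<sigma> s" and K: "K \<in> elts omega"
	shows "rdy \<sigma> (nr \<sigma> s K)" "dom s \<in> elts (dom (nr \<sigma> s K))" "restr (nr \<sigma> s K) (dom s) = s"
		"sc (dom s) \<in> elts (dom (nr \<sigma> s K))" "elts K \<subseteq> elts (hf (ap (nr \<sigma> s K) (sc (dom s))))"
proof -
	note c = ct[OF st s K]
	have W: "wins C (ct \<sigma> s K)" by (rule w[OF c(1,2)])
	obtain m where m: "m \<in> elts omega" "dom s = sc (dbl m)" "\<not> even_nat (ap s (dbl m))"
		using s unfolding rdy_def by blast
	have dw: "dom s \<in> elts omega" using m by simp
	let ?M = "lst omega (\<lambda>m. dom s \<in> elts (dbl m) \<and> flag (ct \<sigma> s K) m)"
	have d: "dfn (\<lambda>s'. dom s \<in> elts (dbl (s' 0)) \<and> flag (ct \<sigma> s K) (s' 0))" by (intro df)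
	obtain k where k: "k \<in> elts omega" "k \<notin> elts (sc m)" "flag (ct \<sigma> s K) k"
		using W sc_omega[OF m(1)] unfolding wins_def by blast
	have "m \<in> elts k" using k(2) Ord_linear[OF Ord_nat[OF k(1)] Ord_nat[OF m(1)]] by auto
	then have "dom s \<in> elts (dbl k)" unfolding m(2) by (rule dbl_mono(2)[OF k(1)])
	then have M: "?M \<in> elts omega" "dom s \<in> elts (dbl ?M)" "flag (ct \<sigma> s K) ?M"
		using lst(1,2)[OF d Ord_omega k(1)] k(3) by blast+
	have n: "sc (dbl ?M) \<in> elts omega" using M(1) by simp
	note r = real_restr[OF c(1) n, folded nr_def]
	show "rdy \<sigma> (nr \<sigma> s K)" unfolding nr_def by (rule rdy_restr[OF c(1,2) M(1,3)])
	show a: "dom s \<in> elts (dom (nr \<sigma> s K))" unfolding r(2) using M(2) by simp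
	have "restr (restr (ct \<sigma> s K) (sc (dbl ?M))) (dom s) = restr (ct \<sigma> s K) (dom s)"
		by (rule restr_restr[of _ omega])
			 (use c(1) omega_subset[OF n] Ord_subset[OF Ord_nat[OF n]] a r(2) in \<open>auto simp: in_reals func_func_on\<close>)
	then show "restr (nr \<sigma> s K) (dom s) = s" using c(3) unfolding nr_def by simp
	show b: "sc (dom s) \<in> elts (dom (nr \<sigma> s K))"
		unfolding r(2) by (rule sc_mono[OF Ord_nat[OF dbl_omega[OF M(1)]] M(2)])
	have "flag (ct \<sigma> s K) m"
	proof -
		have "ap (ct \<sigma> s K) (dbl m) = ap s (dbl m)"
			using real_restr(3)[OF c(1) dw, of "dbl m"] c(3) m(2) by simp
		then show ?thesis using m(3) unfolding flag_def by simp
	qed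
	then have "elts (ap (ct \<sigma> s K) (sc (dbl m))) \<subseteq> elts (hf (ap (ct \<sigma> s K) (dbl (sc m))))"
		using W m(1) unfolding wins_def by blast
	then show "elts K \<subseteq> elts (hf (ap (nr \<sigma> s K) (sc (dom s))))"
		using r(3) b r(2) c(4) m by simp
qed

text \<open>The first value of the sequence \<open>v\<close> that exceeds \<open>K\<close>.\<close>

definition fv :: "'v => 'v => 'v => bool" where
	"fv v K X \<longleftrightarrow> (\<exists>i\<in>elts omega. X = ap v i \<and> K \<in> elts X \<and> (\<forall>k\<in>elts i. K \<notin> elts (ap v k)))"

text \<open>Round \<open>r\<close> starts at the threshold \<open>R(r)\<close>. The sequence
  \<open>x\<close> passes it at \<open>X\<close>, and \<open>y\<close> and \<open>z\<close> pass
  \<open>X\<close> at \<open>Y\<close> and \<open>Z\<close>. The bit is the comparison of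
  \<open>Y\<close> with \<open>Z\<close>, and the larger of the two is the next threshold.\<close>

definition decodes :: "'v => 'v => 'v => 'v => 'v => bool" where
	"decodes x y z R0 w \<longleftrightarrow> (\<exists>R\<in>elts reals. ap R zero = R0 \<and> (\<forall>r\<in>elts omega. \<exists>X Y Z.
		 fv x (ap R r) X \<and> fv y X Y \<and> fv z X Z \<and> ap R (sc r) = un2 Y Z \<and> (r \<in> elts w \<longleftrightarrow> Y \<in> elts Z)))"

lemma dfn_fv [df]: "dft t ==> dft u ==> dft v ==> dfn (\<lambda>s. fv (t s) (u s) (v s))"
	by (rule dfn_app3[of fv]) (unfold fv_def, intro df)

text \<open>One round of the construction of three plays against \<open>\<sigma>\<close>: player II lets the three boards
	continue, one after the other, with a demand larger than everything that has been played.
	The bit to be coded determines which of the last two boards comes first.\<close>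

definition mk :: "'v => 'v => 'v => 'v" where
	"mk a b c = lam three (\<lambda>i. if i = zero then a else if i = one then b else c)"
definition fA :: "'v => 'v => 'v" where
	"fA \<sigma> S = nr \<sigma> (ap S zero) (bn (ap S zero) (ap S one) (ap S two))"
definition gB :: "'v => 'v => 'v" where
	"gB \<sigma> S = nr \<sigma> (ap S one) (bn (fA \<sigma> S) (ap S one) (ap S two))"
definition gC :: "'v => 'v => 'v" where
	"gC \<sigma> S = nr \<sigma> (ap S two) (bn (fA \<sigma> S) (ap S one) (ap S two))"
definition fB :: "'v => 'v => 'v => 'v => 'v" where
	"fB \<sigma> w r S = (if r \<in> elts w then gB \<sigma> S else nr \<sigma> (ap S one) (bn (fA \<sigma> S) (ap S one) (gC \<sigma> S)))"
definition fC :: "'v => 'v => 'v => 'v => 'v" where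
	"fC \<sigma> w r S = (if r \<in> elts w then nr \<sigma> (ap S two) (bn (fA \<sigma> S) (gB \<sigma> S) (ap S two)) else gC \<sigma> S)"

lemma numbers: "zero \<in> elts three" "one \<in> elts three" "two \<in> elts three"
	"one \<noteq> zero" "two \<noteq> zero" "two \<noteq> one"
	by (simp_all add: three_def two_def one_def)

lemma mk [simp]: "ap (mk a b c) zero = a" "ap (mk a b c) one = b" "ap (mk a b c) two = c"
proof -
	have d: "dft (\<lambda>s. if s 0 = zero then a else if s 0 = one then b else c)" by (intro df)
	show "ap (mk a b c) zero = a" "ap (mk a b c) one = b" "ap (mk a b c) two = c"
		unfolding mk_def by (subst ap_lam[OF d]; simp add: numbers)+
qed

lemma dft_mk [df]: "dft t ==> dft u ==> dft v ==> dft (\<lambda>s. mk (t s) (u s) (v s))"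
	by (rule dft_app3[of mk]) (unfold mk_def, intro df)
lemma dft_fA [df]: "dft t ==> dft u ==> dft (\<lambda>s. fA (t s) (u s))"
	unfolding fA_def by (intro df)
lemma dft_gB [df]: "dft t ==> dft u ==> dft (\<lambda>s. gB (t s) (u s))"
	unfolding gB_def by (intro df)
lemma dft_gC [df]: "dft t ==> dft u ==> dft (\<lambda>s. gC (t s) (u s))"
	unfolding gC_def by (intro df)

definition bst :: "'v => 'v => 'v => 'v => 'v" where
	"bst \<sigma> w s0 n = nrec (mk s0 s0 s0) (\<lambda>r S. mk (fA \<sigma> S) (fB \<sigma> w r S) (fC \<sigma> w r S)) n"

lemma bst_step: "dft (\<lambda>s. mk (fA \<sigma> (s 1)) (fB \<sigma> w (s 0) (s 1)) (fC \<sigma> w (s 0) (s 1)))"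
	unfolding fB_def fC_def by (intro df)
lemma dft_bst [df]: "dft t ==> dft (\<lambda>s. bst \<sigma> w s0 (t s))"
	unfolding bst_def fB_def fC_def by (intro df)
lemma bst_zero: "bst \<sigma> w s0 zero = mk s0 s0 s0"
	unfolding bst_def by (rule nrec_zero[OF bst_step])
lemma bst_sc: "n \<in> elts omega ==> bst \<sigma> w s0 (sc n) =
		mk (fA \<sigma> (bst \<sigma> w s0 n)) (fB \<sigma> w n (bst \<sigma> w s0 n)) (fC \<sigma> w n (bst \<sigma> w s0 n))"
	unfolding bst_def by (rule nrec_sc[OF bst_step])

lemma bn:
	assumes "a \<in> elts (finseq omega)" "b \<in> elts (finseq omega)" "c \<in> elts (finseq omega)"
	shows "bn a b c \<in> elts omega" "bd a \<in> elts (bn a b c)" "bd b \<in> elts (bn a b c)" "bd c \<in> elts (bn a b c)"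
proof -
	note B = bd(1)[OF assms(1)] bd(1)[OF assms(2)] bd(1)[OF assms(3)]
	show 1: "bn a b c \<in> elts omega" unfolding bn_def using B by simp
	let ?u = "un2 (un2 (bd a) (bd b)) (bd c)"
	have k: "k \<in> elts (sc ?u)" if "k \<in> elts omega" "elts k \<subseteq> elts ?u" for k
	proof -
		have "?u \<in> elts omega" using B by simp
		then show ?thesis using Ord_subset_iff[OF Ord_nat[OF that(1)] Ord_nat, of ?u] that(2) by auto
	qed
	show "bd a \<in> elts (bn a b c)" "bd b \<in> elts (bn a b c)" "bd c \<in> elts (bn a b c)"
		unfolding bn_def by (rule k[OF B(1)], force, rule k[OF B(2)], force, rule k[OF B(3)], force)
qed

lemma rdy_finseq: "rdy \<sigma> s ==> s \<in> elts (finseq omega)"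
	by (simp add: rdy_def)

text \<open>All values before the demand lie in \<open>s\<close> and do not exceed \<open>K\<close>,
  and the value that answers the demand does; so that value is the first one above
  \<open>K\<close>.\<close>

lemma board_fv:
	assumes x: "x \<in> elts reals" and t: "t \<in> elts (finseq omega)" "restr x (dom t) = t"
		and s: "rdy \<sigma> s" "restr t (dom s) = s" "sc (dom s) \<in> elts (dom t)"
		and K: "K \<in> elts (hf (ap t (sc (dom s))))" "\<And>i. i \<in> elts (dom s) ==> K \<notin> elts (hf (ap s i))"
	shows "fv (vl x) K (hf (ap t (sc (dom s))))"
proof -
	obtain m where m: "m \<in> elts omega" "dom s = sc (dbl m)" using s(1) unfolding rdy_def by blast
	have tw: "dom t \<in> elts omega" using t(1) by (simp add: in_finseq)
	have xt: "ap x i = ap t i" if "i \<in> elts (dom t)" for i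
		using real_restr(3)[OF x tw that] t(2) by simp
	have ts: "ap t i = ap s i" if "i \<in> elts (dom s)" for i
	proof -
		have "dom s \<in> elts (dom t)" using Ord_trans[OF Ord_nat[OF tw] s(3)] by simp
		then show ?thesis
			using ap_restr[of t "dom t" "dom s" i] Ord_subset[OF Ord_nat[OF tw]] t(1) s(2) that
			by (auto simp: in_finseq func_func_on)
	qed
	have st: "i \<in> elts (dom t)" if "i \<in> elts (dom s)" for i
		using Ord_trans[OF Ord_nat[OF tw] Ord_trans[OF Ord_nat[OF tw] s(3), of "dom s"] that] by simp
	show ?thesis unfolding fv_def
	proof (intro bexI[of _ "sc m"] conjI ballI)
		show "sc m \<in> elts omega" using m(1) by simp
		then show "hf (ap t (sc (dom s))) = ap (vl x) (sc m)"
			using xt[OF s(3)] m by (simp add: ap_vl)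
		show "K \<in> elts (hf (ap t (sc (dom s))))" by (rule K(1))
		fix k assume k: "k \<in> elts (sc m)"
		have kw: "k \<in> elts omega" using trans_omega[OF sc_omega[OF m(1)] k] .
		have "dbl k \<in> elts (dom s)" using k dbl_mono(1)[OF m(1)] m(2) by auto
		then show "K \<notin> elts (ap (vl x) k)"
			unfolding ap_vl[OF kw] using K(2) xt[OF st] ts by simp
	qed
qed

text \<open>II can force large jumps through the announcements but cannot choose the values. The
  bits are therefore stored only in the order in which the boards are continued: whichever board
  moves later gets the larger value.\<close>

lemma decodes_if_I_wins:
	assumes st: "\<sigma> \<in> elts St" and w: "\<And>x. x \<in> elts reals ==> folI \<sigma> x ==> wins C x"
	shows "\<exists>x\<in>elts C. \<exists>y\<in>elts C. \<exists>z\<in>elts C. \<exists>R0\<in>elts omega. decodes x y z R0 w"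
proof -
	\<comment> \<open>Against zeros from II, the first announcement of I provides the position
	  \<open>s0\<close> from which all three boards start.\<close>
	define e where "e = lam (finseq omega) (\<lambda>_. zero)"
	have e: "e \<in> elts St" unfolding e_def by (rule strat_lam) (simp_all add: df)
	note x0 = run[OF st e]
	obtain m0 where m0: "m0 \<in> elts omega" "flag (run \<sigma> e) m0"
		using w[OF x0(1,2)] zero_omega unfolding wins_def by blast
	define s0 where "s0 = restr (run \<sigma> e) (sc (dbl m0))"
	have s0: "rdy \<sigma> s0" unfolding s0_def by (rule rdy_restr[OF x0(1,2) m0])
	have ds0: "zero \<in> elts (dom s0)"
		unfolding s0_def using real_restr(2)[OF x0(1), of "sc (dbl m0)"] m0(1) zero_in_sc[of "dbl m0"] by simp
	define S where "S = bst \<sigma> w s0"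
	define A where "A n = ap (S n) zero" for n
	define B where "B n = ap (S n) one" for n
	define D where "D n = ap (S n) two" for n
	have dS: "dft (\<lambda>s. S (s 0))" unfolding S_def by (intro df)
	have dABD: "dft (\<lambda>s. A (s 0))" "dft (\<lambda>s. B (s 0))" "dft (\<lambda>s. D (s 0))"
		unfolding A_def B_def D_def by (intro df dS)+
	have z: "A zero = s0" "B zero = s0" "D zero = s0"
		unfolding A_def B_def D_def S_def bst_zero by simp_all
	\<comment> \<open>The demands on the second and third boards. If \<open>n \<in> elts w\<close>, the
	  second board moves first and the demand on the third exceeds everything on it; otherwise the
	  roles are exchanged.\<close>
	define KB where "KB n = (if n \<in> elts w then bn (A (sc n)) (B n) (D n) else bn (A (sc n)) (B n) (D (sc n)))" for n
	define KC where "KC n = (if n \<in> elts w then bn (A (sc n)) (B (sc n)) (D n) else bn (A (sc n)) (B n) (D n))" for n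
	have step: "A (sc n) = nr \<sigma> (A n) (bn (A n) (B n) (D n))" "B (sc n) = nr \<sigma> (B n) (KB n)"
			"D (sc n) = nr \<sigma> (D n) (KC n)" if n: "n \<in> elts omega" for n
	proof -
		show a: "A (sc n) = nr \<sigma> (A n) (bn (A n) (B n) (D n))"
			unfolding A_def B_def D_def S_def bst_sc[OF n] by (simp add: fA_def)
		have fa: "fA \<sigma> (S n) = A (sc n)" unfolding a unfolding fA_def A_def B_def D_def ..
		have b: "B (sc n) = fB \<sigma> w n (S n)" unfolding B_def S_def bst_sc[OF n] by simp
		have c: "D (sc n) = fC \<sigma> w n (S n)" unfolding D_def S_def bst_sc[OF n] by simp
		have gb: "gB \<sigma> (S n) = nr \<sigma> (B n) (bn (A (sc n)) (B n) (D n))"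
			unfolding gB_def fa B_def D_def ..
		have gc: "gC \<sigma> (S n) = nr \<sigma> (D n) (bn (A (sc n)) (B n) (D n))"
			unfolding gC_def fa B_def D_def ..
		show "B (sc n) = nr \<sigma> (B n) (KB n)"
		proof (cases "n \<in> elts w")
			case True then show ?thesis unfolding b fB_def gb KB_def by simp
		next
			case False
			then have "D (sc n) = gC \<sigma> (S n)" unfolding c fC_def by simp
			then show ?thesis using False unfolding b fB_def KB_def fa by (simp add: B_def)
		qed
		show "D (sc n) = nr \<sigma> (D n) (KC n)"
		proof (cases "n \<in> elts w")
			case False then show ?thesis unfolding c fC_def gc KC_def by simp
		next
			case True
			then have "B (sc n) = gB \<sigma> (S n)" unfolding b fB_def by simp
			then show ?thesis using True unfolding c fC_def KC_def fa by (simp add: D_def)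
		qed
	qed
	have R3: "rdy \<sigma> (A n) \<and> rdy \<sigma> (B n) \<and> rdy \<sigma> (D n)" if "n \<in> elts omega" for n
		using that
	proof (induction rule: omega_induct)
		case dfn show ?case by (intro df dABD)
	next
		case zero show ?case using s0 z by simp
	next
		case (sc n)
		then have f: "A n \<in> elts (finseq omega)" "B n \<in> elts (finseq omega)" "D n \<in> elts (finseq omega)"
			by (auto intro: rdy_finseq)
		have a: "rdy \<sigma> (A (sc n))" unfolding step(1)[OF sc.hyps]
			by (rule nr(1)[OF st w]) (use sc.IH bn(1)[OF f] in auto)
		show ?case
		proof (cases "n \<in> elts w")
			case True
			have b: "rdy \<sigma> (B (sc n))" unfolding step(2)[OF sc.hyps]
				by (rule nr(1)[OF st w]) (use True sc.IH bn(1)[OF rdy_finseq[OF a] f(2,3)] in \<open>auto simp: KB_def\<close>)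
			have "rdy \<sigma> (D (sc n))" unfolding step(3)[OF sc.hyps]
				by (rule nr(1)[OF st w]) (use True sc.IH bn(1)[OF rdy_finseq[OF a] rdy_finseq[OF b] f(3)] in \<open>auto simp: KC_def\<close>)
			with a b show ?thesis by simp
		next
			case False
			have b: "rdy \<sigma> (D (sc n))" unfolding step(3)[OF sc.hyps]
				by (rule nr(1)[OF st w]) (use False sc.IH bn(1)[OF rdy_finseq[OF a] f(2,3)] in \<open>auto simp: KC_def\<close>)
			have "rdy \<sigma> (B (sc n))" unfolding step(2)[OF sc.hyps]
				by (rule nr(1)[OF st w]) (use False sc.IH bn(1)[OF rdy_finseq[OF a] f(2) rdy_finseq[OF b]] in \<open>auto simp: KB_def\<close>)
			with a b show ?thesis by simp
		qed
	qed
	have rdyA: "rdy \<sigma> (A n)" and rdyB: "rdy \<sigma> (B n)" and rdyD: "rdy \<sigma> (D n)"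
		and fin: "A n \<in> elts (finseq omega)" "B n \<in> elts (finseq omega)" "D n \<in> elts (finseq omega)"
		if "n \<in> elts omega" for n
		using R3[OF that] rdy_finseq by auto
	have Kw: "bn (A n) (B n) (D n) \<in> elts omega" "KB n \<in> elts omega" "KC n \<in> elts omega"
		and bdA: "bd (A (sc n)) \<in> elts (KB n)" "bd (A (sc n)) \<in> elts (KC n)"
		and bdB: "n \<in> elts w ==> bd (B (sc n)) \<in> elts (KC n)"
		and bdD: "n \<notin> elts w ==> bd (D (sc n)) \<in> elts (KB n)"
		if n: "n \<in> elts omega" for n
		using bn[OF fin(1)[OF n] fin(2,3)[OF n]] bn[OF fin(1)[OF sc_omega[OF n]] fin(2,3)[OF n]]
			bn[OF fin(1,2)[OF sc_omega[OF n]] fin(3)[OF n]] bn[OF fin(1)[OF sc_omega[OF n]] fin(2)[OF n] fin(3)[OF sc_omega[OF n]]]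
		by (auto simp: KB_def KC_def)
	have nA: "rdy \<sigma> (A (sc n))" "dom (A n) \<in> elts (dom (A (sc n)))" "restr (A (sc n)) (dom (A n)) = A n"
			"sc (dom (A n)) \<in> elts (dom (A (sc n)))"
			"elts (bn (A n) (B n) (D n)) \<subseteq> elts (hf (ap (A (sc n)) (sc (dom (A n)))))" if n: "n \<in> elts omega" for n
		unfolding step(1)[OF n] using nr[OF st w rdyA[OF n] Kw(1)[OF n]] by blast+
	have nB: "rdy \<sigma> (B (sc n))" "dom (B n) \<in> elts (dom (B (sc n)))" "restr (B (sc n)) (dom (B n)) = B n"
			"sc (dom (B n)) \<in> elts (dom (B (sc n)))"
			"elts (KB n) \<subseteq> elts (hf (ap (B (sc n)) (sc (dom (B n)))))" if n: "n \<in> elts omega" for n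
		unfolding step(2)[OF n] using nr[OF st w rdyB[OF n] Kw(2)[OF n]] by blast+
	have nD: "rdy \<sigma> (D (sc n))" "dom (D n) \<in> elts (dom (D (sc n)))" "restr (D (sc n)) (dom (D n)) = D n"
			"sc (dom (D n)) \<in> elts (dom (D (sc n)))"
			"elts (KC n) \<subseteq> elts (hf (ap (D (sc n)) (sc (dom (D n)))))" if n: "n \<in> elts omega" for n
		unfolding step(3)[OF n] using nr[OF st w rdyD[OF n] Kw(3)[OF n]] by blast+
	have lA: "lim A \<in> elts reals" "\<And>n. n \<in> elts omega ==> restr (lim A) (dom (A n)) = A n"
			"\<And>n. n \<in> elts omega ==> n \<in> elts (dom (A n))"
		using lim[OF dABD(1) fin(1)] nA z ds0 by auto
	have lB: "lim B \<in> elts reals" "\<And>n. n \<in> elts omega ==> restr (lim B) (dom (B n)) = B n"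
			"\<And>n. n \<in> elts omega ==> n \<in> elts (dom (B n))"
		using lim[OF dABD(2) fin(2)] nB z ds0 by auto
	have lD: "lim D \<in> elts reals" "\<And>n. n \<in> elts omega ==> restr (lim D) (dom (D n)) = D n"
			"\<And>n. n \<in> elts omega ==> n \<in> elts (dom (D n))"
		using lim[OF dABD(3) fin(3)] nD z ds0 by auto
	have inC: "vl (lim T) \<in> elts C"
		if l: "lim T \<in> elts reals" "\<And>n. n \<in> elts omega ==> restr (lim T) (dom (T n)) = T n"
			"\<And>n. n \<in> elts omega ==> n \<in> elts (dom (T n))" and r: "\<And>n. n \<in> elts omega ==> rdy \<sigma> (T n)" for T
	proof -
		have "folI \<sigma> (lim T)" unfolding folI_def
		proof (intro ballI impI)
			fix n assume n: "n \<in> elts omega" "even_nat n"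
			have dw: "dom (T n) \<in> elts omega" using rdy_finseq[OF r[OF n(1)]] by (simp add: in_finseq)
			have "ap (lim T) n = ap (T n) n" using real_restr(3)[OF l(1) dw l(3)[OF n(1)]] l(2)[OF n(1)] by simp
			also have "\<dots> = ap \<sigma> (restr (T n) n)" using r[OF n(1)] l(3)[OF n(1)] n(2) unfolding rdy_def by blast
			also have "restr (T n) n = restr (lim T) n"
				using restr_restr[of "lim T" omega "dom (T n)" n] l(1) l(2)[OF n(1)] omega_subset[OF dw]
					Ord_subset[OF Ord_nat[OF dw] l(3)[OF n(1)]] by (auto simp: in_reals func_func_on)
			finally show "ap (lim T) n = ap \<sigma> (restr (lim T) n)" .
		qed
		from w[OF l(1) this] show ?thesis unfolding wins_def by blast
	qed
	define Y where "Y n = hf (ap (B (sc n)) (sc (dom (B n))))" for n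
	define Z where "Z n = hf (ap (D (sc n)) (sc (dom (D n))))" for n
	define X where "X n = hf (ap (A (sc n)) (sc (dom (A n))))" for n
	\<comment> \<open>The thresholds for decoding. The first one, \<open>bd s0\<close>, exceeds all
	  values on the starting boards; the later ones are the maxima of the two values of the preceding
	  round.\<close>
	define F where "F n = (if n = zero then bd s0 else un2 (Y (un n)) (Z (un n)))" for n
	have less_bd: "hf (ap s i) \<in> elts (bd s)" if "s \<in> elts (finseq omega)" "i \<in> elts (dom s)" for s i
	proof -
		have "ap s i \<in> elts omega" using that by (auto simp: in_finseq func_ap)
		then show ?thesis using hf_less[OF _ bd(1)[OF that(1)] bd(2)[OF that]] by blast
	qed
	have XYZ: "X n \<in> elts (bd (A (sc n)))" "Y n \<in> elts (bd (B (sc n)))" "Z n \<in> elts (bd (D (sc n)))"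
			"elts (bn (A n) (B n) (D n)) \<subseteq> elts (X n)" "elts (KB n) \<subseteq> elts (Y n)" "elts (KC n) \<subseteq> elts (Z n)"
		if n: "n \<in> elts omega" for n
		unfolding X_def Y_def Z_def
		using less_bd[OF fin(1)[OF sc_omega[OF n]] nA(4)[OF n]] less_bd[OF fin(2)[OF sc_omega[OF n]] nB(4)[OF n]]
			less_bd[OF fin(3)[OF sc_omega[OF n]] nD(4)[OF n]] nA(5)[OF n] nB(5)[OF n] nD(5)[OF n] by auto
	have XYZw: "X n \<in> elts omega" "Y n \<in> elts omega" "Z n \<in> elts omega" if n: "n \<in> elts omega" for n
		using trans_omega[OF bd(1)[OF fin(1)[OF sc_omega[OF n]]]] trans_omega[OF bd(1)[OF fin(2)[OF sc_omega[OF n]]]]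
			trans_omega[OF bd(1)[OF fin(3)[OF sc_omega[OF n]]]] XYZ[OF n] by auto
	have dF: "dft (\<lambda>s. F (s 0))"
		unfolding F_def Y_def Z_def
		by (intro df dft_app1[OF dABD(2)] dft_app1[OF dABD(3)])
	have Fw: "F n \<in> elts omega" if n: "n \<in> elts omega" for n
		using nat_cases[OF n] XYZw bd(1)[OF rdy_finseq[OF s0]] by (auto simp: F_def un_sc Ord_nat)
	define R where "R = lam omega F"
	have R: "R \<in> elts reals" "\<And>n. n \<in> elts omega ==> ap R n = F n"
		unfolding R_def using real_lam[OF dF Fw] ap_lam[OF dF] by auto
	have F1: "F n \<in> elts (bn (A n) (B n) (D n))" if n: "n \<in> elts omega" for n
		using nat_cases[OF n]
	proof
		assume "n = zero"
		then show ?thesis using bn(2)[OF fin[OF n]] z by (simp add: F_def)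
	next
		assume "\<exists>m\<in>elts omega. n = sc m"
		then obtain m where m: "m \<in> elts omega" "n = sc m" by blast
		have "F n = Y m \<or> F n = Z m" using m un2_max[OF Ord_nat Ord_nat] XYZw[OF m(1)] by (simp add: F_def un_sc Ord_nat)
		then show ?thesis using XYZ(2,3)[OF m(1)] bn(3,4)[OF fin[OF n]] m(2) Ord_trans[OF Ord_nat[OF bn(1)[OF fin[OF n]]]] by auto
	qed
	\<comment> \<open>The threshold must be at least all values already on the first board. In later
	  rounds this holds since both \<open>Y m\<close> and \<open>Z m\<close> answer demands above
	  \<open>bd (A (sc m))\<close>.\<close>
	have F2: "F n \<notin> elts (hf (ap (A n) i))" if n: "n \<in> elts omega" and i: "i \<in> elts (dom (A n))" for n i
		using nat_cases[OF n]
	proof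
		assume "n = zero"
		then show ?thesis using less_bd[OF fin(1)[OF n] i] z mem_asym by (simp add: F_def)
	next
		assume "\<exists>m\<in>elts omega. n = sc m"
		then obtain m where m: "m \<in> elts omega" "n = sc m" by blast
		have "hf (ap (A n) i) \<in> elts (bd (A (sc m)))" using less_bd[OF fin(1)[OF n] i] m by simp
		then have "hf (ap (A n) i) \<in> elts (Y m)"
			using bdA(1)[OF m(1)] XYZ(5)[OF m(1)] Ord_trans[OF Ord_nat[OF XYZw(2)[OF m(1)]]] by blast
		then have "hf (ap (A n) i) \<in> elts (F n)" using m by (simp add: F_def un_sc Ord_nat)
		then show ?thesis by (rule mem_asym)
	qed
	have "decodes (vl (lim A)) (vl (lim B)) (vl (lim D)) (bd s0) w"
		unfolding decodes_def
	proof (intro bexI[of _ R] conjI ballI)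
		show "R \<in> elts reals" "ap R zero = bd s0" using R by (simp_all add: F_def)
		fix r assume r: "r \<in> elts omega"
		note sr = sc_omega[OF r]
		have 1: "fv (vl (lim A)) (ap R r) (X r)" unfolding X_def R(2)[OF r]
			by (rule board_fv[OF lA(1) fin(1)[OF sr] lA(2)[OF sr] rdyA[OF r] nA(3)[OF r] nA(4)[OF r]])
				 (use XYZ(4)[OF r] F1[OF r] F2[OF r] in \<open>auto simp: X_def\<close>)
		have XY: "X r \<in> elts (Y r)" "X r \<in> elts (Z r)"
			using XYZ(1,5,6)[OF r] bdA[OF r] Ord_trans[OF Ord_nat[OF XYZw(2)[OF r]]]
				Ord_trans[OF Ord_nat[OF XYZw(3)[OF r]]] by blast+
		have lt: "X r \<notin> elts (hf (ap s i))" if "s \<in> elts (finseq omega)" "i \<in> elts (dom s)"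
			"bd s \<in> elts (bn (A r) (B r) (D r))" for s i
		proof -
			have "hf (ap s i) \<in> elts (X r)"
				using less_bd[OF that(1,2)] that(3) XYZ(4)[OF r] Ord_trans[OF Ord_nat[OF XYZw(1)[OF r]]] by blast
			then show ?thesis by (rule mem_asym)
		qed
		have 2: "fv (vl (lim B)) (X r) (Y r)" unfolding Y_def
			by (rule board_fv[OF lB(1) fin(2)[OF sr] lB(2)[OF sr] rdyB[OF r] nB(3)[OF r] nB(4)[OF r]])
				 (use XY lt[OF fin(2)[OF r]] bn(3)[OF fin[OF r]] in \<open>auto simp: Y_def\<close>)
		have 3: "fv (vl (lim D)) (X r) (Z r)" unfolding Z_def
			by (rule board_fv[OF lD(1) fin(3)[OF sr] lD(2)[OF sr] rdyD[OF r] nD(3)[OF r] nD(4)[OF r]])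
				 (use XY lt[OF fin(3)[OF r]] bn(4)[OF fin[OF r]] in \<open>auto simp: Z_def\<close>)
		have 4: "ap R (sc r) = un2 (Y r) (Z r)" unfolding R(2)[OF sr] F_def using un_sc[OF Ord_nat[OF r]] by simp
		have 5: "r \<in> elts w \<longleftrightarrow> Y r \<in> elts (Z r)"
		proof
			assume "r \<in> elts w"
			then show "Y r \<in> elts (Z r)"
				using bdB[OF r] XYZ(2,6)[OF r] Ord_trans[OF Ord_nat[OF XYZw(3)[OF r]]] by blast
		next
			assume yz: "Y r \<in> elts (Z r)"
			show "r \<in> elts w"
			proof (rule ccontr)
				assume "r \<notin> elts w"
				then have "Z r \<in> elts (Y r)"
					using bdD[OF r] XYZ(3,5)[OF r] Ord_trans[OF Ord_nat[OF XYZw(2)[OF r]]] by blast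
				then show False using yz mem_asym by blast
			qed
		qed
		show "\<exists>X Y Z. fv (vl (lim A)) (ap R r) X \<and> fv (vl (lim B)) X Y \<and> fv (vl (lim D)) X Z \<and>
				ap R (sc r) = un2 Y Z \<and> (r \<in> elts w \<longleftrightarrow> Y \<in> elts Z)"
			using 1 2 3 4 5 by blast
	qed
	then show ?thesis
		using inC[OF lA rdyA] inC[OF lB rdyB] inC[OF lD rdyD] bd(1)[OF rdy_finseq[OF s0]] by blast
qed

lemma dominated_or_decodes:
	assumes AD and C: "elts C \<subseteq> elts reals"
	shows "dominated C \<or> (\<forall>w. \<exists>x\<in>elts C. \<exists>y\<in>elts C. \<exists>z\<in>elts C. \<exists>R0\<in>elts omega. decodes x y z R0 w)"
proof -
	have Q: "dfn (\<lambda>s. wins C (s 0))" by (intro df)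
	from assms(1) Q show ?thesis
	proof (cases rule: AD_cases)
		case 1 then show ?thesis using decodes_if_I_wins by blast
	next
		case 2 then show ?thesis using dominated_if_II_wins[OF _ C] by blast
	qed
qed

lemma fv_unique:
	assumes "fv v K X" "fv v K X'" shows "X = X'"
proof -
	obtain i where i: "i \<in> elts omega" "X = ap v i" "K \<in> elts X" "\<forall>k\<in>elts i. K \<notin> elts (ap v k)"
		using assms(1) unfolding fv_def by blast
	obtain j where j: "j \<in> elts omega" "X' = ap v j" "K \<in> elts X'" "\<forall>k\<in>elts j. K \<notin> elts (ap v k)"
		using assms(2) unfolding fv_def by blast
	have "i = j" using Ord_linear[OF Ord_nat[OF i(1)] Ord_nat[OF j(1)]] i j by blast
	then show ?thesis using i j by simp
qed

text \<open>First values above a threshold are unique, so by induction the thresholds of both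
  decodings agree, and with them the bits.\<close>

lemma decodes_unique:
	assumes d: "decodes x y z R0 w" "decodes x y z R0 w'" and s: "elts w \<subseteq> elts omega" "elts w' \<subseteq> elts omega"
	shows "w = w'"
proof -
	obtain R where R: "ap R zero = R0" "\<And>r. r \<in> elts omega ==> \<exists>X Y Z.
		 fv x (ap R r) X \<and> fv y X Y \<and> fv z X Z \<and> ap R (sc r) = un2 Y Z \<and> (r \<in> elts w \<longleftrightarrow> Y \<in> elts Z)"
		using d(1) unfolding decodes_def by blast
	obtain R' where R': "ap R' zero = R0" "\<And>r. r \<in> elts omega ==> \<exists>X Y Z.
		 fv x (ap R' r) X \<and> fv y X Y \<and> fv z X Z \<and> ap R' (sc r) = un2 Y Z \<and> (r \<in> elts w' \<longleftrightarrow> Y \<in> elts Z)"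
		using d(2) unfolding decodes_def by blast
	have step: "ap R (sc r) = ap R' (sc r)" "r \<in> elts w \<longleftrightarrow> r \<in> elts w'"
		if r: "r \<in> elts omega" and eq: "ap R r = ap R' r" for r
	proof -
		obtain X Y Z where 1: "fv x (ap R r) X" "fv y X Y" "fv z X Z" "ap R (sc r) = un2 Y Z"
			"r \<in> elts w \<longleftrightarrow> Y \<in> elts Z" using R(2)[OF r] by blast
		obtain X' Y' Z' where 2: "fv x (ap R' r) X'" "fv y X' Y'" "fv z X' Z'" "ap R' (sc r) = un2 Y' Z'"
			"r \<in> elts w' \<longleftrightarrow> Y' \<in> elts Z'" using R'(2)[OF r] by blast
		have "X = X'" using fv_unique 1(1) 2(1) eq by metis
		then have "Y = Y'" "Z = Z'" using fv_unique 1(2,3) 2(2,3) by metis+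
		then show "ap R (sc r) = ap R' (sc r)" "r \<in> elts w \<longleftrightarrow> r \<in> elts w'" using 1 2 by auto
	qed
	have "ap R r = ap R' r" if "r \<in> elts omega" for r
		using that
	proof (induction rule: omega_induct)
		case dfn show ?case by (intro df)
	qed (use R(1) R'(1) step(1) in auto)
	then have "r \<in> elts w \<longleftrightarrow> r \<in> elts w'" if "r \<in> elts omega" for r using step(2) that by blast
	then show ?thesis using s by (intro elts_inject) blast
qed

text \<open>The decoding never gets stuck on unbounded sequences. In the ground model this recovers
  a set of numbers that was decoded from ground-model reals in the extension.\<close>

lemma decodes_exists:
	assumes x: "x \<in> elts reals" "y \<in> elts reals" "z \<in> elts reals" and R0: "R0 \<in> elts omega"
		and u: "\<forall>K\<in>elts omega. \<exists>i\<in>elts omega. K \<in> elts (ap x i)"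
			"\<forall>K\<in>elts omega. \<exists>i\<in>elts omega. K \<in> elts (ap y i)"
			"\<forall>K\<in>elts omega. \<exists>i\<in>elts omega. K \<in> elts (ap z i)"
	shows "\<exists>w. elts w \<subseteq> elts omega \<and> decodes x y z R0 w"
proof -
	let ?f = "\<lambda>v K. ap v (lst omega (\<lambda>i. K \<in> elts (ap v i)))"
	have f: "fv v K (?f v K)" "?f v K \<in> elts omega"
		if v: "v \<in> elts reals" "\<forall>K\<in>elts omega. \<exists>i\<in>elts omega. K \<in> elts (ap v i)" "K \<in> elts omega" for v K
	proof -
		have d: "dfn (\<lambda>s. K \<in> elts (ap v (s 0)))" by (intro df)
		obtain i where "i \<in> elts omega" "K \<in> elts (ap v i)" using v(2,3) by blast
		note l = lst[OF d Ord_omega this]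
		show "fv v K (?f v K)" unfolding fv_def using l by blast
		show "?f v K \<in> elts omega" using real_ap[OF v(1) l(1)] .
	qed
	let ?F = "\<lambda>k R. un2 (?f y (?f x R)) (?f z (?f x R))"
	have F: "dft (\<lambda>s. ?F (s 0) (s 1))" by (intro df)
	have Fw: "?F k R \<in> elts omega" if "R \<in> elts omega" for k R
		using f(2)[OF x(1) u(1) that] f(2)[OF x(2) u(2)] f(2)[OF x(3) u(3)] by simp
	let ?R = "lam omega (nrec R0 ?F)"
	have dR: "dft (\<lambda>s. nrec R0 ?F (s 0))" by (intro df)
	have Rw: "nrec R0 ?F n \<in> elts omega" if "n \<in> elts omega" for n
		by (rule nrec_type[OF F that R0]) (use Fw in blast)
	have R: "ap ?R n = nrec R0 ?F n" if "n \<in> elts omega" for n by (rule ap_lam[OF dR that])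
	let ?P = "\<lambda>r. ?f y (?f x (ap ?R r)) \<in> elts (?f z (?f x (ap ?R r)))"
	let ?w = "setof {r \<in> elts omega. ?P r}"
	have w: "elts ?w = {r \<in> elts omega. ?P r}" by (rule sepI) (intro df)
	have "decodes x y z R0 ?w" unfolding decodes_def
	proof (intro bexI[of _ ?R] conjI ballI)
		show "?R \<in> elts reals" by (rule real_lam[OF dR Rw])
		show "ap ?R zero = R0" using R[OF zero_omega] nrec_zero[OF F] by simp
		fix r assume r: "r \<in> elts omega"
		have rw: "ap ?R r \<in> elts omega" using R[OF r] Rw[OF r] by simp
		have 1: "fv x (ap ?R r) (?f x (ap ?R r))" "?f x (ap ?R r) \<in> elts omega" by (rule f[OF x(1) u(1) rw])+
		have 4: "ap ?R (sc r) = ?F r (ap ?R r)" unfolding R[OF sc_omega[OF r]] R[OF r] by (rule nrec_sc[OF F r])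
		have 5: "r \<in> elts ?w \<longleftrightarrow> ?P r" unfolding w using r by blast
		show "\<exists>X Y Z. fv x (ap ?R r) X \<and> fv y X Y \<and> fv z X Z \<and> ap ?R (sc r) = un2 Y Z \<and> (r \<in> elts ?w \<longleftrightarrow> Y \<in> elts Z)"
			using 1(1) f(1)[OF x(2) u(2) 1(2)] f(1)[OF x(3) u(3) 1(2)] 4 5 by blast
	qed
	then show ?thesis using w by blast
qed

text \<open>Converse of \<open>decodes_exists\<close>: the thresholds grow at least as fast as the
  round number, so a full decoding passes every \<open>K\<close> on each of the three
  sequences.\<close>

lemma decodes_unbounded:
	assumes x: "x \<in> elts reals" "y \<in> elts reals" "z \<in> elts reals" and R0: "R0 \<in> elts omega"
		and d: "decodes x y z R0 w" and K: "K \<in> elts omega"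
	shows "\<exists>i\<in>elts omega. K \<in> elts (ap x i)" "\<exists>i\<in>elts omega. K \<in> elts (ap y i)" "\<exists>i\<in>elts omega. K \<in> elts (ap z i)"
proof -
	obtain R where R: "R \<in> elts reals" "ap R zero = R0" "\<And>r. r \<in> elts omega ==> \<exists>X Y Z.
		 fv x (ap R r) X \<and> fv y X Y \<and> fv z X Z \<and> ap R (sc r) = un2 Y Z \<and> (r \<in> elts w \<longleftrightarrow> Y \<in> elts Z)"
		using d unfolding decodes_def by blast
	have fvD: "(\<exists>i\<in>elts omega. X = ap v i) \<and> K \<in> elts X" if "fv v K X" for v K X
		using that unfolding fv_def by blast
	have le: "elts r \<subseteq> elts (ap R r)" if "r \<in> elts omega" for r
		using that
	proof (induction rule: omega_induct)
		case dfn show ?case by (intro df)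
	next
		case (sc r)
		obtain X Y Z where 1: "fv x (ap R r) X" "fv y X Y" "ap R (sc r) = un2 Y Z" using R(3)[OF sc.hyps] by blast
		have "Y \<in> elts omega" using fvD[OF 1(2)] real_ap[OF x(2)] by blast
		then have "ap R r \<in> elts Y" using fvD[OF 1(1)] fvD[OF 1(2)] Ord_trans[OF Ord_nat] by blast
		then have "ap R r \<in> elts (ap R (sc r))" using 1(3) by simp
		then have "r \<in> elts (ap R (sc r))"
			using le_lt[OF Ord_nat[OF sc.hyps] Ord_nat[OF real_ap[OF R(1) sc_omega[OF sc.hyps]]] sc.IH] by blast
		then show ?case
			using Ord_subset[OF Ord_nat[OF real_ap[OF R(1) sc_omega[OF sc.hyps]]]] by auto
	qed simp
	obtain X Y Z where 1: "fv x (ap R K) X" "fv y X Y" "fv z X Z" using R(3)[OF K] by blast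
	have o: "Ord X" "Ord Y" "Ord Z" using fvD[OF 1(1)] fvD[OF 1(2)] fvD[OF 1(3)] real_ap x Ord_nat by blast+
	have kx: "K \<in> elts X" using le_lt[OF Ord_nat[OF K] o(1) le[OF K]] fvD[OF 1(1)] by blast
	then have "K \<in> elts Y" "K \<in> elts Z" using fvD[OF 1(2)] fvD[OF 1(3)] o Ord_trans by blast+
	then show "\<exists>i\<in>elts omega. K \<in> elts (ap x i)" "\<exists>i\<in>elts omega. K \<in> elts (ap y i)" "\<exists>i\<in>elts omega. K \<in> elts (ap z i)"
		using kx fvD[OF 1(1)] fvD[OF 1(2)] fvD[OF 1(3)] by blast+
qed

lemma CH_reals_if_CH_power_omega:
	assumes "CH (power omega)" shows "CH reals"
proof -
	let ?g = "\<lambda>x. setof {k \<in> elts omega. \<exists>n\<in>elts omega. k = pr n (ap x n)}"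
	have g: "elts (?g x) = {k \<in> elts omega. \<exists>n\<in>elts omega. k = pr n (ap x n)}" for x
		by (rule sepI) (intro df)
	show ?thesis
	proof (rule CH_rel[OF assms, of "\<lambda>w x. w = ?g x"])
		show "dfn (\<lambda>s. s 0 = ?g (s 1))" by (intro df)
		show "\<exists>w\<in>elts (power omega). w = ?g x" for x by (simp add: g)
		fix w x y assume e: "w = ?g x" "w = ?g y" and x: "x \<in> elts reals" and y: "y \<in> elts reals"
		show "x = y"
		proof (rule real_ext[OF x y])
			fix n assume n: "n \<in> elts omega"
			have "pr n (ap x n) \<in> elts (?g x)" unfolding g using n real_ap[OF x n] by auto
			then have "pr n (ap x n) \<in> elts (?g y)" using e by simp
			then obtain m where "m \<in> elts omega" "pr n (ap x n) = pr m (ap y m)" unfolding g by blast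
			then show "ap x n = ap y n" using n real_ap[OF x n] real_ap[OF y] by auto
		qed
	qed
qed

text \<open>The game is played for the range of \<open>z\<close>, which inherits a choice function
  from \<open>I\<close>. If this range is dominated, so are all reals by countably many, which
  diagonalization refutes. If it decodes, every set of numbers comes from three members of the range
  and a number, so choice spreads to the reals.\<close>

lemma no_dominating_family:
	assumes ad: AD and I: "CH I" and z: "func z I reals"
	shows "\<exists>v\<in>elts reals. \<forall>p\<in>elts I. \<exists>m\<in>elts omega. \<not> elts (ap v m) \<subseteq> elts (ap (ap z p) m)"
proof (rule ccontr)
	assume n: "\<not> ?thesis"
	let ?C = "setof {y \<in> elts reals. \<exists>p\<in>elts I. y = ap z p}"
	have C: "elts ?C = {y \<in> elts reals. \<exists>p\<in>elts I. y = ap z p}" by (rule sepI) (intro df)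
	have chC: "CH ?C"
		by (rule CH_rel[OF I, of "\<lambda>p y. y = ap z p"]) (intro df, auto simp: C)
	have "elts ?C \<subseteq> elts reals" unfolding C by blast
	from dominated_or_decodes[OF ad this] show False
	proof
		assume "dominated ?C"
		then obtain B where B: "func B (finseq omega) reals"
			"\<And>v. v \<in> elts ?C ==> \<exists>t\<in>elts (finseq omega). \<forall>m\<in>elts omega. elts (ap v m) \<subseteq> elts (ap (ap B t) m)"
			unfolding dominated_def by blast
		\<comment> \<open>Diagonalization: \<open>?v\<close> is above the function with index
		  \<open>t\<close> at the argument \<open>code t\<close>; injectivity of \<open>code\<close> makes
		  only one such \<open>t\<close> relevant for each argument.\<close>
		let ?P = "\<lambda>n k. \<forall>t\<in>elts (finseq omega). code t = n --> ap (ap B t) n \<in> elts k"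
		let ?v = "lam omega (\<lambda>n. lst omega (?P n))"
		have d: "dft (\<lambda>s. lst omega (?P (s 0)))" by (intro df)
		have P: "lst omega (?P n) \<in> elts omega" "?P n (lst omega (?P n))" if n: "n \<in> elts omega" for n
		proof -
			have dP: "dfn (\<lambda>s. ?P n (s 0))" by (intro df)
			have "\<exists>k\<in>elts omega. ?P n k"
			proof (cases "\<exists>t\<in>elts (finseq omega). code t = n")
				case True
				then obtain t where t: "t \<in> elts (finseq omega)" "code t = n" by blast
				have "u = t" if "u \<in> elts (finseq omega)" "code u = n" for u
					using code_inject[OF that(1) t(1)] that(2) t(2) by simp
				moreover have "ap (ap B t) n \<in> elts omega" by (rule real_ap[OF func_ap[OF B(1) t(1)] n])
				ultimately show ?thesis by (intro bexI[of _ "sc (ap (ap B t) n)"]) auto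
			next
				case False then show ?thesis by (intro bexI[of _ zero]) auto
			qed
			then obtain k where k: "k \<in> elts omega" "?P n k" by blast
			from lst(1,2)[of "?P n" omega k, OF dP Ord_omega k] show "lst omega (?P n) \<in> elts omega" "?P n (lst omega (?P n))" by blast+
		qed
		have v: "?v \<in> elts reals" by (rule real_lam[OF d P(1)])
		then obtain p where p: "p \<in> elts I" "\<forall>m\<in>elts omega. elts (ap ?v m) \<subseteq> elts (ap (ap z p) m)" using n by blast
		have "ap z p \<in> elts ?C" unfolding C using func_ap[OF z p(1)] p(1) by blast
		then obtain t where t: "t \<in> elts (finseq omega)" "\<forall>m\<in>elts omega. elts (ap (ap z p) m) \<subseteq> elts (ap (ap B t) m)"
			using B(2) by blast
		have c: "code t \<in> elts omega" by (rule code_omega[OF t(1)])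
		have "ap (ap B t) (code t) \<in> elts (ap ?v (code t))"
			unfolding ap_lam[OF d c] using P(2)[OF c] t(1) by blast
		then show False using p(2) t(2) c not_mem_self by blast
	next
		assume dec: "\<forall>w. \<exists>x\<in>elts ?C. \<exists>y\<in>elts ?C. \<exists>z\<in>elts ?C. \<exists>R0\<in>elts omega. decodes x y z R0 w"
		let ?R = "\<lambda>q w. \<exists>x y z R0. q = pair (pair x y) (pair z R0) \<and> decodes x y z R0 w \<and> elts w \<subseteq> elts omega"
		have "CH (power omega)"
		proof (rule CH_rel[of "prd (prd ?C ?C) (prd ?C omega)" ?R])
			show "CH (prd (prd ?C ?C) (prd ?C omega))" by (intro CH_prd chC CH_Ord) simp
			show "dfn (\<lambda>s. ?R (s 0) (s 1))" unfolding decodes_def by (intro df)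
			fix w assume "w \<in> elts (power omega)"
			then have w: "elts w \<subseteq> elts omega" by simp
			obtain x y z R0 where 1: "x \<in> elts ?C" "y \<in> elts ?C" "z \<in> elts ?C" "R0 \<in> elts omega" "decodes x y z R0 w"
				using dec by blast
			have "pair (pair x y) (pair z R0) \<in> elts (prd (prd ?C ?C) (prd ?C omega))"
				unfolding pair_in_prd using 1 by blast
			then show "\<exists>q\<in>elts (prd (prd ?C ?C) (prd ?C omega)). ?R q w" using w 1(5) by blast
		next
			fix q w w' assume "?R q w" "?R q w'"
			then show "w = w'" using decodes_unique by fastforce
		qed
		then show False using CH_reals_if_CH_power_omega AD_not_CH_reals[OF ad] by blast
	qed
qed

section \<open>Ordinal definability and choice from ordinal definable elements\<close>

section \<open>The cumulative hierarchy\<close>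

definition Vl :: "'v => 'v" where
	"Vl a = trec (\<lambda>a h. setof {x. \<exists>b\<in>elts a. elts x \<subseteq> elts (ap h b)}) a"

lemma isset_Vl: "isset {x. \<exists>b\<in>elts a. elts x \<subseteq> elts (ap h b)}"
proof -
	have "isset (\<Union>b\<in>elts a. elts (power (ap h b)))" by (rule isset_UN) (intro df)
	then show ?thesis by (simp add: UNION_eq)
qed

lemma dft_Vl_step: "dft (\<lambda>s. setof {x. \<exists>b\<in>elts (s 0). elts x \<subseteq> elts (ap (s 1) b)})"
	by (rule dft_setof) ((intro df)[1], rule isset_Vl)

lemma dft_Vl [df]: "dft t ==> dft (\<lambda>s. Vl (t s))"
	by (rule dft_app1[of Vl]) (unfold Vl_def, intro df dft_Vl_step)

lemma elts_Vl: assumes a: "Ord a" shows "elts (Vl a) = {x. \<exists>b\<in>elts a. elts x \<subseteq> elts (Vl b)}"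
proof -
	have d: "dft (\<lambda>s. trec (\<lambda>a h. setof {x. \<exists>b\<in>elts a. elts x \<subseteq> elts (ap h b)}) (s 0))"
		by (intro df dft_Vl_step)
	have "Vl a = setof {x. \<exists>b\<in>elts a. elts x \<subseteq> elts (ap (lam a Vl) b)}"
		unfolding Vl_def by (rule trec[OF dft_Vl_step a])
	also have "{x. \<exists>b\<in>elts a. elts x \<subseteq> elts (ap (lam a Vl) b)} = {x. \<exists>b\<in>elts a. elts x \<subseteq> elts (Vl b)}"
		using ap_lam[of Vl _ a] by (auto simp: dft_Vl dft_var)
	finally show ?thesis using isset_Vl[of a "lam a Vl"] ap_lam[of Vl _ a, OF dft_Vl[OF dft_var]]
		by (simp cong: bex_cong)
qed

lemma transitive_Vl: "Ord a ==> transitive (Vl a)"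
proof (erule Ord_induct[rotated], goal_cases)
	case (1 a)
	have "y \<in> elts (Vl a)" if x: "x \<in> elts (Vl a)" and y: "y \<in> elts x" for x y
	proof -
		obtain b where b: "b \<in> elts a" "elts x \<subseteq> elts (Vl b)" using x unfolding elts_Vl[OF 1(1)] by blast
		have "elts y \<subseteq> elts (Vl b)" using 1(2)[OF b(1)] b(2) y unfolding transitive_def by blast
		then show ?thesis unfolding elts_Vl[OF 1(1)] using b(1) by blast
	qed
	then show ?case unfolding transitive_def by blast
qed (intro df)

lemma Vl_trans: "Ord a ==> x \<in> elts (Vl a) ==> y \<in> elts x ==> y \<in> elts (Vl a)"
	using transD[OF transitive_Vl] .

lemma Vl_mem: "Ord a ==> b \<in> elts a ==> Vl b \<in> elts (Vl a)"
	by (auto simp: elts_Vl)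

lemma Vl_mono: "Ord a ==> Ord b ==> elts b \<subseteq> elts a ==> elts (Vl b) \<subseteq> elts (Vl a)"
	unfolding elts_Vl by blast

lemma elts_Vl_sc: assumes "Ord a" shows "elts (Vl (sc a)) = {x. elts x \<subseteq> elts (Vl a)}"
	unfolding elts_Vl[OF Ord_sc[OF assms]]
	using Vl_mono[OF assms Ord_in[OF assms]] Ord_subset[OF assms] by (auto; blast)

lemma Ord_in_Vl: "Ord a ==> Ord b ==> b \<in> elts (Vl a) \<longleftrightarrow> b \<in> elts a"
proof -
	have "\<forall>b. Ord b --> (b \<in> elts (Vl a) \<longleftrightarrow> b \<in> elts a)" if "Ord a"
		using that
	proof (rule Ord_induct[rotated], goal_cases)
		case (1 a)
		show ?case
		proof (intro allI impI iffI)
			fix b assume b: "Ord b" "b \<in> elts (Vl a)"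
			then obtain c where c: "c \<in> elts a" "elts b \<subseteq> elts (Vl c)" unfolding elts_Vl[OF 1(1)] by blast
			have "elts b \<subseteq> elts c" using 1(2)[OF c(1)] Ord_in[OF b(1)] c(2) by blast
			then show "b \<in> elts a" using le_lt[OF b(1) 1(1)] c(1) by blast
		next
			fix b assume b: "Ord b" "b \<in> elts a"
			have "elts b \<subseteq> elts (Vl b)" using 1(2)[OF b(2)] Ord_in[OF b(1)] by blast
			then show "b \<in> elts (Vl a)" unfolding elts_Vl[OF 1(1)] using b(2) by blast
		qed
	qed (intro df)
	then show "Ord a ==> Ord b ==> ?thesis" by blast
qed

lemma V_hierarchy_Vl:
	assumes a: "Ord a" shows "V_hierarchy a h \<longleftrightarrow> h = lam (sc a) Vl"
proof
	have d: "dft (\<lambda>s. Vl (s 0))" by (intro df)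
	{
		assume "h = lam (sc a) Vl"
		have f: "func_on (lam (sc a) Vl) (sc a)" by (rule func_on_lam[OF d])
		have app: "app (lam (sc a) Vl) b = Vl b" if "b \<in> elts (sc a)" for b
			using app_eq[OF f that] ap_lam[OF d that] by simp
		have "elts (app (lam (sc a) Vl) b) = (\<Union>c\<in>elts b. elts (power (app (lam (sc a) Vl) c)))"
			if b: "b \<in> elts (sc a)" for b
		proof -
			have "app (lam (sc a) Vl) c = Vl c" if "c \<in> elts b" for c
				using app Ord_trans[OF Ord_sc[OF a] b that] by blast
			then show ?thesis using app[OF b] elts_Vl[OF Ord_in[OF Ord_sc[OF a] b]] by auto
		qed
		then show "V_hierarchy a h" unfolding V_hierarchy_def \<open>h = lam (sc a) Vl\<close> using a f by blast
	}
	assume h: "V_hierarchy a h"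
	have f: "func_on h (sc a)" using h unfolding V_hierarchy_def by blast
	have eq: "b \<in> elts (sc a) --> ap h b = Vl b" if "Ord b" for b
		using that
	proof (rule Ord_induct[rotated], goal_cases)
		case (1 b)
		show ?case
		proof
			assume b: "b \<in> elts (sc a)"
			have "elts (ap h b) = (\<Union>c\<in>elts b. elts (power (app h c)))"
			proof -
				have "\<forall>\<beta>\<in>elts (sc a). elts (app h \<beta>) = (\<Union>c\<in>elts \<beta>. elts (power (app h c)))"
					using h unfolding V_hierarchy_def by blast
				from bspec[OF this b] show ?thesis unfolding app_eq[OF f b] .
			qed
			also have "\<dots> = (\<Union>c\<in>elts b. elts (power (Vl c)))"
			proof -
				have "app h c = Vl c" if c: "c \<in> elts b" for c
					using 1(2)[OF c] Ord_trans[OF Ord_sc[OF a] b c] app_eq[OF f] by metis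
				then show ?thesis by simp
			qed
			also have "\<dots> = elts (Vl b)" using elts_Vl[OF 1(1)] by auto
			finally show "ap h b = Vl b" by (rule elts_inject)
		qed
	qed (intro df)
	show "h = lam (sc a) Vl"
		by (rule fun_ext[OF f func_on_lam[OF d]])
			 (use eq Ord_in[OF Ord_sc[OF a]] ap_lam[OF d] in auto)
qed

lemma V_level_eq: "Ord a ==> V_level a = Vl a"
proof -
	assume a: "Ord a"
	have d: "dft (\<lambda>s. Vl (s 0))" by (intro df)
	have "app (lam (sc a) Vl) a = Vl a" using app_eq[OF func_on_lam[OF d], of a "sc a"] ap_lam[OF d, of a "sc a"] by simp
	then show ?thesis unfolding V_level_def V_hierarchy_Vl[OF a] by simp
qed

section \<open>Definability inside the structure\<close>

text \<open>\<open>upd\<close> rebuilt by \<open>lam\<close>: this form is definable in all three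
  arguments and can be evaluated for every \<open>s\<close>.\<close>

definition ud :: "'v => 'v => 'v => 'v" where
	"ud s i a = lam omega (\<lambda>k. if k = i then a else ap s k)"

lemma dft_ud [df]: "dft t ==> dft u ==> dft v ==> dft (\<lambda>s. ud (t s) (u s) (v s))"
	by (rule dft_app3[of ud]) (unfold ud_def, intro df)

lemma ud_d: "dft (\<lambda>s'. if s' 0 = i then a else ap s (s' 0))" by (intro df)
lemma ap_ud: "k \<in> elts omega ==> ap (ud s i a) k = (if k = i then a else ap s k)"
	unfolding ud_def by (rule ap_lam[OF ud_d])
lemma ud_fspace: "func s omega A ==> a \<in> elts A ==> func (ud s i a) omega A"
	unfolding ud_def by (rule func_lam[OF ud_d]) (auto simp: func_ap)

lemma upd_eq:
	assumes s: "func s omega A" and i: "i \<in> elts omega"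
	shows "upd s i a = ud s i a"
proof -
	have f: "func_on s omega" by (rule func_func_on[OF s])
	have e: "elts (setof {p \<in> elts s. \<forall>b. p \<noteq> pair i b}) = {p \<in> elts s. \<forall>b. p \<noteq> pair i b}"
		by (rule sepI) (intro df)
	have "elts (ud s i a) = insert (pair i a) {p \<in> elts s. \<forall>b. p \<noteq> pair i b}"
		unfolding ud_def elts_lam[OF ud_d] using in_func_on[OF f] i by auto
	then show ?thesis unfolding upd_def by (metis setof_elts)
qed

definition aM :: "'v => 'v => 'v => 'v" where
	"aM A i j = setof {s \<in> elts (fspace omega A). ap s i \<in> elts (ap s j)}"
definition aE :: "'v => 'v => 'v => 'v" where
	"aE A i j = setof {s \<in> elts (fspace omega A). ap s i = ap s j}"
definition cN :: "'v => 'v => 'v" where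
	"cN A X = setof {s \<in> elts (fspace omega A). s \<notin> elts X}"
definition cI :: "'v => 'v => 'v" where
	"cI X Y = setof {s \<in> elts X. s \<in> elts Y}"
definition cX :: "'v => 'v => 'v => 'v" where
	"cX A i X = setof {s \<in> elts (fspace omega A). \<exists>a\<in>elts A. ud s i a \<in> elts X}"

lemma elts_aM: "elts (aM A i j) = {s \<in> elts (fspace omega A). ap s i \<in> elts (ap s j)}"
	unfolding aM_def by (rule sepI) (intro df)
lemma elts_aE: "elts (aE A i j) = {s \<in> elts (fspace omega A). ap s i = ap s j}"
	unfolding aE_def by (rule sepI) (intro df)
lemma elts_cN: "elts (cN A X) = elts (fspace omega A) - elts X"
proof -
	have "elts (cN A X) = {s \<in> elts (fspace omega A). s \<notin> elts X}" unfolding cN_def by (rule sepI) (intro df)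
	then show ?thesis by blast
qed
lemma elts_cI: "elts (cI X Y) = elts X \<inter> elts Y"
proof -
	have "elts (cI X Y) = {s \<in> elts X. s \<in> elts Y}" unfolding cI_def by (rule sepI) (intro df)
	then show ?thesis by blast
qed
lemma elts_cX: "elts (cX A i X) = {s \<in> elts (fspace omega A). \<exists>a\<in>elts A. ud s i a \<in> elts X}"
	unfolding cX_def by (rule sepI) (intro df)

lemma dft_aM [df]: "dft t ==> dft u ==> dft v ==> dft (\<lambda>s. aM (t s) (u s) (v s))"
	by (rule dft_app3[of aM]) (unfold aM_def, intro df)
lemma dft_aE [df]: "dft t ==> dft u ==> dft v ==> dft (\<lambda>s. aE (t s) (u s) (v s))"
	by (rule dft_app3[of aE]) (unfold aE_def, intro df)
lemma dft_cN [df]: "dft t ==> dft u ==> dft (\<lambda>s. cN (t s) (u s))"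
	by (rule dft_app2[of cN]) (unfold cN_def, intro df)
lemma dft_cI [df]: "dft t ==> dft u ==> dft (\<lambda>s. cI (t s) (u s))"
	by (rule dft_app2[of cI]) (unfold cI_def, intro df)
lemma dft_cX [df]: "dft t ==> dft u ==> dft v ==> dft (\<lambda>s. cX (t s) (u s) (v s))"
	by (rule dft_app3[of cX]) (unfold cX_def, intro df)

definition clause :: "'v => 'v => 'v => 'v => bool" where
	"clause A S t \<chi> \<longleftrightarrow>
		 (\<exists>i\<in>elts omega. \<exists>j\<in>elts omega. \<chi> = cMem i j \<and> ap S \<chi> = aM A i j) \<or>
		 (\<exists>i\<in>elts omega. \<exists>j\<in>elts omega. \<chi> = cEq i j \<and> ap S \<chi> = aE A i j) \<or>
		 (\<exists>\<phi>\<in>elts t. \<chi> = cNeg \<phi> \<and> ap S \<chi> = cN A (ap S \<phi>)) \<or>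
		 (\<exists>\<phi>\<in>elts t. \<exists>\<psi>\<in>elts t. \<chi> = cAnd \<phi> \<psi> \<and> ap S \<chi> = cI (ap S \<phi>) (ap S \<psi>)) \<or>
		 (\<exists>i\<in>elts omega. \<exists>\<phi>\<in>elts t. \<chi> = cEx i \<phi> \<and> ap S \<chi> = cX A i (ap S \<phi>))"

lemma dft_codes [df]:
	"dft t ==> dft u ==> dft (\<lambda>s. cMem (t s) (u s))"
	"dft t ==> dft u ==> dft (\<lambda>s. cEq (t s) (u s))"
	"dft t ==> dft (\<lambda>s. cNeg (t s))"
	"dft t ==> dft u ==> dft (\<lambda>s. cAnd (t s) (u s))"
	"dft t ==> dft u ==> dft (\<lambda>s. cEx (t s) (u s))"
	unfolding cMem_def cEq_def cNeg_def cAnd_def cEx_def by (intro df; assumption)+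

lemma dfn_clause [df]: "dft t ==> dft u ==> dft v ==> dft w ==> dfn (\<lambda>s. clause (t s) (u s) (v s) (w s))"
	by (rule dfn_app4[of clause]) (unfold clause_def, intro df)

lemma app_fspace: "s \<in> elts (fspace omega A) ==> i \<in> elts omega ==> app s i = ap s i"
	by (simp add: func_app)

lemma sat_interp_iff: "sat_interp A S t \<longleftrightarrow> func_on S t \<and> (\<forall>\<chi>\<in>elts t. clause A S t \<chi>)"
proof (cases "func_on S t")
	case True
	have e: "elts X = elts Y \<longleftrightarrow> X = Y" for X Y using elts_inject by blast
	have M: "{s \<in> elts (fspace omega A). app s i \<in> elts (app s j)} = elts (aM A i j)"
		"{s \<in> elts (fspace omega A). app s i = app s j} = elts (aE A i j)"
		if "i \<in> elts omega" "j \<in> elts omega" for i j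
		unfolding elts_aM elts_aE using app_fspace that by auto
	have X: "{s \<in> elts (fspace omega A). \<exists>a\<in>elts A. upd s i a \<in> elts Y} = elts (cX A i Y)"
		if "i \<in> elts omega" for i Y
		unfolding elts_cX using upd_eq that by auto
	have S: "app S \<phi> = ap S \<phi>" if "\<phi> \<in> elts t" for \<phi> by (rule app_eq[OF True that])
	have c: "((\<exists>i\<in>elts omega. \<exists>j\<in>elts omega. \<chi> = cMem i j \<and>
				elts (app S \<chi>) = {s \<in> elts (fspace omega A). app s i \<in> elts (app s j)}) \<or>
		 (\<exists>i\<in>elts omega. \<exists>j\<in>elts omega. \<chi> = cEq i j \<and>
				elts (app S \<chi>) = {s \<in> elts (fspace omega A). app s i = app s j}) \<or>
		 (\<exists>\<phi>\<in>elts t. \<chi> = cNeg \<phi> \<and>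
				elts (app S \<chi>) = elts (fspace omega A) - elts (app S \<phi>)) \<or>
		 (\<exists>\<phi>\<in>elts t. \<exists>\<psi>\<in>elts t. \<chi> = cAnd \<phi> \<psi> \<and>
				elts (app S \<chi>) = elts (app S \<phi>) \<inter> elts (app S \<psi>)) \<or>
		 (\<exists>i\<in>elts omega. \<exists>\<phi>\<in>elts t. \<chi> = cEx i \<phi> \<and>
				elts (app S \<chi>) =
					{s \<in> elts (fspace omega A). \<exists>a\<in>elts A. upd s i a \<in> elts (app S \<phi>)})) \<longleftrightarrow> clause A S t \<chi>"
		if t: "\<chi> \<in> elts t" for \<chi>
		unfolding clause_def S[OF t] elts_cN[symmetric] elts_cI[symmetric]
		by (simp only: M X S elts_cN[symmetric] elts_cI[symmetric] e cong: bex_cong)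
	show ?thesis unfolding sat_interp_def using True c by (simp only: True simp_thms cong: ball_cong)
next
	case False then show ?thesis unfolding sat_interp_def by blast
qed

lemma dfn_sat_interp [df]: "dft t ==> dft u ==> dft v ==> dfn (\<lambda>s. sat_interp (t s) (u s) (v s))"
	unfolding sat_interp_iff by (rule dfn_app3[of "\<lambda>A S t. func_on S t \<and> (\<forall>\<chi>\<in>elts t. clause A S t \<chi>)"]) (intro df)

lemma numerals_neq:
	"zero \<noteq> one" "zero \<noteq> two" "zero \<noteq> three" "zero \<noteq> four" "one \<noteq> two" "one \<noteq> three" "one \<noteq> four"
	"two \<noteq> three" "two \<noteq> four" "three \<noteq> four"
	by (simp_all add: one_def two_def three_def four_def)

lemmas codes_def = cMem_def cEq_def cNeg_def cAnd_def cEx_def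
lemmas codes_simps = codes_def numerals_neq numerals_neq[symmetric]

lemma clause_inv:
	"clause A S t (cMem i j) ==> ap S (cMem i j) = aM A i j"
	"clause A S t (cEq i j) ==> ap S (cEq i j) = aE A i j"
	"clause A S t (cNeg \<phi>) ==> \<phi> \<in> elts t \<and> ap S (cNeg \<phi>) = cN A (ap S \<phi>)"
	"clause A S t (cAnd \<phi> \<psi>) ==> \<phi> \<in> elts t \<and> \<psi> \<in> elts t \<and> ap S (cAnd \<phi> \<psi>) = cI (ap S \<phi>) (ap S \<psi>)"
	"clause A S t (cEx i \<phi>) ==> \<phi> \<in> elts t \<and> ap S (cEx i \<phi>) = cX A i (ap S \<phi>)"
	unfolding clause_def by (auto simp: codes_simps)

lemma clauseE:
	assumes "clause A S t \<chi>"
	obtains (Mem) i j where "i \<in> elts omega" "j \<in> elts omega" "\<chi> = cMem i j" "ap S \<chi> = aM A i j"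
	| (Eq) i j where "i \<in> elts omega" "j \<in> elts omega" "\<chi> = cEq i j" "ap S \<chi> = aE A i j"
	| (Neg) \<phi> where "\<phi> \<in> elts t" "\<chi> = cNeg \<phi>" "ap S \<chi> = cN A (ap S \<phi>)"
	| (And) \<phi> \<psi> where "\<phi> \<in> elts t" "\<psi> \<in> elts t" "\<chi> = cAnd \<phi> \<psi>" "ap S \<chi> = cI (ap S \<phi>) (ap S \<psi>)"
	| (Ex) i \<phi> where "i \<in> elts omega" "\<phi> \<in> elts t" "\<chi> = cEx i \<phi>" "ap S \<chi> = cX A i (ap S \<phi>)"
	using assms unfolding clause_def by blast

lemma pair_tc: "\<exists>z\<in>elts (pair a b). b \<in> elts (tc_sing z)" "\<exists>z\<in>elts (pair a b). a \<in> elts (tc_sing z)"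
proof -
	have "b \<in> elts (tc_sing (up a b))" "a \<in> elts (tc_sing (up a b))"
		using transD[OF transitive_tc_sing tc_sing_self] by auto
	then show "\<exists>z\<in>elts (pair a b). b \<in> elts (tc_sing z)" "\<exists>z\<in>elts (pair a b). a \<in> elts (tc_sing z)"
		unfolding pair_eq by auto
qed

lemma pair_pair_tc: "\<exists>z\<in>elts (pair c (pair a b)). b \<in> elts (tc_sing z)" "\<exists>z\<in>elts (pair c (pair a b)). a \<in> elts (tc_sing z)"
proof -
	obtain z where z: "z \<in> elts (pair c (pair a b))" "pair a b \<in> elts (tc_sing z)" using pair_tc by blast
	have "elts (tc_sing u) \<subseteq> elts (tc_sing z)" if "u \<in> elts (pair a b)" for u
		using tc_sing_min[OF transitive_tc_sing transD[OF transitive_tc_sing z(2) that]] .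
	then show "\<exists>z\<in>elts (pair c (pair a b)). b \<in> elts (tc_sing z)" "\<exists>z\<in>elts (pair c (pair a b)). a \<in> elts (tc_sing z)"
		using pair_tc z(1) by blast+
qed

lemma subformula_tc:
	"\<exists>z\<in>elts (cNeg \<phi>). \<phi> \<in> elts (tc_sing z)" "\<exists>z\<in>elts (cAnd \<phi> \<psi>). \<phi> \<in> elts (tc_sing z)"
	"\<exists>z\<in>elts (cAnd \<phi> \<psi>). \<psi> \<in> elts (tc_sing z)" "\<exists>z\<in>elts (cEx i \<phi>). \<phi> \<in> elts (tc_sing z)"
	unfolding codes_def using pair_tc pair_pair_tc by blast+

text \<open>The tag of a code determines which clause applies and hence the subformulas, so the
  values agree by induction along the codes.\<close>

lemma sat_unique:
	assumes 1: "sat_interp A S t" and 2: "sat_interp A S' t'" and x: "\<chi> \<in> elts t" "\<chi> \<in> elts t'"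
	shows "ap S \<chi> = ap S' \<chi>"
proof -
	have "\<chi> \<in> elts t \<and> \<chi> \<in> elts t' --> ap S \<chi> = ap S' \<chi>"
	proof (rule tc_induct[of _ \<chi>], goal_cases)
		case 1 show ?case by (intro df)
	next
		case IH: (2 \<chi>)
		show ?case
		proof (intro impI, elim conjE)
			assume x: "\<chi> \<in> elts t" "\<chi> \<in> elts t'"
			have c: "clause A S t \<chi>" "clause A S' t' \<chi>" using 1 2 x unfolding sat_interp_iff by blast+
			from c(1) show "ap S \<chi> = ap S' \<chi>"
			proof (cases rule: clauseE)
				case (Mem i j) then show ?thesis using clause_inv(1) c(2) by metis
			next
				case (Eq i j) then show ?thesis using clause_inv(2) c(2) by metis
			next
				case (Neg \<phi>)
				then have "\<phi> \<in> elts t'" "ap S' \<chi> = cN A (ap S' \<phi>)" using clause_inv(3) c(2) by blast+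
				moreover then have "ap S \<phi> = ap S' \<phi>" using IH subformula_tc(1)[of \<phi>] Neg by blast
				ultimately show ?thesis using Neg by simp
			next
				case (And \<phi> \<psi>)
				then have "\<phi> \<in> elts t'" "\<psi> \<in> elts t'" "ap S' \<chi> = cI (ap S' \<phi>) (ap S' \<psi>)" using clause_inv(4) c(2) by blast+
				moreover then have "ap S \<phi> = ap S' \<phi>" "ap S \<psi> = ap S' \<psi>" using IH subformula_tc(2,3)[of \<phi> \<psi>] And by blast+
				ultimately show ?thesis using And by simp
			next
				case (Ex i \<phi>)
				then have "\<phi> \<in> elts t'" "ap S' \<chi> = cX A i (ap S' \<phi>)" using clause_inv(5) c(2) by blast+
				moreover then have "ap S \<phi> = ap S' \<phi>" using IH subformula_tc(4)[of i \<phi>] Ex by blast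
				ultimately show ?thesis using Ex by simp
			qed
		qed
	qed
	then show ?thesis using x by blast
qed

text \<open>The sets of assignments defined over \<open>A\<close> by formulas of the structure, with
  the codes forgotten. These formulas may be nonstandard, so the sets need not come from
  \<open>fm\<close>.\<close>

definition Dd :: "'v => 'v => bool" where
	"Dd A X \<longleftrightarrow> (\<exists>S t \<chi>. sat_interp A S t \<and> \<chi> \<in> elts t \<and> X = ap S \<chi>)"

lemma Dd_induct [consumes 1, case_names dfn Mem Eq Neg And Ex]:
	assumes "Dd A X" and "dfn (\<lambda>s. Q (s 0))"
		and "\<And>i j. i \<in> elts omega ==> j \<in> elts omega ==> Q (aM A i j)"
		and "\<And>i j. i \<in> elts omega ==> j \<in> elts omega ==> Q (aE A i j)"
		and "\<And>X. Q X ==> Q (cN A X)" "\<And>X Y. Q X ==> Q Y ==> Q (cI X Y)"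
		and "\<And>i X. i \<in> elts omega ==> Q X ==> Q (cX A i X)"
	shows "Q X"
proof -
	obtain S t \<chi> where 1: "sat_interp A S t" "\<chi> \<in> elts t" "X = ap S \<chi>" using assms(1) unfolding Dd_def by blast
	have "\<chi> \<in> elts t --> Q (ap S \<chi>)"
	proof (rule tc_induct[of _ \<chi>], goal_cases)
		case 1 show ?case by (intro df dfn_app1[OF assms(2)])
	next
		case IH: (2 \<chi>)
		show ?case
		proof
			assume "\<chi> \<in> elts t"
			then have "clause A S t \<chi>" using 1(1) unfolding sat_interp_iff by blast
			then show "Q (ap S \<chi>)"
			proof (cases rule: clauseE)
				case (Mem i j) then show ?thesis using assms(3) by simp
			next
				case (Eq i j) then show ?thesis using assms(4) by simp
			next
				case (Neg \<phi>)
				then have "Q (ap S \<phi>)" using IH subformula_tc(1)[of \<phi>] by blast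
				then show ?thesis using Neg assms(5) by simp
			next
				case (And \<phi> \<psi>)
				then have "Q (ap S \<phi>)" "Q (ap S \<psi>)" using IH subformula_tc(2,3)[of \<phi> \<psi>] by blast+
				then show ?thesis using And assms(6) by simp
			next
				case (Ex i \<phi>)
				then have "Q (ap S \<phi>)" using IH subformula_tc(4)[of i \<phi>] by blast
				then show ?thesis using Ex assms(7) by simp
			qed
		qed
	qed
	then show ?thesis using 1 by blast
qed

lemma clause_mono:
	assumes "clause A S t \<chi>" and "elts t \<subseteq> elts t'" and "\<And>\<phi>. \<phi> \<in> elts t ==> ap S' \<phi> = ap S \<phi>" and "\<chi> \<in> elts t"
	shows "clause A S' t' \<chi>"
	using assms(1)
proof (cases rule: clauseE)
	case (Mem i j) then show ?thesis using assms(3)[OF assms(4)] unfolding clause_def by metis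
next
	case (Eq i j) then show ?thesis using assms(3)[OF assms(4)] unfolding clause_def by metis
next
	case (Neg \<phi>)
	then have "ap S' \<chi> = cN A (ap S' \<phi>)" using assms(3,4) by simp
	then show ?thesis using Neg assms(2) unfolding clause_def by blast
next
	case (And \<phi> \<psi>)
	then have "ap S' \<chi> = cI (ap S' \<phi>) (ap S' \<psi>)" using assms(3,4) by simp
	then show ?thesis using And assms(2) unfolding clause_def by blast
next
	case (Ex i \<phi>)
	then have "ap S' \<chi> = cX A i (ap S' \<phi>)" using assms(3,4) by simp
	then show ?thesis using Ex assms(2) unfolding clause_def by blast
qed

lemma sat_join:
	assumes 1: "sat_interp A S t" and 2: "sat_interp A S' t'"
	shows "\<exists>S''. sat_interp A S'' (un2 t t') \<and> (\<forall>\<chi>\<in>elts t. ap S'' \<chi> = ap S \<chi>) \<and> (\<forall>\<chi>\<in>elts t'. ap S'' \<chi> = ap S' \<chi>)"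
proof -
	let ?S = "lam (un2 t t') (\<lambda>\<chi>. if \<chi> \<in> elts t then ap S \<chi> else ap S' \<chi>)"
	have d: "dft (\<lambda>s. if s 0 \<in> elts t then ap S (s 0) else ap S' (s 0))" by (intro df)
	have a: "\<forall>\<chi>\<in>elts t. ap ?S \<chi> = ap S \<chi>" by (auto simp: ap_lam[OF d])
	have b: "\<forall>\<chi>\<in>elts t'. ap ?S \<chi> = ap S' \<chi>" using sat_unique[OF 1 2] by (auto simp: ap_lam[OF d])
	have "clause A ?S (un2 t t') \<chi>" if "\<chi> \<in> elts (un2 t t')" for \<chi>
		using that clause_mono[of A S t \<chi> "un2 t t'" ?S] clause_mono[of A S' t' \<chi> "un2 t t'" ?S] a b 1 2
		unfolding sat_interp_iff by auto
	then show ?thesis using func_on_lam[OF d] a b unfolding sat_interp_iff by blast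
qed

text \<open>Adds a single new code to a set of formulas closed under subformulas. A code that is
  already present has the right value by \<open>clause_inv\<close>, which explains the case
  distinctions in \<open>Dd_intros\<close>.\<close>

lemma sat_extend:
	assumes 1: "sat_interp A S t" and n: "\<chi> \<notin> elts t"
		and c: "\<And>S'. ap S' \<chi> = X ==> (\<And>\<phi>. \<phi> \<in> elts t ==> ap S' \<phi> = ap S \<phi>) ==> clause A S' (un2 t (sing \<chi>)) \<chi>"
	shows "Dd A X"
proof -
	let ?t = "un2 t (sing \<chi>)"
	let ?S = "lam ?t (\<lambda>\<phi>. if \<phi> = \<chi> then X else ap S \<phi>)"
	have d: "dft (\<lambda>s. if s 0 = \<chi> then X else ap S (s 0))" by (intro df)
	have a: "ap ?S \<chi> = X" "\<And>\<phi>. \<phi> \<in> elts t ==> ap ?S \<phi> = ap S \<phi>"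
		using n by (auto simp: ap_lam[OF d])
	have "clause A ?S ?t \<phi>" if "\<phi> \<in> elts ?t" for \<phi>
		using that clause_mono[of A S t \<phi> ?t ?S] a 1 c[OF a] unfolding sat_interp_iff by auto
	then have "sat_interp A ?S ?t" unfolding sat_interp_iff using func_on_lam[OF d] by blast
	then show ?thesis unfolding Dd_def using a(1) by (metis elts_sing elts_un2 UnCI singletonI)
qed

lemma sat_empty: "sat_interp A zero zero"
	unfolding sat_interp_iff func_on_iff by simp

lemma Dd_intros:
	"i \<in> elts omega ==> j \<in> elts omega ==> Dd A (aM A i j)"
	"i \<in> elts omega ==> j \<in> elts omega ==> Dd A (aE A i j)"
	"Dd A X ==> Dd A (cN A X)" "Dd A X ==> Dd A Y ==> Dd A (cI X Y)"
	"i \<in> elts omega ==> Dd A X ==> Dd A (cX A i X)"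
proof -
	show "Dd A (aM A i j)" if "i \<in> elts omega" "j \<in> elts omega"
		by (rule sat_extend[OF sat_empty, of "cMem i j"]) (use that in \<open>auto simp: clause_def\<close>)
	show "Dd A (aE A i j)" if "i \<in> elts omega" "j \<in> elts omega"
		by (rule sat_extend[OF sat_empty, of "cEq i j"]) (use that in \<open>auto simp: clause_def\<close>)
	show "Dd A (cN A X)" if "Dd A X"
	proof -
		obtain S t \<phi> where 1: "sat_interp A S t" "\<phi> \<in> elts t" "X = ap S \<phi>" using \<open>Dd A X\<close> unfolding Dd_def by blast
		show ?thesis
		proof (cases "cNeg \<phi> \<in> elts t")
			case True
			then have "ap S (cNeg \<phi>) = cN A X" using 1 clause_inv(3)[of A S t \<phi>] unfolding sat_interp_iff by blast
			then show ?thesis unfolding Dd_def using 1(1) True by metis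
		next
			case False
			show ?thesis by (rule sat_extend[OF 1(1) False]) (use 1 in \<open>auto simp: clause_def\<close>)
		qed
	qed
	show "Dd A (cX A i X)" if i: "i \<in> elts omega" and "Dd A X"
	proof -
		obtain S t \<phi> where 1: "sat_interp A S t" "\<phi> \<in> elts t" "X = ap S \<phi>" using \<open>Dd A X\<close> unfolding Dd_def by blast
		show ?thesis
		proof (cases "cEx i \<phi> \<in> elts t")
			case True
			then have "ap S (cEx i \<phi>) = cX A i X" using 1 clause_inv(5)[of A S t i \<phi>] unfolding sat_interp_iff by blast
			then show ?thesis unfolding Dd_def using 1(1) True by metis
		next
			case False
			show ?thesis by (rule sat_extend[OF 1(1) False]) (use 1 i in \<open>auto simp: clause_def\<close>)
		qed
	qed
	show "Dd A (cI X Y)" if "Dd A X" "Dd A Y"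
	proof -
		obtain S t \<phi> where 1: "sat_interp A S t" "\<phi> \<in> elts t" "X = ap S \<phi>" using \<open>Dd A X\<close> unfolding Dd_def by blast
		obtain S' t' \<psi> where 2: "sat_interp A S' t'" "\<psi> \<in> elts t'" "Y = ap S' \<psi>" using \<open>Dd A Y\<close> unfolding Dd_def by blast
		obtain T where T: "sat_interp A T (un2 t t')" "\<forall>\<chi>\<in>elts t. ap T \<chi> = ap S \<chi>" "\<forall>\<chi>\<in>elts t'. ap T \<chi> = ap S' \<chi>"
			using sat_join[OF 1(1) 2(1)] by blast
		have e: "\<phi> \<in> elts (un2 t t')" "\<psi> \<in> elts (un2 t t')" "X = ap T \<phi>" "Y = ap T \<psi>" using 1 2 T by auto
		show ?thesis
		proof (cases "cAnd \<phi> \<psi> \<in> elts (un2 t t')")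
			case True
			then have "ap T (cAnd \<phi> \<psi>) = cI X Y" using T e clause_inv(4)[of A T "un2 t t'" \<phi> \<psi>] unfolding sat_interp_iff by blast
			then show ?thesis unfolding Dd_def using T(1) True by metis
		next
			case False
			show ?thesis
			proof (rule sat_extend[OF T(1) False])
				fix S' assume "ap S' (cAnd \<phi> \<psi>) = cI X Y" "\<And>\<chi>. \<chi> \<in> elts (un2 t t') ==> ap S' \<chi> = ap T \<chi>"
				then have "ap S' (cAnd \<phi> \<psi>) = cI (ap S' \<phi>) (ap S' \<psi>)" using e by metis
				then show "clause A S' (un2 (un2 t t') (sing (cAnd \<phi> \<psi>))) (cAnd \<phi> \<psi>)"
					unfolding clause_def using e(1,2) by auto
			qed
		qed
	qed
qed

definition ODv :: "'v => 'v => bool" where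
	"ODv \<beta> x \<longleftrightarrow> (\<exists>X s. x \<in> elts (Vl \<beta>) \<and> s \<in> elts (fspace omega (Vl \<beta>)) \<and>
		 (\<forall>i\<in>elts omega. i \<noteq> zero --> Ord (ap s i)) \<and> Dd (Vl \<beta>) X \<and>
		 (\<forall>y\<in>elts (Vl \<beta>). ud s zero y \<in> elts X \<longleftrightarrow> y = x))"

lemma dfn_Dd [df]: "dft t ==> dft u ==> dfn (\<lambda>s. Dd (t s) (u s))"
	by (rule dfn_app2[of Dd]) (unfold Dd_def, intro df)
lemma dfn_ODv [df]: "dft t ==> dft u ==> dfn (\<lambda>s. ODv (t s) (u s))"
	by (rule dfn_app2[of ODv]) (unfold ODv_def, intro df)

lemma OD_iff: "OD x \<longleftrightarrow> (\<exists>\<beta>. Ord \<beta> \<and> ODv \<beta> x)"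
proof
	assume "OD x"
	then obtain \<beta> \<phi> s where 1: "Ord \<beta>" "x \<in> elts (V_level \<beta>)" "s \<in> elts (fspace omega (V_level \<beta>))"
		"\<forall>i\<in>elts omega. i \<noteq> zero --> Ord (app s i)"
		"\<forall>y\<in>elts (V_level \<beta>). Sat (V_level \<beta>) \<phi> (upd s zero y) \<longleftrightarrow> y = x"
		unfolding OD_def by blast
	note 2 = 1[unfolded V_level_eq[OF 1(1)]]
	obtain S t where S: "sat_interp (Vl \<beta>) S t" "\<phi> \<in> elts t" using 2(2,5) unfolding Sat_def by blast
	have "Sat (Vl \<beta>) \<phi> u \<longleftrightarrow> u \<in> elts (ap S \<phi>)" for u
	proof -
		have "app S' \<phi> = ap S \<phi>" if "sat_interp (Vl \<beta>) S' t'" "\<phi> \<in> elts t'" for S' t'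
			using sat_unique[OF that(1) S(1) that(2) S(2)] app_eq[of S' t' \<phi>] that unfolding sat_interp_iff by simp
		then show ?thesis unfolding Sat_def using S by metis
	qed
	moreover have "upd s zero y = ud s zero y" for y
		using upd_eq[of s "Vl \<beta>" zero y] 2(3) by simp
	moreover have "Dd (Vl \<beta>) (ap S \<phi>)" unfolding Dd_def using S by blast
	moreover have "\<forall>i\<in>elts omega. i \<noteq> zero --> Ord (ap s i)" using 2(4) app_fspace[OF 2(3)] by simp
	ultimately have "ODv \<beta> x" unfolding ODv_def using 2(2,3,5) by (intro exI[of _ "ap S \<phi>"] exI[of _ s]) simp
	then show "\<exists>\<beta>. Ord \<beta> \<and> ODv \<beta> x" using 1(1) by blast
next
	assume "\<exists>\<beta>. Ord \<beta> \<and> ODv \<beta> x"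
	then obtain \<beta> X s where 1: "Ord \<beta>" "x \<in> elts (Vl \<beta>)" "s \<in> elts (fspace omega (Vl \<beta>))"
		"\<forall>i\<in>elts omega. i \<noteq> zero --> Ord (ap s i)" "Dd (Vl \<beta>) X"
		"\<forall>y\<in>elts (Vl \<beta>). ud s zero y \<in> elts X \<longleftrightarrow> y = x" unfolding ODv_def by blast
	obtain S t \<phi> where S: "sat_interp (Vl \<beta>) S t" "\<phi> \<in> elts t" "X = ap S \<phi>" using 1(5) unfolding Dd_def by blast
	have "Sat (Vl \<beta>) \<phi> u \<longleftrightarrow> u \<in> elts X" for u
	proof -
		have "app S' \<phi> = ap S \<phi>" if "sat_interp (Vl \<beta>) S' t'" "\<phi> \<in> elts t'" for S' t'
			using sat_unique[OF that(1) S(1) that(2) S(2)] app_eq[of S' t' \<phi>] that unfolding sat_interp_iff by simp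
		then show ?thesis unfolding Sat_def using S by metis
	qed
	moreover have "upd s zero y = ud s zero y" for y
		using upd_eq[of s "Vl \<beta>" zero y] 1(3) by simp
	moreover have "\<forall>i\<in>elts omega. i \<noteq> zero --> Ord (app s i)" using 1(4) app_fspace[OF 1(3)] by simp
	ultimately show "OD x" unfolding OD_def using 1 V_level_eq[OF 1(1)]
		by (intro exI[of _ \<beta>] exI[of _ \<phi>]) auto
qed

lemma dfn_OD [df]: "dft t ==> dfn (\<lambda>s. OD (t s))"
	by (rule dfn_app1[of OD]) (unfold OD_iff, intro df)
lemma dfn_HOD [df]: "dft t ==> dfn (\<lambda>s. HOD (t s))"
	by (rule dfn_app1[of HOD]) (unfold HOD_def, intro df)

section \<open>Sets of ordinal definable sets have choice functions\<close>

text \<open>First the least length occurring in \<open>z\<close> is fixed, then one entry after the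
  other by choosing a value among those that remain. After all entries are fixed a single sequence
  is left, and \<open>un\<close> extracts it.\<close>

lemma CH_finseq:
	assumes "CH A" shows "CH (finseq A)"
proof -
	obtain c where c: "\<And>y. elts y \<subseteq> elts A ==> y \<noteq> zero ==> ap c y \<in> elts y"
		using assms unfolding CH_def by blast
	let ?n = "\<lambda>z. lst omega (\<lambda>n. \<exists>s\<in>elts z. dom s = n)"
	let ?z0 = "\<lambda>z. setof {s \<in> elts z. dom s = ?n z}"
	let ?v = "\<lambda>k y. setof {a \<in> elts A. \<exists>s\<in>elts y. a = ap s k}"
	let ?f = "\<lambda>k y. setof {s \<in> elts y. ap s k = ap c (?v k y)}"
	have f: "dft (\<lambda>s. ?f (s 0) (s 1))" by (intro df)
	have ef: "elts (?f k y) = {s \<in> elts y. ap s k = ap c (?v k y)}" for k y by (rule sepI) (intro df)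
	have ev: "elts (?v k y) = {a \<in> elts A. \<exists>s\<in>elts y. a = ap s k}" for k y by (rule sepI) (intro df)
	let ?y = "\<lambda>z. nrec (?z0 z) ?f (?n z)"
	show ?thesis
	proof (rule CH_I)
		show "dft (\<lambda>s. un (?y (s 0)))" by (intro df)
		fix z assume z: "elts z \<subseteq> elts (finseq A)" "z \<noteq> zero"
		define n where "n = ?n z"
		define z0 where "z0 = setof {s \<in> elts z. dom s = n}"
		define y where "y k = nrec z0 ?f k" for k
		have ez: "elts z0 = {s \<in> elts z. dom s = n}" unfolding z0_def by (rule sepI) (intro df)
		have dy: "dft (\<lambda>s. y (s 0))" unfolding y_def by (intro df)
		have y0: "y zero = z0" unfolding y_def by (rule nrec_zero[OF f])
		have ys: "elts (y (sc k)) = {s \<in> elts (y k). ap s k = ap c (?v k (y k))}" if "k \<in> elts omega" for k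
			unfolding y_def nrec_sc[OF f that] by (rule ef)
		obtain s where s: "s \<in> elts z" using z(2) nonzero by blast
		have d: "dfn (\<lambda>s'. \<exists>s\<in>elts z. dom s = s' 0)" by (intro df)
		have "dom s \<in> elts omega" using s z(1) in_finseq by blast
		then have n: "n \<in> elts omega" "\<exists>s\<in>elts z. dom s = n"
			unfolding n_def using lst(1,2)[OF d Ord_omega, of "dom s"] s by blast+
		have step: "k \<in> elts (sc n) --> y k \<noteq> zero \<and> elts (y k) \<subseteq> elts z0 \<and>
				(\<forall>s\<in>elts (y k). \<forall>t\<in>elts (y k). \<forall>i\<in>elts k. ap s i = ap t i)"
			if "k \<in> elts omega" for k
			using that
		proof (induction rule: omega_induct)
			case dfn show ?case by (intro df dft_app1[OF dy])
		next
			case zero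
			have "z0 \<noteq> zero" unfolding nonzero ez using n(2) by blast
			then show ?case unfolding y0 by simp
		next
			case (sc k)
			show ?case
			proof
				assume k: "sc k \<in> elts (sc n)"
				have "k \<in> elts (sc k)" by simp
				moreover have "sc k \<in> elts n \<or> sc k = n" using k by auto
				ultimately have kn: "k \<in> elts n" using Ord_trans[OF Ord_nat[OF n(1)]] by blast
				then have "k \<in> elts (sc n)" by simp
				note IH' = mp[OF sc.IH this]
				note IH = conjunct1[OF IH'] conjunct1[OF conjunct2[OF IH']] conjunct2[OF conjunct2[OF IH']]
				have "ap s k \<in> elts A" if "s \<in> elts (y k)" for s
				proof -
					have "s \<in> elts (finseq A)" "dom s = n" using that IH(2) ez z(1) by blast+
					then show ?thesis using kn by (auto simp: in_finseq func_ap)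
				qed
				moreover obtain s0 where "s0 \<in> elts (y k)" using IH(1) unfolding nonzero by blast
				moreover define V where "V = ?v k (y k)"
				have V: "elts V = {a \<in> elts A. \<exists>s\<in>elts (y k). a = ap s k}" unfolding V_def by (rule ev)
				ultimately have "ap s0 k \<in> elts V" by blast
				then have vz: "V \<noteq> zero" unfolding nonzero by blast
				have "elts V \<subseteq> elts A" unfolding V by blast
				from c[OF this vz] obtain s where s: "s \<in> elts (y k)" "ap s k = ap c V" unfolding V by auto
				show "y (sc k) \<noteq> zero \<and> elts (y (sc k)) \<subseteq> elts z0 \<and>
					(\<forall>s\<in>elts (y (sc k)). \<forall>t\<in>elts (y (sc k)). \<forall>i\<in>elts (sc k). ap s i = ap t i)"
					unfolding nonzero ys[OF sc.hyps] elts_sc V_def[symmetric]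
				proof (intro conjI ballI)
					show "\<exists>x. x \<in> {s \<in> elts (y k). ap s k = ap c V}" using s by blast
					show "{s \<in> elts (y k). ap s k = ap c V} \<subseteq> elts z0" using IH(2) by blast
					fix u v i assume u: "u \<in> {s \<in> elts (y k). ap s k = ap c V}"
						and v: "v \<in> {s \<in> elts (y k). ap s k = ap c V}" and i: "i \<in> insert k (elts k)"
					show "ap u i = ap v i"
					proof (cases "i = k")
						case True then show ?thesis using u v by simp
					next
						case False then show ?thesis using u v i IH(3) by blast
					qed
				qed
			qed
		qed
		have nn: "n \<in> elts (sc n)" by simp
		have y: "y n \<noteq> zero" "elts (y n) \<subseteq> elts z0" "\<forall>s\<in>elts (y n). \<forall>t\<in>elts (y n). \<forall>i\<in>elts n. ap s i = ap t i"
			using step[OF n(1)] nn by blast+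
		obtain t where t: "t \<in> elts (y n)" using y(1) nonzero by blast
		have mem: "u \<in> elts z" "dom u = n" if "u \<in> elts (y n)" for u
			using subsetD[OF y(2) that] unfolding ez by blast+
		have "s = t" if s: "s \<in> elts (y n)" for s
		proof (rule finseq_ext)
			show "s \<in> elts (finseq A)" "t \<in> elts (finseq A)"
				using mem(1)[OF s] mem(1)[OF t] z(1) by blast+
			show "dom s = dom t" using mem(2)[OF s] mem(2)[OF t] by simp
			fix i assume i: "i \<in> elts (dom s)"
			show "ap s i = ap t i" using y(3)[rule_format, OF s t] i unfolding mem(2)[OF s] by blast
		qed
		then have yt: "elts (y n) = {t}" using t by blast
		have "un (y n) = t" by (rule elts_inject) (unfold elts_un yt, blast)
		then have "un (y n) \<in> elts z" using mem(1)[OF t] by (rule ssubst)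
		then show "un (?y z) \<in> elts z" unfolding y_def z0_def n_def .
	qed
qed

text \<open>The arguments packed into a number are smaller than it, so the recursion behind
  \<open>EE\<close> may use its values at them.\<close>

lemma pr_mono:
	assumes "m \<in> elts omega" "n \<in> elts omega"
	shows "n \<in> elts (pr m n)" "m \<in> elts (pr m n)"
proof -
	have "n \<in> elts (pr m n) \<and> m \<in> elts (pr m n)"
		using assms(1)
	proof (induction rule: omega_induct)
		case dfn show ?case by (intro df)
	next
		case zero
		have "n \<in> elts (dbl n) \<or> n = dbl n"
			using Ord_subset_iff[OF Ord_nat[OF assms(2)] Ord_nat[OF dbl_omega[OF assms(2)]]] le_dbl[OF assms(2)] by blast
		then show ?case using zero_in_sc[OF dbl_omega[OF assms(2)]] by auto
	next
		case (sc m)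
		have q: "pr m n \<in> elts omega" using sc.hyps assms(2) by simp
		have m: "m \<in> elts (dbl m) \<or> m = dbl m"
			using Ord_subset_iff[OF Ord_nat[OF sc.hyps] Ord_nat[OF dbl_omega[OF sc.hyps]]] le_dbl[OF sc.hyps] by blast
		have "elts (sc m) \<subseteq> elts (sc (dbl m))" using m le_dbl[OF sc.hyps] by auto
		then have "sc m \<in> elts (dbl (pr m n))"
			using le_lt[of "sc m" "dbl (pr m n)" "sc (dbl m)"] dbl_mono(2)[OF q] sc q
			by (simp add: Ord_sc Ord_nat)
		then show ?case using sc le_dbl[OF q] by auto
	qed
	then show "n \<in> elts (pr m n)" "m \<in> elts (pr m n)" by blast+
qed

definition p1 :: "'v => 'v" where "p1 k = lst omega (\<lambda>i. \<exists>j\<in>elts omega. k = pr i j)"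
definition p2 :: "'v => 'v" where "p2 k = lst omega (\<lambda>j. \<exists>i\<in>elts omega. k = pr i j)"

lemma dft_p [df]: "dft t ==> dft (\<lambda>s. p1 (t s))" "dft t ==> dft (\<lambda>s. p2 (t s))"
	by (rule dft_app1[of p1], unfold p1_def, intro df, assumption) (rule dft_app1[of p2], unfold p2_def, intro df)

lemma p_pr [simp]:
	assumes "i \<in> elts omega" "j \<in> elts omega" shows "p1 (pr i j) = i" "p2 (pr i j) = j"
proof -
	have 1: "dfn (\<lambda>s. \<exists>j'\<in>elts omega. pr i j = pr (s 0) j')" by (intro df)
	have 2: "dfn (\<lambda>s. \<exists>i'\<in>elts omega. pr i j = pr i' (s 0))" by (intro df)
	show "p1 (pr i j) = i" unfolding p1_def
		by (rule lst_eq[OF 1 Ord_omega assms(1)]) (use assms trans_omega[OF assms(1)] in auto)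
	show "p2 (pr i j) = j" unfolding p2_def
		by (rule lst_eq[OF 2 Ord_omega assms(2)]) (use assms trans_omega[OF assms(2)] in auto)
qed

text \<open>One step of an enumeration of all sets in \<open>Dd A\<close> by natural numbers: the
  tag in \<open>p1 n\<close> imitates the tag of a formula code. Numbers are well-ordered, which
  makes formulas available to a choice function.\<close>

definition EF :: "'v => 'v => 'v => 'v" where
	"EF A n h = (if p1 n = zero then aM A (p1 (p2 n)) (p2 (p2 n))
		 else if p1 n = one then aE A (p1 (p2 n)) (p2 (p2 n))
		 else if p1 n = two then cN A (ap h (p2 n))
		 else if p1 n = three then cI (ap h (p1 (p2 n))) (ap h (p2 (p2 n)))
		 else cX A (p1 (p2 n)) (ap h (p2 (p2 n))))"
definition EE :: "'v => 'v => 'v" where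
	"EE A n = trec (EF A) n"

lemma dft_EF [df]: "dft t ==> dft u ==> dft v ==> dft (\<lambda>s. EF (t s) (u s) (v s))"
	by (rule dft_app3[of EF]) (unfold EF_def, intro df)
lemma dft_EE [df]: "dft t ==> dft u ==> dft (\<lambda>s. EE (t s) (u s))"
	by (rule dft_app2[of EE]) (unfold EE_def, intro df)

lemma EE: "n \<in> elts omega ==> EE A n = EF A n (lam n (EE A))"
	unfolding EE_def by (rule trec) (intro df, rule Ord_nat)

lemma ap_lam_EE: "m \<in> elts n ==> ap (lam n (EE A)) m = EE A m"
	by (rule ap_lam) (intro df)

lemma numerals_omega [simp]: "one \<in> elts omega" "two \<in> elts omega" "three \<in> elts omega" "four \<in> elts omega"
	by (simp_all add: one_def two_def three_def four_def)

lemma EE_simps: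
	assumes "i \<in> elts omega" "j \<in> elts omega"
	shows "EE A (pr zero (pr i j)) = aM A i j" "EE A (pr one (pr i j)) = aE A i j"
		"EE A (pr two i) = cN A (EE A i)" "EE A (pr three (pr i j)) = cI (EE A i) (EE A j)"
		"EE A (pr four (pr i j)) = cX A i (EE A j)"
proof -
	have w: "pr k (pr i j) \<in> elts omega" "i \<in> elts (pr k (pr i j))" "j \<in> elts (pr k (pr i j))"
		if k: "k \<in> elts omega" for k
	proof -
		have "pr i j \<in> elts omega" using assms by simp
		note q = pr_mono(1)[OF k this]
		show o: "pr k (pr i j) \<in> elts omega" using k assms by simp
		show "i \<in> elts (pr k (pr i j))" "j \<in> elts (pr k (pr i j))"
			using Ord_trans[OF Ord_nat[OF o] q] pr_mono[OF assms] by blast+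
	qed
	have z: "pr zero (pr i j) \<in> elts omega" by (rule w(1)) simp
	show "EE A (pr zero (pr i j)) = aM A i j"
		unfolding EE[OF z] EF_def using assms p_pr[OF zero_omega, of "pr i j"] by (simp del: pr_zero)
	show "EE A (pr one (pr i j)) = aE A i j" "EE A (pr three (pr i j)) = cI (EE A i) (EE A j)"
		"EE A (pr four (pr i j)) = cX A i (EE A j)"
		using assms w by (simp_all add: EE EF_def ap_lam_EE numerals_neq numerals_neq[symmetric])
	have "pr two i \<in> elts omega" using assms by simp
	then show "EE A (pr two i) = cN A (EE A i)"
		using assms pr_mono(1)[of two i] by (simp add: EE EF_def ap_lam_EE numerals_neq numerals_neq[symmetric])
qed

lemma Dd_EE: "Dd A X ==> \<exists>n\<in>elts omega. X = EE A n"
proof (induction rule: Dd_induct)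
	case dfn show ?case by (intro df)
next
	case (Mem i j)
	show ?case by (rule bexI[of _ "pr zero (pr i j)"], rule EE_simps(1)[symmetric]) (use Mem in simp_all)
next
	case (Eq i j)
	show ?case by (rule bexI[of _ "pr one (pr i j)"], rule EE_simps(2)[symmetric]) (use Eq in simp_all)
next
	case (Neg X)
	then obtain n where "n \<in> elts omega" "X = EE A n" by blast
	then show ?case using EE_simps(3) by (intro bexI[of _ "pr two n"]) simp_all
next
	case (And X Y)
	then obtain n m where "n \<in> elts omega" "X = EE A n" "m \<in> elts omega" "Y = EE A m" by blast
	then show ?case using EE_simps(4) by (intro bexI[of _ "pr three (pr n m)"]) simp_all
next
	case (Ex i X)
	then obtain n where "n \<in> elts omega" "X = EE A n" by blast
	then show ?case using EE_simps(5) Ex by (intro bexI[of _ "pr four (pr i n)"]) simp_all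
qed

text \<open>Only finitely many variables matter. This is essential for choice: finite sequences of
  ordinals admit a choice function by \<open>CH_finseq\<close>, whereas determinacy forbids one for
  the infinite sequences that serve as assignments.\<close>

lemma Dd_support:
	"Dd A X ==> \<exists>n\<in>elts omega. \<forall>s\<in>elts (fspace omega A). \<forall>t\<in>elts (fspace omega A).
		 (\<forall>i\<in>elts n. ap s i = ap t i) --> (s \<in> elts X \<longleftrightarrow> t \<in> elts X)"
proof (induction rule: Dd_induct)
	case dfn show ?case by (intro df)
next
	case (Mem i j)
	show ?case by (rule bexI[of _ "un2 (sc i) (sc j)"]) (use Mem in \<open>auto simp: elts_aM\<close>)
next
	case (Eq i j)
	show ?case by (rule bexI[of _ "un2 (sc i) (sc j)"]) (use Eq in \<open>auto simp: elts_aE\<close>)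
next
	case (Neg X)
	then obtain n where 1: "n \<in> elts omega" "\<forall>s\<in>elts (fspace omega A). \<forall>t\<in>elts (fspace omega A).
		 (\<forall>i\<in>elts n. ap s i = ap t i) --> (s \<in> elts X \<longleftrightarrow> t \<in> elts X)" by blast
	show ?case
	proof (intro bexI[of _ n] ballI impI 1(1))
		fix s t assume st: "s \<in> elts (fspace omega A)" "t \<in> elts (fspace omega A)" "\<forall>i\<in>elts n. ap s i = ap t i"
		then show "s \<in> elts (cN A X) \<longleftrightarrow> t \<in> elts (cN A X)"
			unfolding elts_cN using 1(2)[rule_format, OF st(1,2)] by blast
	qed
next
	case (And X Y)
	then obtain n m where 1: "n \<in> elts omega" "\<forall>s\<in>elts (fspace omega A). \<forall>t\<in>elts (fspace omega A).
		 (\<forall>i\<in>elts n. ap s i = ap t i) --> (s \<in> elts X \<longleftrightarrow> t \<in> elts X)" and 2: "m \<in> elts omega"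
		"\<forall>s\<in>elts (fspace omega A). \<forall>t\<in>elts (fspace omega A).
		 (\<forall>i\<in>elts m. ap s i = ap t i) --> (s \<in> elts Y \<longleftrightarrow> t \<in> elts Y)" by blast
	have "s \<in> elts (cI X Y) \<longleftrightarrow> t \<in> elts (cI X Y)" if "s \<in> elts (fspace omega A)" "t \<in> elts (fspace omega A)"
		"\<forall>i\<in>elts (un2 n m). ap s i = ap t i" for s t
		using 1(2)[rule_format, OF that(1,2)] 2(2)[rule_format, OF that(1,2)] that(3)
		unfolding elts_cI elts_un2 by blast
	moreover have "un2 n m \<in> elts omega" using 1(1) 2(1) by simp
	ultimately show ?case by blast
next
	case (Ex i X)
	then obtain n where 1: "n \<in> elts omega" "\<forall>s\<in>elts (fspace omega A). \<forall>t\<in>elts (fspace omega A).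
		 (\<forall>i\<in>elts n. ap s i = ap t i) --> (s \<in> elts X \<longleftrightarrow> t \<in> elts X)" by blast
	have "s \<in> elts (cX A i X) \<longleftrightarrow> t \<in> elts (cX A i X)" if st: "s \<in> elts (fspace omega A)" "t \<in> elts (fspace omega A)"
		"\<forall>i\<in>elts n. ap s i = ap t i" for s t
	proof -
		have "ud s i a \<in> elts X \<longleftrightarrow> ud t i a \<in> elts X" if a: "a \<in> elts A" for a
		proof (rule 1(2)[rule_format])
			show "ud s i a \<in> elts (fspace omega A)" "ud t i a \<in> elts (fspace omega A)"
				using ud_fspace[OF _ a] st by auto
			show "ap (ud s i a) k = ap (ud t i a) k" if "k \<in> elts n" for k
				using that st(3) trans_omega[OF 1(1) that] by (simp add: ap_ud)
		qed
		then show ?thesis unfolding elts_cX using st(1,2) by simp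
	qed
	then show ?case using 1(1) by blast
qed

definition xt :: "'v => 'v" where
	"xt a = lam omega (\<lambda>i. if i \<in> elts (dom a) then ap a i else zero)"

lemma dft_xt [df]: "dft t ==> dft (\<lambda>s. xt (t s))"
	by (rule dft_app1[of xt]) (unfold xt_def, intro df)

lemma ap_xt: "i \<in> elts omega ==> ap (xt a) i = (if i \<in> elts (dom a) then ap a i else zero)"
	unfolding xt_def by (rule ap_lam) (intro df)

definition names :: "'v => 'v => 'v => 'v => bool" where
	"names \<beta> n a x \<longleftrightarrow> x \<in> elts (Vl \<beta>) \<and> (\<forall>y\<in>elts (Vl \<beta>). ud (xt a) zero y \<in> elts (EE (Vl \<beta>) n) \<longleftrightarrow> y = x)"

lemma dfn_names [df]: "dft t ==> dft u ==> dft v ==> dft w ==> dfn (\<lambda>s. names (t s) (u s) (v s) (w s))"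
	by (rule dfn_app4[of names]) (unfold names_def, intro df)

lemma ODv_names:
	assumes b: "Ord \<beta>" and x: "ODv \<beta> x"
	shows "\<exists>n\<in>elts omega. \<exists>a\<in>elts (finseq \<beta>). names \<beta> n a x"
proof -
	obtain X s where 1: "x \<in> elts (Vl \<beta>)" "s \<in> elts (fspace omega (Vl \<beta>))"
		"\<forall>i\<in>elts omega. i \<noteq> zero --> Ord (ap s i)" "Dd (Vl \<beta>) X"
		"\<forall>y\<in>elts (Vl \<beta>). ud s zero y \<in> elts X \<longleftrightarrow> y = x" using x unfolding ODv_def by blast
	obtain n where n: "n \<in> elts omega" "X = EE (Vl \<beta>) n" using Dd_EE[OF 1(4)] by blast
	obtain k where k: "k \<in> elts omega" "\<And>s t. s \<in> elts (fspace omega (Vl \<beta>)) ==> t \<in> elts (fspace omega (Vl \<beta>)) ==>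
		 (\<And>i. i \<in> elts k ==> ap s i = ap t i) ==> (s \<in> elts X \<longleftrightarrow> t \<in> elts X)" using Dd_support[OF 1(4)] by blast
	have "\<beta> \<noteq> zero" using 1(1) unfolding elts_Vl[OF b] by auto
	then have z: "zero \<in> elts \<beta>" by (rule zero_in[OF b])
	\<comment> \<open>Entry \<open>zero\<close> of \<open>s\<close> is unrestricted and need not be an
	  ordinal; it is replaced by \<open>zero\<close>, which is harmless because variable 0 is
	  overwritten anyway.\<close>
	define a where "a = lam k (\<lambda>i. if i = zero then zero else ap s i)"
	have d: "dft (\<lambda>s'. if s' 0 = zero then zero else ap s (s' 0))" by (intro df)
	have "(if i = zero then zero else ap s i) \<in> elts \<beta>" if "i \<in> elts k" for i
		using z 1(2,3) trans_omega[OF k(1) that] Ord_in_Vl[OF b, of "ap s i"] by (auto simp: func_ap)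
	then have fa: "func a k \<beta>" unfolding a_def by (rule func_lam[OF d])
	then have a: "a \<in> elts (finseq \<beta>)" "dom a = k" using finseqI[OF k(1)] func_dom by blast+
	have xa: "func (xt a) omega (Vl \<beta>)" unfolding xt_def
	proof (rule func_lam)
		show "dft (\<lambda>s. if s 0 \<in> elts (dom a) then ap a (s 0) else zero)" by (intro df)
		fix i show "(if i \<in> elts (dom a) then ap a i else zero) \<in> elts (Vl \<beta>)"
			using func_ap[OF fa] Ord_in_Vl[OF b Ord_in[OF b]] z a(2) by auto
	qed
	have "ud (xt a) zero y \<in> elts X \<longleftrightarrow> ud s zero y \<in> elts X" if y: "y \<in> elts (Vl \<beta>)" for y
	proof (rule k(2))
		show "ud (xt a) zero y \<in> elts (fspace omega (Vl \<beta>))" "ud s zero y \<in> elts (fspace omega (Vl \<beta>))"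
			using ud_fspace[OF xa y] ud_fspace[OF _ y] 1(2) by auto
		fix i assume i: "i \<in> elts k"
		have "ap a i = (if i = zero then zero else ap s i)" unfolding a_def by (rule ap_lam[OF d i])
		then show "ap (ud (xt a) zero y) i = ap (ud s zero y) i"
			using trans_omega[OF k(1) i] i a(2) by (simp add: ap_ud ap_xt)
	qed
	then have "names \<beta> n a x" unfolding names_def using 1(1,5) n(2) by simp
	then show ?thesis using n(1) a(1) by blast
qed

text \<open>An ordinal definable element is determined by a level, the number of a definition and a
  finite sequence of ordinals. Bounding the levels by replacement gives a set of such triples, and
  each of its three factors has a choice function.\<close>

lemma CH_OD:
	assumes P: "\<And>x. x \<in> elts P ==> OD x"
	shows "CH P"
proof -
	\<comment> \<open>The least \<open>\<beta>\<close> with \<open>ODv \<beta> x\<close>, written as an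
	  intersection of ordinals. The conjunct \<open>OD x\<close> makes it empty, and hence a set, for
	  all other \<open>x\<close>.\<close>
	let ?F = "\<lambda>x. setof {\<gamma>. OD x \<and> (\<forall>\<beta>. Ord \<beta> \<and> ODv \<beta> x --> \<gamma> \<in> elts \<beta>)}"
	have least: "\<exists>\<beta>. Ord \<beta> \<and> ODv \<beta> x \<and> {\<gamma>. OD x \<and> (\<forall>\<beta>. Ord \<beta> \<and> ODv \<beta> x --> \<gamma> \<in> elts \<beta>)} = elts \<beta>" if x: "OD x" for x
	proof -
		have d: "dfn (\<lambda>s. ODv (s 0) x)" by (intro df)
		obtain \<alpha> where "Ord \<alpha>" "ODv \<alpha> x" using x OD_iff by blast
		from Ord_least[OF d this] obtain \<beta> where \<beta>: "Ord \<beta>" "ODv \<beta> x" "\<forall>c\<in>elts \<beta>. \<not> ODv c x" by blast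
		have "\<gamma> \<in> elts \<beta>'" if "Ord \<beta>'" "ODv \<beta>' x" "\<gamma> \<in> elts \<beta>" for \<beta>' \<gamma>
			using Ord_linear[OF \<beta>(1) that(1)] \<beta>(3) that Ord_trans[OF that(1)] by blast
		then have "{\<gamma>. OD x \<and> (\<forall>\<beta>. Ord \<beta> \<and> ODv \<beta> x --> \<gamma> \<in> elts \<beta>)} = elts \<beta>" using x \<beta>(1,2) by blast
		then show ?thesis using \<beta> by blast
	qed
	have iss: "isset {\<gamma>. OD x \<and> (\<forall>\<beta>. Ord \<beta> \<and> ODv \<beta> x --> \<gamma> \<in> elts \<beta>)}" for x
	proof (cases "OD x")
		case True then show ?thesis using least[OF True] unfolding isset_def by blast
	next
		case False then show ?thesis using isset_empty by simp
	qed
	have F: "dft (\<lambda>s. ?F (s 0))" by (rule dft_setof) ((intro df)[1], rule iss)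
	have Fx: "Ord (?F x)" "ODv (?F x) x" if "OD x" for x
	proof -
		obtain \<beta> where "Ord \<beta>" "ODv \<beta> x" "{\<gamma>. OD x \<and> (\<forall>\<beta>. Ord \<beta> \<and> ODv \<beta> x --> \<gamma> \<in> elts \<beta>)} = elts \<beta>"
			using least[OF \<open>OD x\<close>] by blast
		then show "Ord (?F x)" "ODv (?F x) x" by simp_all
	qed
	let ?L = "un (setof (?F ` elts P))"
	have eL: "elts (setof (?F ` elts P)) = ?F ` elts P" using isset_image[OF F] by simp
	have L: "Ord ?L" by (rule Ord_un) (use eL Fx P in auto)
	have FL: "?F x \<in> elts (sc ?L)" if x: "x \<in> elts P" for x
	proof -
		have "?F x \<in> elts (setof (?F ` elts P))" unfolding eL using x by blast
		then have "elts (?F x) \<subseteq> elts ?L" unfolding elts_un by blast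
		then have "?F x \<in> elts ?L \<or> ?F x = ?L" using Ord_subset_iff[OF Fx(1)[OF P[OF x]] L] by blast
		then show ?thesis by (simp only: elts_sc insert_iff) blast
	qed
	let ?A = "prd (sc ?L) (prd omega (finseq (sc ?L)))"
	let ?R = "\<lambda>q x. \<exists>\<beta> n a. q = pair \<beta> (pair n a) \<and> names \<beta> n a x"
	show ?thesis
	proof (rule CH_rel[of ?A ?R])
		show "CH ?A" by (intro CH_prd CH_finseq CH_Ord Ord_sc L Ord_omega)
		show "dfn (\<lambda>s. ?R (s 0) (s 1))" by (intro df)
		fix x assume x: "x \<in> elts P"
		obtain n a where 1: "n \<in> elts omega" "a \<in> elts (finseq (?F x))" "names (?F x) n a x"
			using ODv_names[OF Fx[OF P[OF x]]] by blast
		have "elts (?F x) \<subseteq> elts (sc ?L)" by (rule Ord_subset[OF Ord_sc[OF L] FL[OF x]])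
		then have "a \<in> elts (finseq (sc ?L))" using 1(2) unfolding in_finseq func_iff by blast
		then have "pair (?F x) (pair n a) \<in> elts ?A" unfolding pair_in_prd using 1(1) FL[OF x] by blast
		then show "\<exists>q\<in>elts ?A. ?R q x" using 1(3) by blast
	next
		fix q x y assume "?R q x" "?R q y"
		then show "x = y" unfolding names_def by auto
	qed
qed

end

section \<open>Ordinal definability of extended conditions\<close>

primrec mv :: "fm => nat" where
	"mv (Mem i j) = Suc (max i j)"
| "mv (Eq i j) = Suc (max i j)"
| "mv (Neg \<phi>) = mv \<phi>"
| "mv (And \<phi> \<psi>) = max (mv \<phi>) (mv \<psi>)"
| "mv (Ex i \<phi>) = max (Suc i) (mv \<phi>)"

lemma satr_cong: "(\<And>i. i < mv \<phi> ==> s i = s' i) ==> satr U E s \<phi> = satr U E s' \<phi>"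
proof (induction \<phi> arbitrary: s s')
	case (Ex i \<phi>)
	have "satr U E (s(i := x)) \<phi> = satr U E (s'(i := x)) \<phi>" for x
		by (rule Ex.IH) (use Ex.prems in simp)
	then show ?case by simp
next
	case (Neg \<phi>)
	then show ?case by (metis mv.simps(3) satr.simps(3))
next
	case (And \<phi> \<psi>)
	have "satr U E s \<phi> = satr U E s' \<phi>" "satr U E s \<psi> = satr U E s' \<psi>"
		by (rule And.IH; use And.prems in simp)+
	then show ?case by simp
qed auto

context eps_structure
begin

text \<open>Terms that may occur in formulas over a level: variables and parameters from
  \<open>K\<close>. Over a level there is no replacement, so operations are expressed by bounded
  formulas such as \<open>ispair\<close> instead of by \<open>dft\<close>.\<close>

definition dtr :: "'v set => ((nat => 'v) => 'v) => bool" where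
	"dtr K t \<longleftrightarrow> (\<exists>i. t = (\<lambda>s. s i)) \<or> (\<exists>k\<in>K. t = (\<lambda>s. k))"

lemma dtr_var: "dtr K (\<lambda>s. s i)"
	unfolding dtr_def by blast
lemma dtr_const: "k \<in> K ==> dtr K (\<lambda>s. k)"
	unfolding dtr_def by blast

lemma dfr_const: "k \<in> K ==> dfr U K (\<lambda>s. b)"
proof -
	assume k: "k \<in> K"
	have "dfr U K (\<lambda>s. s 0 = s 0)" by (rule dfr_eq_vv[OF k])
	from this dfr_neg[OF this] show ?thesis by (cases b) auto
qed

lemma dfr_mem: "k0 \<in> K ==> dtr K t ==> dtr K u ==> dfr U K (\<lambda>s. t s \<in> elts (u s))"
	unfolding dtr_def using dfr_mem_vv[of k0 K U] dfr_mem_vc[of _ K U] dfr_mem_cv[of _ K U] dfr_const[of k0 K U]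
	by auto

end

context zf
begin

lemma dft_funpow [df]: "dft t ==> dft (\<lambda>s. (sc ^^ N) (t s))"
proof (induction N)
	case (Suc N)
	show ?case unfolding funpow.simps comp_def by (rule dft_sc[OF Suc.IH[OF Suc.prems]])
qed simp

abbreviation num :: "nat => 'v" where "num n \<equiv> (sc ^^ n) zero"

lemma funpow_omega [simp]: "(sc ^^ n) k \<in> elts omega \<longleftrightarrow> k \<in> elts omega"
	by (induction n) auto
lemma funpow_inject [simp]: "(sc ^^ n) i = (sc ^^ n) j \<longleftrightarrow> i = j"
	by (induction n) auto
lemma funpow_neq: "n < N ==> (sc ^^ N) i \<noteq> num n"
	by (induction n arbitrary: N) (auto simp: gr0_conv_Suc elim: Suc_lessE)
lemma num_inject [simp]: "num m = num n \<longleftrightarrow> m = n"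
	by (metis funpow_neq linorder_neqE_nat)
lemma elts_num: "elts (num n) = num ` {..<n}"
	by (induction n) (auto simp: lessThan_Suc)

text \<open>Transfers a formula of the datatype into the structure. The renaming
  \<open>\<nu>\<close> places its variables at numbers of the structure; injectivity is required
  only on the variables that occur, in order to protect bound ones.\<close>

lemma Dd_fm:
	assumes "inj_on \<nu> {..<mv \<phi>}" "\<And>n. \<nu> n \<in> elts omega"
	shows "\<exists>X. Dd A X \<and> (\<forall>s\<in>elts (fspace omega A). s \<in> elts X \<longleftrightarrow> satr (elts A) mem (\<lambda>n. ap s (\<nu> n)) \<phi>)"
	using assms
proof (induction \<phi>)
	case (Mem i j)
	show ?case
		by (rule exI[of _ "aM A (\<nu> i) (\<nu> j)"]) (use Mem Dd_intros(1) in \<open>auto simp: elts_aM elts_def[of "ap _ _"]\<close>)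
next
	case (Eq i j)
	show ?case
		by (rule exI[of _ "aE A (\<nu> i) (\<nu> j)"]) (use Eq Dd_intros(2) in \<open>auto simp: elts_aE\<close>)
next
	case (Neg \<phi>)
	then obtain X where X: "Dd A X" "\<forall>s\<in>elts (fspace omega A). s \<in> elts X \<longleftrightarrow> satr (elts A) mem (\<lambda>n. ap s (\<nu> n)) \<phi>"
		by auto
	show ?case
		by (rule exI[of _ "cN A X"], rule conjI[OF Dd_intros(3)[OF X(1)]]) (use X(2) in \<open>simp add: elts_cN\<close>)
next
	case (And \<phi> \<psi>)
	have "inj_on \<nu> {..<mv \<phi>}" "inj_on \<nu> {..<mv \<psi>}"
		by (rule inj_on_subset[OF And.prems(1)]; auto)+
	then obtain X Y where X: "Dd A X" "\<forall>s\<in>elts (fspace omega A). s \<in> elts X \<longleftrightarrow> satr (elts A) mem (\<lambda>n. ap s (\<nu> n)) \<phi>"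
		and Y: "Dd A Y" "\<forall>s\<in>elts (fspace omega A). s \<in> elts Y \<longleftrightarrow> satr (elts A) mem (\<lambda>n. ap s (\<nu> n)) \<psi>"
		using And.IH And.prems(2) by blast
	show ?case
		by (rule exI[of _ "cI X Y"], rule conjI[OF Dd_intros(4)[OF X(1) Y(1)]]) (use X(2) Y(2) in \<open>simp add: elts_cI\<close>)
next
	case (Ex i \<phi>)
	have "inj_on \<nu> {..<mv \<phi>}" by (rule inj_on_subset[OF Ex.prems(1)]) auto
	then obtain X where X: "Dd A X" "\<forall>s\<in>elts (fspace omega A). s \<in> elts X \<longleftrightarrow> satr (elts A) mem (\<lambda>n. ap s (\<nu> n)) \<phi>"
		using Ex.IH Ex.prems(2) by blast
	have "ud s (\<nu> i) a \<in> elts X \<longleftrightarrow> satr (elts A) mem ((\<lambda>n. ap s (\<nu> n))(i := a)) \<phi>"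
		if s: "s \<in> elts (fspace omega A)" and a: "a \<in> elts A" for s a
	proof -
		have "ud s (\<nu> i) a \<in> elts X \<longleftrightarrow> satr (elts A) mem (\<lambda>n. ap (ud s (\<nu> i) a) (\<nu> n)) \<phi>"
			using X(2) ud_fspace[OF _ a] s by simp
		also have "\<dots> \<longleftrightarrow> satr (elts A) mem ((\<lambda>n. ap s (\<nu> n))(i := a)) \<phi>"
		proof (rule satr_cong)
			fix n assume "n < mv \<phi>"
			then have "\<nu> n = \<nu> i \<longleftrightarrow> n = i" using inj_on_eq_iff[OF Ex.prems(1), of n i] by simp
			then show "ap (ud s (\<nu> i) a) (\<nu> n) = ((\<lambda>n. ap s (\<nu> n))(i := a)) n"
				using Ex.prems(2)[of n] by (simp add: ap_ud)
		qed
		finally show ?thesis .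
	qed
	then show ?case
		by (intro exI[of _ "cX A (\<nu> i) X"] conjI Dd_intros(5) Ex.prems(2) X(1)) (simp add: elts_cX)
qed

definition icons :: "'v => 'v => 'v" where
	"icons c s = lam omega (\<lambda>k. if k = zero then c else ap s (un k))"
primrec consl :: "'v list => 'v => 'v" where
	"consl [] s = s"
| "consl (c # cs) s = icons c (consl cs s)"

lemma icons_d: "dft (\<lambda>s'. if s' 0 = zero then c else ap s (un (s' 0)))" by (intro df)
lemma icons: "ap (icons c s) zero = c" "k \<in> elts omega ==> ap (icons c s) (sc k) = ap s k"
	unfolding icons_def by (simp_all add: ap_lam[OF icons_d] un_sc Ord_nat)

lemma icons_func: "func s omega A ==> c \<in> elts A ==> func (icons c s) omega A"
	unfolding icons_def
	by (rule func_lam[OF icons_d]) (use nat_cases in \<open>fastforce simp: func_ap un_sc Ord_nat\<close>)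

lemma consl_func: "func s omega A ==> set cs \<subseteq> elts A ==> func (consl cs s) omega A"
	by (induction cs) (auto intro: icons_func)

lemma consl_nth: "n < length cs ==> ap (consl cs s) (num n) = cs ! n"
	by (induction cs arbitrary: n) (auto simp: icons less_Suc_eq_0_disj)
lemma consl_add: "k \<in> elts omega ==> ap (consl cs s) ((sc ^^ length cs) k) = ap s k"
	by (induction cs) (simp_all add: icons)

lemma omega_split: "i \<in> elts omega ==> i \<in> elts (num N) \<or> (\<exists>k\<in>elts omega. i = (sc ^^ N) k)"
proof (induction N)
	case (Suc N)
	then consider "i \<in> elts (num N)" | k where "k \<in> elts omega" "i = (sc ^^ N) k" by blast
	then show ?case
	proof cases
		case (2 k)
		from nat_cases[OF 2(1)] show ?thesis
		proof
			assume "k = zero" then show ?thesis using 2(2) by simp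
		next
			assume "\<exists>m\<in>elts omega. k = sc m"
			then obtain m where "m \<in> elts omega" "k = sc m" by blast
			have "i = (sc ^^ Suc N) m" using 2(2) \<open>k = sc m\<close> funpow_swap1[of sc N m] by simp
			then show ?thesis using \<open>m \<in> elts omega\<close> by blast
		qed
	qed simp
qed simp

text \<open>The first \<open>N\<close> variables are reserved for parameters; the others are those of \<open>X\<close>.\<close>

lemma Dd_relativize:
	assumes X: "Dd A X" and A: "elts A \<subseteq> elts A'"
		and c: "\<And>k. k \<in> elts omega ==> \<exists>Y. Dd A' Y \<and> (\<forall>u\<in>elts (fspace omega A').
			 (\<forall>j\<in>elts (num N). j \<noteq> zero --> j \<noteq> one --> ap u j = ap c0 j) -->
			 (u \<in> elts Y \<longleftrightarrow> ap u ((sc ^^ N) k) \<in> elts A))"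
	shows "\<exists>Y. Dd A' Y \<and> (\<forall>u\<in>elts (fspace omega A').
			 (\<forall>j\<in>elts (num N). j \<noteq> zero --> j \<noteq> one --> ap u j = ap c0 j) -->
			 (\<forall>k\<in>elts omega. ap u ((sc ^^ N) k) \<in> elts A) -->
			 (u \<in> elts Y \<longleftrightarrow> lam omega (\<lambda>k. ap u ((sc ^^ N) k)) \<in> elts X))"
	using X
proof (induction rule: Dd_induct)
	case dfn show ?case by (intro df)
next
	case (Mem i j)
	have d: "dft (\<lambda>s. ap u ((sc ^^ N) (s 0)))" for u by (intro df)
	show ?case
	proof (intro exI[of _ "aM A' ((sc ^^ N) i) ((sc ^^ N) j)"] conjI ballI impI)
		show "Dd A' (aM A' ((sc ^^ N) i) ((sc ^^ N) j))" using Mem by (intro Dd_intros) simp_all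
		fix u assume u: "u \<in> elts (fspace omega A')" "\<forall>k\<in>elts omega. ap u ((sc ^^ N) k) \<in> elts A"
		then have "func (lam omega (\<lambda>k. ap u ((sc ^^ N) k))) omega A" by (intro func_lam d) blast
		then show "u \<in> elts (aM A' ((sc ^^ N) i) ((sc ^^ N) j)) \<longleftrightarrow> lam omega (\<lambda>k. ap u ((sc ^^ N) k)) \<in> elts (aM A i j)"
			using Mem u(1) by (simp add: elts_aM ap_lam[OF d])
	qed
next
	case (Eq i j)
	have d: "dft (\<lambda>s. ap u ((sc ^^ N) (s 0)))" for u by (intro df)
	show ?case
	proof (intro exI[of _ "aE A' ((sc ^^ N) i) ((sc ^^ N) j)"] conjI ballI impI)
		show "Dd A' (aE A' ((sc ^^ N) i) ((sc ^^ N) j))" using Eq by (intro Dd_intros) simp_all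
		fix u assume u: "u \<in> elts (fspace omega A')" "\<forall>k\<in>elts omega. ap u ((sc ^^ N) k) \<in> elts A"
		then have "func (lam omega (\<lambda>k. ap u ((sc ^^ N) k))) omega A" by (intro func_lam d) blast
		then show "u \<in> elts (aE A' ((sc ^^ N) i) ((sc ^^ N) j)) \<longleftrightarrow> lam omega (\<lambda>k. ap u ((sc ^^ N) k)) \<in> elts (aE A i j)"
			using Eq u(1) by (simp add: elts_aE ap_lam[OF d])
	qed
next
	case (Neg X)
	have d: "dft (\<lambda>s. ap u ((sc ^^ N) (s 0)))" for u by (intro df)
	obtain Y where Y: "Dd A' Y" "\<And>u. u \<in> elts (fspace omega A') ==>
			 (\<forall>j\<in>elts (num N). j \<noteq> zero --> j \<noteq> one --> ap u j = ap c0 j) ==>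
			 (\<forall>k\<in>elts omega. ap u ((sc ^^ N) k) \<in> elts A) ==>
			 (u \<in> elts Y \<longleftrightarrow> lam omega (\<lambda>k. ap u ((sc ^^ N) k)) \<in> elts X)" using Neg by blast
	show ?case
	proof (intro exI[of _ "cN A' Y"] conjI ballI impI Dd_intros Y(1))
		fix u assume u: "u \<in> elts (fspace omega A')" "\<forall>j\<in>elts (num N). j \<noteq> zero --> j \<noteq> one --> ap u j = ap c0 j"
			"\<forall>k\<in>elts omega. ap u ((sc ^^ N) k) \<in> elts A"
		then have "func (lam omega (\<lambda>k. ap u ((sc ^^ N) k))) omega A" by (intro func_lam d) blast
		then show "u \<in> elts (cN A' Y) \<longleftrightarrow> lam omega (\<lambda>k. ap u ((sc ^^ N) k)) \<in> elts (cN A X)"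
			using Y(2)[OF u] u(1) by (simp add: elts_cN)
	qed
next
	case (And X1 X2)
	obtain Y1 where Y1: "Dd A' Y1" "\<And>u. u \<in> elts (fspace omega A') ==>
			 (\<forall>j\<in>elts (num N). j \<noteq> zero --> j \<noteq> one --> ap u j = ap c0 j) ==>
			 (\<forall>k\<in>elts omega. ap u ((sc ^^ N) k) \<in> elts A) ==>
			 (u \<in> elts Y1 \<longleftrightarrow> lam omega (\<lambda>k. ap u ((sc ^^ N) k)) \<in> elts X1)" using And(1) by blast
	obtain Y2 where Y2: "Dd A' Y2" "\<And>u. u \<in> elts (fspace omega A') ==>
			 (\<forall>j\<in>elts (num N). j \<noteq> zero --> j \<noteq> one --> ap u j = ap c0 j) ==>
			 (\<forall>k\<in>elts omega. ap u ((sc ^^ N) k) \<in> elts A) ==>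
			 (u \<in> elts Y2 \<longleftrightarrow> lam omega (\<lambda>k. ap u ((sc ^^ N) k)) \<in> elts X2)" using And(2) by blast
	show ?case
		by (intro exI[of _ "cI Y1 Y2"] conjI ballI impI Dd_intros Y1(1) Y2(1)) (simp only: elts_cI Int_iff Y1(2) Y2(2))
next
	case (Ex i X)
	have d: "dft (\<lambda>s. ap u ((sc ^^ N) (s 0)))" for u by (intro df)
	obtain Y where Y: "Dd A' Y" "\<And>u. u \<in> elts (fspace omega A') ==>
			 (\<forall>j\<in>elts (num N). j \<noteq> zero --> j \<noteq> one --> ap u j = ap c0 j) ==>
			 (\<forall>k\<in>elts omega. ap u ((sc ^^ N) k) \<in> elts A) ==>
			 (u \<in> elts Y \<longleftrightarrow> lam omega (\<lambda>k. ap u ((sc ^^ N) k)) \<in> elts X)" using Ex by blast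
	obtain Z where Z: "Dd A' Z" "\<And>u. u \<in> elts (fspace omega A') ==>
			 (\<forall>j\<in>elts (num N). j \<noteq> zero --> j \<noteq> one --> ap u j = ap c0 j) ==>
			 (u \<in> elts Z \<longleftrightarrow> ap u ((sc ^^ N) i) \<in> elts A)" using c[OF Ex(1)] by blast
	have iw: "(sc ^^ N) i \<in> elts omega" using Ex(1) by simp
	show ?case
	\<comment> \<open>The conjunct \<open>Z\<close> bounds the quantifier by \<open>A\<close>.\<close>
	proof (intro exI[of _ "cX A' ((sc ^^ N) i) (cI Y Z)"] conjI ballI impI)
		show "Dd A' (cX A' ((sc ^^ N) i) (cI Y Z))" using iw Y(1) Z(1) by (intro Dd_intros)
		fix u assume u: "u \<in> elts (fspace omega A')" "\<forall>j\<in>elts (num N). j \<noteq> zero --> j \<noteq> one --> ap u j = ap c0 j"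
			"\<forall>k\<in>elts omega. ap u ((sc ^^ N) k) \<in> elts A"
		have *: "ud u ((sc ^^ N) i) a \<in> elts (cI Y Z) \<longleftrightarrow> a \<in> elts A \<and> ud (lam omega (\<lambda>k. ap u ((sc ^^ N) k))) i a \<in> elts X"
			if a: "a \<in> elts A'" for a
		proof -
			let ?u = "ud u ((sc ^^ N) i) a"
			have u': "?u \<in> elts (fspace omega A')" using ud_fspace[OF _ a] u(1) by simp
			have ap: "ap ?u k = (if k = (sc ^^ N) i then a else ap u k)" if "k \<in> elts omega" for k
				by (rule ap_ud[OF that])
			have c': "\<forall>j\<in>elts (num N). j \<noteq> zero --> j \<noteq> one --> ap ?u j = ap c0 j"
			proof (intro ballI impI)
				fix j assume j: "j \<in> elts (num N)" "j \<noteq> zero" "j \<noteq> one"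
				then obtain n where n: "n < N" "j = num n" unfolding elts_num by blast
				have "j \<in> elts omega" using n by simp
				then show "ap ?u j = ap c0 j" using ap u(2) j funpow_neq[OF n(1), of i] n(2) by simp
			qed
			have ai: "ap ?u ((sc ^^ N) k) = (if k = i then a else ap u ((sc ^^ N) k))" if "k \<in> elts omega" for k
				using ap[of "(sc ^^ N) k"] that by simp
			have z: "?u \<in> elts Z \<longleftrightarrow> a \<in> elts A" using Z(2)[OF u' c'] ai[OF Ex(1)] by simp
			have "?u \<in> elts Y \<longleftrightarrow> ud (lam omega (\<lambda>k. ap u ((sc ^^ N) k))) i a \<in> elts X" if "a \<in> elts A"
			proof -
				have "\<forall>k\<in>elts omega. ap ?u ((sc ^^ N) k) \<in> elts A" using ai u(3) that by simp
				moreover have "lam omega (\<lambda>k. ap ?u ((sc ^^ N) k)) = ud (lam omega (\<lambda>k. ap u ((sc ^^ N) k))) i a"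
					unfolding ud_def[of "lam omega (\<lambda>k. ap u ((sc ^^ N) k))"]
					by (rule lam_cong) (simp add: ai ap_lam[OF d])
				ultimately show ?thesis using Y(2)[OF u' c'] by simp
			qed
			then show ?thesis using z by (auto simp: elts_cI)
		qed
		have "func (lam omega (\<lambda>k. ap u ((sc ^^ N) k))) omega A" using u(3) by (intro func_lam d) blast
		then show "u \<in> elts (cX A' ((sc ^^ N) i) (cI Y Z)) \<longleftrightarrow> lam omega (\<lambda>k. ap u ((sc ^^ N) k)) \<in> elts (cX A i X)"
			using u(1) A * by (auto simp: elts_cX)
	qed
qed

lemma Vl_super: "Ord a ==> x \<in> elts (Vl a) ==> elts y \<subseteq> elts x ==> y \<in> elts (Vl a)"
	unfolding elts_Vl by blast

text \<open>\<open>V\<^sub>\<beta>\<close> is characterized in larger levels as the level of height \<open>\<beta>\<close> that belongs to some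
	set \<open>c\<close> of levels; the condition on \<open>c\<close> forces each of its members to be a level.\<close>

lemma level_set:
	assumes b': "Ord \<beta>'" and c: "c \<in> elts (Vl \<beta>')"
		and lev: "\<forall>u\<in>elts (Vl \<beta>'). u \<in> elts c --> (\<forall>x\<in>elts (Vl \<beta>'). x \<in> elts u \<longleftrightarrow>
			 (\<exists>w\<in>elts (Vl \<beta>'). w \<in> elts c \<and> w \<in> elts u \<and> (\<forall>t\<in>elts (Vl \<beta>'). t \<in> elts x --> t \<in> elts w)))"
		and u: "u \<in> elts c"
	shows "\<exists>\<alpha>. Ord \<alpha> \<and> u = Vl \<alpha>"
proof -
	have "u \<in> elts c --> (\<exists>\<alpha>. Ord \<alpha> \<and> u = Vl \<alpha>)"
	proof (rule eps_induct[of _ u])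
		show "dfn (\<lambda>s. s 0 \<in> elts c --> (\<exists>\<alpha>. Ord \<alpha> \<and> s 0 = Vl \<alpha>))" by (intro df)
		fix u assume IH: "\<And>w. w \<in> elts u ==> w \<in> elts c --> (\<exists>\<alpha>. Ord \<alpha> \<and> w = Vl \<alpha>)"
		show "u \<in> elts c --> (\<exists>\<alpha>. Ord \<alpha> \<and> u = Vl \<alpha>)"
		proof
			assume uc: "u \<in> elts c"
			note tr = Vl_trans[OF b']
			have uU: "u \<in> elts (Vl \<beta>')" using tr[OF c uc] .
			have mem: "x \<in> elts u \<longleftrightarrow> (\<exists>w. w \<in> elts c \<and> w \<in> elts u \<and> elts x \<subseteq> elts w)" for x
			proof
				assume x: "x \<in> elts u"
				have xU: "x \<in> elts (Vl \<beta>')" using tr[OF uU x] .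
				then obtain w where w: "w \<in> elts c" "w \<in> elts u" "\<forall>t\<in>elts (Vl \<beta>'). t \<in> elts x --> t \<in> elts w"
					using lev uU uc x by blast
				have "elts x \<subseteq> elts w" using w(3) tr[OF xU] by blast
				then show "\<exists>w. w \<in> elts c \<and> w \<in> elts u \<and> elts x \<subseteq> elts w" using w by blast
			next
				assume "\<exists>w. w \<in> elts c \<and> w \<in> elts u \<and> elts x \<subseteq> elts w"
				then obtain w where w: "w \<in> elts c" "w \<in> elts u" "elts x \<subseteq> elts w" by blast
				have wU: "w \<in> elts (Vl \<beta>')" using tr[OF c w(1)] .
				have "x \<in> elts (Vl \<beta>')" by (rule Vl_super[OF b' wU w(3)])
				then show "x \<in> elts u" using lev uU uc w wU by blast
			qed
			have lw: "\<exists>\<alpha>. Ord \<alpha> \<and> w = Vl \<alpha>" if "w \<in> elts c" "w \<in> elts u" for w using IH that by blast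
			have utr: "y \<in> elts u" if x: "x \<in> elts u" and y: "y \<in> elts x" for x y
			proof -
				obtain w where w: "w \<in> elts c" "w \<in> elts u" "elts x \<subseteq> elts w" using x mem by blast
				obtain \<alpha> where a: "Ord \<alpha>" "w = Vl \<alpha>" using lw[OF w(1,2)] by blast
				have "elts y \<subseteq> elts w" using w(3) y Vl_trans[OF a(1)] a(2) by blast
				then show ?thesis using mem w by blast
			qed
			define \<alpha> where "\<alpha> = setof {o' \<in> elts u. Ord o'}"
			have ea: "elts \<alpha> = {o' \<in> elts u. Ord o'}" unfolding \<alpha>_def by (rule sepI) (intro df)
			have oa: "Ord \<alpha>"
			proof -
				have "elts x \<subseteq> elts \<alpha>" if "x \<in> elts \<alpha>" for x
					using that utr Ord_in unfolding ea by blast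
				moreover have "transitive x" if "x \<in> elts \<alpha>" for x using that unfolding ea Ord_def by blast
				ultimately show ?thesis unfolding Ord_def transitive_def by blast
			qed
			have "elts u = elts (Vl \<alpha>)"
			proof (intro equalityI subsetI)
				fix x assume "x \<in> elts u"
				then obtain w where w: "w \<in> elts c" "w \<in> elts u" "elts x \<subseteq> elts w" using mem by blast
				obtain \<gamma> where g: "Ord \<gamma>" "w = Vl \<gamma>" using lw[OF w(1,2)] by blast
				have "elts \<gamma> \<subseteq> elts w" using g Ord_in_Vl[OF g(1)] Ord_in[OF g(1)] by blast
				then have "\<gamma> \<in> elts \<alpha>" unfolding ea using mem w g(1) by blast
				then show "x \<in> elts (Vl \<alpha>)" unfolding elts_Vl[OF oa] using w(3) g(2) by blast
			next
				fix x assume "x \<in> elts (Vl \<alpha>)"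
				then obtain \<gamma> where g: "\<gamma> \<in> elts \<alpha>" "elts x \<subseteq> elts (Vl \<gamma>)" unfolding elts_Vl[OF oa] by blast
				then have g': "\<gamma> \<in> elts u" "Ord \<gamma>" unfolding ea by auto
				obtain w where w: "w \<in> elts c" "w \<in> elts u" "elts \<gamma> \<subseteq> elts w" using mem g'(1) by blast
				obtain \<delta> where d: "Ord \<delta>" "w = Vl \<delta>" using lw[OF w(1,2)] by blast
				have "elts \<gamma> \<subseteq> elts \<delta>" using w(3) d Ord_in_Vl[OF d(1)] Ord_in[OF g'(2)] by blast
				then have "elts x \<subseteq> elts w" using g(2) Vl_mono[OF d(1) g'(2)] d(2) by blast
				then show "x \<in> elts u" using mem w by blast
			qed
			then have "u = Vl \<alpha>" by (rule elts_inject)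
			then show "\<exists>\<alpha>. Ord \<alpha> \<and> u = Vl \<alpha>" using oa by blast
		qed
	qed
	then show ?thesis using u by blast
qed

lemma Vl_height:
	assumes "Ord \<alpha>" "Ord \<beta>" "\<beta> \<notin> elts (Vl \<alpha>)" "elts \<beta> \<subseteq> elts (Vl \<alpha>)" shows "\<alpha> = \<beta>"
proof -
	have "elts \<beta> \<subseteq> elts \<alpha>" using assms(4) Ord_in_Vl[OF assms(1)] Ord_in[OF assms(2)] by blast
	moreover have "\<beta> \<notin> elts \<alpha>" using assms(3) Ord_in_Vl[OF assms(1,2)] by blast
	ultimately show ?thesis using Ord_subset_iff[OF assms(2,1)] by blast
qed

definition levelp :: "'v => 'v => 'v => bool" where
	"levelp U \<beta> x \<longleftrightarrow> (\<exists>c\<in>elts U. \<exists>z\<in>elts U. z \<in> elts c \<and>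
		 (\<forall>u\<in>elts U. u \<in> elts c --> (\<forall>x\<in>elts U. x \<in> elts u \<longleftrightarrow>
			 (\<exists>w\<in>elts U. w \<in> elts c \<and> w \<in> elts u \<and> (\<forall>t\<in>elts U. t \<in> elts x --> t \<in> elts w)))) \<and>
		 \<beta> \<notin> elts z \<and> (\<forall>y\<in>elts U. y \<in> elts \<beta> --> y \<in> elts z) \<and> x \<in> elts z)"

lemma levelp_iff:
	assumes b: "Ord \<beta>" and b': "Ord \<beta>'" and bb: "sc \<beta> \<in> elts \<beta>'"
	shows "levelp (Vl \<beta>') \<beta> x \<longleftrightarrow> x \<in> elts (Vl \<beta>)"
proof
	have bin: "\<beta> \<in> elts \<beta>'" using Ord_trans[OF b' bb] by simp
	have sub: "elts \<beta> \<subseteq> elts (Vl \<beta>')"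
		using Ord_trans[OF b' bin] Ord_in_Vl[OF b'] Ord_in[OF b] by blast
	{
		assume "levelp (Vl \<beta>') \<beta> x"
		then obtain c z where c: "c \<in> elts (Vl \<beta>')" "z \<in> elts c"
			"\<forall>u\<in>elts (Vl \<beta>'). u \<in> elts c --> (\<forall>x\<in>elts (Vl \<beta>'). x \<in> elts u \<longleftrightarrow>
			 (\<exists>w\<in>elts (Vl \<beta>'). w \<in> elts c \<and> w \<in> elts u \<and> (\<forall>t\<in>elts (Vl \<beta>'). t \<in> elts x --> t \<in> elts w)))"
			"\<beta> \<notin> elts z" "\<forall>y\<in>elts (Vl \<beta>'). y \<in> elts \<beta> --> y \<in> elts z" "x \<in> elts z"
			unfolding levelp_def by blast
		obtain \<alpha> where a: "Ord \<alpha>" "z = Vl \<alpha>" using level_set[OF b' c(1,3,2)] by blast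
		have "\<alpha> = \<beta>" by (rule Vl_height[OF a(1) b]) (use c(4,5) sub a(2) in auto)
		then show "x \<in> elts (Vl \<beta>)" using a c(6) by simp
	}
	assume x: "x \<in> elts (Vl \<beta>)"
	have d: "dft (\<lambda>s. Vl (s 0))" by (intro df)
	\<comment> \<open>All levels up to \<open>Vl \<beta>\<close>. This set is a subset of
	  \<open>Vl (sc \<beta>)\<close>, and it is an element of \<open>Vl \<beta>'\<close> because
	  \<open>sc \<beta> \<in> elts \<beta>'\<close>.\<close>
	define c where "c = setof (Vl ` elts (sc \<beta>))"
	have ec: "elts c = Vl ` elts (sc \<beta>)" unfolding c_def by (rule elts_setof[OF isset_image[OF d]])
	have "elts c \<subseteq> elts (Vl (sc \<beta>))" unfolding ec using Vl_mem[OF Ord_sc[OF b]] by blast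
	then have cU: "c \<in> elts (Vl \<beta>')" unfolding elts_Vl[OF b'] using bb by blast
	have zU: "Vl \<beta> \<in> elts (Vl \<beta>')" by (rule Vl_mem[OF b' bin])
	have z: "Vl \<beta> \<in> elts c" unfolding ec by simp
	have lev: "x \<in> elts u \<longleftrightarrow>
			 (\<exists>w\<in>elts (Vl \<beta>'). w \<in> elts c \<and> w \<in> elts u \<and> (\<forall>t\<in>elts (Vl \<beta>'). t \<in> elts x --> t \<in> elts w))"
		if xU: "x \<in> elts (Vl \<beta>')" and uc: "u \<in> elts c" for x u
	proof -
		obtain \<alpha> where a: "\<alpha> \<in> elts (sc \<beta>)" "u = Vl \<alpha>" using uc unfolding ec by blast
		have oa: "Ord \<alpha>" by (rule Ord_in[OF Ord_sc[OF b] a(1)])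
		show ?thesis
		proof
			assume "x \<in> elts u"
			then obtain \<gamma> where g: "\<gamma> \<in> elts \<alpha>" "elts x \<subseteq> elts (Vl \<gamma>)" unfolding a(2) elts_Vl[OF oa] by blast
			have "\<gamma> \<in> elts (sc \<beta>)" using Ord_trans[OF Ord_sc[OF b] a(1) g(1)] .
			then have "Vl \<gamma> \<in> elts c" unfolding ec by blast
			moreover have "Vl \<gamma> \<in> elts u" unfolding a(2) by (rule Vl_mem[OF oa g(1)])
			ultimately show "\<exists>w\<in>elts (Vl \<beta>'). w \<in> elts c \<and> w \<in> elts u \<and> (\<forall>t\<in>elts (Vl \<beta>'). t \<in> elts x --> t \<in> elts w)"
				using g(2) Vl_trans[OF b' cU] by blast
		next
			assume "\<exists>w\<in>elts (Vl \<beta>'). w \<in> elts c \<and> w \<in> elts u \<and> (\<forall>t\<in>elts (Vl \<beta>'). t \<in> elts x --> t \<in> elts w)"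
			then obtain w where w: "w \<in> elts u" "\<forall>t\<in>elts (Vl \<beta>'). t \<in> elts x --> t \<in> elts w" by blast
			have "elts x \<subseteq> elts w" using w(2) Vl_trans[OF b' xU] by blast
			then show "x \<in> elts u" using Vl_super[OF oa] w(1) a(2) by blast
		qed
	qed
	show "levelp (Vl \<beta>') \<beta> x" unfolding levelp_def
	proof (rule bexI[OF _ cU], rule bexI[OF _ zU], intro conjI z x ballI impI)
		show "\<beta> \<notin> elts (Vl \<beta>)" using Ord_in_Vl[OF b b] by simp
		show "y \<in> elts (Vl \<beta>)" if "y \<in> elts \<beta>" for y using Ord_in_Vl[OF b Ord_in[OF b that]] that by simp
	qed (rule lev)
qed

lemma dfr_levelp:
	assumes "\<beta> \<in> K" shows "dfr (elts U) K (\<lambda>s. levelp U \<beta> (s 0))"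
	unfolding levelp_def
	by (intro dfr_ex dfr_all dfr_conj dfr_imp dfr_iff dfr_neg dfr_mem[OF assms] dtr_var dtr_const[OF assms])

text \<open>\<open>y0\<close> is defined in the larger level by saying that some \<open>p\<close> in
  \<open>Vl \<beta>\<close> satisfies there the definition of \<open>p\<close>, relativized by means
  of \<open>levelp\<close>, and that \<open>Q\<close> holds of \<open>y0\<close> and this
  \<open>p\<close>. The definition of \<open>p\<close> may be a nonstandard formula, whereas
  \<open>Q\<close> is a formula of the datatype.\<close>

lemma OD_definable:
	assumes b: "Ord \<beta>" and p: "ODv \<beta> p" and b': "Ord \<beta>'" and bb: "sc \<beta> \<in> elts \<beta>'"
		and y0: "y0 \<in> elts (Vl \<beta>')"
		and Q: "dfr (elts (Vl \<beta>')) {x \<in> elts (Vl \<beta>'). Ord x} (\<lambda>s. Q (s 0) (s 1))"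
		and uniq: "\<And>y. y \<in> elts (Vl \<beta>') ==> Q y p \<longleftrightarrow> y = y0"
	shows "OD y0"
proof -
	let ?A = "Vl \<beta>" and ?A' = "Vl \<beta>'"
	let ?K = "{x \<in> elts ?A'. Ord x}"
	have bin: "\<beta> \<in> elts \<beta>'" using Ord_trans[OF b' bb] by simp
	have bK: "\<beta> \<in> ?K" using bin Ord_in_Vl[OF b' b] b by simp
	have AA: "elts ?A \<subseteq> elts ?A'" by (rule Vl_mono[OF b' b Ord_subset[OF b' bin]])
	obtain X s where X: "p \<in> elts ?A" "s \<in> elts (fspace omega ?A)"
		"\<forall>i\<in>elts omega. i \<noteq> zero --> Ord (ap s i)" "Dd ?A X"
		"\<forall>y\<in>elts ?A. ud s zero y \<in> elts X \<longleftrightarrow> y = p" using p unfolding ODv_def by blast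
	have "\<beta> \<noteq> zero" using X(1) unfolding elts_Vl[OF b] by auto
	then have zA: "zero \<in> elts ?A" using zero_in[OF b] Ord_in_Vl[OF b Ord_zero] by blast
	\<comment> \<open>All entries become ordinals, including entry \<open>zero\<close>, since after the
	  shift by \<open>N\<close> this entry is no longer the distinguished variable.\<close>
	define s' where "s' = ud s zero zero"
	have s': "func s' omega ?A" "\<And>i. i \<in> elts omega ==> Ord (ap s' i)"
		"\<And>y. ud s' zero y = ud s zero y"
	proof -
		show "func s' omega ?A" unfolding s'_def using ud_fspace[OF _ zA] X(2) by simp
		show "Ord (ap s' i)" if "i \<in> elts omega" for i unfolding s'_def using X(3) that by (simp add: ap_ud)
		show "ud s' zero y = ud s zero y" for y
			unfolding ud_def[of s'] ud_def[of s zero y] by (rule lam_cong) (simp add: s'_def ap_ud)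
	qed
	obtain \<phi>1 c1 where f1: "range c1 \<subseteq> ?K" "\<And>s. range s \<subseteq> elts ?A' ==> levelp ?A' \<beta> (s 0) = satr (elts ?A') mem (mrg c1 s) \<phi>1"
		using dfr_levelp[OF bK, of ?A'] unfolding dfr_def by metis
	obtain \<phi>2 c2 where f2: "range c2 \<subseteq> ?K" "\<And>s. range s \<subseteq> elts ?A' ==> Q (s 0) (s 1) = satr (elts ?A') mem (mrg c2 s) \<phi>2"
		using Q unfolding dfr_def by metis
	let ?d = "\<lambda>_::nat. \<beta>"
	define M where "M = max (mv \<phi>1) (mv \<phi>2)"
	\<comment> \<open>Layout of the variables: 0 holds \<open>y\<close>, 1 holds \<open>p\<close>, 2n +
	  4 and 2n + 5 hold the variable n of \<open>\<phi>1\<close> and \<open>\<phi>2\<close>, and those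
	  of the definition of \<open>p\<close> start at \<open>N\<close>.\<close>
	define N where "N = 2 * M + 6"
	define cs where "cs = map (\<lambda>j. if even j then mrg c1 ?d ((j - 4) div 2) else mrg c2 ?d ((j - 5) div 2)) [0..<N]"
	have cs: "length cs = N" "set cs \<subseteq> ?K"
	proof -
		show "length cs = N" unfolding cs_def by simp
		have "range ?d \<subseteq> ?K" using bK by auto
		then show "set cs \<subseteq> ?K" unfolding cs_def using range_mrg[OF f1(1)] range_mrg[OF f2(1)] by auto
	qed
	define c0 where "c0 = consl cs s'"
	have c0: "func c0 omega ?A'"
		unfolding c0_def by (rule consl_func) (use s'(1) AA cs(2) in \<open>auto simp: func_iff\<close>)
	have c0r: "ap c0 ((sc ^^ N) k) = ap s' k" if "k \<in> elts omega" for k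
		using consl_add[OF that, of cs s'] cs(1) unfolding c0_def by simp
	have c0n: "ap c0 (num n) = cs ! n" if "n < N" for n
		using consl_nth[of n cs s'] that cs(1) unfolding c0_def by simp
	have c0O: "Ord (ap c0 i)" if "i \<in> elts omega" for i
		using omega_split[OF that, of N]
	proof
		assume "i \<in> elts (num N)"
		then obtain n where n: "n < N" "i = num n" unfolding elts_num by blast
		then have "ap c0 i \<in> set cs" using c0n cs(1) by simp
		then show ?thesis using cs(2) by blast
	next
		assume "\<exists>k\<in>elts omega. i = (sc ^^ N) k"
		then show ?thesis using c0r s'(2) by auto
	qed
	let ?cond = "\<lambda>u. \<forall>j\<in>elts (num N). j \<noteq> zero --> j \<noteq> one --> ap u j = ap c0 j"
	have cond: "ap u (num n) = cs ! n" if "?cond u" "n < N" "2 \<le> n" for u n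
	proof -
		have "num n \<noteq> num 0" "num n \<noteq> num 1" using that(3) by (simp_all only: num_inject)
		then have "num n \<noteq> zero" "num n \<noteq> one" by (simp_all add: one_def)
		moreover have "num n \<in> elts (num N)" unfolding elts_num using that(2) by blast
		ultimately show ?thesis using that(1) c0n[OF that(2)] by simp
	qed
	have par: "2 * n + 4 < N" "2 * n + 5 < N" if "n < mv \<phi>1 \<or> n < mv \<phi>2" for n
		using that unfolding N_def M_def by auto
	have cs_nth: "cs ! (2 * n + 4) = mrg c1 ?d n" "cs ! (2 * n + 5) = mrg c2 ?d n" if "n < mv \<phi>1 \<or> n < mv \<phi>2" for n
		using par[OF that] unfolding cs_def by simp_all
	have inA: "\<exists>Y. Dd ?A' Y \<and> (\<forall>u\<in>elts (fspace omega ?A'). ?cond u --> (u \<in> elts Y \<longleftrightarrow> ap u ((sc ^^ N) k) \<in> elts ?A))"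
		if k: "k \<in> elts omega" for k
	proof -
		let ?\<nu> = "\<lambda>n. if n = 1 then (sc ^^ N) k else if n < mv \<phi>1 then num (2 * n + 4) else zero"
		have "inj_on ?\<nu> {..<mv \<phi>1}"
		proof (rule inj_onI)
			fix a b assume ab: "a \<in> {..<mv \<phi>1}" "b \<in> {..<mv \<phi>1}" "?\<nu> a = ?\<nu> b"
			have ne: "(sc ^^ N) k \<noteq> num (2 * n + 4)" "num (2 * n + 4) \<noteq> (sc ^^ N) k" if "n < mv \<phi>1" for n
				using funpow_neq[OF par(1)] that by metis+
			show "a = b" using ab ne num_inject[of "2 * a + 4" "2 * b + 4"] by (auto simp del: funpow.simps split: if_splits)
		qed
		moreover have "?\<nu> n \<in> elts omega" for n using k by (simp del: funpow.simps)
		ultimately obtain Y where Y: "Dd ?A' Y" "\<And>u. u \<in> elts (fspace omega ?A') ==>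
				u \<in> elts Y \<longleftrightarrow> satr (elts ?A') mem (\<lambda>n. ap u (?\<nu> n)) \<phi>1"
			using Dd_fm[of ?\<nu> \<phi>1 ?A'] by blast
		have "u \<in> elts Y \<longleftrightarrow> ap u ((sc ^^ N) k) \<in> elts ?A" if u: "u \<in> elts (fspace omega ?A')" "?cond u" for u
		proof -
			let ?s = "case_nat (ap u ((sc ^^ N) k)) ?d"
			have uk: "ap u ((sc ^^ N) k) \<in> elts ?A'" using u(1) k by (auto simp: func_ap)
			then have rs: "range ?s \<subseteq> elts ?A'" using bK by (auto simp: image_subset_iff split: nat.splits)
			have "satr (elts ?A') mem (\<lambda>n. ap u (?\<nu> n)) \<phi>1 = satr (elts ?A') mem (mrg c1 ?s) \<phi>1"
			proof (rule satr_cong)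
				fix n assume n: "n < mv \<phi>1"
				show "ap u (?\<nu> n) = mrg c1 ?s n"
				proof (cases "n = 1")
					case True then show ?thesis by (simp add: mrg_def)
				next
					case False
					have "ap u (?\<nu> n) = mrg c1 ?d n"
						using cond[OF u(2) par(1)[of n]] cs_nth(1)[of n] n False by (simp del: funpow.simps)
					also have "\<dots> = mrg c1 ?s n"
					proof -
						have "n div 2 \<noteq> 0" if "odd n" using that False by presburger
						then show ?thesis by (auto simp: mrg_def split: nat.splits)
					qed
					finally show ?thesis .
				qed
			qed
			also have "\<dots> = levelp ?A' \<beta> (ap u ((sc ^^ N) k))" using f1(2)[OF rs] by simp
			also have "\<dots> \<longleftrightarrow> ap u ((sc ^^ N) k) \<in> elts ?A" by (rule levelp_iff[OF b b' bb])
			finally show ?thesis using Y(2)[OF u(1)] by simp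
		qed
		then show ?thesis using Y(1) by blast
	qed
	obtain XX where XX: "Dd ?A' XX" "\<And>u. u \<in> elts (fspace omega ?A') ==> ?cond u ==>
			(\<forall>k\<in>elts omega. ap u ((sc ^^ N) k) \<in> elts ?A) ==>
			(u \<in> elts XX \<longleftrightarrow> lam omega (\<lambda>k. ap u ((sc ^^ N) k)) \<in> elts X)"
		using Dd_relativize[OF X(4) AA inA] by blast
	obtain IN0 where IN0: "Dd ?A' IN0" "\<And>u. u \<in> elts (fspace omega ?A') ==> ?cond u ==>
			(u \<in> elts IN0 \<longleftrightarrow> ap u (num N) \<in> elts ?A)" using inA[OF zero_omega] by blast
	obtain Z where Z: "Dd ?A' Z" "\<And>u. u \<in> elts (fspace omega ?A') ==> ?cond u ==>
			(u \<in> elts Z \<longleftrightarrow> Q (ap u zero) (ap u one))"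
	proof -
		let ?\<nu> = "\<lambda>n. if n = 1 then num 0 else if n = 3 then num 1 else if n < mv \<phi>2 then num (2 * n + 5) else zero"
		have "inj_on ?\<nu> {..<mv \<phi>2}"
		proof (rule inj_onI)
			fix a b assume ab: "a \<in> {..<mv \<phi>2}" "b \<in> {..<mv \<phi>2}" "?\<nu> a = ?\<nu> b"
			have "num (if a = 1 then 0 else if a = 3 then 1 else 2 * a + 5) = num (if b = 1 then 0 else if b = 3 then 1 else 2 * b + 5)"
			proof -
				have nu: "?\<nu> n = num (if n = 1 then 0 else if n = 3 then 1 else 2 * n + 5)" if "n < mv \<phi>2" for n
					by (cases "n = 1"; cases "n = 3") (simp_all only: if_True if_False that refl)
				show ?thesis
					by (rule trans[OF nu[symmetric] trans[OF ab(3) nu]]) (use ab(1,2) in simp_all)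
			qed
			then have "(if a = 1 then 0 else if a = 3 then 1 else 2 * a + 5) = (if b = 1 then 0 else if b = 3 then 1 else 2 * b + 5)"
				by (rule num_inject[THEN iffD1])
			then show "a = b" by presburger
		qed
		moreover have "?\<nu> n \<in> elts omega" for n by (simp del: funpow.simps)
		ultimately obtain Y where Y: "Dd ?A' Y" "\<And>u. u \<in> elts (fspace omega ?A') ==>
				u \<in> elts Y \<longleftrightarrow> satr (elts ?A') mem (\<lambda>n. ap u (?\<nu> n)) \<phi>2"
			using Dd_fm[of ?\<nu> \<phi>2 ?A'] by blast
		have "u \<in> elts Y \<longleftrightarrow> Q (ap u zero) (ap u one)" if u: "u \<in> elts (fspace omega ?A')" "?cond u" for u
		proof -
			let ?s = "case_nat (ap u zero) (case_nat (ap u one) ?d)"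
			have "ap u zero \<in> elts ?A'" "ap u one \<in> elts ?A'" using u(1) by (auto simp: func_ap)
			then have rs: "range ?s \<subseteq> elts ?A'" using bK by (auto simp: image_subset_iff split: nat.splits)
			have "satr (elts ?A') mem (\<lambda>n. ap u (?\<nu> n)) \<phi>2 = satr (elts ?A') mem (mrg c2 ?s) \<phi>2"
			proof (rule satr_cong)
				fix n assume n: "n < mv \<phi>2"
				consider "n = 1" | "n = 3" | "n \<noteq> 1" "n \<noteq> 3" by blast
				then show "ap u (?\<nu> n) = mrg c2 ?s n"
				proof cases
					case 1 then show ?thesis by (simp add: mrg_def)
				next
					case 2 then show ?thesis by (simp add: mrg_def one_def)
				next
					case 3
					have "ap u (?\<nu> n) = mrg c2 ?d n"
						using cond[OF u(2) par(2)[of n]] cs_nth(2)[of n] n 3 by (simp del: funpow.simps)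
					also have "\<dots> = mrg c2 ?s n"
					proof -
						have "\<exists>j. n div 2 = Suc (Suc j)" if "odd n" using that 3 by presburger
						then show ?thesis by (auto simp: mrg_def)
					qed
					finally show ?thesis .
				qed
			qed
			also have "\<dots> = Q (ap u zero) (ap u one)" using f2(2)[OF rs] by simp
			finally show ?thesis using Y(2)[OF u(1)] by simp
		qed
		then show thesis using that Y(1) by blast
	qed
	\<comment> \<open>\<open>p\<close> occurs twice, as variable 1 for \<open>Q\<close> and as variable
	  \<open>num N\<close>, the shifted variable 0 of its definition; the conjunct \<open>aE\<close>
	  identifies the two.\<close>
	define W where "W = cI (cI XX Z) (cI (aE ?A' one (num N)) IN0)"
	define X' where "X' = cX ?A' one (cX ?A' (num N) W)"
	have DX': "Dd ?A' X'" unfolding X'_def W_def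
		by (intro Dd_intros XX(1) Z(1) IN0(1)) simp_all
	have N2: "num N \<noteq> zero" "num N \<noteq> one" "zero \<noteq> num N" "one \<noteq> num N"
	proof -
		have "num N \<noteq> num 0" "num N \<noteq> num 1" unfolding N_def by (simp_all only: num_inject)
		then show "num N \<noteq> zero" "num N \<noteq> one" "zero \<noteq> num N" "one \<noteq> num N" by (auto simp: one_def)
	qed
	have key: "ud c0 zero y \<in> elts X' \<longleftrightarrow> Q y p" if y: "y \<in> elts ?A'" for y
	proof -
		have W: "ud (ud (ud c0 zero y) one a) (num N) b' \<in> elts W \<longleftrightarrow> a = b' \<and> b' = p \<and> Q y a"
			if a: "a \<in> elts ?A'" and b': "b' \<in> elts ?A'" for a b'
		proof -
			let ?u = "ud (ud (ud c0 zero y) one a) (num N) b'"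
			have u: "?u \<in> elts (fspace omega ?A')" using c0 y a b' by (simp add: ud_fspace)
			have ap: "ap ?u i = (if i = num N then b' else if i = one then a else if i = zero then y else ap c0 i)"
				if "i \<in> elts omega" for i using that by (simp add: ap_ud)
			have c: "?cond ?u"
			proof (intro ballI impI)
				fix j assume j: "j \<in> elts (num N)" "j \<noteq> zero" "j \<noteq> one"
				then have "j \<in> elts omega" unfolding elts_num by auto
				moreover have "j \<noteq> num N" using j(1) by auto
				ultimately show "ap ?u j = ap c0 j" using ap j by simp
			qed
			have v: "ap ?u zero = y" "ap ?u one = a" "ap ?u (num N) = b'"
				using ap[of zero] ap[of one] ap[of "num N"] N2 by (simp_all add: numerals_neq)
			have E: "?u \<in> elts (aE ?A' one (num N)) \<longleftrightarrow> a = b'" using u v by (simp add: elts_aE)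
			have I: "?u \<in> elts IN0 \<longleftrightarrow> b' \<in> elts ?A" using IN0(2)[OF u c] v by simp
			have QQ: "?u \<in> elts Z \<longleftrightarrow> Q y a" using Z(2)[OF u c] v by simp
			have P: "?u \<in> elts XX \<longleftrightarrow> b' = p" if bA: "b' \<in> elts ?A"
			proof -
				have r: "ap ?u ((sc ^^ N) k) = (if k = zero then b' else ap s' k)" if k: "k \<in> elts omega" for k
				proof -
					have "(sc ^^ N) k \<noteq> num 0" "(sc ^^ N) k \<noteq> num 1"
						using funpow_neq[of 0 N k] funpow_neq[of 1 N k] unfolding N_def by auto
					then have "(sc ^^ N) k \<noteq> zero" "(sc ^^ N) k \<noteq> one" by (simp_all add: one_def)
					then show ?thesis using ap[of "(sc ^^ N) k"] k c0r[OF k] by simp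
				qed
				have all: "\<forall>k\<in>elts omega. ap ?u ((sc ^^ N) k) \<in> elts ?A" using r bA func_ap[OF s'(1)] by simp
				have "lam omega (\<lambda>k. ap ?u ((sc ^^ N) k)) = ud s' zero b'"
					unfolding ud_def[of s'] by (rule lam_cong) (simp add: r)
				then show ?thesis using XX(2)[OF u c all] s'(3) X(5) bA by simp
			qed
			show ?thesis unfolding W_def elts_cI using E I QQ P X(1) by blast
		qed
		have u0: "ud c0 zero y \<in> elts (fspace omega ?A')" using c0 y by (simp add: ud_fspace)
		have "ud c0 zero y \<in> elts X' \<longleftrightarrow> (\<exists>a\<in>elts ?A'. \<exists>b'\<in>elts ?A'. ud (ud (ud c0 zero y) one a) (num N) b' \<in> elts W)"
			unfolding X'_def elts_cX using u0 by (auto simp: ud_fspace)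
		also have "\<dots> \<longleftrightarrow> Q y p" using W X(1) AA by blast
		finally show ?thesis .
	qed
	have "ODv \<beta>' y0" unfolding ODv_def
	proof (intro exI conjI)
		show "y0 \<in> elts ?A'" by (rule y0)
		show "c0 \<in> elts (fspace omega ?A')" using c0 by simp
		show "\<forall>i\<in>elts omega. i \<noteq> zero --> Ord (ap c0 i)" using c0O by blast
		show "Dd ?A' X'" by (rule DX')
		show "\<forall>y\<in>elts ?A'. ud c0 zero y \<in> elts X' \<longleftrightarrow> y = y0" using key uniq by blast
	qed
	then show ?thesis using OD_iff b' by blast
qed

end

context eps_structure
begin

lemma dfr_eq: "k0 \<in> K ==> dtr K t ==> dtr K u ==> dfr U K (\<lambda>s. t s = u s)"
proof -
	assume k0: "k0 \<in> K" and tu: "dtr K t" "dtr K u"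
	have cv: "dfr U K (\<lambda>s. k = s i)" if "k \<in> K" for k i
		using dfr_eq_vc[OF that, of U i] by (simp add: eq_commute)
	show ?thesis using tu unfolding dtr_def
		using dfr_eq_vv[OF k0, of U] dfr_eq_vc[of _ K U] cv dfr_const[OF k0, of U] by auto
qed

end

context zf
begin

lemma up_in_Vl: "Ord \<mu> ==> a \<in> elts (Vl \<mu>) ==> b \<in> elts (Vl \<mu>) ==> up a b \<in> elts (Vl (sc \<mu>))"
	by (simp add: elts_Vl_sc)
lemma pair_in_Vl: "Ord \<mu> ==> a \<in> elts (Vl \<mu>) ==> b \<in> elts (Vl \<mu>) ==> pair a b \<in> elts (Vl (sc (sc \<mu>)))"
	unfolding pair_eq sing_up by (intro up_in_Vl Ord_sc)

text \<open>Chooses a level above both \<open>Vl \<nu>\<close> and the level in which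
  \<open>q\<close> is definable. The bound \<open>\<nu>\<close> leaves room for auxiliary sets, such
  as the components of pairs, that the formula mentions.\<close>

lemma OD_by:
	assumes q: "OD q" and nu: "Ord \<nu>" "y0 \<in> elts (Vl \<nu>)"
		and d: "\<And>\<beta>'. Ord \<beta>' ==> elts (Vl \<nu>) \<subseteq> elts (Vl \<beta>') ==>
			dfr (elts (Vl \<beta>')) {x \<in> elts (Vl \<beta>'). Ord x} (\<lambda>s. Q (Vl \<beta>') (s 0) (s 1))"
		and u: "\<And>\<beta>' y. Ord \<beta>' ==> elts (Vl \<nu>) \<subseteq> elts (Vl \<beta>') ==> q \<in> elts (Vl \<beta>') ==> y \<in> elts (Vl \<beta>') ==>
			Q (Vl \<beta>') y q \<longleftrightarrow> y = y0"
	shows "OD y0"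
proof -
	obtain \<beta> where b: "Ord \<beta>" "ODv \<beta> q" using q OD_iff by blast
	have qV: "q \<in> elts (Vl \<beta>)" using b(2) unfolding ODv_def by blast
	define \<beta>' where "\<beta>' = un2 (sc (sc \<beta>)) \<nu>"
	have ob: "Ord \<beta>'" unfolding \<beta>'_def using Ord_un2 Ord_sc b(1) nu(1) by blast
	have bb: "sc \<beta> \<in> elts \<beta>'" unfolding \<beta>'_def by simp
	have sub: "elts (Vl \<nu>) \<subseteq> elts (Vl \<beta>')" by (rule Vl_mono[OF ob nu(1)]) (auto simp: \<beta>'_def)
	have qb: "q \<in> elts (Vl \<beta>')" using Vl_mono[OF ob b(1)] qV unfolding \<beta>'_def by auto
	show ?thesis
		by (rule OD_definable[OF b ob bb, where Q = "Q (Vl \<beta>')"]) (use sub nu(2) d[OF ob sub] u[OF ob sub qb] in auto)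
qed

text \<open>Unordered and ordered pairs expressed by quantifiers bounded by \<open>U\<close>; in a
  transitive \<open>U\<close> they have their usual meaning.\<close>

definition isup :: "'v => 'v => 'v => 'v => bool" where
	"isup U y a b \<longleftrightarrow> (\<forall>x\<in>elts U. x \<in> elts y \<longleftrightarrow> x = a \<or> x = b)"
definition ispair :: "'v => 'v => 'v => 'v => bool" where
	"ispair U y a b \<longleftrightarrow> (\<exists>u\<in>elts U. \<exists>w\<in>elts U. isup U u a a \<and> isup U w a b \<and> isup U y u w)"

lemma isup_iff:
	assumes U: "transitive U" and "y \<in> elts U" "a \<in> elts U" "b \<in> elts U"
	shows "isup U y a b \<longleftrightarrow> y = up a b"
proof
	assume "isup U y a b"
	then have "elts y = {a, b}" unfolding isup_def using assms transD[OF U] by blast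
	then show "y = up a b" by (intro elts_inject) simp
qed (auto simp: isup_def)

lemma ispair_iff:
	assumes U: "transitive U" and y: "y \<in> elts U" and ab: "a \<in> elts U" "b \<in> elts U"
	shows "ispair U y a b \<longleftrightarrow> y = pair a b"
proof
	assume "ispair U y a b"
	then show "y = pair a b" unfolding ispair_def pair_eq sing_up using isup_iff[OF U] y ab by auto
next
	assume y': "y = pair a b"
	then have u: "up a a \<in> elts U" "up a b \<in> elts U" using transD[OF U y] unfolding pair_eq sing_up by auto
	show "ispair U y a b" unfolding ispair_def
		by (rule bexI[OF _ u(1)], rule bexI[OF _ u(2)])
			(use isup_iff[OF U] u y ab y' in \<open>simp add: pair_eq sing_up\<close>)
qed

lemma dfr_isup:
	"k \<in> K ==> dtr K t ==> dtr K u ==> dtr K v ==> (\<And>x. dtr K x ==> dtr K (\<lambda>s. x (\<lambda>n. s (Suc n)))) ==>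
		dfr (elts U) K (\<lambda>s. isup U (t s) (u s) (v s))"
	unfolding isup_def by (intro dfr_all dfr_iff dfr_disj dfr_mem dfr_eq dtr_var)

lemma dtr_Suc: "dtr K x ==> dtr K (\<lambda>s. x (\<lambda>n. s (Suc n)))"
	unfolding dtr_def by auto

lemma dfr_ispair:
	"k \<in> K ==> dtr K t ==> dtr K u ==> dtr K v ==> dfr (elts U) K (\<lambda>s. ispair U (t s) (u s) (v s))"
	unfolding ispair_def by (intro dfr_ex dfr_conj dfr_isup dtr_var dtr_Suc)

lemma OD_Ord:
	assumes q: "OD q" and a: "Ord a" shows "OD a"
proof (rule OD_by[OF q, where \<nu> = "sc a" and Q = "\<lambda>_ y _. y = a"])
	show "a \<in> elts (Vl (sc a))" using a by (simp add: Ord_in_Vl Ord_sc)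
	show "dfr (elts (Vl \<beta>')) {x \<in> elts (Vl \<beta>'). Ord x} (\<lambda>s. s 0 = a)"
		if "Ord \<beta>'" "elts (Vl (sc a)) \<subseteq> elts (Vl \<beta>')" for \<beta>'
		by (rule dfr_eq_vc) (use that(2) a \<open>a \<in> elts (Vl (sc a))\<close> in blast)
qed (simp_all add: a Ord_sc)

lemma
	assumes q: "OD q" and a: "Ord a" and b: "Ord b"
	shows OD_up: "OD (up a b)" and OD_pair: "OD (pair a b)"
proof -
	define \<mu> where "\<mu> = un2 (sc a) (sc b)"
	have m: "Ord \<mu>" unfolding \<mu>_def by (intro Ord_un2 Ord_sc a b)
	have ab: "a \<in> elts (Vl \<mu>)" "b \<in> elts (Vl \<mu>)" using m a b by (simp_all add: Ord_in_Vl) (simp_all add: \<mu>_def)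
	define \<nu> where "\<nu> = sc (sc \<mu>)"
	have n: "Ord \<nu>" unfolding \<nu>_def by (intro Ord_sc m)
	have in1: "up a b \<in> elts (Vl \<nu>)" "pair a b \<in> elts (Vl \<nu>)" "a \<in> elts (Vl \<nu>)" "b \<in> elts (Vl \<nu>)"
	proof -
		show "pair a b \<in> elts (Vl \<nu>)" unfolding \<nu>_def by (rule pair_in_Vl[OF m ab])
		show "a \<in> elts (Vl \<nu>)" "b \<in> elts (Vl \<nu>)" using n a b by (simp_all add: Ord_in_Vl) (simp_all add: \<nu>_def \<mu>_def)
		show "up a b \<in> elts (Vl \<nu>)" by (rule Vl_trans[OF n \<open>pair a b \<in> elts (Vl \<nu>)\<close>]) (simp add: pair_eq)
	qed
	have k: "a \<in> {x \<in> elts (Vl \<beta>'). Ord x}" "b \<in> {x \<in> elts (Vl \<beta>'). Ord x}" "transitive (Vl \<beta>')"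
		if "Ord \<beta>'" "elts (Vl \<nu>) \<subseteq> elts (Vl \<beta>')" for \<beta>'
		using that in1 a b transitive_Vl by auto
	show "OD (up a b)"
	proof (rule OD_by[OF q n in1(1), where Q = "\<lambda>U y _. isup U y a b"])
		show "dfr (elts (Vl \<beta>')) {x \<in> elts (Vl \<beta>'). Ord x} (\<lambda>s. isup (Vl \<beta>') (s 0) a b)"
			if "Ord \<beta>'" "elts (Vl \<nu>) \<subseteq> elts (Vl \<beta>')" for \<beta>'
			by (rule dfr_isup[OF k(1)[OF that] dtr_var dtr_const[OF k(1)[OF that]] dtr_const[OF k(2)[OF that]] dtr_Suc])
		show "isup (Vl \<beta>') y a b \<longleftrightarrow> y = up a b"
			if "Ord \<beta>'" "elts (Vl \<nu>) \<subseteq> elts (Vl \<beta>')" "y \<in> elts (Vl \<beta>')" for \<beta>' y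
			using isup_iff[OF k(3)[OF that(1,2)] that(3)] k[OF that(1,2)] by simp
	qed
	show "OD (pair a b)"
	proof (rule OD_by[OF q n in1(2), where Q = "\<lambda>U y _. ispair U y a b"])
		show "dfr (elts (Vl \<beta>')) {x \<in> elts (Vl \<beta>'). Ord x} (\<lambda>s. ispair (Vl \<beta>') (s 0) a b)"
			if "Ord \<beta>'" "elts (Vl \<nu>) \<subseteq> elts (Vl \<beta>')" for \<beta>'
			by (rule dfr_ispair[OF k(1)[OF that] dtr_var dtr_const[OF k(1)[OF that]] dtr_const[OF k(2)[OF that]]])
		show "ispair (Vl \<beta>') y a b \<longleftrightarrow> y = pair a b"
			if "Ord \<beta>'" "elts (Vl \<nu>) \<subseteq> elts (Vl \<beta>')" "y \<in> elts (Vl \<beta>')" for \<beta>' y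
			using ispair_iff[OF k(3)[OF that(1,2)] that(3)] k[OF that(1,2)] by simp
	qed
qed

lemma tc_Ord: "Ord a ==> y \<in> elts (tc_sing a) ==> Ord y"
	using tc_sing_min[of "sc a" a] Ord_sc[of a] Ord_in[of "sc a" y] by (auto simp: Ord_def)

lemma HOD_pair:
	assumes q: "OD q" and a: "Ord a" and b: "Ord b" shows "HOD (pair a b)"
	unfolding HOD_def
proof
	fix y assume "y \<in> elts (tc_sing (pair a b))"
	then consider "y = pair a b" | z where "z = up a a \<or> z = up a b" "y \<in> elts (tc_sing z)"
		using tc_sing_cases[of y "pair a b"] by (auto simp: pair_eq sing_up)
	then show "OD y"
	proof cases
		case 1 then show ?thesis using OD_pair[OF q a b] by simp
	next
		case (2 z)
		have "y = z \<or> y \<in> elts (tc_sing a) \<or> y \<in> elts (tc_sing b)" using tc_sing_cases[OF 2(2)] 2(1) by auto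
		then show ?thesis using 2(1) OD_up[OF q a a] OD_up[OF q a b] OD_Ord[OF q] tc_Ord[OF a] tc_Ord[OF b] by blast
	qed
qed

text \<open>The condition \<open>p\<close> with domain \<open>\<gamma>\<close>, prolonged by zeros
  up to \<open>\<epsilon>\<close> and by the value \<open>b\<close> at \<open>\<epsilon>\<close>.
  The filler is definable, so that only ordinals are added to the definition of
  \<open>p\<close>.\<close>

definition pext :: "'v => 'v => 'v => 'v => 'v" where
	"pext p \<gamma> \<epsilon> b = un2 p (un2 (lam (setof {\<zeta> \<in> elts \<epsilon>. \<zeta> \<notin> elts \<gamma>}) (\<lambda>_. zero)) (sing (pair \<epsilon> b)))"

lemma elts_pext: "e \<in> elts (pext p \<gamma> \<epsilon> b) \<longleftrightarrow>
		e \<in> elts p \<or> (\<exists>\<zeta>. \<zeta> \<in> elts \<epsilon> \<and> \<zeta> \<notin> elts \<gamma> \<and> e = pair \<zeta> zero) \<or> e = pair \<epsilon> b"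
proof -
	have "elts (setof {\<zeta> \<in> elts \<epsilon>. \<zeta> \<notin> elts \<gamma>}) = {\<zeta> \<in> elts \<epsilon>. \<zeta> \<notin> elts \<gamma>}" by (rule sepI) (intro df)
	then show ?thesis by (auto simp: pext_def elts_lam[OF dft_const])
qed

lemma func_pext:
	assumes p: "func p \<gamma> two" and g: "elts \<gamma> \<subseteq> elts \<epsilon>" and b: "b \<in> elts two"
	shows "func (pext p \<gamma> \<epsilon> b) (sc \<epsilon>) two"
proof -
	have t: "zero \<in> elts two" by (simp add: two_def one_def)
	have fo: "func_on p \<gamma>" using p by (rule func_func_on)
	have mem: "pair x y \<in> elts (pext p \<gamma> \<epsilon> b) \<longleftrightarrow> (x \<in> elts \<gamma> \<and> y = ap p x) \<or> (x \<in> elts \<epsilon> \<and> x \<notin> elts \<gamma> \<and> y = zero) \<or> (x = \<epsilon> \<and> y = b)" for x y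
		by (auto simp: elts_pext pair_in_func[OF fo])
	have ne: "\<epsilon> \<notin> elts \<gamma>" using g not_mem_self by blast
	have "\<exists>x\<in>elts (sc \<epsilon>). \<exists>y\<in>elts two. e = pair x y" if "e \<in> elts (pext p \<gamma> \<epsilon> b)" for e
	proof -
		have "\<exists>x\<in>elts \<gamma>. \<exists>y\<in>elts two. e = pair x y" if "e \<in> elts p" using p that unfolding func_def by blast
		then show ?thesis using that t b g unfolding elts_pext elts_sc by blast
	qed
	moreover have "\<exists>!y. pair x y \<in> elts (pext p \<gamma> \<epsilon> b)" if "x \<in> elts (sc \<epsilon>)" for x
		unfolding mem using that ne g not_mem_self[of \<epsilon>] by (cases "x = \<epsilon>"; cases "x \<in> elts \<gamma>") auto
	ultimately show ?thesis unfolding func_def by blast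
qed

text \<open>The extension is definable from \<open>p\<close> and the ordinals
  \<open>\<gamma>\<close>, \<open>\<epsilon>\<close>, \<open>b\<close>. Its elements belong to
  \<open>p\<close> or are pairs of ordinals, so the rest of the transitive closure is ordinal
  definable as well.\<close>

lemma HOD_pext:
	assumes p: "HOD p" and ga: "Ord \<gamma>" and e: "Ord \<epsilon>" and b: "Ord b"
	shows "HOD (pext p \<gamma> \<epsilon> b)"
proof -
	have q: "OD p" using p unfolding HOD_def by simp
	let ?y = "pext p \<gamma> \<epsilon> b"
	obtain \<beta> where be: "Ord \<beta>" "p \<in> elts (Vl \<beta>)" using q unfolding OD_iff ODv_def by blast
	define \<mu> where "\<mu> = un2 \<beta> (un2 (un2 (sc \<epsilon>) (sc \<gamma>)) (un2 (sc b) (sc zero)))"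
	have m: "Ord \<mu>" unfolding \<mu>_def by (intro Ord_un2 Ord_sc be e b ga Ord_zero)
	define \<nu> where "\<nu> = sc (sc (sc \<mu>))"
	have n: "Ord \<nu>" unfolding \<nu>_def by (intro Ord_sc m)
	have Om: "x \<in> elts (Vl \<mu>)" if "x \<in> elts \<epsilon> \<or> x = \<epsilon> \<or> x = \<gamma> \<or> x = b \<or> x = zero" for x
	proof -
		have "Ord x" using that e b ga Ord_in Ord_zero by blast
		moreover have "x \<in> elts \<mu>" using that unfolding \<mu>_def by auto
		ultimately show ?thesis using m by (simp add: Ord_in_Vl)
	qed
	have mn: "elts (Vl \<mu>) \<subseteq> elts (Vl \<nu>)" by (rule Vl_mono[OF n m]) (auto simp: \<nu>_def)
	have s2: "elts (Vl \<mu>) \<subseteq> elts (Vl (sc (sc \<mu>)))" by (rule Vl_mono[OF _ m]) (auto intro: Ord_sc m)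
	have "x \<in> elts (Vl (sc (sc \<mu>)))" if "x \<in> elts ?y" for x
	proof -
		have "elts (Vl \<beta>) \<subseteq> elts (Vl \<mu>)" by (rule Vl_mono[OF m be(1)]) (auto simp: \<mu>_def)
		moreover have "x \<in> elts (Vl \<beta>)" if "x \<in> elts p" using Vl_trans[OF be that] .
		ultimately show ?thesis using that s2 unfolding elts_pext
			using pair_in_Vl[OF m] Om by blast
	qed
	then have yn: "?y \<in> elts (Vl \<nu>)" unfolding \<nu>_def by (subst elts_Vl_sc) (auto intro: Ord_sc m)
	define Q where "Q U y q \<longleftrightarrow> (\<forall>x\<in>elts U. x \<in> elts y \<longleftrightarrow> x \<in> elts q \<or>
		(\<exists>\<zeta>\<in>elts U. \<zeta> \<in> elts \<epsilon> \<and> \<zeta> \<notin> elts \<gamma> \<and> ispair U x \<zeta> zero) \<or> ispair U x \<epsilon> b)" for U y q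
	have K: "\<gamma> \<in> {x \<in> elts (Vl \<beta>'). Ord x}" "\<epsilon> \<in> {x \<in> elts (Vl \<beta>'). Ord x}" "b \<in> {x \<in> elts (Vl \<beta>'). Ord x}"
		 "zero \<in> {x \<in> elts (Vl \<beta>'). Ord x}" if "Ord \<beta>'" "elts (Vl \<nu>) \<subseteq> elts (Vl \<beta>')" for \<beta>'
		using that(2) mn Om ga e b Ord_zero by blast+
	have "OD ?y"
	proof (rule OD_by[OF q n yn, where Q = Q])
		show "dfr (elts (Vl \<beta>')) {x \<in> elts (Vl \<beta>'). Ord x} (\<lambda>s. Q (Vl \<beta>') (s 0) (s 1))"
			if "Ord \<beta>'" "elts (Vl \<nu>) \<subseteq> elts (Vl \<beta>')" for \<beta>'
			unfolding Q_def
			by (intro dfr_all dfr_iff dfr_disj dfr_ex dfr_conj dfr_neg dfr_mem[OF K(1)[OF that]]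
				dfr_ispair[OF K(1)[OF that]] dtr_var dtr_const K[OF that])
		fix \<beta>' y assume b': "Ord \<beta>'" "elts (Vl \<nu>) \<subseteq> elts (Vl \<beta>')" "p \<in> elts (Vl \<beta>')" "y \<in> elts (Vl \<beta>')"
		have tr: "transitive (Vl \<beta>')" by (rule transitive_Vl[OF b'(1)])
		have ip: "ispair (Vl \<beta>') x c d \<longleftrightarrow> x = pair c d" if "x \<in> elts (Vl \<beta>')" "c \<in> elts (Vl \<mu>)" "d \<in> elts (Vl \<mu>)" for x c d
			by (rule ispair_iff[OF tr that(1)]) (use that mn b'(2) in blast)+
		have eU: "\<zeta> \<in> elts (Vl \<beta>')" if "\<zeta> \<in> elts \<epsilon>" for \<zeta> using Om that mn b'(2) by blast
		have "Q (Vl \<beta>') y p \<longleftrightarrow> (\<forall>x\<in>elts (Vl \<beta>'). x \<in> elts y \<longleftrightarrow> x \<in> elts ?y)"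
		proof -
			have "(\<exists>\<zeta>\<in>elts (Vl \<beta>'). \<zeta> \<in> elts \<epsilon> \<and> \<zeta> \<notin> elts \<gamma> \<and> ispair (Vl \<beta>') x \<zeta> zero) \<longleftrightarrow>
					(\<exists>\<zeta>. \<zeta> \<in> elts \<epsilon> \<and> \<zeta> \<notin> elts \<gamma> \<and> x = pair \<zeta> zero)" if "x \<in> elts (Vl \<beta>')" for x
				using ip[OF that] Om eU by blast
			moreover have "ispair (Vl \<beta>') x \<epsilon> b \<longleftrightarrow> x = pair \<epsilon> b" if "x \<in> elts (Vl \<beta>')" for x
				using ip[OF that] Om by blast
			ultimately show ?thesis unfolding Q_def elts_pext by (intro ball_cong refl) simp
		qed
		also have "\<dots> \<longleftrightarrow> y = ?y"
		proof
			assume *: "\<forall>x\<in>elts (Vl \<beta>'). x \<in> elts y \<longleftrightarrow> x \<in> elts ?y"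
			have "elts y \<subseteq> elts (Vl \<beta>')" "elts ?y \<subseteq> elts (Vl \<beta>')"
				using transD[OF tr] b'(2,4) yn by blast+
			then show "y = ?y" using * by (intro elts_inject) blast
		qed simp
		finally show "Q (Vl \<beta>') y p \<longleftrightarrow> y = ?y" .
	qed
	moreover have "OD y" if zy: "z \<in> elts ?y" and yz: "y \<in> elts (tc_sing z)" for y z
	proof -
		consider "z \<in> elts p" | \<zeta> where "\<zeta> \<in> elts \<epsilon>" "z = pair \<zeta> zero" | "z = pair \<epsilon> b"
			using zy unfolding elts_pext by blast
		then consider "z \<in> elts p" | \<zeta> c where "Ord \<zeta>" "Ord c" "z = pair \<zeta> c"
			using Ord_in[OF e] e b Ord_zero by metis
		then show ?thesis
		proof cases
			case 1 then show ?thesis using p yz tc_sing_mem unfolding HOD_def by blast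
		next
			case 2 then show ?thesis using HOD_pair[OF q] yz unfolding HOD_def by blast
		qed
	qed
	ultimately show ?thesis unfolding HOD_def using tc_sing_cases by blast
qed

section \<open>The ordinal Theta\<close>

lemma surj_func_iff: "surj_func f a b \<longleftrightarrow> func f a b \<and> (\<forall>y\<in>elts b. \<exists>x\<in>elts a. ap f x = y)"
	unfolding surj_func_def using func_app by metis

lemma dfn_surj_func [df]: "dft t ==> dft u ==> dft v ==> dfn (\<lambda>s. surj_func (t s) (u s) (v s))"
	by (rule dfn_app3[of surj_func]) (unfold surj_func_iff, intro df)

text \<open>\<open>r\<close> is the strict part of a prewellordering of \<open>a\<close>, and
  \<open>\<alpha>\<close> is its length; the surjection \<open>f\<close> is the rank
  function.\<close>

definition ordtype :: "'v => 'v => 'v => bool" where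
	"ordtype a r \<alpha> \<longleftrightarrow> Ord \<alpha> \<and> (\<exists>f. surj_func f a \<alpha> \<and>
		 (\<forall>x\<in>elts a. \<forall>y\<in>elts a. pair x y \<in> elts r \<longleftrightarrow> ap f x \<in> elts (ap f y)))"

lemma dfn_ordtype [df]: "dft t ==> dft u ==> dft v ==> dfn (\<lambda>s. ordtype (t s) (u s) (v s))"
	by (rule dfn_app3[of ordtype]) (unfold ordtype_def, intro df)

lemma ordtype_unique:
	assumes "ordtype a r \<alpha>" "ordtype a r \<alpha>'" shows "\<alpha> = \<alpha>'"
proof -
	obtain f where a: "Ord \<alpha>" and f: "func f a \<alpha>" "\<forall>y\<in>elts \<alpha>. \<exists>x\<in>elts a. ap f x = y"
		"\<forall>x\<in>elts a. \<forall>y\<in>elts a. pair x y \<in> elts r \<longleftrightarrow> ap f x \<in> elts (ap f y)"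
		using assms(1) unfolding ordtype_def surj_func_iff by blast
	obtain f' where a': "Ord \<alpha>'" and f': "func f' a \<alpha>'" "\<forall>y\<in>elts \<alpha>'. \<exists>x\<in>elts a. ap f' x = y"
		"\<forall>x\<in>elts a. \<forall>y\<in>elts a. pair x y \<in> elts r \<longleftrightarrow> ap f' x \<in> elts (ap f' y)"
		using assms(2) unfolding ordtype_def surj_func_iff by blast
	have el: "elts (ap f x) = {ap f y |y. y \<in> elts a \<and> pair y x \<in> elts r}" if x: "x \<in> elts a" for x
	proof -
		have s: "elts (ap f x) \<subseteq> elts \<alpha>" using Ord_subset[OF a func_ap[OF f(1) x]] .
		show ?thesis
		proof (intro equalityI subsetI)
			fix z assume z: "z \<in> elts (ap f x)"
			then obtain y where "y \<in> elts a" "ap f y = z" using s f(2) by blast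
			then show "z \<in> {ap f y |y. y \<in> elts a \<and> pair y x \<in> elts r}" using z f(3) x by blast
		qed (use f(3) x in blast)
	qed
	have el': "elts (ap f' x) = {ap f' y |y. y \<in> elts a \<and> pair y x \<in> elts r}" if x: "x \<in> elts a" for x
	proof -
		have s: "elts (ap f' x) \<subseteq> elts \<alpha>'" using Ord_subset[OF a' func_ap[OF f'(1) x]] .
		show ?thesis
		proof (intro equalityI subsetI)
			fix z assume z: "z \<in> elts (ap f' x)"
			then obtain y where "y \<in> elts a" "ap f' y = z" using s f'(2) by blast
			then show "z \<in> {ap f' y |y. y \<in> elts a \<and> pair y x \<in> elts r}" using z f'(3) x by blast
		qed (use f'(3) x in blast)
	qed
	have eq: "\<forall>x\<in>elts a. ap f x = b --> ap f' x = b" if b: "Ord b" for b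
	proof (rule Ord_induct[OF _ b, where Q = "\<lambda>b. \<forall>x\<in>elts a. ap f x = b --> ap f' x = b"])
		show "dfn (\<lambda>s. \<forall>x\<in>elts a. ap f x = s 0 --> ap f' x = s 0)" by (intro df)
		fix b assume IH: "\<And>c. c \<in> elts b ==> \<forall>x\<in>elts a. ap f x = c --> ap f' x = c"
		show "\<forall>x\<in>elts a. ap f x = b --> ap f' x = b"
		proof (intro ballI impI)
			fix x assume x: "x \<in> elts a" "ap f x = b"
			have "ap f' y = ap f y" if "y \<in> elts a" "pair y x \<in> elts r" for y
				using IH[of "ap f y"] that x f(3) by blast
			then have "elts (ap f' x) = elts (ap f x)" unfolding el[OF x(1)] el'[OF x(1)] by metis
			then show "ap f' x = b" using elts_inject x(2) by metis
		qed
	qed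
	have "ap f' x = ap f x" if "x \<in> elts a" for x
		using eq[OF Ord_in[OF a func_ap[OF f(1) that]]] that by blast
	then have "elts \<alpha> = elts \<alpha>'" using f(1,2) f'(1,2) func_ap by (intro equalityI subsetI) metis+
	then show ?thesis by (rule elts_inject)
qed

text \<open>Each surjection from the reals onto an ordinal induces a relation on the reals that
  determines the ordinal. Replacement over the set of all such relations makes the supremum
  exist.\<close>

lemma elts_Theta: "elts Theta = (\<Union>\<alpha>\<in>{\<alpha>. Ord \<alpha> \<and> (\<exists>f. surj_func f reals \<alpha>)}. elts \<alpha>)"
proof -
	have i: "isset {z. \<exists>\<alpha>. ordtype reals r \<alpha> \<and> z \<in> elts \<alpha>}" for r
	proof (cases "\<exists>\<alpha>. ordtype reals r \<alpha>")
		case True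
		then obtain \<alpha> where "ordtype reals r \<alpha>" by blast
		then have "{z. \<exists>\<alpha>. ordtype reals r \<alpha> \<and> z \<in> elts \<alpha>} = elts \<alpha>" using ordtype_unique by blast
		then show ?thesis by simp
	next
		case False then show ?thesis using isset_empty by simp
	qed
	have d: "dft (\<lambda>s. setof {z. \<exists>\<alpha>. ordtype reals (s 0) \<alpha> \<and> z \<in> elts \<alpha>})"
		by (rule dft_setof[of "\<lambda>z s. \<exists>\<alpha>. ordtype reals (s 0) \<alpha> \<and> z \<in> elts \<alpha>"]) (intro df, rule i)
	have "(\<Union>\<alpha>\<in>{\<alpha>. Ord \<alpha> \<and> (\<exists>f. surj_func f reals \<alpha>)}. elts \<alpha>) =
			(\<Union>r\<in>elts (power (prd reals reals)). elts (setof {z. \<exists>\<alpha>. ordtype reals r \<alpha> \<and> z \<in> elts \<alpha>}))"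
	proof (intro equalityI subsetI)
		fix z assume "z \<in> (\<Union>\<alpha>\<in>{\<alpha>. Ord \<alpha> \<and> (\<exists>f. surj_func f reals \<alpha>)}. elts \<alpha>)"
		then obtain \<alpha> f where a: "Ord \<alpha>" "surj_func f reals \<alpha>" "z \<in> elts \<alpha>" by blast
		define r where "r = setof {p \<in> elts (prd reals reals). \<exists>x y. p = pair x y \<and> ap f x \<in> elts (ap f y)}"
		have r: "elts r = {p \<in> elts (prd reals reals). \<exists>x y. p = pair x y \<and> ap f x \<in> elts (ap f y)}"
			unfolding r_def by (rule sepI) (intro df)
		have "r \<in> elts (power (prd reals reals))" using r by auto
		moreover have "ordtype reals r \<alpha>" unfolding ordtype_def r using a by auto
		ultimately show "z \<in> (\<Union>r\<in>elts (power (prd reals reals)). elts (setof {z. \<exists>\<alpha>. ordtype reals r \<alpha> \<and> z \<in> elts \<alpha>}))"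
			unfolding elts_setof[OF i] using a(3) by blast
	next
		fix z assume "z \<in> (\<Union>r\<in>elts (power (prd reals reals)). elts (setof {z. \<exists>\<alpha>. ordtype reals r \<alpha> \<and> z \<in> elts \<alpha>}))"
		then obtain r \<alpha> where "ordtype reals r \<alpha>" "z \<in> elts \<alpha>" unfolding elts_setof[OF i] by blast
		then show "z \<in> (\<Union>\<alpha>\<in>{\<alpha>. Ord \<alpha> \<and> (\<exists>f. surj_func f reals \<alpha>)}. elts \<alpha>)"
			unfolding ordtype_def by blast
	qed
	then have "isset (\<Union>\<alpha>\<in>{\<alpha>. Ord \<alpha> \<and> (\<exists>f. surj_func f reals \<alpha>)}. elts \<alpha>)" by (simp only: isset_UN[OF d])
	then show ?thesis unfolding Theta_def by (rule elts_setof)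
qed

lemma Ord_Theta: "Ord Theta"
proof -
	have "elts x \<subseteq> elts Theta" "transitive x" if x: "x \<in> elts Theta" for x
	proof -
		obtain \<alpha> f where a: "Ord \<alpha>" "surj_func f reals \<alpha>" "x \<in> elts \<alpha>" using x unfolding elts_Theta by blast
		show "transitive x" using Ord_in[OF a(1,3)] unfolding Ord_def by blast
		show "elts x \<subseteq> elts Theta" using Ord_subset[OF a(1,3)] a(1,2) unfolding elts_Theta by blast
	qed
	then show ?thesis unfolding Ord_def transitive_def by blast
qed

lemma cofinal_func_iff: "cofinal_func f a k \<longleftrightarrow> func f a k \<and>
	 (\<forall>b\<in>elts k. \<exists>x\<in>elts a. b = ap f x \<or> b \<in> elts (ap f x))"
	unfolding cofinal_func_def using func_app by metis

lemma singularE: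
	assumes "singular k"
	obtains f \<delta> where "\<delta> \<in> elts k" "func f \<delta> k" "\<forall>b\<in>elts k. \<exists>x\<in>elts \<delta>. b = ap f x \<or> b \<in> elts (ap f x)"
proof -
	have k: "Ord k" "cf k \<in> elts k" using assms unfolding singular_def Limit_def by auto
	have d: "dfn (\<lambda>s. \<exists>f. cofinal_func f (s 0) k)" unfolding cofinal_func_iff by (intro df)
	have di: "dft (\<lambda>s. s 0)" by (intro df)
	have "cofinal_func (lam k (\<lambda>x. x)) k k" unfolding cofinal_func_iff using func_lam[OF di] ap_lam[OF di] by auto
	then obtain b where b: "Ord b" "\<exists>f. cofinal_func f b k" "\<forall>c\<in>elts b. \<not> (\<exists>f. cofinal_func f c k)"
		using Ord_least[OF d k(1)] by blast
	have "cf k = b" unfolding cf_def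
	proof (rule the_equality)
		show "Ord b \<and> (\<exists>f. cofinal_func f b k) \<and> (\<forall>c\<in>elts b. \<not> (\<exists>f. cofinal_func f c k))" using b by blast
		fix a assume "Ord a \<and> (\<exists>f. cofinal_func f a k) \<and> (\<forall>b\<in>elts a. \<not> (\<exists>f. cofinal_func f b k))"
		then show "a = b" using b Ord_linear[of a b] by blast
	qed
	then show thesis using that b(2) k(2) unfolding cofinal_func_iff by blast
qed

lemma omega_in_Theta: "omega \<in> elts Theta"
proof -
	let ?F = "\<lambda>x. if ap x zero = zero then omega else un (ap x zero)"
	have d: "dft (\<lambda>s. ?F (s 0))" by (intro df)
	have dc: "dft (\<lambda>s. a)" for a by (intro df)
	have "surj_func (lam reals ?F) reals (sc omega)"
		unfolding surj_func_iff
	proof (intro conjI ballI)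
		show "func (lam reals ?F) reals (sc omega)"
		proof (rule func_lam[OF d])
			fix x assume "x \<in> elts reals"
			then have "ap x zero \<in> elts omega" by (rule real_ap) simp
			then show "?F x \<in> elts (sc omega)" using nat_cases[of "ap x zero"] un_sc Ord_nat by auto
		qed
		fix y assume y: "y \<in> elts (sc omega)"
		define n where "n = (if y = omega then zero else sc y)"
		have n: "n \<in> elts omega" using y unfolding n_def by auto
		have l: "lam omega (\<lambda>_. n) \<in> elts reals" by (rule real_lam[OF dc n])
		have "?F (lam omega (\<lambda>_. n)) = y"
			using y un_sc Ord_nat unfolding ap_lam[OF dc zero_omega] by (auto simp: n_def)
		then show "\<exists>x\<in>elts reals. ap (lam reals ?F) x = y" by (intro bexI[OF _ l]) (subst ap_lam[OF d l])
	qed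
	then show ?thesis unfolding elts_Theta using Ord_sc[OF Ord_omega] by auto
qed

lemma AD_plus_imp_AD:
	assumes AD_plus shows AD
	unfolding AD_def
proof (intro allI impI)
	fix A assume A: "elts A \<subseteq> elts reals"
	have d: "dft (\<lambda>s. s 0)" by (intro df)
	define i where "i = lam reals (\<lambda>x. x)"
	have i: "func i reals reals" "\<And>x. x \<in> elts reals ==> app i x = x"
		unfolding i_def using func_lam[OF d, of reals reals] func_app ap_lam[OF d, of _ reals] by auto
	have "continuous_to_reals i omega"
		unfolding continuous_to_reals_def reals_def[symmetric] using i by metis
	then have "determined omega (setof {x \<in> elts (fspace omega omega). app i x \<in> elts A})"
	proof -
		have "omega \<noteq> zero" using zero_omega by fastforce
		then show ?thesis
			using assms omega_in_Theta A \<open>continuous_to_reals i omega\<close>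
			unfolding AD_plus_def ordinal_determinacy_def by blast
	qed
	moreover have "{x \<in> elts (fspace omega omega). app i x \<in> elts A} = elts A"
		unfolding reals_def[symmetric] using i(2) A by auto
	ultimately show "determined omega A" by simp
qed

lemma elts_Add_in:
	"elts (Add_in HOD Theta) = {p. HOD p \<and> (\<exists>\<gamma>\<in>elts Theta. func p \<gamma> two)}"
	unfolding Add_in_def
proof (rule elts_setof, rule isset_sub)
	show "{p. HOD p \<and> (\<exists>\<gamma>\<in>elts Theta. func p \<gamma> two)} \<subseteq> elts (power (prd Theta two))"
	proof
		fix p assume "p \<in> {p. HOD p \<and> (\<exists>\<gamma>\<in>elts Theta. func p \<gamma> two)}"
		then obtain \<gamma> where g: "\<gamma> \<in> elts Theta" "func p \<gamma> two" by blast
		have "elts \<gamma> \<subseteq> elts Theta" by (rule Ord_subset[OF Ord_Theta g(1)])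
		moreover have "\<exists>x\<in>elts \<gamma>. \<exists>y\<in>elts two. e = pair x y" if "e \<in> elts p" for e
			using g(2) that unfolding func_def by blast
		ultimately show "p \<in> elts (power (prd Theta two))" unfolding elts_power elts_prd by blast
	qed
	have "dfn (\<lambda>s. HOD (s 0) \<and> (\<exists>\<gamma>\<in>elts Theta. func (s 0) \<gamma> two))" by (intro df)
	then show "dfn (\<lambda>s. s 0 \<in> {p. HOD p \<and> (\<exists>\<gamma>\<in>elts Theta. func p \<gamma> two)})" by simp
qed

lemma CH_Add_in: "CH (Add_in HOD Theta)"
	by (rule CH_OD) (simp add: elts_Add_in HOD_def)

end

section \<open>Comparison of the ground model with its extension\<close>

section \<open>Absoluteness\<close>

locale zf_embedding = M: zf M + N: zf N
	for M :: "'v => 'v => bool" and N :: "'w => 'w => bool" +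
	fixes j :: "'v => 'w"
	assumes inj_j: "inj j" and elts_j [simp]: "N.elts (j x) = j ` M.elts x"
begin

lemma j_eq [simp]: "j x = j y \<longleftrightarrow> x = y"
	using inj_j by (auto dest: injD)
lemma j_mem [simp]: "j x \<in> j ` A \<longleftrightarrow> x \<in> A"
	using inj_j by (auto dest: injD)
lemma j_subset [simp]: "j ` A \<subseteq> j ` B \<longleftrightarrow> A \<subseteq> B"
	using inj_j by (simp add: inj_image_subset_iff)

lemma j_zero [simp]: "j M.zero = N.zero" by (rule N.elts_inject) simp
lemma j_sc [simp]: "j (M.sc x) = N.sc (j x)" by (rule N.elts_inject) simp
lemma j_up [simp]: "j (M.up x y) = N.up (j x) (j y)" by (rule N.elts_inject) simp
lemma j_sing [simp]: "j (M.sing x) = N.sing (j x)" by (rule N.elts_inject) simp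
lemma j_un2 [simp]: "j (M.un2 x y) = N.un2 (j x) (j y)" by (rule N.elts_inject) auto
lemma j_pair [simp]: "j (M.pair x y) = N.pair (j x) (j y)" by (simp add: M.pair_eq N.pair_eq)
lemma j_two [simp]: "j M.one = N.one" "j M.two = N.two" by (simp_all add: M.one_def N.one_def M.two_def N.two_def)

lemma zero_j [simp]: "N.zero = j x \<longleftrightarrow> x = M.zero" "j x = N.zero \<longleftrightarrow> x = M.zero"
	using j_eq[of M.zero x] by auto

text \<open>The range of \<open>j\<close> is transitive: the members of a pair in the range, and in
  turn their members, are in the range.\<close>

lemma pair_range: "N.pair a b = j p ==> \<exists>a' b'. a = j a' \<and> b = j b' \<and> p = M.pair a' b'"
proof -
	assume p: "N.pair a b = j p"
	have "N.up a b \<in> N.elts (j p)" unfolding p[symmetric] by (simp add: N.pair_eq)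
	then obtain u where u: "N.up a b = j u" by auto
	have "a \<in> N.elts (j u)" "b \<in> N.elts (j u)" unfolding u[symmetric] by auto
	then obtain a' b' where ab: "a = j a'" "b = j b'" unfolding elts_j by blast
	have "j (M.pair a' b') = j p" using p unfolding ab j_pair .
	then have "p = M.pair a' b'" unfolding j_eq ..
	then show ?thesis using ab by (intro exI conjI)
qed

lemma pair_in_j: "N.pair a b \<in> j ` M.elts f \<longleftrightarrow> (\<exists>a' b'. a = j a' \<and> b = j b' \<and> M.pair a' b' \<in> M.elts f)"
proof
	assume "N.pair a b \<in> j ` M.elts f"
	then obtain p where p: "p \<in> M.elts f" "N.pair a b = j p" by auto
	with pair_range[OF p(2)] show "\<exists>a' b'. a = j a' \<and> b = j b' \<and> M.pair a' b' \<in> M.elts f" by blast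
next
	assume "\<exists>a' b'. a = j a' \<and> b = j b' \<and> M.pair a' b' \<in> M.elts f"
	then show "N.pair a b \<in> j ` M.elts f" by (metis j_pair imageI)
qed

lemma pair_in_j' [simp]: "N.pair (j a) (j b) \<in> j ` M.elts f \<longleftrightarrow> M.pair a b \<in> M.elts f"
	unfolding pair_in_j by auto

lemma j_prd [simp]: "j (M.prd a b) = N.prd (j a) (j b)"
proof (rule N.elts_inject)
	have "N.elts (N.prd (j a) (j b)) = (\<Union>x\<in>M.elts a. \<Union>y\<in>M.elts b. {j (M.pair x y)})"
		unfolding N.elts_prd by auto
	also have "\<dots> = j ` M.elts (M.prd a b)" unfolding M.elts_prd by blast
	finally show "N.elts (j (M.prd a b)) = N.elts (N.prd (j a) (j b))" by simp
qed

lemma j_ap [simp]: "N.ap (j f) (j x) = j (M.ap f x)"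
	by (rule N.elts_inject) (auto simp: M.elts_ap N.elts_ap pair_in_j, blast)
lemma j_dom [simp]: "j (M.dom f) = N.dom (j f)"
	by (rule N.elts_inject) (auto simp: M.elts_dom N.elts_dom pair_in_j)

lemma func_on_j [simp]: "N.func_on (j f) (j a) \<longleftrightarrow> M.func_on f a"
proof -
	have "(\<forall>p\<in>M.elts f. \<exists>x\<in>M.elts a. \<exists>y. j p = N.pair (j x) y) \<longleftrightarrow> (\<forall>p\<in>M.elts f. \<exists>x\<in>M.elts a. \<exists>y. p = M.pair x y)"
		using pair_range by (metis j_pair j_eq)
	moreover have "(\<exists>!y. N.pair (j x) y \<in> j ` M.elts f) \<longleftrightarrow> (\<exists>!y. M.pair x y \<in> M.elts f)" for x
		unfolding pair_in_j by (auto; metis j_eq)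
	ultimately show ?thesis unfolding N.func_on_iff M.func_on_iff by simp
qed
lemma func_j [simp]: "N.func (j f) (j a) (j b) \<longleftrightarrow> M.func f a b"
	by (simp add: N.func_iff M.func_iff)

lemma transitive_j [simp]: "N.transitive (j x) \<longleftrightarrow> M.transitive x"
	by (auto simp: N.transitive_def M.transitive_def)
lemma Ord_j [simp]: "N.Ord (j x) \<longleftrightarrow> M.Ord x"
	by (simp add: N.Ord_def M.Ord_def)

lemma j_omega [simp]: "j M.omega = N.omega"
proof (rule N.elts_inject, intro equalityI subsetI)
	fix n assume n: "n \<in> N.elts N.omega"
	then show "n \<in> N.elts (j M.omega)"
	proof (induction rule: N.omega_induct)
		case dfn show ?case by (intro N.df)
	next
		case zero show ?case using M.zero_omega by simp
	next
		case (sc n)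
		then obtain m where "n = j m" "m \<in> M.elts M.omega" by auto
		then show ?case by (simp flip: j_sc)
	qed
next
	fix n assume n: "n \<in> N.elts (j M.omega)"
	show "n \<in> N.elts N.omega"
	proof (rule ccontr)
		assume "n \<notin> N.elts N.omega"
		have "N.dfn (\<lambda>s. s 0 \<notin> N.elts N.omega)" by (intro N.df)
		from N.minimal[where Q = "\<lambda>y. y \<notin> N.elts N.omega", OF this n \<open>n \<notin> N.elts N.omega\<close>] obtain y where y: "y \<in> N.elts (j M.omega)" "y \<notin> N.elts N.omega"
			"\<forall>z\<in>N.elts y. z \<in> N.elts (j M.omega) --> z \<in> N.elts N.omega" by blast
		obtain x where x: "y = j x" "x \<in> M.elts M.omega" using y(1) by auto
		from M.nat_cases[OF x(2)] show False
		proof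
			assume "x = M.zero" then show False using y(2) x(1) by simp
		next
			assume "\<exists>m\<in>M.elts M.omega. x = M.sc m"
			then obtain m where m: "m \<in> M.elts M.omega" "x = M.sc m" by blast
			have "j m \<in> N.elts y" "j m \<in> N.elts (j M.omega)" using m x(1) by simp_all
			then have "j m \<in> N.elts N.omega" using y(3) by blast
			then show False using y(2) x(1) m(2) by simp
		qed
	qed
qed

lemma elts_omega_j: "N.elts N.omega = j ` M.elts M.omega"
	by (simp flip: j_omega)
lemma in_omega_j [simp]: "j n \<in> N.elts N.omega \<longleftrightarrow> n \<in> M.elts M.omega"
	by (simp add: elts_omega_j)

lemma func_omega_j [simp]:
	"N.func (j f) N.omega (j b) \<longleftrightarrow> M.func f M.omega b"
	"N.func (j f) (j b) N.omega \<longleftrightarrow> M.func f b M.omega"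
	"N.func (j f) N.omega N.omega \<longleftrightarrow> M.func f M.omega M.omega"
	by (simp_all flip: j_omega)

lemma j_real [simp]: "j x \<in> N.elts N.reals \<longleftrightarrow> x \<in> M.elts M.reals"
	by (simp add: N.in_reals M.in_reals)

lemma j_restr [simp]: "j (M.restr f a) = N.restr (j f) (j a)"
proof (rule N.elts_inject, intro equalityI subsetI)
	fix e assume "e \<in> N.elts (j (M.restr f a))"
	then obtain x y where "x \<in> M.elts a" "M.pair x y \<in> M.elts f" "e = j (M.pair x y)" by (auto simp: M.elts_restr)
	then show "e \<in> N.elts (N.restr (j f) (j a))" unfolding N.elts_restr by (auto simp: pair_in_j)
next
	fix e assume "e \<in> N.elts (N.restr (j f) (j a))"
	then obtain z y where z: "e \<in> j ` M.elts f" "z \<in> j ` M.elts a" "e = N.pair z y"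
		unfolding N.elts_restr elts_j by blast
	then obtain x where x: "z = j x" "x \<in> M.elts a" by blast
	then have e: "N.pair (j x) y \<in> j ` M.elts f" "x \<in> M.elts a" "e = N.pair (j x) y" using z by auto
	then obtain y' where "y = j y'" "M.pair x y' \<in> M.elts f" unfolding pair_in_j by auto
	then show "e \<in> N.elts (j (M.restr f a))" using e by (auto simp: M.elts_restr simp flip: j_pair)
qed

lemma j_lam:
	assumes F: "M.dft (\<lambda>s. F (s 0))" and H: "N.dft (\<lambda>s. H (s 0))"
		and eq: "\<And>x. x \<in> M.elts a ==> H (j x) = j (F x)"
	shows "j (M.lam a F) = N.lam (j a) H"
proof (rule N.elts_inject)
	have "N.elts (N.lam (j a) H) = {p. \<exists>x\<in>M.elts a. p = j (M.pair x (F x))}"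
		unfolding N.elts_lam[OF H] using eq by auto
	also have "\<dots> = j ` M.elts (M.lam a F)" unfolding M.elts_lam[OF F] by blast
	finally show "N.elts (j (M.lam a F)) = N.elts (N.lam (j a) H)" by simp
qed

lemma j_finseq [simp]: "j (M.finseq a) = N.finseq (j a)"
proof (rule N.elts_inject, intro equalityI subsetI)
	fix s assume "s \<in> N.elts (j (M.finseq a))"
	then obtain s' n where "s = j s'" "n \<in> M.elts M.omega" "M.func s' n a" by (auto simp: M.elts_finseq)
	then show "s \<in> N.elts (N.finseq (j a))" unfolding N.elts_finseq by (auto simp: elts_omega_j)
next
	fix s assume "s \<in> N.elts (N.finseq (j a))"
	then obtain n where n: "n \<in> N.elts N.omega" "N.func s n (j a)" by (auto simp: N.elts_finseq)
	have "\<forall>s. N.func s n (j a) --> s \<in> N.elts (j (M.finseq a))" using n(1)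
	proof (induction rule: N.omega_induct)
		case dfn show ?case by (intro N.df)
	next
		case zero
		have "j M.zero \<in> j ` M.elts (M.finseq a)"
			by (simp only: j_mem) (rule M.finseqI[OF M.zero_omega], simp add: M.func_def)
		moreover have "s = N.zero" if "N.func s N.zero (j a)" for s
			using that unfolding N.func_def by (auto simp flip: N.elts_eq_empty)
		ultimately show ?case by auto
	next
		case (sc n)
		show ?case
		proof (intro allI impI)
			fix s assume s: "N.func s (N.sc n) (j a)"
			have so: "N.func_on s (N.sc n)" using s by (rule N.func_func_on)
			have rn: "N.func (N.restr s n) n (j a)"
				unfolding N.func_iff by (subst (1 2) N.restr_eq[OF so]) (use N.func_ap[OF s] in \<open>auto intro!: N.func_on_lam N.df simp: N.ap_lam[OF N.dft_ap[OF N.dft_const N.dft_var]]\<close>)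
			then obtain s' where s': "N.restr s n = j s'" "s' \<in> M.elts (M.finseq a)" using sc.IH by auto
			obtain m where m: "n = j m" "m \<in> M.elts M.omega" using sc.hyps by (auto simp: elts_omega_j)
			obtain b where b: "N.ap s n = j b" "b \<in> M.elts a" using N.func_ap[OF s, of n] by auto
			have ds: "M.dom s' = m"
			proof -
				have "j (M.dom s') = N.dom (N.restr s n)" using s'(1) by simp
				also have "\<dots> = n" by (rule N.dom_restr[OF so]) auto
				finally show ?thesis unfolding m(1) j_eq .
			qed
			have fin: "M.snoc s' b \<in> M.elts (M.finseq a)" by (rule M.snoc_finseq[OF s'(2) b(2)])
			have fs: "M.func (M.snoc s' b) (M.sc m) a" using fin unfolding M.in_finseq M.dom_snoc ds by blast
			have "s = j (M.snoc s' b)"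
			proof (rule N.fun_ext[OF so])
				show "N.func_on (j (M.snoc s' b)) (N.sc n)" using M.func_func_on[OF fs] m by (simp flip: j_sc)
				fix x assume x: "x \<in> N.elts (N.sc n)"
				show "N.ap s x = N.ap (j (M.snoc s' b)) x"
				proof (cases "x = n")
					case True then show ?thesis using m b(1) M.ap_snoc_last[of s' b] ds by simp
				next
					case False
					then obtain i where i: "x = j i" "i \<in> M.elts m" using x m by auto
					have "N.ap s x = N.ap (N.restr s n) x" by (rule N.ap_restr[OF so, symmetric]) (use i m in auto)
					also have "\<dots> = j (M.ap s' i)" using s'(1) i by simp
					also have "\<dots> = N.ap (j (M.snoc s' b)) x" using M.ap_snoc[of i s' b] i ds by simp
					finally show ?thesis .
				qed
			qed
			then show "s \<in> N.elts (j (M.finseq a))" using fin by simp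
		qed
	qed
	then show "s \<in> N.elts (j (M.finseq a))" using n(2) by blast
qed

lemma in_finseq_j: "N.finseq N.omega = j (M.finseq M.omega)" by simp
lemma finseq_mem_j [simp]: "j t \<in> N.elts (N.finseq N.omega) \<longleftrightarrow> t \<in> M.elts (M.finseq M.omega)"
	unfolding in_finseq_j elts_j by (rule j_mem)

lemma decodes_j:
	assumes d: "M.decodes x y z R0 w"
	shows "N.decodes (j x) (j y) (j z) (j R0) (j w)"
proof -
	have fv: "N.fv (j v) (j K) (j X)" if "M.fv v K X" for v K X
		using that unfolding M.fv_def N.fv_def elts_omega_j by auto
	obtain R where R: "R \<in> M.elts M.reals" "M.ap R M.zero = R0"
		"\<forall>r\<in>M.elts M.omega. \<exists>X Y Z. M.fv x (M.ap R r) X \<and> M.fv y X Y \<and> M.fv z X Z \<and>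
			 M.ap R (M.sc r) = M.un2 Y Z \<and> (r \<in> M.elts w \<longleftrightarrow> Y \<in> M.elts Z)"
		using d unfolding M.decodes_def by blast
	show ?thesis unfolding N.decodes_def
	proof (rule bexI[of _ "j R"], intro conjI ballI)
		show "N.ap (j R) N.zero = j R0" using R(2) by (simp flip: j_zero)
		fix r assume "r \<in> N.elts N.omega"
		then obtain r' where r: "r = j r'" "r' \<in> M.elts M.omega" by (auto simp: elts_omega_j)
		obtain X Y Z where X: "M.fv x (M.ap R r') X" "M.fv y X Y" "M.fv z X Z"
			 "M.ap R (M.sc r') = M.un2 Y Z" "r' \<in> M.elts w \<longleftrightarrow> Y \<in> M.elts Z" using R(3) r(2) by blast
		have "N.ap (j R) (N.sc r) = N.un2 (j Y) (j Z)" unfolding r(1) j_sc[symmetric] j_ap X(4) j_un2 ..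
		moreover have "N.fv (j x) (N.ap (j R) r) (j X)" unfolding r(1) j_ap by (rule fv[OF X(1)])
		ultimately show "\<exists>X Y Z. N.fv (j x) (N.ap (j R) r) X \<and> N.fv (j y) X Y \<and> N.fv (j z) X Z \<and>
			 N.ap (j R) (N.sc r) = N.un2 Y Z \<and> (r \<in> N.elts (j w) \<longleftrightarrow> Y \<in> N.elts Z)"
			using fv[OF X(2)] fv[OF X(3)] X(5) r(1) by (intro exI[of _ "j X"] exI[of _ "j Y"] exI[of _ "j Z"]) simp
	qed (use R(1) in simp)
qed

end

section \<open>Names for sets of natural numbers\<close>

context zf
begin

text \<open>\<open>pair p \<rho> \<in> elts (feq P t n)\<close> says that \<open>p\<close> forces the value of the name \<open>\<rho>\<close> to be the natural
	number \<open>n\<close>.\<close>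

definition fstep :: "'v => 'v => 'v => 'v => 'v" where
	"fstep P t n h = setof {x \<in> elts (prd P t). \<exists>p \<rho>. x = pair p \<rho> \<and>
		(\<forall>\<rho>' q. pair \<rho>' q \<in> elts \<rho> --> (\<forall>r\<in>elts P. elts p \<subseteq> elts r \<and> elts q \<subseteq> elts r -->
			 (\<exists>r'\<in>elts P. elts r \<subseteq> elts r' \<and> (\<exists>n'\<in>elts n. pair r' \<rho>' \<in> elts (ap h n'))))) \<and>
		(\<forall>n'\<in>elts n. \<forall>r\<in>elts P. elts p \<subseteq> elts r -->
			 (\<exists>r'\<in>elts P. elts r \<subseteq> elts r' \<and> (\<exists>\<rho>' q. pair \<rho>' q \<in> elts \<rho> \<and> elts q \<subseteq> elts r' \<and> pair r' \<rho>' \<in> elts (ap h n'))))}"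

definition feq :: "'v => 'v => 'v => 'v" where
	"feq P t n = trec (fstep P t) n"

lemma dft_fstep: "dft (\<lambda>s. fstep P t (s 0) (s 1))"
	unfolding fstep_def by (intro df)
lemma dft_feq [df]: "dft u ==> dft (\<lambda>s. feq P t (u s))"
	unfolding feq_def by (rule dft_app1[of "trec (fstep P t)"]) (unfold fstep_def, intro df)

text \<open>Equality with a number unfolds to two inclusions. The first clause says that each
  possible member of the name is eventually forced to equal a smaller number, the second that each
  smaller number is eventually the value of a member. Both refer only to smaller numbers, so a
  recursion on \<open>n\<close> over the fixed set \<open>t\<close> of names suffices.\<close>

lemma feq_iff:
	assumes n: "Ord n"
	shows "pair p \<rho> \<in> elts (feq P t n) \<longleftrightarrow> p \<in> elts P \<and> \<rho> \<in> elts t \<and>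
		(\<forall>\<rho>' q. pair \<rho>' q \<in> elts \<rho> --> (\<forall>r\<in>elts P. elts p \<subseteq> elts r \<and> elts q \<subseteq> elts r -->
			 (\<exists>r'\<in>elts P. elts r \<subseteq> elts r' \<and> (\<exists>n'\<in>elts n. pair r' \<rho>' \<in> elts (feq P t n'))))) \<and>
		(\<forall>n'\<in>elts n. \<forall>r\<in>elts P. elts p \<subseteq> elts r -->
			 (\<exists>r'\<in>elts P. elts r \<subseteq> elts r' \<and> (\<exists>\<rho>' q. pair \<rho>' q \<in> elts \<rho> \<and> elts q \<subseteq> elts r' \<and> pair r' \<rho>' \<in> elts (feq P t n'))))"
proof -
	have e: "feq P t n = fstep P t n (lam n (feq P t))"
		unfolding feq_def by (rule trec[OF dft_fstep n])
	have a: "ap (lam n (feq P t)) n' = feq P t n'" if "n' \<in> elts n" for n'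
		by (rule ap_lam[OF _ that]) (intro df)
	define h where "h = lam n (feq P t)"
	have a: "ap h n' = feq P t n'" if "n' \<in> elts n" for n' unfolding h_def by (rule a[OF that])
	have "elts (fstep P t n h) = {x \<in> elts (prd P t). \<exists>p \<rho>. x = pair p \<rho> \<and>
		(\<forall>\<rho>' q. pair \<rho>' q \<in> elts \<rho> --> (\<forall>r\<in>elts P. elts p \<subseteq> elts r \<and> elts q \<subseteq> elts r -->
			 (\<exists>r'\<in>elts P. elts r \<subseteq> elts r' \<and> (\<exists>n'\<in>elts n. pair r' \<rho>' \<in> elts (ap h n'))))) \<and>
		(\<forall>n'\<in>elts n. \<forall>r\<in>elts P. elts p \<subseteq> elts r -->
			 (\<exists>r'\<in>elts P. elts r \<subseteq> elts r' \<and> (\<exists>\<rho>' q. pair \<rho>' q \<in> elts \<rho> \<and> elts q \<subseteq> elts r' \<and> pair r' \<rho>' \<in> elts (ap h n'))))}"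
		unfolding fstep_def by (rule sepI) (intro df)
	then show ?thesis unfolding e h_def[symmetric] by (simp add: a cong: bex_cong ball_cong)
qed

lemma feq_mono:
	assumes n: "Ord n" and a: "pair p \<rho> \<in> elts (feq P t n)" and p': "p' \<in> elts P" and le: "elts p \<subseteq> elts p'"
	shows "pair p' \<rho> \<in> elts (feq P t n)"
proof -
	note a = a[unfolded feq_iff[OF n]]
	note a1 = a[THEN conjunct2, THEN conjunct2, THEN conjunct1]
	note a2 = a[THEN conjunct2, THEN conjunct2, THEN conjunct2]
	show ?thesis unfolding feq_iff[OF n]
	proof (intro conjI allI impI ballI)
		show "p' \<in> elts P" "\<rho> \<in> elts t" using p' a by blast+
		show "\<exists>r'\<in>elts P. elts r \<subseteq> elts r' \<and> (\<exists>n'\<in>elts n. pair r' \<rho>' \<in> elts (feq P t n'))"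
			if "pair \<rho>' q \<in> elts \<rho>" "r \<in> elts P" "elts p' \<subseteq> elts r \<and> elts q \<subseteq> elts r" for \<rho>' q r
			using a1[rule_format, OF that(1,2)] that(3) le by blast
		show "\<exists>r'\<in>elts P. elts r \<subseteq> elts r' \<and> (\<exists>\<rho>' q. pair \<rho>' q \<in> elts \<rho> \<and> elts q \<subseteq> elts r' \<and> pair r' \<rho>' \<in> elts (feq P t n'))"
			if "n' \<in> elts n" "r \<in> elts P" "elts p' \<subseteq> elts r" for n' r
			using a2[rule_format, OF that(1,2)] that(3) le by blast
	qed
qed

end

locale gext = zf_embedding M N j
	for M :: "'v => 'v => bool" and N :: "'w => 'w => bool" and j :: "'v => 'w" +
	fixes P :: 'v and G :: "'v set" and g :: 'w
	assumes generic: "M.generic_filter P M.rev_incl G" and elts_g: "N.elts g = j ` G"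
		and names: "\<exists>\<tau>. M.forcing_name P \<tau> \<and> N.name_value g (j \<tau>) w"
begin

lemma G_P: "p \<in> G ==> p \<in> M.elts P"
	using generic unfolding M.generic_filter_def by blast
lemma G_up: "p \<in> G ==> q \<in> M.elts P ==> M.elts q \<subseteq> M.elts p ==> q \<in> G"
	using generic unfolding M.generic_filter_def M.rev_incl_def by blast
lemma G_dir: "p \<in> G ==> q \<in> G ==> \<exists>r\<in>G. M.elts p \<subseteq> M.elts r \<and> M.elts q \<subseteq> M.elts r"
	using generic unfolding M.generic_filter_def M.rev_incl_def by blast

text \<open>Density below a condition \<open>r\<close> of the filter. Conditions incompatible with
  \<open>r\<close> are added to obtain a dense set, and two conditions of the filter are never
  incompatible.\<close>

lemma G_meets:
	assumes r: "r \<in> G" and D: "M.dfn (\<lambda>s. D (s 0))"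
		and dense: "\<And>p. p \<in> M.elts P ==> M.elts r \<subseteq> M.elts p ==> \<exists>d\<in>M.elts P. M.elts p \<subseteq> M.elts d \<and> D d"
	shows "\<exists>d\<in>G. D d"
proof -
	define A where "A = M.setof {d \<in> M.elts P. D d \<or> \<not> (\<exists>x\<in>M.elts P. M.elts d \<subseteq> M.elts x \<and> M.elts r \<subseteq> M.elts x)}"
	have A: "M.elts A = {d \<in> M.elts P. D d \<or> \<not> (\<exists>x\<in>M.elts P. M.elts d \<subseteq> M.elts x \<and> M.elts r \<subseteq> M.elts x)}"
		unfolding A_def by (rule M.sepI) (intro M.df D)
	have "\<exists>d\<in>M.elts A. M.elts p \<subseteq> M.elts d" if p: "p \<in> M.elts P" for p
	proof (cases "\<exists>x\<in>M.elts P. M.elts p \<subseteq> M.elts x \<and> M.elts r \<subseteq> M.elts x")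
		case True
		then obtain x where "x \<in> M.elts P" "M.elts p \<subseteq> M.elts x" "M.elts r \<subseteq> M.elts x" by blast
		then show ?thesis unfolding A using dense[of x] by blast
	next
		case False
		then show ?thesis unfolding A using p by blast
	qed
	then have "M.dense_in P M.rev_incl A" unfolding M.dense_in_def M.rev_incl_def A by blast
	then obtain d where d: "d \<in> G" "d \<in> M.elts A" using generic unfolding M.generic_filter_def by blast
	then show ?thesis using G_dir[OF d(1) r] G_P unfolding A by blast
qed

text \<open>\<open>B\<close> is a simplified name for the numbers in \<open>S\<close>: pairs of a
  condition and a number that it puts into \<open>S\<close>, closed under stronger conditions. The
  truth lemma for \<open>feq\<close> is proved on the way.\<close>

lemma name_omega:
	"\<exists>B. (\<forall>p n. M.pair p n \<in> M.elts B --> p \<in> M.elts P \<and> n \<in> M.elts M.omega \<and>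
					(\<forall>p'\<in>M.elts P. M.elts p \<subseteq> M.elts p' --> M.pair p' n \<in> M.elts B)) \<and>
			 (\<forall>n\<in>M.elts M.omega. j n \<in> N.elts S \<longleftrightarrow> (\<exists>p\<in>G. M.pair p n \<in> M.elts B))"
proof -
	obtain \<tau> where tau: "M.forcing_name P \<tau>" "N.name_value g (j \<tau>) S" using names by blast
	obtain t where t: "\<tau> \<in> M.elts t" "\<forall>\<sigma>\<in>M.elts t. \<forall>x\<in>M.elts \<sigma>. \<exists>\<rho>\<in>M.elts t. \<exists>p\<in>M.elts P. x = M.pair \<rho> p"
		using tau(1) unfolding M.forcing_name_def by blast
	obtain e t' where e: "N.func_on e t'" "j \<tau> \<in> N.elts t'" "N.app e (j \<tau>) = S"
		and et: "\<forall>\<sigma>\<in>N.elts t'. (\<forall>\<rho>. \<forall>p\<in>N.elts g. N.pair \<rho> p \<in> N.elts \<sigma> --> \<rho> \<in> N.elts t') \<and>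
				N.elts (N.app e \<sigma>) = {N.app e \<rho> |\<rho>. \<exists>p\<in>N.elts g. N.pair \<rho> p \<in> N.elts \<sigma>}"
		using tau(2) unfolding N.name_value_def by blast
	define vl where "vl \<rho> = N.ap e (j \<rho>)" for \<rho>
	\<comment> \<open>The names for which the given evaluation \<open>e\<close> computes a value. They
	  include \<open>\<tau>\<close> and, by \<open>tT\<close>, all names that matter for its
	  value.\<close>
	define T where "T = {\<rho> \<in> M.elts t. j \<rho> \<in> N.elts t'}"
	have appv: "N.app e (j \<rho>) = vl \<rho>" if "\<rho> \<in> T" for \<rho>
		unfolding vl_def by (rule N.app_eq[OF e(1)]) (use that T_def in blast)
	have tT: "\<rho> \<in> T" "q \<in> M.elts P" if "\<sigma> \<in> T" "M.pair \<rho> q \<in> M.elts \<sigma>" "q \<in> G" for \<sigma> \<rho> q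
	proof -
		have "M.pair \<rho> q \<in> M.elts \<sigma> ==> \<rho> \<in> M.elts t \<and> q \<in> M.elts P" using t(2) that(1) unfolding T_def by force
		moreover have "N.pair (j \<rho>) (j q) \<in> N.elts (j \<sigma>)" "j q \<in> N.elts g" using that(2,3) by (simp_all add: elts_g)
		ultimately show "\<rho> \<in> T" "q \<in> M.elts P" using that et unfolding T_def by blast+
	qed
	have vlT: "z \<in> N.elts (vl \<sigma>) \<longleftrightarrow> (\<exists>\<rho> q. \<rho> \<in> T \<and> q \<in> G \<and> M.pair \<rho> q \<in> M.elts \<sigma> \<and> z = vl \<rho>)" if s: "\<sigma> \<in> T" for z \<sigma>
	proof -
		have "N.elts (vl \<sigma>) = {N.app e \<rho> |\<rho>. \<exists>p\<in>N.elts g. N.pair \<rho> p \<in> N.elts (j \<sigma>)}"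
		proof -
			have "j \<sigma> \<in> N.elts t'" using s unfolding T_def by blast
			from et[rule_format, OF this, THEN conjunct2] show ?thesis unfolding appv[OF s] .
		qed
		also have "\<dots> = {N.app e (j \<rho>) |\<rho>. \<exists>p\<in>G. M.pair \<rho> p \<in> M.elts \<sigma>}"
			unfolding elts_g elts_j by (auto simp: pair_in_j)
		finally show ?thesis using tT[OF s] appv by force
	qed
	have tauT: "\<tau> \<in> T" using t(1) e(2) unfolding T_def by simp
	have Pq: "q \<in> M.elts P" if "\<sigma> \<in> M.elts t" "M.pair \<rho> q \<in> M.elts \<sigma>" for \<sigma> \<rho> q using t(2) that by force
	define E where "E = M.feq P t"
	define F where "F = M.lam M.omega E"
	have dE: "M.dft (\<lambda>s. E (u s))" if "M.dft u" for u unfolding E_def by (intro M.df that)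
	have apF: "N.ap (j F) (j n) = j (E n)" if "n \<in> M.elts M.omega" for n
		unfolding j_ap F_def using M.ap_lam[OF dE[OF M.dft_var] that] by simp
	note E_iff = M.feq_iff[of _ _ _ P t, folded E_def] and E_mono = M.feq_mono[of _ _ _ P t, folded E_def]
	have truth: "vl \<rho> = j n \<longleftrightarrow> (\<exists>p\<in>G. M.pair p \<rho> \<in> M.elts (E n))"
		if n: "n \<in> M.elts M.omega" and r: "\<rho> \<in> T" for n \<rho>
	proof -
		\<comment> \<open>The induction on \<open>n\<close> takes place in \<open>N\<close>, so its
		  statement must be first-order there: the names enter through the set \<open>j t\<close>, and the
		  forcing relation through the function \<open>F\<close> of the ground model.\<close>
		define Q where "Q z \<longleftrightarrow> (z \<in> N.elts N.omega --> (\<forall>\<rho>\<in>N.elts (j t). \<rho> \<in> N.elts t' -->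
				(N.ap e \<rho> = z \<longleftrightarrow> (\<exists>p\<in>N.elts g. N.pair p \<rho> \<in> N.elts (N.ap (j F) z)))))" for z
		have Q_iff: "Q (j n) \<longleftrightarrow> (\<forall>\<rho>\<in>T. vl \<rho> = j n \<longleftrightarrow> (\<exists>p\<in>G. M.pair p \<rho> \<in> M.elts (E n)))" if "n \<in> M.elts M.omega" for n
			unfolding Q_def apF[OF that] using that by (auto simp: T_def vl_def elts_g)
		have "Q (j n)"
		proof (rule N.Ord_induct[where Q = Q])
			show "N.dfn (\<lambda>s. Q (s 0))" unfolding Q_def by (intro N.df)
			show "N.Ord (j n)" using M.Ord_nat[OF n] by simp
			fix z assume IH: "\<And>b. b \<in> N.elts z ==> Q b"
			show "Q z"
			proof (cases "z \<in> N.elts N.omega")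
				case False then show ?thesis unfolding Q_def by simp
			next
				case True
				then obtain m where m: "m \<in> M.elts M.omega" "z = j m" by (auto simp: elts_omega_j)
				have om: "M.Ord m" by (rule M.Ord_nat[OF m(1)])
				have on: "M.Ord n'" "n' \<in> M.elts M.omega" if "n' \<in> M.elts m" for n'
					using M.Ord_in[OF om that] M.trans_omega[OF m(1) that] .
				have IH': "vl \<rho> = j n' \<longleftrightarrow> (\<exists>p\<in>G. M.pair p \<rho> \<in> M.elts (E n'))" if "n' \<in> M.elts m" "\<rho> \<in> T" for n' \<rho>
					using IH[of "j n'"] Q_iff[OF on(2)[OF that(1)]] that m(2) by simp
				have "vl \<rho> = j m \<longleftrightarrow> (\<exists>p\<in>G. M.pair p \<rho> \<in> M.elts (E m))" if r: "\<rho> \<in> T" for \<rho>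
				proof
					assume "\<exists>p\<in>G. M.pair p \<rho> \<in> M.elts (E m)"
					then obtain p where p: "p \<in> G" "M.pair p \<rho> \<in> M.elts (E m)" by blast
					show "vl \<rho> = j m"
					proof (rule N.elts_inject, intro equalityI subsetI)
						fix z assume "z \<in> N.elts (vl \<rho>)"
						then obtain \<rho>' q where q: "\<rho>' \<in> T" "q \<in> G" "M.pair \<rho>' q \<in> M.elts \<rho>" "z = vl \<rho>'" using vlT[OF r] by blast
						obtain r0 where r0: "r0 \<in> G" "M.elts p \<subseteq> M.elts r0" "M.elts q \<subseteq> M.elts r0" using G_dir[OF p(1) q(2)] by blast
						have "\<exists>d\<in>G. \<exists>n'\<in>M.elts m. M.pair d \<rho>' \<in> M.elts (E n')"
						proof (rule G_meets[OF r0(1)])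
							show "M.dfn (\<lambda>s. \<exists>n'\<in>M.elts m. M.pair (s 0) \<rho>' \<in> M.elts (E n'))" by (intro M.df dE)
							fix p' assume p': "p' \<in> M.elts P" "M.elts r0 \<subseteq> M.elts p'"
							have "\<forall>r\<in>M.elts P. M.elts p \<subseteq> M.elts r \<and> M.elts q \<subseteq> M.elts r -->
								 (\<exists>r'\<in>M.elts P. M.elts r \<subseteq> M.elts r' \<and> (\<exists>n'\<in>M.elts m. M.pair r' \<rho>' \<in> M.elts (E n')))"
								using p(2)[unfolded E_iff[OF om]] q(3) by blast
							then show "\<exists>d\<in>M.elts P. M.elts p' \<subseteq> M.elts d \<and> (\<exists>n'\<in>M.elts m. M.pair d \<rho>' \<in> M.elts (E n'))"
								using p' r0(2,3) by blast
						qed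
						then show "z \<in> N.elts (j m)" using IH' q by auto
					next
						fix z assume "z \<in> N.elts (j m)"
						then obtain n' where n': "n' \<in> M.elts m" "z = j n'" by auto
						have "\<exists>d\<in>G. \<exists>\<rho>' q. M.pair \<rho>' q \<in> M.elts \<rho> \<and> M.elts q \<subseteq> M.elts d \<and> M.pair d \<rho>' \<in> M.elts (E n')"
						proof (rule G_meets[OF p(1)])
							show "M.dfn (\<lambda>s. \<exists>\<rho>' q. M.pair \<rho>' q \<in> M.elts \<rho> \<and> M.elts q \<subseteq> M.elts (s 0) \<and> M.pair (s 0) \<rho>' \<in> M.elts (E n'))"
								by (intro M.df dE)
						qed (use p(2)[unfolded E_iff[OF om]] n'(1) in blast)
						then obtain d \<rho>' q where d: "d \<in> G" "M.pair \<rho>' q \<in> M.elts \<rho>" "M.elts q \<subseteq> M.elts d" "M.pair d \<rho>' \<in> M.elts (E n')"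
							by blast
						have qG: "q \<in> G" by (rule G_up[OF d(1) Pq d(3)]) (use r d(2) in \<open>auto simp: T_def\<close>)
						have "\<rho>' \<in> T" by (rule tT(1)[OF r d(2) qG])
						moreover have "vl \<rho>' = j n'" using IH'[OF n'(1) \<open>\<rho>' \<in> T\<close>] d by blast
						ultimately show "z \<in> N.elts (vl \<rho>)" unfolding vlT[OF r] using qG d(2) n'(2) by metis
					qed
				next
					assume v: "vl \<rho> = j m"
					\<comment> \<open>\<open>D1\<close> and \<open>D2\<close> say that the condition itself refutes
					  one of the two clauses of \<open>feq_iff\<close>. Below any condition there is one that
					  forces the equation or refutes it in this strong sense.\<close>
					define D1 where "D1 p \<longleftrightarrow> (\<exists>\<rho>' q. M.pair \<rho>' q \<in> M.elts \<rho> \<and> M.elts q \<subseteq> M.elts p \<and>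
						\<not> (\<exists>r'\<in>M.elts P. M.elts p \<subseteq> M.elts r' \<and> (\<exists>n'\<in>M.elts m. M.pair r' \<rho>' \<in> M.elts (E n'))))" for p
					define D2 where "D2 p \<longleftrightarrow> (\<exists>n'\<in>M.elts m. \<not> (\<exists>r'\<in>M.elts P. M.elts p \<subseteq> M.elts r' \<and>
						(\<exists>\<rho>' q. M.pair \<rho>' q \<in> M.elts \<rho> \<and> M.elts q \<subseteq> M.elts r' \<and> M.pair r' \<rho>' \<in> M.elts (E n'))))" for p
					obtain p0 where p0: "p0 \<in> G" using generic unfolding M.generic_filter_def by blast
					have "\<exists>d\<in>G. M.pair d \<rho> \<in> M.elts (E m) \<or> D1 d \<or> D2 d"
					proof (rule G_meets[OF p0])
						show "M.dfn (\<lambda>s. M.pair (s 0) \<rho> \<in> M.elts (E m) \<or> D1 (s 0) \<or> D2 (s 0))"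
							unfolding D1_def D2_def by (intro M.df dE)
						fix p assume p: "p \<in> M.elts P"
						show "\<exists>d\<in>M.elts P. M.elts p \<subseteq> M.elts d \<and> (M.pair d \<rho> \<in> M.elts (E m) \<or> D1 d \<or> D2 d)"
						proof (cases "M.pair p \<rho> \<in> M.elts (E m)")
							case True then show ?thesis using p by blast
						next
							case False
							have rt: "\<rho> \<in> M.elts t" using r unfolding T_def by blast
							consider \<rho>' q r0 where "M.pair \<rho>' q \<in> M.elts \<rho>" "r0 \<in> M.elts P" "M.elts p \<subseteq> M.elts r0" "M.elts q \<subseteq> M.elts r0"
									"\<not> (\<exists>r'\<in>M.elts P. M.elts r0 \<subseteq> M.elts r' \<and> (\<exists>n'\<in>M.elts m. M.pair r' \<rho>' \<in> M.elts (E n')))"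
								| n' r0 where "n' \<in> M.elts m" "r0 \<in> M.elts P" "M.elts p \<subseteq> M.elts r0"
									"\<not> (\<exists>r'\<in>M.elts P. M.elts r0 \<subseteq> M.elts r' \<and>
						(\<exists>\<rho>' q. M.pair \<rho>' q \<in> M.elts \<rho> \<and> M.elts q \<subseteq> M.elts r' \<and> M.pair r' \<rho>' \<in> M.elts (E n')))"
								using False[unfolded E_iff[OF om]] p rt by blast
							then show ?thesis
							proof cases
								case (1 \<rho>' q r0)
								have "D1 r0" unfolding D1_def using 1(1,4,5) by blast
								then show ?thesis using 1(2,3) by blast
							next
								case (2 n' r0)
								have "D2 r0" unfolding D2_def using 2(1,4) by blast
								then show ?thesis using 2(2,3) by blast
							qed
						qed
					qed
					then obtain d where d: "d \<in> G" "M.pair d \<rho> \<in> M.elts (E m) \<or> D1 d \<or> D2 d" by blast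
					have "\<not> D1 d"
					proof
						assume "D1 d"
						then obtain \<rho>' q where q: "M.pair \<rho>' q \<in> M.elts \<rho>" "M.elts q \<subseteq> M.elts d"
							"\<not> (\<exists>r'\<in>M.elts P. M.elts d \<subseteq> M.elts r' \<and> (\<exists>n'\<in>M.elts m. M.pair r' \<rho>' \<in> M.elts (E n')))"
							unfolding D1_def by blast
						have qG: "q \<in> G" by (rule G_up[OF d(1) Pq q(2)]) (use r q(1) in \<open>auto simp: T_def\<close>)
						have T': "\<rho>' \<in> T" by (rule tT(1)[OF r q(1) qG])
						have "vl \<rho>' \<in> N.elts (j m)" unfolding v[symmetric] vlT[OF r] using q(1) qG T' by blast
						then obtain n' where n': "n' \<in> M.elts m" "vl \<rho>' = j n'" by auto
						then obtain p' where p': "p' \<in> G" "M.pair p' \<rho>' \<in> M.elts (E n')" using IH'[OF n'(1) T'] by blast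
						obtain r' where r': "r' \<in> G" "M.elts d \<subseteq> M.elts r'" "M.elts p' \<subseteq> M.elts r'" using G_dir[OF d(1) p'(1)] by blast
						then show False using q(3) n'(1) E_mono[OF on(1)[OF n'(1)] p'(2) G_P[OF r'(1)] r'(3)] G_P by blast
					qed
					moreover have "\<not> D2 d"
					proof
						assume "D2 d"
						then obtain n' where n': "n' \<in> M.elts m" and no: "\<not> (\<exists>r'\<in>M.elts P. M.elts d \<subseteq> M.elts r' \<and>
						(\<exists>\<rho>' q. M.pair \<rho>' q \<in> M.elts \<rho> \<and> M.elts q \<subseteq> M.elts r' \<and> M.pair r' \<rho>' \<in> M.elts (E n')))"
							unfolding D2_def by blast
						have "j n' \<in> N.elts (vl \<rho>)" unfolding v using n' by simp
						then obtain \<rho>' q where q: "\<rho>' \<in> T" "q \<in> G" "M.pair \<rho>' q \<in> M.elts \<rho>" "vl \<rho>' = j n'" using vlT[OF r] by metis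
						then obtain p' where p': "p' \<in> G" "M.pair p' \<rho>' \<in> M.elts (E n')" using IH'[OF n' q(1)] by blast
						obtain r1 where r1: "r1 \<in> G" "M.elts d \<subseteq> M.elts r1" "M.elts p' \<subseteq> M.elts r1" using G_dir[OF d(1) p'(1)] by blast
						obtain r' where r': "r' \<in> G" "M.elts r1 \<subseteq> M.elts r'" "M.elts q \<subseteq> M.elts r'" using G_dir[OF r1(1) q(2)] by blast
						have "M.pair r' \<rho>' \<in> M.elts (E n')"
							by (rule E_mono[OF on(1)[OF n'] p'(2) G_P[OF r'(1)]]) (use r'(2) r1(3) in blast)
						then show False using no q(3) r' r1(2) G_P by blast
					qed
					ultimately show "\<exists>p\<in>G. M.pair p \<rho> \<in> M.elts (E m)" using d by blast
				qed
				then show ?thesis unfolding m(2) Q_iff[OF m(1)] by blast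
			qed
		qed
		then show ?thesis unfolding Q_iff[OF n] using r by blast
	qed
	define B where "B = M.setof {x \<in> M.elts (M.prd P M.omega). \<exists>p n \<rho> q. x = M.pair p n \<and>
		 M.pair \<rho> q \<in> M.elts \<tau> \<and> M.elts q \<subseteq> M.elts p \<and> M.pair p \<rho> \<in> M.elts (E n)}"
	have eB: "M.elts B = {x \<in> M.elts (M.prd P M.omega). \<exists>p n \<rho> q. x = M.pair p n \<and>
		 M.pair \<rho> q \<in> M.elts \<tau> \<and> M.elts q \<subseteq> M.elts p \<and> M.pair p \<rho> \<in> M.elts (E n)}"
		unfolding B_def by (rule M.sepI) (intro M.df dE)
	have B: "M.pair p n \<in> M.elts B \<longleftrightarrow> p \<in> M.elts P \<and> n \<in> M.elts M.omega \<and>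
			(\<exists>\<rho> q. M.pair \<rho> q \<in> M.elts \<tau> \<and> M.elts q \<subseteq> M.elts p \<and> M.pair p \<rho> \<in> M.elts (E n))" for p n
		unfolding eB by simp
	show ?thesis
	proof (intro exI[of _ B] conjI allI impI ballI)
		fix p n assume pn: "M.pair p n \<in> M.elts B"
		then show "p \<in> M.elts P" "n \<in> M.elts M.omega" unfolding B by blast+
		fix p' assume "p' \<in> M.elts P" "M.elts p \<subseteq> M.elts p'"
		then show "M.pair p' n \<in> M.elts B" using pn E_mono[OF M.Ord_nat] unfolding B by blast
	next
		fix n assume n: "n \<in> M.elts M.omega"
		have S: "S = vl \<tau>" using e(3) appv[OF tauT] by simp
		show "j n \<in> N.elts S \<longleftrightarrow> (\<exists>p\<in>G. M.pair p n \<in> M.elts B)"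
		proof
			assume "j n \<in> N.elts S"
			then obtain \<rho> q where q: "\<rho> \<in> T" "q \<in> G" "M.pair \<rho> q \<in> M.elts \<tau>" "vl \<rho> = j n"
				unfolding S vlT[OF tauT] by metis
			then obtain p where p: "p \<in> G" "M.pair p \<rho> \<in> M.elts (E n)" using truth[OF n q(1)] by blast
			obtain r where r: "r \<in> G" "M.elts p \<subseteq> M.elts r" "M.elts q \<subseteq> M.elts r" using G_dir[OF p(1) q(2)] by blast
			have "M.pair r n \<in> M.elts B" unfolding B
				using n q(3) r G_P E_mono[OF M.Ord_nat[OF n] p(2) G_P[OF r(1)] r(2)] by blast
			then show "\<exists>p\<in>G. M.pair p n \<in> M.elts B" using r(1) by blast
		next
			assume "\<exists>p\<in>G. M.pair p n \<in> M.elts B"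
			then obtain p \<rho> q where p: "p \<in> G" "M.pair \<rho> q \<in> M.elts \<tau>" "M.elts q \<subseteq> M.elts p" "M.pair p \<rho> \<in> M.elts (E n)"
				unfolding B by blast
			have qG: "q \<in> G" by (rule G_up[OF p(1) Pq[OF t(1) p(2)] p(3)])
			have T': "\<rho> \<in> T" by (rule tT(1)[OF tauT p(2) qG])
			have "vl \<rho> = j n" using truth[OF n T'] p by blast
			then show "j n \<in> N.elts S" unfolding S vlT[OF tauT] using p(2) qG T' by metis
		qed
	qed
qed

end

section \<open>No new sets of natural numbers\<close>

context zf
begin

definition enum :: "'v => 'v => bool" where
	"enum c A \<longleftrightarrow> func c A omega \<and> (\<forall>x\<in>elts A. \<forall>y\<in>elts A. ap c x = ap c y --> x = y)"

lemma enum_omega: "enum (lam omega (\<lambda>n. n)) omega"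
proof -
	have d: "dft (\<lambda>s. s 0)" by (intro df)
	show ?thesis unfolding enum_def using func_lam[OF d, of omega omega] ap_lam[OF d] by simp
qed

lemma enum_finseq: "enum (lam (finseq omega) code) (finseq omega)"
proof -
	have d: "dft (\<lambda>s. code (s 0))" by (intro df)
	show ?thesis unfolding enum_def
		using func_lam[OF d, of "finseq omega" omega] ap_lam[OF d] code_omega code_inject by simp
qed

lemma enum_prd:
	assumes c: "enum c A" and d: "enum d B"
	shows "\<exists>e. enum e (prd A B)"
proof -
	define F where "F x = setof {z \<in> elts omega. \<exists>a b. x = pair a b \<and> z \<in> elts (pr (ap c a) (ap d b))}" for x
	have dF: "dft (\<lambda>s. F (s 0))" unfolding F_def by (intro df)
	have cd: "ap c a \<in> elts omega" "ap d b \<in> elts omega" if "a \<in> elts A" "b \<in> elts B" for a b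
		using c d that func_ap unfolding enum_def by blast+
	have F: "F (pair a b) = pr (ap c a) (ap d b)" if "a \<in> elts A" "b \<in> elts B" for a b
	proof (rule elts_inject)
		have "elts (F (pair a b)) = {z \<in> elts omega. \<exists>a' b'. pair a b = pair a' b' \<and> z \<in> elts (pr (ap c a') (ap d b'))}"
			unfolding F_def by (rule sepI) (intro df)
		moreover have "elts (pr (ap c a) (ap d b)) \<subseteq> elts omega" by (rule omega_subset) (use cd[OF that] in simp)
		ultimately show "elts (F (pair a b)) = elts (pr (ap c a) (ap d b))" by auto
	qed
	have "enum (lam (prd A B) F) (prd A B)"
		unfolding enum_def
	proof (intro conjI ballI impI)
		show "func (lam (prd A B) F) (prd A B) omega"
		proof (rule func_lam[OF dF])
			fix x assume "x \<in> elts (prd A B)"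
			then obtain a b where "a \<in> elts A" "b \<in> elts B" "x = pair a b" unfolding elts_prd by blast
			then show "F x \<in> elts omega" using F cd by simp
		qed
		fix x y assume xy: "x \<in> elts (prd A B)" "y \<in> elts (prd A B)" "ap (lam (prd A B) F) x = ap (lam (prd A B) F) y"
		obtain a b where a: "a \<in> elts A" "b \<in> elts B" "x = pair a b" using xy(1) unfolding elts_prd by blast
		obtain a' b' where a': "a' \<in> elts A" "b' \<in> elts B" "y = pair a' b'" using xy(2) unfolding elts_prd by blast
		have "F x = F y" using xy(3) unfolding ap_lam[OF dF xy(1)] ap_lam[OF dF xy(2)] .
		then have "ap c a = ap c a'" "ap d b = ap d b'"
			unfolding a(3) a'(3) F[OF a(1,2)] F[OF a'(1,2)] pr_inject[OF cd[OF a(1,2)] cd[OF a'(1,2)]] by auto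
		then show "x = y" using c d a a' unfolding enum_def by blast
	qed
	then show ?thesis by blast
qed

end

context gext
begin

text \<open>If \<open>S\<close> is decoded from three old reals, these are unbounded, so the
  decoding can be carried out in the ground model; by absoluteness and uniqueness it yields
  \<open>S\<close>. If the old reals are dominated, then \<open>H\<close> dominates them in the
  ground model, against \<open>no_dominating_family\<close>.\<close>

theorem subset_omega_in_range:
	assumes MAD: "M.AD" and NAD: "N.AD" and CHP: "M.CH P" and S: "N.elts S \<subseteq> N.elts N.omega"
	shows "S \<in> range j"
proof -
	have C: "N.elts (j M.reals) \<subseteq> N.elts N.reals" by auto
	from N.dominated_or_decodes[OF NAD C] show ?thesis
	proof
		assume "\<forall>w. \<exists>x\<in>N.elts (j M.reals). \<exists>y\<in>N.elts (j M.reals). \<exists>z\<in>N.elts (j M.reals). \<exists>R0\<in>N.elts N.omega. N.decodes x y z R0 w"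
		then obtain x y z R0 where xyz: "x \<in> M.elts M.reals" "y \<in> M.elts M.reals" "z \<in> M.elts M.reals" "R0 \<in> M.elts M.omega"
			and d: "N.decodes (j x) (j y) (j z) (j R0) S" unfolding elts_j elts_omega_j by blast
		have nR: "j x \<in> N.elts N.reals" "j y \<in> N.elts N.reals" "j z \<in> N.elts N.reals" "j R0 \<in> N.elts N.omega"
			using xyz by simp_all
		have tr: "\<exists>i\<in>M.elts M.omega. K \<in> M.elts (M.ap x i)" if "\<exists>i\<in>N.elts N.omega. j K \<in> N.elts (N.ap (j x) i)" for K x
			using that unfolding elts_omega_j by auto
		have u: "\<exists>i\<in>M.elts M.omega. K \<in> M.elts (M.ap x i)" "\<exists>i\<in>M.elts M.omega. K \<in> M.elts (M.ap y i)"
			"\<exists>i\<in>M.elts M.omega. K \<in> M.elts (M.ap z i)" if "K \<in> M.elts M.omega" for K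
			using tr N.decodes_unbounded[OF nR d, of "j K"] that by auto
		obtain w where w: "M.elts w \<subseteq> M.elts M.omega" "M.decodes x y z R0 w"
			using M.decodes_exists[OF xyz] u by blast
		have "j w = S"
			by (rule N.decodes_unique[OF decodes_j[OF w(2)] d _ S]) (use w(1) in \<open>auto simp: elts_omega_j\<close>)
		then show ?thesis by auto
	next
		assume "N.dominated (j M.reals)"
		then obtain B where B: "N.func B (N.finseq N.omega) N.reals"
			"\<forall>v\<in>N.elts (j M.reals). \<exists>t\<in>N.elts (N.finseq N.omega). \<forall>m\<in>N.elts N.omega. N.elts (N.ap v m) \<subseteq> N.elts (N.ap (N.ap B t) m)"
			unfolding N.dominated_def by blast
		obtain c1 where c1: "M.enum c1 (M.prd M.omega M.omega)" using M.enum_prd[OF M.enum_omega M.enum_omega] by blast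
		obtain c where c: "M.enum c (M.prd (M.finseq M.omega) (M.prd M.omega M.omega))"
			using M.enum_prd[OF M.enum_finseq c1] by blast
		define cd where "cd t m k = M.ap c (M.pair t (M.pair m k))" for t m k
		have cd_omega: "cd t m k \<in> M.elts M.omega"
			if "t \<in> M.elts (M.finseq M.omega)" "m \<in> M.elts M.omega" "k \<in> M.elts M.omega" for t m k
			unfolding cd_def by (rule M.func_ap[where a = "M.prd (M.finseq M.omega) (M.prd M.omega M.omega)"])
				(use c that in \<open>simp_all add: M.enum_def\<close>)
		have cd_inj: "t = t' \<and> m = m' \<and> k = k'" if "cd t m k = cd t' m' k'"
			"t \<in> M.elts (M.finseq M.omega)" "m \<in> M.elts M.omega" "k \<in> M.elts M.omega"
			"t' \<in> M.elts (M.finseq M.omega)" "m' \<in> M.elts M.omega" "k' \<in> M.elts M.omega" for t m k t' m' k'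
		proof -
			have "M.pair t (M.pair m k) = M.pair t' (M.pair m' k')"
				using c that unfolding M.enum_def cd_def by (metis M.pair_in_prd)
			then show ?thesis by simp
		qed
		\<comment> \<open>The graph of the dominating family as a set of numbers. It is coded by an
		  enumeration from the ground model, so that \<open>name_omega\<close> describes the family
		  there.\<close>
		define W where "W = N.setof {n \<in> N.elts N.omega. \<exists>t\<in>N.elts (N.finseq N.omega). \<exists>m\<in>N.elts N.omega. \<exists>k\<in>N.elts N.omega.
			 n = N.ap (j c) (N.pair t (N.pair m k)) \<and> N.ap (N.ap B t) m = k}"
		have W: "N.elts W = {n \<in> N.elts N.omega. \<exists>t\<in>N.elts (N.finseq N.omega). \<exists>m\<in>N.elts N.omega. \<exists>k\<in>N.elts N.omega.
			 n = N.ap (j c) (N.pair t (N.pair m k)) \<and> N.ap (N.ap B t) m = k}"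
			unfolding W_def by (rule N.sepI) (intro N.df)
		obtain D where D1: "\<forall>p n. M.pair p n \<in> M.elts D --> p \<in> M.elts P \<and> n \<in> M.elts M.omega \<and>
					(\<forall>p'\<in>M.elts P. M.elts p \<subseteq> M.elts p' --> M.pair p' n \<in> M.elts D)"
			and D2: "\<forall>n\<in>M.elts M.omega. j n \<in> N.elts W \<longleftrightarrow> (\<exists>p\<in>G. M.pair p n \<in> M.elts D)"
			using name_omega[of W] by blast
		have val: "N.ap (N.ap B (j t)) (j m) = j k \<longleftrightarrow> (\<exists>p\<in>G. M.pair p (cd t m k) \<in> M.elts D)"
			if tmk: "t \<in> M.elts (M.finseq M.omega)" "m \<in> M.elts M.omega" "k \<in> M.elts M.omega" for t m k
		proof -
			have jc: "N.ap (j c) (N.pair (j t) (N.pair (j m) (j k))) = j (cd t m k)" for t m k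
				unfolding cd_def j_pair[symmetric] j_ap ..
			have "j (cd t m k) \<in> N.elts W \<longleftrightarrow> N.ap (N.ap B (j t)) (j m) = j k"
			proof
				assume "j (cd t m k) \<in> N.elts W"
				then obtain t' m' k' where t': "t' \<in> M.elts (M.finseq M.omega)" "m' \<in> M.elts M.omega" "k' \<in> M.elts M.omega"
					"j (cd t m k) = N.ap (j c) (N.pair (j t') (N.pair (j m') (j k')))" "N.ap (N.ap B (j t')) (j m') = j k'"
					unfolding W in_finseq_j elts_omega_j elts_j by blast
				then have "cd t m k = cd t' m' k'" unfolding jc by simp
				then show "N.ap (N.ap B (j t)) (j m) = j k" using cd_inj[OF _ tmk t'(1-3)] t'(5) by blast
			next
				assume a: "N.ap (N.ap B (j t)) (j m) = j k"
				have "j t \<in> N.elts (N.finseq N.omega)" "j m \<in> N.elts N.omega" "j k \<in> N.elts N.omega"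
					"j (cd t m k) \<in> N.elts N.omega" using tmk cd_omega by simp_all
				then show "j (cd t m k) \<in> N.elts W" unfolding W using a jc[of t m k, symmetric] by blast
			qed
			then show ?thesis using D2 cd_omega[OF tmk] by blast
		qed
		\<comment> \<open>The values \<open>k\<close> that extensions of \<open>p\<close> allow at
		  \<open>m\<close> for the function with index \<open>t\<close>. \<open>H\<close> takes the least
		  allowed value, so no choice is involved; where nothing is allowed it is
		  \<open>zero\<close>.\<close>
		define \<Phi> where "\<Phi> x m k \<longleftrightarrow> (\<exists>p t q. x = M.pair p t \<and> q \<in> M.elts P \<and> M.elts p \<subseteq> M.elts q \<and> M.pair q (cd t m k) \<in> M.elts D)"
			for x m k
		define H where "H x = M.lam M.omega (\<lambda>m. if \<exists>k\<in>M.elts M.omega. \<Phi> x m k then M.lst M.omega (\<Phi> x m) else M.zero)" for x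
		have dcd: "M.dft (\<lambda>s. cd (t s) (m s) (k s))" if "M.dft t" "M.dft m" "M.dft k" for t m k
			unfolding cd_def by (intro M.df that)
		have dPhi: "M.dfn (\<lambda>s. \<Phi> (x s) (m s) (k s))" if "M.dft x" "M.dft m" "M.dft k" for x m k
			by (rule M.dfn_app3[where R = \<Phi>, OF _ that]) (unfold \<Phi>_def, intro M.df dcd)
		have dH: "M.dft (\<lambda>s. H (s 0))" unfolding H_def by (intro M.df dPhi)
		have dHm: "M.dft (\<lambda>s. if \<exists>k\<in>M.elts M.omega. \<Phi> x (s 0) k then M.lst M.omega (\<Phi> x (s 0)) else M.zero)" for x
			by (intro M.df dPhi)
		have lst: "M.lst M.omega (\<Phi> x m) \<in> M.elts M.omega" "\<Phi> x m (M.lst M.omega (\<Phi> x m))"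
			if ex: "\<exists>k\<in>M.elts M.omega. \<Phi> x m k" for x m
		proof -
			obtain k where k: "k \<in> M.elts M.omega" "\<Phi> x m k" using ex by blast
			have d: "M.dfn (\<lambda>s. \<Phi> x m (s 0))" by (intro dPhi M.df)
			show "M.lst M.omega (\<Phi> x m) \<in> M.elts M.omega" "\<Phi> x m (M.lst M.omega (\<Phi> x m))"
				using M.lst(1,2)[where Q = "\<Phi> x m" and a = M.omega and x = k, OF d M.Ord_omega k] .
		qed
		define I where "I = M.prd P (M.finseq M.omega)"
		have z: "M.func (M.lam I H) I M.reals"
		proof (rule M.func_lam[OF dH])
			show "H x \<in> M.elts M.reals" for x unfolding H_def
				by (rule M.real_lam[OF dHm]) (use lst in simp)
		qed
		have "M.CH I" unfolding I_def by (intro M.CH_prd CHP M.CH_finseq M.CH_Ord M.Ord_omega)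
		then obtain v where v: "v \<in> M.elts M.reals"
			"\<forall>i\<in>M.elts I. \<exists>m\<in>M.elts M.omega. \<not> M.elts (M.ap v m) \<subseteq> M.elts (M.ap (M.ap (M.lam I H) i) m)"
			using M.no_dominating_family[OF MAD _ z] by blast
		have "j v \<in> N.elts (j M.reals)" using v(1) by simp
		then obtain jt where jt: "jt \<in> N.elts (N.finseq N.omega)"
			"\<forall>m\<in>N.elts N.omega. N.elts (N.ap (j v) m) \<subseteq> N.elts (N.ap (N.ap B jt) m)" using B(2) by blast
		obtain t where t: "t \<in> M.elts (M.finseq M.omega)" "jt = j t" using jt(1) unfolding in_finseq_j elts_j by blast
		have dom: "\<exists>k\<in>M.elts M.omega. N.ap (N.ap B (j t)) (j m) = j k \<and> M.elts (M.ap v m) \<subseteq> M.elts k"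
			if m: "m \<in> M.elts M.omega" for m
		proof -
			have "N.ap (N.ap B jt) (j m) \<in> N.elts N.omega"
				using N.real_ap[OF N.func_ap[OF B(1) jt(1)], of "j m"] m by simp
			then obtain k where k: "k \<in> M.elts M.omega" "N.ap (N.ap B (j t)) (j m) = j k"
				unfolding elts_omega_j t(2) by auto
			have "N.elts (N.ap (j v) (j m)) \<subseteq> N.elts (N.ap (N.ap B jt) (j m))" by (rule jt(2)[rule_format]) (use m in simp)
			then show ?thesis using k unfolding t(2) by auto
		qed
		\<comment> \<open>\<open>A1 p\<close> says that extensions of \<open>p\<close> allow only values
		  that dominate \<open>v\<close>, whence the least allowed value does so too. \<open>A2 p\<close>
		  says that \<open>p\<close> itself puts a value violating this into the graph, which is
		  impossible in the filter.\<close>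
		define A1 where "A1 p \<longleftrightarrow> (\<forall>m\<in>M.elts M.omega. \<forall>k\<in>M.elts M.omega. \<forall>q\<in>M.elts P.
			 M.elts p \<subseteq> M.elts q \<and> M.pair q (cd t m k) \<in> M.elts D --> M.elts (M.ap v m) \<subseteq> M.elts k)" for p
		define A2 where "A2 p \<longleftrightarrow> (\<exists>m\<in>M.elts M.omega. \<exists>k\<in>M.elts M.omega.
			 M.pair p (cd t m k) \<in> M.elts D \<and> \<not> M.elts (M.ap v m) \<subseteq> M.elts k)" for p
		obtain p0 where p0: "p0 \<in> G" using generic unfolding M.generic_filter_def by blast
		have "\<exists>d\<in>G. A1 d \<or> A2 d"
		proof (rule G_meets[OF p0])
			show "M.dfn (\<lambda>s. A1 (s 0) \<or> A2 (s 0))" unfolding A1_def A2_def by (intro M.df dcd)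
			fix p assume p: "p \<in> M.elts P"
			show "\<exists>d\<in>M.elts P. M.elts p \<subseteq> M.elts d \<and> (A1 d \<or> A2 d)"
			proof (cases "A1 p")
				case False
				then obtain q where "q \<in> M.elts P" "M.elts p \<subseteq> M.elts q" "A2 q" unfolding A1_def A2_def by blast
				then show ?thesis by blast
			qed (use p in blast)
		qed
		then obtain p where p: "p \<in> G" "A1 p \<or> A2 p" by blast
		have "\<not> A2 p"
		proof
			assume "A2 p"
			then obtain m k where mk: "m \<in> M.elts M.omega" "k \<in> M.elts M.omega" "M.pair p (cd t m k) \<in> M.elts D"
				"\<not> M.elts (M.ap v m) \<subseteq> M.elts k" unfolding A2_def by blast
			have "N.ap (N.ap B (j t)) (j m) = j k" using val[OF t(1) mk(1,2)] p(1) mk(3) by blast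
			then show False using dom[OF mk(1)] mk(4) by simp
		qed
		then have A1: "A1 p" using p(2) by blast
		have i: "M.pair p t \<in> M.elts I" unfolding I_def using G_P[OF p(1)] t(1) by simp
		obtain m where m: "m \<in> M.elts M.omega" "\<not> M.elts (M.ap v m) \<subseteq> M.elts (M.ap (M.ap (M.lam I H) (M.pair p t)) m)"
			using v(2) i by blast
		have ex: "\<exists>k\<in>M.elts M.omega. \<Phi> (M.pair p t) m k"
		proof -
			obtain k where k: "k \<in> M.elts M.omega" "N.ap (N.ap B (j t)) (j m) = j k" using dom[OF m(1)] by blast
			then obtain p' where p': "p' \<in> G" "M.pair p' (cd t m k) \<in> M.elts D" using val[OF t(1) m(1)] by blast
			obtain r where r: "r \<in> G" "M.elts p \<subseteq> M.elts r" "M.elts p' \<subseteq> M.elts r" using G_dir[OF p(1) p'(1)] by blast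
			have "M.pair r (cd t m k) \<in> M.elts D" using D1 p'(2) G_P[OF r(1)] r(3) by blast
			then show ?thesis unfolding \<Phi>_def using k(1) r(2) G_P[OF r(1)] by blast
		qed
		have "M.ap (M.ap (M.lam I H) (M.pair p t)) m = M.lst M.omega (\<Phi> (M.pair p t) m)"
			unfolding M.ap_lam[OF dH i] unfolding H_def M.ap_lam[OF dHm m(1)] using ex by simp
		moreover have "M.elts (M.ap v m) \<subseteq> M.elts (M.lst M.omega (\<Phi> (M.pair p t) m))"
			using lst[OF ex] A1 m(1) unfolding A1_def \<Phi>_def by auto
		ultimately show ?thesis using m(2) by simp
	qed
qed

text \<open>The injection \<open>c\<close> belongs to the ground model, so a set and its image in
  \<open>omega\<close> can be computed from each other there. Reals and strategies are treated in
  this way.\<close>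

lemma enum_subset_in_range:
	assumes R: "\<And>S. N.elts S \<subseteq> N.elts N.omega ==> S \<in> range j"
		and c: "M.enum c A" and X: "N.elts X \<subseteq> N.elts (j A)"
	shows "X \<in> range j"
proof -
	define S where "S = N.setof {n \<in> N.elts N.omega. \<exists>x\<in>N.elts X. n = N.ap (j c) x}"
	have S: "N.elts S = {n \<in> N.elts N.omega. \<exists>x\<in>N.elts X. n = N.ap (j c) x}"
		unfolding S_def by (rule N.sepI) (intro N.df)
	obtain S0 where S0: "S = j S0" using R[of S] unfolding S by auto
	define X0 where "X0 = M.setof {x \<in> M.elts A. M.ap c x \<in> M.elts S0}"
	have X0: "M.elts X0 = {x \<in> M.elts A. M.ap c x \<in> M.elts S0}" unfolding X0_def by (rule M.sepI) (intro M.df)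
	have mem: "j x \<in> N.elts X \<longleftrightarrow> x \<in> M.elts X0" if x: "x \<in> M.elts A" for x
	proof -
		have cx: "M.ap c x \<in> M.elts M.omega" using c x M.func_ap unfolding M.enum_def by blast
		have "x \<in> M.elts X0 \<longleftrightarrow> j (M.ap c x) \<in> N.elts S" unfolding X0 S0 using x by simp
		also have "\<dots> \<longleftrightarrow> (\<exists>y\<in>N.elts X. j (M.ap c x) = N.ap (j c) y)" unfolding S using cx by simp
		also have "\<dots> \<longleftrightarrow> j x \<in> N.elts X"
		proof
			assume "\<exists>y\<in>N.elts X. j (M.ap c x) = N.ap (j c) y"
			then obtain y where y: "y \<in> N.elts X" "j (M.ap c x) = N.ap (j c) y" by blast
			then obtain y' where y': "y = j y'" "y' \<in> M.elts A" using X by auto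
			then have "M.ap c x = M.ap c y'" using y(2) by simp
			then show "j x \<in> N.elts X" using c x y' y(1) unfolding M.enum_def by blast
		qed (use j_ap in metis)
		finally show ?thesis by blast
	qed
	have "N.elts X = N.elts (j X0)"
	proof (intro equalityI subsetI)
		fix z assume "z \<in> N.elts X"
		then show "z \<in> N.elts (j X0)" using X mem by auto
	next
		fix z assume "z \<in> N.elts (j X0)"
		then show "z \<in> N.elts X" using mem unfolding elts_j X0 by auto
	qed
	then show ?thesis using N.elts_inject by blast
qed

lemma func_in_range:
	assumes R: "\<And>S. N.elts S \<subseteq> N.elts N.omega ==> S \<in> range j"
		and c: "M.enum c A" and f: "N.func f (j A) N.omega"
	shows "f \<in> range j"
proof -
	obtain d where "M.enum d (M.prd A M.omega)" using M.enum_prd[OF c M.enum_omega] by blast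
	moreover have "N.elts f \<subseteq> N.elts (j (M.prd A M.omega))"
		using f unfolding N.func_def j_prd j_omega N.elts_prd by blast
	ultimately show ?thesis using enum_subset_in_range[OF R] by blast
qed

end

section \<open>Coding lemma, and its use against new bounded subsets of Theta\<close>

section \<open>Coding sets of ordinals by reals\<close>

context zf
begin

text \<open>Together with \<open>od\<close>, this reads the moves of I and of II from a play; the
  same splitting turns one real into two.\<close>

definition ev :: "'v => 'v" where "ev x = lam omega (\<lambda>n. ap x (dbl n))"
definition od :: "'v => 'v" where "od x = lam omega (\<lambda>n. ap x (sc (dbl n)))"
definition join :: "'v => 'v => 'v" where
	"join x y = lam omega (\<lambda>n. if even_nat n then ap x (hf n) else ap y (hf n))"
text \<open>A strategy for either player that plays out \<open>x\<close> and ignores the opponent: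
  in a position of length 2n or 2n + 1 it plays entry n.\<close>

definition ply :: "'v => 'v" where "ply x = lam (finseq omega) (\<lambda>t. ap x (hf (dom t)))"
definition str :: "'v => 'v" where "str x = lam (finseq omega) (\<lambda>t. ap x (code t))"

lemma dft_ev [df]: "dft t ==> dft (\<lambda>s. ev (t s))"
	by (rule dft_app1[of ev]) (unfold ev_def, intro df)
lemma dft_od [df]: "dft t ==> dft (\<lambda>s. od (t s))"
	by (rule dft_app1[of od]) (unfold od_def, intro df)
lemma dft_ply [df]: "dft t ==> dft (\<lambda>s. ply (t s))"
	by (rule dft_app1[of ply]) (unfold ply_def, intro df)
lemma dft_str [df]: "dft t ==> dft (\<lambda>s. str (t s))"
	by (rule dft_app1[of str]) (unfold str_def, intro df)

lemma ev_d: "dft (\<lambda>s. ap x (dbl (s 0)))" by (intro df)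
lemma od_d: "dft (\<lambda>s. ap x (sc (dbl (s 0))))" by (intro df)
lemma ply_d: "dft (\<lambda>s. ap x (hf (dom (s 0))))" by (intro df)
lemma str_d: "dft (\<lambda>s. ap x (code (s 0)))" by (intro df)
lemma join_d: "dft (\<lambda>s. if even_nat (s 0) then ap x (hf (s 0)) else ap y (hf (s 0)))" by (intro df)

lemma ap_ev: "n \<in> elts omega ==> ap (ev x) n = ap x (dbl n)"
	unfolding ev_def by (rule ap_lam[OF ev_d])
lemma ap_od: "n \<in> elts omega ==> ap (od x) n = ap x (sc (dbl n))"
	unfolding od_def by (rule ap_lam[OF od_d])
lemma ev_real: "x \<in> elts reals ==> ev x \<in> elts reals"
	unfolding ev_def by (rule real_lam[OF ev_d]) (simp add: real_ap)
lemma od_real: "x \<in> elts reals ==> od x \<in> elts reals"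
	unfolding od_def by (rule real_lam[OF od_d]) (simp add: real_ap)

lemma join:
	assumes x: "x \<in> elts reals" and y: "y \<in> elts reals"
	shows "join x y \<in> elts reals" "ev (join x y) = x" "od (join x y) = y"
proof -
	show j: "join x y \<in> elts reals"
		unfolding join_def by (rule real_lam[OF join_d]) (simp add: real_ap x y)
	show "ev (join x y) = x"
		by (rule real_ext[OF ev_real[OF j] x]) (simp add: ap_ev join_def ap_lam[OF join_d])
	show "od (join x y) = y"
		by (rule real_ext[OF od_real[OF j] y]) (simp add: ap_od join_def ap_lam[OF join_d])
qed

lemma ply_strat: "x \<in> elts reals ==> ply x \<in> elts St"
	unfolding ply_def by (rule strat_lam[OF ply_d]) (simp add: in_finseq real_ap)

lemma ap_ply:
	assumes "r \<in> elts reals" "n \<in> elts omega" shows "ap (ply x) (restr r n) = ap x (hf n)"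
	unfolding ply_def ap_lam[OF ply_d real_restr(1)[OF assms]] real_restr(2)[OF assms] ..

lemma ev_ply:
	assumes x: "x \<in> elts reals" and r: "r \<in> elts reals" "folI (ply x) r" shows "ev r = x"
	by (rule real_ext[OF ev_real[OF r(1)] x]) (use r in \<open>simp add: ap_ev folI_def ap_ply\<close>)
lemma od_ply:
	assumes x: "x \<in> elts reals" and r: "r \<in> elts reals" "folII (ply x) r" shows "od r = x"
	by (rule real_ext[OF od_real[OF r(1)] x]) (use r in \<open>simp add: ap_od folII_def ap_ply\<close>)

lemma str_strat: "x \<in> elts reals ==> str x \<in> elts St"
	unfolding str_def by (rule strat_lam[OF str_d]) (simp add: real_ap code_omega)

lemma str_surj:
	assumes s: "s \<in> elts St" shows "\<exists>x\<in>elts reals. str x = s"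
proof -
	define F where "F n = setof {m \<in> elts omega. \<exists>t\<in>elts (finseq omega). n = code t \<and> m \<in> elts (ap s t)}" for n
	have d: "dft (\<lambda>s. F (s 0))" unfolding F_def by (intro df)
	have F: "elts (F n) = {m \<in> elts omega. \<exists>t\<in>elts (finseq omega). n = code t \<and> m \<in> elts (ap s t)}" for n
		unfolding F_def by (rule sepI) (intro df)
	have Fc: "F (code t) = ap s t" if t: "t \<in> elts (finseq omega)" for t
	proof (rule elts_inject)
		have "elts (ap s t) \<subseteq> elts omega" by (rule omega_subset[OF strat_ap[OF s t]])
		moreover have "t' = t" if "t' \<in> elts (finseq omega)" "code t = code t'" for t'
			using code_inject[OF that(1) t] that(2) by simp
		ultimately show "elts (F (code t)) = elts (ap s t)" unfolding F using t by blast
	qed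
	have Fw: "F n \<in> elts omega" for n
	proof (cases "\<exists>t\<in>elts (finseq omega). n = code t")
		case True then show ?thesis using Fc strat_ap[OF s] by auto
	next
		case False
		then have "elts (F n) = {}" unfolding F by blast
		then show ?thesis by simp
	qed
	have r: "lam omega F \<in> elts reals" by (rule real_lam[OF d Fw])
	have "str (lam omega F) = s"
	proof (rule fun_ext)
		show "func_on (str (lam omega F)) (finseq omega)" "func_on s (finseq omega)"
			using str_strat[OF r] s by (simp_all add: func_func_on)
		fix t assume t: "t \<in> elts (finseq omega)"
		show "ap (str (lam omega F)) t = ap s t"
			unfolding str_def ap_lam[OF str_d t] ap_lam[OF d code_omega[OF t]] by (rule Fc[OF t])
	qed
	then show ?thesis using r by blast
qed

text \<open>A real \<open>x\<close> codes the ordinal \<open>ap \<pi> (ev x)\<close> and a set with value \<open>V x\<close>. In the game for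
	\<open>S \<subseteq> \<eta>\<close>, the players build codes \<open>x\<close> and \<open>y\<close> of initial segments of \<open>S\<close>, and II has to outgrow I;
	\<open>stp\<close> recovers \<open>S\<close> from a winning strategy \<open>s\<close>. The mode \<open>m\<close> is \<open>zero\<close> or \<open>one\<close> if \<open>s\<close> is a
	strategy of I; mode \<open>one\<close> says that \<open>S\<close> contains the last element of \<open>\<eta>\<close>. For a strategy of II, the
	codes of initial segments of \<open>S\<close> are those on whose proper initial segments \<open>s\<close> answers
	coherently.\<close>

definition inV :: "'v => ('v => 'v) => 'v => 'v => 'v => bool" where
	"inV \<pi> V \<eta> \<zeta> x \<longleftrightarrow> ap \<pi> (ev x) \<in> elts \<eta> \<and> \<zeta> \<in> elts (V x)"
definition coh :: "'v => ('v => 'v) => 'v => 'v => 'v => bool" where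
	"coh \<pi> V \<eta> s x \<longleftrightarrow> (\<forall>\<zeta>'\<in>elts (ap \<pi> (ev x)). \<zeta>' \<in> elts (V x) \<longleftrightarrow>
		 (\<exists>x'\<in>elts reals. ap \<pi> (ev x') = \<zeta>' \<and> (\<forall>u. u \<in> elts (V x') \<longleftrightarrow> u \<in> elts (V x) \<and> u \<in> elts \<zeta>') \<and>
				inV \<pi> V \<eta> \<zeta>' (od (run (ply x') s))))"
definition stp :: "'v => ('v => 'v) => 'v => 'v => 'v => 'v => bool" where
	"stp \<pi> V \<eta> s m \<zeta> \<longleftrightarrow> (if m = zero \<or> m = one
		 then (m = one \<and> sc \<zeta> = \<eta>) \<or> (\<exists>y\<in>elts reals. inV \<pi> V \<eta> \<zeta> (ev (run s (ply y))))
		 else (\<exists>x\<in>elts reals. ap \<pi> (ev x) = \<zeta> \<and> coh \<pi> V \<eta> s x \<and> inV \<pi> V \<eta> \<zeta> (od (run (ply x) s))))"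

definition vals :: "'v => 'v => 'v => 'v" where "vals \<pi> h x = ap (ap h (ap \<pi> (ev x))) (od x)"
text \<open>One step of a recursion in the ground model that attaches to each ordinal a family of
  its subsets indexed by reals. The index \<open>z\<close> supplies the mode as entry
  \<open>zero\<close> of \<open>ev z\<close> and a strategy, coded by \<open>od z\<close>.\<close>

definition rhos :: "'v => 'v => 'v => 'v" where
	"rhos \<pi> \<eta> h = lam reals (\<lambda>z. setof {\<zeta> \<in> elts \<eta>. stp \<pi> (vals \<pi> h) \<eta> (str (od z)) (ap (ev z) zero) \<zeta>})"
definition rho :: "'v => 'v => 'v" where "rho \<pi> \<eta> = trec (rhos \<pi>) \<eta>"
definition val :: "'v => 'v => 'v" where "val \<pi> x = ap (rho \<pi> (ap \<pi> (ev x))) (od x)"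

lemma dfn_if [df]: "dfn P ==> dfn Q ==> dfn R ==> dfn (\<lambda>s. if P s then Q s else R s)"
	unfolding if_bool_eq_conj by (intro df)

lemma dft_rhos: "dft (\<lambda>s. rhos \<pi> (s 0) (s 1))"
	unfolding rhos_def vals_def stp_def coh_def inV_def by (intro df)
lemma dft_rho [df]: "dft t ==> dft (\<lambda>s. rho \<pi> (t s))"
	unfolding rho_def
	by (rule dft_app1[of "trec (rhos \<pi>)"]) (unfold rhos_def vals_def stp_def coh_def inV_def, intro df)

lemma coh_cong:
	assumes eta: "Ord \<eta>" and V: "\<And>x. ap \<pi> (ev x) \<in> elts \<eta> ==> V x = V' x" and x: "ap \<pi> (ev x) \<in> elts \<eta>"
	shows "coh \<pi> V \<eta> s x = coh \<pi> V' \<eta> s x"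
proof -
	have i: "inV \<pi> V \<eta> = inV \<pi> V' \<eta>" unfolding inV_def using V by (intro ext) auto
	have "(ap \<pi> (ev x') = \<zeta>' \<and> (\<forall>u. u \<in> elts (V x') \<longleftrightarrow> u \<in> elts (V x) \<and> u \<in> elts \<zeta>') \<and> Q) \<longleftrightarrow>
			(ap \<pi> (ev x') = \<zeta>' \<and> (\<forall>u. u \<in> elts (V' x') \<longleftrightarrow> u \<in> elts (V' x) \<and> u \<in> elts \<zeta>') \<and> Q)"
		if "\<zeta>' \<in> elts (ap \<pi> (ev x))" for x' \<zeta>' Q
		using V[of x'] V[OF x] Ord_trans[OF eta x that] by (cases "ap \<pi> (ev x') = \<zeta>'") simp_all
	then show ?thesis unfolding coh_def i V[OF x] by (intro ball_cong refl) simp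
qed

text \<open>Values are consulted only at reals that code ordinals below \<open>\<eta>\<close>, so
  the history of the recursion determines the step.\<close>

lemma stp_cong:
	assumes eta: "Ord \<eta>" and V: "\<And>x. ap \<pi> (ev x) \<in> elts \<eta> ==> V x = V' x" and z: "\<zeta> \<in> elts \<eta>"
	shows "stp \<pi> V \<eta> s m \<zeta> = stp \<pi> V' \<eta> s m \<zeta>"
proof -
	have i: "inV \<pi> V \<eta> = inV \<pi> V' \<eta>" unfolding inV_def using V by (intro ext) auto
	have "ap \<pi> (ev x) = \<zeta> ==> coh \<pi> V \<eta> s x = coh \<pi> V' \<eta> s x" for x
		by (rule coh_cong[OF eta V]) (simp_all add: z)
	then show ?thesis unfolding stp_def i by (simp cong: conj_cong)
qed

lemma elts_rho:
	assumes eta: "Ord \<eta>" and z: "z \<in> elts reals"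
	shows "elts (ap (rho \<pi> \<eta>) z) = {\<zeta> \<in> elts \<eta>. stp \<pi> (val \<pi>) \<eta> (str (od z)) (ap (ev z) zero) \<zeta>}"
proof -
	define h where "h = lam \<eta> (rho \<pi>)"
	have d: "dft (\<lambda>s. rho \<pi> (s 0))" by (intro df)
	have r: "rho \<pi> \<eta> = rhos \<pi> \<eta> h"
		unfolding h_def using trec[OF dft_rhos eta] by (simp add: rho_def[abs_def])
	have v: "vals \<pi> h x = val \<pi> x" if "ap \<pi> (ev x) \<in> elts \<eta>" for x
		unfolding vals_def val_def h_def ap_lam[OF d that] ..
	have d2: "dft (\<lambda>s. setof {\<zeta> \<in> elts \<eta>. stp \<pi> (vals \<pi> h) \<eta> (str (od (s 0))) (ap (ev (s 0)) zero) \<zeta>})"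
		unfolding vals_def stp_def coh_def inV_def by (intro df)
	have "ap (rho \<pi> \<eta>) z = setof {\<zeta> \<in> elts \<eta>. stp \<pi> (vals \<pi> h) \<eta> (str (od z)) (ap (ev z) zero) \<zeta>}"
		unfolding r rhos_def by (rule ap_lam[OF d2 z])
	moreover have "elts (setof {\<zeta> \<in> elts \<eta>. stp \<pi> (vals \<pi> h) \<eta> (str (od z)) (ap (ev z) zero) \<zeta>})
			= {\<zeta> \<in> elts \<eta>. stp \<pi> (vals \<pi> h) \<eta> (str (od z)) (ap (ev z) zero) \<zeta>}"
		by (rule sepI) (unfold vals_def stp_def coh_def inV_def, intro df)
	ultimately show ?thesis using stp_cong[OF eta v] by auto
qed

lemma val_subset:
	assumes "Ord (ap \<pi> (ev x))" "x \<in> elts reals" shows "elts (val \<pi> x) \<subseteq> elts (ap \<pi> (ev x))"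
	unfolding val_def elts_rho[OF assms(1) od_real[OF assms(2)]] by blast

definition codes_seg :: "'v => 'v => 'v set => 'v => bool" where
	"codes_seg \<pi> \<eta> S x \<longleftrightarrow> ap \<pi> (ev x) \<in> elts \<eta> \<and> elts (val \<pi> x) = S \<inter> elts (ap \<pi> (ev x))"

text \<open>\<open>S\<close> is an external set: in the application it is the trace on the ground
  model of a set of the extension. Separation and foundation of the ground model do not apply to
  it.\<close>

context
	fixes \<pi> \<alpha> \<eta> :: 'v and S :: "'v set"
	assumes surj: "surj_func \<pi> reals \<alpha>" and Ord_a: "Ord \<alpha>" and eta: "Ord \<eta>" "elts \<eta> \<subseteq> elts \<alpha>"
		and IH: "\<And>\<zeta>. \<zeta> \<in> elts \<eta> ==> \<exists>z\<in>elts reals. elts (ap (rho \<pi> \<zeta>) z) = S \<inter> elts \<zeta>"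
begin

lemma codes_seg_exists: "\<zeta> \<in> elts \<eta> ==> \<exists>x\<in>elts reals. ap \<pi> (ev x) = \<zeta> \<and> codes_seg \<pi> \<eta> S x"
proof -
	assume z: "\<zeta> \<in> elts \<eta>"
	obtain a where a: "a \<in> elts reals" "ap \<pi> a = \<zeta>" using surj z eta(2) unfolding surj_func_iff by blast
	obtain b where b: "b \<in> elts reals" "elts (ap (rho \<pi> \<zeta>) b) = S \<inter> elts \<zeta>" using IH[OF z] by blast
	show ?thesis
		by (rule bexI[OF _ join(1)[OF a(1) b(1)]]) (simp add: codes_seg_def val_def join(2,3)[OF a(1) b(1)] a(2) b(2) z)
qed

text \<open>Against a winning strategy of I, whatever II plays is answered by a correct initial
  segment of \<open>S\<close>. If II plays a correct code of length \<open>sc \<zeta>\<close>, the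
  answer is at least as long and so decides \<open>\<zeta>\<close>. Thus \<open>S\<close> is the
  union of all answers of I.\<close>

lemma rho_if_I_wins:
	assumes s: "s \<in> elts St"
		and win: "\<And>r. r \<in> elts reals ==> folI s r ==>
			codes_seg \<pi> \<eta> S (ev r) \<and> \<not> (codes_seg \<pi> \<eta> S (od r) \<and> ap \<pi> (ev (ev r)) \<in> elts (ap \<pi> (ev (od r))))"
	shows "\<exists>z\<in>elts reals. elts (ap (rho \<pi> \<eta>) z) = S \<inter> elts \<eta>"
proof -
	\<comment> \<open>All segments played have length below \<open>\<eta>\<close>, so none of them
	  contains the last element of a successor \<open>\<eta>\<close>; the mode supplies this
	  bit.\<close>
	define m where "m = (if \<exists>\<zeta>\<in>S. sc \<zeta> = \<eta> then one else zero)"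
	have dc: "dft (\<lambda>s. m)" by (intro df)
	obtain b where b: "b \<in> elts reals" "str b = s" using str_surj[OF s] by blast
	have m: "m \<in> elts omega" unfolding m_def by simp
	have a: "lam omega (\<lambda>_. m) \<in> elts reals" "ap (lam omega (\<lambda>_. m)) zero = m"
		using real_lam[OF dc m] ap_lam[OF dc zero_omega] by auto
	note z = join[OF a(1) b(1)]
	have "\<zeta> \<in> S" if c: "\<zeta> \<in> elts \<eta>" "stp \<pi> (val \<pi>) \<eta> s m \<zeta>" for \<zeta>
	proof -
		from c(2) consider "m = one" "sc \<zeta> = \<eta>" | y where "y \<in> elts reals" "inV \<pi> (val \<pi>) \<eta> \<zeta> (ev (run s (ply y)))"
			unfolding stp_def m_def by (auto split: if_splits)
		then show ?thesis
		proof cases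
			case 1
			then have "\<exists>\<zeta>\<in>S. sc \<zeta> = \<eta>" unfolding m_def using numerals_neq by (auto split: if_splits)
			then show ?thesis using 1(2) sc_inject by metis
		next
			case (2 y)
			note r = run[OF s ply_strat[OF 2(1)]]
			show ?thesis using win[OF r(1,2)] 2(2) unfolding codes_seg_def inV_def by blast
		qed
	qed
	moreover have "stp \<pi> (val \<pi>) \<eta> s m \<zeta>" if c: "\<zeta> \<in> elts \<eta>" "\<zeta> \<in> S" for \<zeta>
	proof (cases "sc \<zeta> = \<eta>")
		case True
		then have "m = one" unfolding m_def using c(2) by auto
		then show ?thesis using True unfolding stp_def by simp
	next
		case False
		have oz: "Ord \<zeta>" by (rule Ord_in[OF eta(1) c(1)])
		have "sc \<zeta> \<in> elts \<eta>" using sc_mono[OF eta(1) c(1)] False by simp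
		then obtain y where y: "y \<in> elts reals" "ap \<pi> (ev y) = sc \<zeta>" "codes_seg \<pi> \<eta> S y" using codes_seg_exists by blast
		define r where "r = run s (ply y)"
		have r: "r \<in> elts reals" "folI s r" "od r = y"
			unfolding r_def using run[OF s ply_strat[OF y(1)]] od_ply[OF y(1)] by auto
		have w: "codes_seg \<pi> \<eta> S (ev r)" "ap \<pi> (ev (ev r)) \<notin> elts (sc \<zeta>)"
			using win[OF r(1,2)] y(2,3) r(3) by auto
		then have in_eta: "ap \<pi> (ev (ev r)) \<in> elts \<eta>" unfolding codes_seg_def by blast
		have "elts (sc \<zeta>) \<subseteq> elts (ap \<pi> (ev (ev r)))"
			using w(2) Ord_not_mem[OF Ord_in[OF eta(1) in_eta] Ord_sc[OF oz]] by blast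
		then have "\<zeta> \<in> elts (ap \<pi> (ev (ev r)))" by simp
		then have "inV \<pi> (val \<pi>) \<eta> \<zeta> (ev r)" unfolding inV_def using w(1) c(2) unfolding codes_seg_def by blast
		then show ?thesis unfolding stp_def m_def r_def using y(1) by auto
	qed
	ultimately have "elts (ap (rho \<pi> \<eta>) (join (lam omega (\<lambda>_. m)) b)) = S \<inter> elts \<eta>"
		unfolding elts_rho[OF eta(1) z(1)] z(2,3) a(2) b(2) by blast
	then show ?thesis using z(1) by blast
qed

text \<open>The answer to a correct code of length \<open>\<zeta>\<close> is a longer correct
  segment, so it decides \<open>\<zeta>\<close>. To use this, correct codes must be recognized
  without \<open>S\<close>, which is the purpose of \<open>coh\<close>. As \<open>S\<close> is
  external, the existence of a least difference is the hypothesis \<open>least\<close>.\<close>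

lemma rho_if_II_wins:
	assumes s: "s \<in> elts St"
		and win: "\<And>r. r \<in> elts reals ==> folII s r ==> codes_seg \<pi> \<eta> S (ev r) ==>
			codes_seg \<pi> \<eta> S (od r) \<and> ap \<pi> (ev (ev r)) \<in> elts (ap \<pi> (ev (od r)))"
		and least: "\<And>A \<zeta>. \<zeta> \<in> elts \<eta> ==> elts A \<inter> elts \<zeta> \<noteq> S \<inter> elts \<zeta> ==>
			\<exists>\<zeta>'\<in>elts \<zeta>. elts A \<inter> elts \<zeta>' = S \<inter> elts \<zeta>' \<and> (\<zeta>' \<in> elts A) \<noteq> (\<zeta>' \<in> S)"
	shows "\<exists>z\<in>elts reals. elts (ap (rho \<pi> \<eta>) z) = S \<inter> elts \<eta>"
proof -
	have dc: "dft (\<lambda>s. two)" by (intro df)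
	obtain b where b: "b \<in> elts reals" "str b = s" using str_surj[OF s] by blast
	have a: "lam omega (\<lambda>_. two) \<in> elts reals" "ap (lam omega (\<lambda>_. two)) zero = two"
		using real_lam[OF dc numerals_omega(2)] ap_lam[OF dc zero_omega] by auto
	note z = join[OF a(1) b(1)]
	define y where "y x = od (run (ply x) s)" for x
	have ans: "inV \<pi> (val \<pi>) \<eta> \<zeta> (y x) \<longleftrightarrow> \<zeta> \<in> S" if x: "x \<in> elts reals" "codes_seg \<pi> \<eta> S x" "ap \<pi> (ev x) = \<zeta>" for x \<zeta>
	proof -
		define r where "r = run (ply x) s"
		have r: "r \<in> elts reals" "folII s r" "ev r = x"
			unfolding r_def using run[OF ply_strat[OF x(1)] s] ev_ply[OF x(1)] by auto
		have "codes_seg \<pi> \<eta> S (od r)" "\<zeta> \<in> elts (ap \<pi> (ev (od r)))" using win[OF r(1,2)] r(3) x(2,3) by auto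
		then show ?thesis unfolding inV_def codes_seg_def y_def r_def by blast
	qed
	\<comment> \<open>At the least ordinal where a coherent \<open>x\<close> goes wrong, the segment of
	  \<open>x\<close> below it is still correct, so the answers of \<open>s\<close> to its codes tell
	  the truth about that ordinal; coherence forces \<open>x\<close> to agree with them.\<close>
	have same: "elts (val \<pi> x) = S \<inter> elts (ap \<pi> (ev x)) \<longleftrightarrow> coh \<pi> (val \<pi>) \<eta> s x"
		if x: "x \<in> elts reals" "ap \<pi> (ev x) \<in> elts \<eta>" for x
	proof -
		have sub: "elts (val \<pi> x) \<subseteq> elts (ap \<pi> (ev x))" by (rule val_subset[OF Ord_in[OF eta(1) x(2)] x(1)])
		have step: "(\<exists>x'\<in>elts reals. ap \<pi> (ev x') = \<zeta>' \<and> (\<forall>u. u \<in> elts (val \<pi> x') \<longleftrightarrow> u \<in> elts (val \<pi> x) \<and> u \<in> elts \<zeta>') \<and>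
				inV \<pi> (val \<pi>) \<eta> \<zeta>' (od (run (ply x') s))) \<longleftrightarrow> \<zeta>' \<in> S"
			if c: "\<zeta>' \<in> elts (ap \<pi> (ev x))" "elts (val \<pi> x) \<inter> elts \<zeta>' = S \<inter> elts \<zeta>'" for \<zeta>'
		proof -
			have ze: "\<zeta>' \<in> elts \<eta>" by (rule Ord_trans[OF eta(1) x(2) c(1)])
			have "(\<forall>u. u \<in> elts (val \<pi> x') \<longleftrightarrow> u \<in> elts (val \<pi> x) \<and> u \<in> elts \<zeta>') \<longleftrightarrow> codes_seg \<pi> \<eta> S x'"
				if "ap \<pi> (ev x') = \<zeta>'" for x'
				unfolding codes_seg_def that using c(2) ze by auto
			then have "(ap \<pi> (ev x') = \<zeta>' \<and> (\<forall>u. u \<in> elts (val \<pi> x') \<longleftrightarrow> u \<in> elts (val \<pi> x) \<and> u \<in> elts \<zeta>') \<and>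
				inV \<pi> (val \<pi>) \<eta> \<zeta>' (od (run (ply x') s))) \<longleftrightarrow> ap \<pi> (ev x') = \<zeta>' \<and> codes_seg \<pi> \<eta> S x' \<and> \<zeta>' \<in> S"
				if "x' \<in> elts reals" for x' using ans[OF that] unfolding y_def by blast
			then show ?thesis using codes_seg_exists[OF ze] by blast
		qed
		show ?thesis
		proof
			assume eq: "elts (val \<pi> x) = S \<inter> elts (ap \<pi> (ev x))"
			have "elts (val \<pi> x) \<inter> elts \<zeta>' = S \<inter> elts \<zeta>'" if "\<zeta>' \<in> elts (ap \<pi> (ev x))" for \<zeta>'
				using eq Ord_subset[OF Ord_in[OF eta(1) x(2)] that] by blast
			then show "coh \<pi> (val \<pi>) \<eta> s x" unfolding coh_def using step eq by blast
		next
			assume coh: "coh \<pi> (val \<pi>) \<eta> s x"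
			have "elts (val \<pi> x) \<inter> elts (ap \<pi> (ev x)) = S \<inter> elts (ap \<pi> (ev x))"
			proof (rule ccontr)
				assume "elts (val \<pi> x) \<inter> elts (ap \<pi> (ev x)) \<noteq> S \<inter> elts (ap \<pi> (ev x))"
				then obtain \<zeta>' where l: "\<zeta>' \<in> elts (ap \<pi> (ev x))" "elts (val \<pi> x) \<inter> elts \<zeta>' = S \<inter> elts \<zeta>'"
					"(\<zeta>' \<in> elts (val \<pi> x)) \<noteq> (\<zeta>' \<in> S)" using least[OF x(2)] by blast
				then show False using coh step[OF l(1,2)] unfolding coh_def by blast
			qed
			then show "elts (val \<pi> x) = S \<inter> elts (ap \<pi> (ev x))" using sub by blast
		qed
	qed
	have "stp \<pi> (val \<pi>) \<eta> s two \<zeta> \<longleftrightarrow> \<zeta> \<in> S" if ze: "\<zeta> \<in> elts \<eta>" for \<zeta>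
	proof -
		have "stp \<pi> (val \<pi>) \<eta> s two \<zeta> \<longleftrightarrow> (\<exists>x\<in>elts reals. ap \<pi> (ev x) = \<zeta> \<and> coh \<pi> (val \<pi>) \<eta> s x \<and> inV \<pi> (val \<pi>) \<eta> \<zeta> (y x))"
			unfolding stp_def y_def using numerals_neq by auto
		also have "\<dots> \<longleftrightarrow> (\<exists>x\<in>elts reals. ap \<pi> (ev x) = \<zeta> \<and> codes_seg \<pi> \<eta> S x \<and> inV \<pi> (val \<pi>) \<eta> \<zeta> (y x))"
			using same ze unfolding codes_seg_def by blast
		also have "\<dots> \<longleftrightarrow> \<zeta> \<in> S" using ans codes_seg_exists[OF ze] by blast
		finally show ?thesis .
	qed
	then have "elts (ap (rho \<pi> \<eta>) (join (lam omega (\<lambda>_. two)) b)) = S \<inter> elts \<eta>"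
		unfolding elts_rho[OF eta(1) z(1)] z(2,3) a(2) b(2) by blast
	then show ?thesis using z(1) by blast
qed

end

end

section \<open>No new subsets of small ordinals\<close>

context zf_embedding
begin

lemma j_dbl: "n \<in> M.elts M.omega ==> j (M.dbl n) = N.dbl (j n)"
proof -
	assume n: "n \<in> M.elts M.omega"
	have d: "M.dft (\<lambda>s. M.dbl (s 0))" by (intro M.df)
	define D where "D = M.lam M.omega M.dbl"
	have D: "N.ap (j D) (j k) = j (M.dbl k)" if "k \<in> M.elts M.omega" for k
		unfolding D_def j_ap M.ap_lam[OF d that] ..
	have "j n \<in> N.elts N.omega" using n by simp
	then have "N.ap (j D) (j n) = N.dbl (j n)"
	proof (rule N.omega_induct[where Q = "\<lambda>x. N.ap (j D) x = N.dbl x"], goal_cases dfn zero sc)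
		case dfn show ?case by (intro N.df)
	next
		case zero
		show ?case using D[OF M.zero_omega] by simp
	next
		case (sc x)
		then obtain k where k: "x = j k" "k \<in> M.elts M.omega" by (auto simp: elts_omega_j)
		have "N.ap (j D) (N.sc x) = j (M.dbl (M.sc k))" using D[of "M.sc k"] k by simp
		then show ?case using sc(2) k D[OF k(2)] sc(1) by simp
	qed
	then show ?thesis using D[OF n] by simp
qed

lemma even_nat_j: "n \<in> M.elts M.omega ==> N.even_nat (j n) \<longleftrightarrow> M.even_nat n"
	unfolding N.even_nat_iff M.even_nat_iff elts_omega_j
	by (auto simp: j_dbl simp flip: j_eq)

lemma j_ev: "x \<in> M.elts M.reals ==> j (M.ev x) = N.ev (j x)"
	unfolding M.ev_def N.ev_def
	by (subst j_lam[OF M.ev_d N.ev_d]) (simp_all flip: j_dbl)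
lemma j_od: "x \<in> M.elts M.reals ==> j (M.od x) = N.od (j x)"
	unfolding M.od_def N.od_def
	by (subst j_lam[OF M.od_d N.od_d]) (simp_all flip: j_dbl j_sc)

lemma fol_j: "N.folI (j s) (j x) \<longleftrightarrow> M.folI s x" "N.folII (j s) (j x) \<longleftrightarrow> M.folII s x"
	unfolding N.folI_def M.folI_def N.folII_def M.folII_def elts_omega_j
	by (simp_all add: even_nat_j flip: j_restr)

end

context gext
begin

text \<open>The coding game is determined in the extension, but its winning strategies are old,
  being functions from a countable old set to numbers. So a code of \<open>S\<close> exists in the
  ground model at every stage up to \<open>\<delta>\<close>.\<close>

theorem subset_ordinal_in_range:
	assumes NAD: "N.AD" and R: "\<And>S. N.elts S \<subseteq> N.elts N.omega ==> S \<in> range j"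
		and surj: "M.surj_func \<pi> M.reals \<alpha>" and al: "M.Ord \<alpha>" and de: "\<delta> \<in> M.elts \<alpha>"
		and S: "N.elts S \<subseteq> N.elts (j \<delta>)"
	shows "S \<in> range j"
proof -
	have reals: "x \<in> j ` M.elts M.reals" if "x \<in> N.elts N.reals" for x
	proof -
		have "N.func x (j M.omega) N.omega" using that by (simp add: N.in_reals)
		from func_in_range[OF R M.enum_omega this] obtain x' where "x = j x'" by blast
		then show ?thesis using that by simp
	qed
	then have reals_eq: "N.elts N.reals = j ` M.elts M.reals" by auto
	have strats: "\<exists>s'. s = j s' \<and> s' \<in> M.elts M.St" if "s \<in> N.elts N.St" for s
	proof -
		have f: "N.func s (j (M.finseq M.omega)) N.omega" using that by simp
		from func_in_range[OF R M.enum_finseq this] obtain s' where s': "s = j s'" by blast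
		have "N.func (j s') (j (M.finseq M.omega)) (j M.omega)" using f unfolding s' by simp
		then show ?thesis using s' unfolding func_j by simp
	qed
	have od: "M.Ord \<delta>" by (rule M.Ord_in[OF al de])
	define SS where "SS = {\<zeta>. j \<zeta> \<in> N.elts S}"
	\<comment> \<open>The induction takes place in \<open>N\<close>. No absoluteness of the recursion
	  \<open>rho\<close> is required, as its old values up to \<open>\<delta>\<close> are handed to
	  \<open>N\<close> in a single set.\<close>
	define W where "W = M.lam (M.sc \<delta>) (M.rho \<pi>)"
	have dr: "M.dft (\<lambda>s. M.rho \<pi> (s 0))" by (intro M.df)
	have W: "N.ap (j W) (j \<eta>) = j (M.rho \<pi> \<eta>)" if "\<eta> \<in> M.elts (M.sc \<delta>)" for \<eta>
		unfolding W_def j_ap M.ap_lam[OF dr that] ..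
	have im: "(\<forall>u. u \<in> N.elts (j A) \<longleftrightarrow> u \<in> N.elts S \<and> u \<in> N.elts (j B)) \<longleftrightarrow> M.elts A = SS \<inter> M.elts B" for A B
	proof
		assume *: "\<forall>u. u \<in> N.elts (j A) \<longleftrightarrow> u \<in> N.elts S \<and> u \<in> N.elts (j B)"
		have "x \<in> M.elts A \<longleftrightarrow> x \<in> SS \<inter> M.elts B" for x using *[rule_format, of "j x"] unfolding SS_def by simp
		then show "M.elts A = SS \<inter> M.elts B" by blast
	qed (auto simp: SS_def)
	define Q where "Q \<eta> \<longleftrightarrow> (\<eta> \<in> N.elts (j (M.sc \<delta>)) --> (\<exists>z\<in>N.elts N.reals. \<forall>u.
			u \<in> N.elts (N.ap (N.ap (j W) \<eta>) z) \<longleftrightarrow> u \<in> N.elts S \<and> u \<in> N.elts \<eta>))" for \<eta>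
	have Q: "Q (j \<eta>) \<longleftrightarrow> (\<exists>z\<in>M.elts M.reals. M.elts (M.ap (M.rho \<pi> \<eta>) z) = SS \<inter> M.elts \<eta>)"
		if e: "\<eta> \<in> M.elts (M.sc \<delta>)" for \<eta>
	proof -
		have "j \<eta> \<in> N.elts (j (M.sc \<delta>))" unfolding elts_j j_mem by (rule e)
		then have "Q (j \<eta>) \<longleftrightarrow> (\<exists>z\<in>N.elts N.reals. \<forall>u.
			u \<in> N.elts (N.ap (j (M.rho \<pi> \<eta>)) z) \<longleftrightarrow> u \<in> N.elts S \<and> u \<in> N.elts (j \<eta>))"
			unfolding Q_def W[OF e] by blast
		also have "\<dots> \<longleftrightarrow> (\<exists>z\<in>M.elts M.reals. \<forall>u.
			u \<in> N.elts (N.ap (j (M.rho \<pi> \<eta>)) (j z)) \<longleftrightarrow> u \<in> N.elts S \<and> u \<in> N.elts (j \<eta>))"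
			by (simp only: reals_eq bex_simps)
		also have "\<dots> \<longleftrightarrow> (\<exists>z\<in>M.elts M.reals. M.elts (M.ap (M.rho \<pi> \<eta>) z) = SS \<inter> M.elts \<eta>)"
			unfolding j_ap im ..
		finally show ?thesis .
	qed
	have "Q (j \<delta>)"
	proof (rule N.Ord_induct[where Q = Q])
		show "N.dfn (\<lambda>s. Q (s 0))" unfolding Q_def by (intro N.df)
		show "N.Ord (j \<delta>)" using od by simp
		fix a assume IH: "\<And>b. b \<in> N.elts a ==> Q b"
		show "Q a"
		proof (cases "a \<in> N.elts (j (M.sc \<delta>))")
			case False then show ?thesis unfolding Q_def by simp
		next
			case True
			then obtain \<eta> where e: "a = j \<eta>" "\<eta> \<in> M.elts (M.sc \<delta>)" unfolding elts_j by blast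
			have oe: "M.Ord \<eta>" by (rule M.Ord_in[OF M.Ord_sc[OF od] e(2)])
			have sub: "M.elts \<eta> \<subseteq> M.elts \<delta>" using e(2) M.Ord_subset[OF od] by auto
			have ea: "M.elts \<eta> \<subseteq> M.elts \<alpha>" using sub M.Ord_subset[OF al de] by blast
			have sd: "\<zeta> \<in> M.elts (M.sc \<delta>)" if "\<zeta> \<in> M.elts \<eta>" for \<zeta> using sub that by auto
			have IH': "\<exists>z\<in>M.elts M.reals. M.elts (M.ap (M.rho \<pi> \<zeta>) z) = SS \<inter> M.elts \<zeta>" if "\<zeta> \<in> M.elts \<eta>" for \<zeta>
				using IH[of "j \<zeta>"] Q[OF sd[OF that]] that e(1) by simp
			\<comment> \<open>The counterpart in \<open>N\<close> of \<open>codes_seg\<close>, phrased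
			  through \<open>j \<pi>\<close> and \<open>j W\<close>, so that it is first-order in
			  \<open>N\<close> and may define a payoff set.\<close>
			define cN where "cN x \<longleftrightarrow> N.ap (j \<pi>) (N.ev x) \<in> N.elts (j \<eta>) \<and>
				(\<forall>u. u \<in> N.elts (N.ap (N.ap (j W) (N.ap (j \<pi>) (N.ev x))) (N.od x)) \<longleftrightarrow>
					u \<in> N.elts S \<and> u \<in> N.elts (N.ap (j \<pi>) (N.ev x)))" for x
			have cN: "cN (j x) \<longleftrightarrow> M.codes_seg \<pi> \<eta> SS x" if x: "x \<in> M.elts M.reals" for x
			proof (cases "M.ap \<pi> (M.ev x) \<in> M.elts \<eta>")
				case False
				then show ?thesis unfolding cN_def M.codes_seg_def j_ev[OF x, symmetric] j_ap by simp
			next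
				case True
				show ?thesis unfolding cN_def M.codes_seg_def M.val_def j_ev[OF x, symmetric] j_od[OF x, symmetric]
						j_ap[of \<pi>] W[OF sd[OF True]] using im True by simp
			qed
			define A where "A r \<longleftrightarrow> cN (N.ev r) \<and>
				\<not> (cN (N.od r) \<and> N.ap (j \<pi>) (N.ev (N.ev r)) \<in> N.elts (N.ap (j \<pi>) (N.ev (N.od r))))" for r
			have dA: "N.dfn (\<lambda>s. A (s 0))" unfolding A_def cN_def by (intro N.df)
			have A: "A (j r) \<longleftrightarrow> M.codes_seg \<pi> \<eta> SS (M.ev r) \<and>
					\<not> (M.codes_seg \<pi> \<eta> SS (M.od r) \<and> M.ap \<pi> (M.ev (M.ev r)) \<in> M.elts (M.ap \<pi> (M.ev (M.od r))))"
				if r: "r \<in> M.elts M.reals" for r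
				unfolding A_def j_ev[OF r, symmetric] j_od[OF r, symmetric] cN[OF M.ev_real[OF r]] cN[OF M.od_real[OF r]]
					j_ev[OF M.ev_real[OF r], symmetric] j_ev[OF M.od_real[OF r], symmetric] by simp
			have "\<exists>z\<in>M.elts M.reals. M.elts (M.ap (M.rho \<pi> \<eta>) z) = SS \<inter> M.elts \<eta>"
			proof (rule N.AD_cases[OF NAD dA])
				fix \<sigma> assume s: "\<sigma> \<in> N.elts N.St" "\<And>x. x \<in> N.elts N.reals ==> N.folI \<sigma> x ==> A x"
				obtain s' where s': "\<sigma> = j s'" "s' \<in> M.elts M.St" using strats[OF s(1)] by blast
				show ?thesis
				proof (rule M.rho_if_I_wins[OF surj al oe ea IH' s'(2)])
					fix r assume r: "r \<in> M.elts M.reals" "M.folI s' r"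
					have "A (j r)" using s(2)[of "j r"] r fol_j s'(1) by simp
					then show "M.codes_seg \<pi> \<eta> SS (M.ev r) \<and>
						\<not> (M.codes_seg \<pi> \<eta> SS (M.od r) \<and> M.ap \<pi> (M.ev (M.ev r)) \<in> M.elts (M.ap \<pi> (M.ev (M.od r))))"
						unfolding A[OF r(1)] .
				qed
			next
				fix \<sigma> assume s: "\<sigma> \<in> N.elts N.St" "\<And>x. x \<in> N.elts N.reals ==> N.folII \<sigma> x ==> \<not> A x"
				obtain s' where s': "\<sigma> = j s'" "s' \<in> M.elts M.St" using strats[OF s(1)] by blast
				show ?thesis
				proof (rule M.rho_if_II_wins[OF surj al oe ea IH' s'(2)])
					fix r assume r: "r \<in> M.elts M.reals" "M.folII s' r" "M.codes_seg \<pi> \<eta> SS (M.ev r)"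
					have "\<not> A (j r)" using s(2)[of "j r"] r fol_j s'(1) by simp
					then show "M.codes_seg \<pi> \<eta> SS (M.od r) \<and> M.ap \<pi> (M.ev (M.ev r)) \<in> M.elts (M.ap \<pi> (M.ev (M.od r)))"
						unfolding A[OF r(1)] using r(3) by blast
				next
					fix B \<zeta> assume z: "\<zeta> \<in> M.elts \<eta>" "M.elts B \<inter> M.elts \<zeta> \<noteq> SS \<inter> M.elts \<zeta>"
					\<comment> \<open>The least difference is found by foundation in \<open>N\<close>, where
					  \<open>S\<close> is a set; it lies below \<open>j \<zeta>\<close> and hence in the range of
					  \<open>j\<close>.\<close>
					have d: "N.dfn (\<lambda>s. (s 0 \<in> N.elts (j B)) \<noteq> (s 0 \<in> N.elts S))" by (intro N.df)
					obtain \<zeta>0 where z0: "\<zeta>0 \<in> M.elts \<zeta>" "(\<zeta>0 \<in> M.elts B) \<noteq> (\<zeta>0 \<in> SS)" using z(2) by blast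
					have j0: "j \<zeta>0 \<in> N.elts (j \<zeta>)" "(j \<zeta>0 \<in> N.elts (j B)) \<noteq> (j \<zeta>0 \<in> N.elts S)"
						using z0 unfolding SS_def by simp_all
					obtain y where y: "y \<in> N.elts (j \<zeta>)" "(y \<in> N.elts (j B)) \<noteq> (y \<in> N.elts S)"
						"\<forall>z\<in>N.elts y. z \<in> N.elts (j \<zeta>) --> \<not> ((z \<in> N.elts (j B)) \<noteq> (z \<in> N.elts S))"
						using N.minimal[where Q = "\<lambda>z. (z \<in> N.elts (j B)) \<noteq> (z \<in> N.elts S)", OF d j0] by blast
					obtain \<zeta>' where z': "y = j \<zeta>'" "\<zeta>' \<in> M.elts \<zeta>" using y(1) unfolding elts_j by blast
					have "M.elts \<zeta>' \<subseteq> M.elts \<zeta>" by (rule M.Ord_subset[OF M.Ord_in[OF oe z(1)] z'(2)])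
					then have "M.elts B \<inter> M.elts \<zeta>' = SS \<inter> M.elts \<zeta>'"
						using y(3) unfolding z'(1) SS_def by auto
					moreover have "(\<zeta>' \<in> M.elts B) \<noteq> (\<zeta>' \<in> SS)" using y(2) unfolding z'(1) SS_def by simp
					ultimately show "\<exists>\<zeta>'\<in>M.elts \<zeta>. M.elts B \<inter> M.elts \<zeta>' = SS \<inter> M.elts \<zeta>' \<and> (\<zeta>' \<in> M.elts B) \<noteq> (\<zeta>' \<in> SS)"
						using z'(2) by blast
				qed
			qed
			then show ?thesis unfolding e(1) Q[OF e(2)] .
		qed
	qed
	moreover have "\<delta> \<in> M.elts (M.sc \<delta>)" by simp
	ultimately obtain z where "M.elts (M.ap (M.rho \<pi> \<delta>) z) = SS \<inter> M.elts \<delta>" using Q by blast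
	moreover have "N.elts S = j ` (SS \<inter> M.elts \<delta>)" using S unfolding SS_def by auto
	ultimately have "S = j (M.ap (M.rho \<pi> \<delta>) z)" by (intro N.elts_inject) simp
	then show ?thesis by blast
qed

text \<open>A condition is bounded in \<open>Theta\<close> and the range of \<open>f\<close> is not,
  so any condition can be prolonged to contradict a given old subset of \<open>\<delta>\<close> at
  some index. The whole generic function is too long for \<open>subset_ordinal_in_range\<close>, its
  trace along \<open>f\<close> is not.\<close>

lemma not_AD_if_singular:
	assumes ADp: "M.AD_plus" and sing: "M.singular M.Theta" and P: "P = M.Add_in M.HOD M.Theta"
	shows "\<not> N.AD"
proof
	assume NAD: "N.AD"
	note eP = M.elts_Add_in[folded P]
	have R: "S \<in> range j" if "N.elts S \<subseteq> N.elts N.omega" for S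
		by (rule subset_omega_in_range[OF M.AD_plus_imp_AD[OF ADp] NAD _ that]) (simp add: P M.CH_Add_in)
	obtain f \<delta> where f: "\<delta> \<in> M.elts M.Theta" "M.func f \<delta> M.Theta"
		"\<forall>b\<in>M.elts M.Theta. \<exists>x\<in>M.elts \<delta>. b = M.ap f x \<or> b \<in> M.elts (M.ap f x)"
		using M.singularE[OF sing] by blast
	have lim: "M.sc \<epsilon> \<in> M.elts M.Theta" if "\<epsilon> \<in> M.elts M.Theta" for \<epsilon>
		using sing that unfolding M.singular_def M.Limit_def by blast
	obtain \<alpha> \<pi> where a: "M.Ord \<alpha>" "M.surj_func \<pi> M.reals \<alpha>" "\<delta> \<in> M.elts \<alpha>"
		using f(1) unfolding M.elts_Theta by blast
	define S where "S = N.setof {i \<in> N.elts (j \<delta>). \<exists>p\<in>N.elts g. N.pair (N.ap (j f) i) N.one \<in> N.elts p}"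
	have S: "N.elts S = {i \<in> N.elts (j \<delta>). \<exists>p\<in>N.elts g. N.pair (N.ap (j f) i) N.one \<in> N.elts p}"
		unfolding S_def by (rule N.sepI) (intro N.df)
	have "S \<in> range j" by (rule subset_ordinal_in_range[OF NAD R a(2,1,3)]) (use S in blast)+
	then obtain S0 where S0: "S = j S0" by blast
	have inS: "i \<in> M.elts S0 \<longleftrightarrow> (\<exists>p\<in>G. M.pair (M.ap f i) M.one \<in> M.elts p)" if i: "i \<in> M.elts \<delta>" for i
	proof -
		have "i \<in> M.elts S0 \<longleftrightarrow> j i \<in> N.elts S" unfolding S0 by simp
		also have "\<dots> \<longleftrightarrow> (\<exists>p\<in>G. N.pair (N.ap (j f) (j i)) (j M.one) \<in> N.elts (j p))"
			unfolding S elts_g using i by simp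
		also have "\<dots> \<longleftrightarrow> (\<exists>p\<in>G. M.pair (M.ap f i) M.one \<in> M.elts p)"
			unfolding j_ap j_pair[symmetric] elts_j j_mem ..
		finally show ?thesis .
	qed
	obtain p0 where p0: "p0 \<in> G" using generic unfolding M.generic_filter_def by blast
	have "\<exists>d\<in>G. \<exists>i\<in>M.elts \<delta>. (M.pair (M.ap f i) M.one \<in> M.elts d \<and> i \<notin> M.elts S0) \<or>
			(M.pair (M.ap f i) M.zero \<in> M.elts d \<and> i \<in> M.elts S0)"
	proof (rule G_meets[OF p0])
		show "M.dfn (\<lambda>s. \<exists>i\<in>M.elts \<delta>. (M.pair (M.ap f i) M.one \<in> M.elts (s 0) \<and> i \<notin> M.elts S0) \<or>
			(M.pair (M.ap f i) M.zero \<in> M.elts (s 0) \<and> i \<in> M.elts S0))" by (intro M.df)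
		fix p assume "p \<in> M.elts P"
		then obtain \<gamma> where p: "M.HOD p" "\<gamma> \<in> M.elts M.Theta" "M.func p \<gamma> M.two" unfolding eP by blast
		obtain i where i: "i \<in> M.elts \<delta>" "\<gamma> = M.ap f i \<or> \<gamma> \<in> M.elts (M.ap f i)" using f(3) p(2) by blast
		define \<epsilon> where "\<epsilon> = M.ap f i"
		have e: "\<epsilon> \<in> M.elts M.Theta" unfolding \<epsilon>_def by (rule M.func_ap[OF f(2) i(1)])
		have oe: "M.Ord \<epsilon>" by (rule M.Ord_in[OF M.Ord_Theta e])
		have ge: "M.elts \<gamma> \<subseteq> M.elts \<epsilon>" using i(2) M.Ord_subset[OF oe] unfolding \<epsilon>_def by blast
		\<comment> \<open>The bit opposite to what \<open>S0\<close> predicts at \<open>i\<close>. The old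
		  condition has domain \<open>\<gamma>\<close>, contained in \<open>\<epsilon>\<close>, so its
		  value at \<open>\<epsilon>\<close> is still free.\<close>
		define b where "b = (if i \<in> M.elts S0 then M.zero else M.one)"
		have b: "b \<in> M.elts M.two" "M.Ord b" unfolding b_def using M.Ord_nat by (auto simp: M.two_def M.one_def)
		define q where "q = M.pext p \<gamma> \<epsilon> b"
		have "M.HOD q" unfolding q_def by (rule M.HOD_pext[OF p(1) M.Ord_in[OF M.Ord_Theta p(2)] oe b(2)])
		moreover have "M.func q (M.sc \<epsilon>) M.two" unfolding q_def by (rule M.func_pext[OF p(3) ge b(1)])
		ultimately have "q \<in> M.elts P" unfolding eP using lim[OF e] by blast
		moreover have "M.elts p \<subseteq> M.elts q" "M.pair \<epsilon> b \<in> M.elts q" unfolding q_def subset_iff M.elts_pext by blast+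
		ultimately show "\<exists>d\<in>M.elts P. M.elts p \<subseteq> M.elts d \<and> (\<exists>i\<in>M.elts \<delta>.
			(M.pair (M.ap f i) M.one \<in> M.elts d \<and> i \<notin> M.elts S0) \<or>
			(M.pair (M.ap f i) M.zero \<in> M.elts d \<and> i \<in> M.elts S0))"
			using i(1) unfolding b_def \<epsilon>_def by (auto split: if_splits)
	qed
	then obtain d i where d: "d \<in> G" "i \<in> M.elts \<delta>" "(M.pair (M.ap f i) M.one \<in> M.elts d \<and> i \<notin> M.elts S0) \<or>
			(M.pair (M.ap f i) M.zero \<in> M.elts d \<and> i \<in> M.elts S0)" by blast
	from d(3) show False
	proof
		assume "M.pair (M.ap f i) M.one \<in> M.elts d \<and> i \<notin> M.elts S0"
		then show False using inS[OF d(2)] d(1) by blast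
	next
		assume z: "M.pair (M.ap f i) M.zero \<in> M.elts d \<and> i \<in> M.elts S0"
		then obtain p where p: "p \<in> G" "M.pair (M.ap f i) M.one \<in> M.elts p" using inS[OF d(2)] by blast
		obtain r where r: "r \<in> G" "M.elts d \<subseteq> M.elts r" "M.elts p \<subseteq> M.elts r" using G_dir[OF d(1) p(1)] by blast
		obtain \<gamma> where "M.func r \<gamma> M.two" using G_P[OF r(1)] unfolding eP by blast
		then have "M.zero = M.one" using M.func_on_unique[OF M.func_func_on] r(2,3) z p(2) by blast
		then show False using M.numerals_neq by blast
	qed
qed

end

theorem theorem5p2:
  fixes M :: "'v \<Rightarrow> 'v \<Rightarrow> bool" and P :: 'v and G :: "'v set"
    and N :: "'w \<Rightarrow> 'w \<Rightarrow> bool" and j :: "'v \<Rightarrow> 'w"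
  assumes "eps_structure.ZF M"
    and "eps_structure.AD_plus M"
    and "eps_structure.V_eq_L_of M (eps_structure.power M (eps_structure.reals M))"
    and "eps_structure.singular M (eps_structure.Theta M)"
    and "P = eps_structure.Add_in M (eps_structure.HOD M) (eps_structure.Theta M)"
    and "eps_structure.generic_filter M P (eps_structure.rev_incl M) G"
    and "generic_extension M P G N j"
  shows "\<not> eps_structure.AD N"
proof -
  obtain g where g: "eps_structure.elts N g = j ` G"
    "\<forall>w. \<exists>\<tau>. eps_structure.forcing_name M P \<tau> \<and> eps_structure.name_value N g (j \<tau>) w"
    using assms(7) unfolding generic_extension_def by blast
  have e: "eps_structure.ZF N" "inj j" "\<forall>x. eps_structure.elts N (j x) = j ` eps_structure.elts M x"
    using assms(7) unfolding generic_extension_def by blast+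
  interpret gext M N j P G g
    by unfold_locales (use assms(1,6) e g in blast)+
  show ?thesis by (rule not_AD_if_singular[OF assms(2,4,5)])
qed

end
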